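(* Let $\alpha\in(1,2]$, let $Y=(Y_t)_{t\ge0}$ be a $d$-dimensional isotropic $\alpha$-stable Lévy process, and let $U=(U_t)_{t\ge0}$ be a nonnegative, increasing process with càdlàg paths, independent of $Y$, with $U_0=0$. Define $X_t=Y_{U_t}$. Assume that for some $p>1$, $$\mathbb{E}[U_t^{p/\alpha}]<\infty\ \text{ for all } t\ge0,\qquad \lim_{t\downarrow0}\frac{\mathbb{E}[U_t^{p/\alpha}]}{\mathbb{E}[U_t^{1/\alpha}]}=0 .$$ Then for any bounded open set $\Omega\subset\mathbb{R}^d$ with $C^{1,1}$ boundary, $$\lim_{t\downarrow0}\frac{\mathrm{Vol}(\Omega)-Q^X_\Omega(t)}{m(t)}=\mathrm{Per}(\Omega),\qquad m(t)=\mathbb{E}_0\Big[\sup_{0\le s\le t}X^{(1)}_s\Big].$$ In particular, when $U$ has continuous paths, $m(t)=\mathbb{E}_0\big[\sup_{0\le s\le 1}Y^{(1)}_s\big]\,\mathbb{E}[U_t^{1/\alpha}]$.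
   Context: $Y$ is the Lévy process with $\mathbb{E}_0[e^{i\langle\xi,Y_t\rangle}]=e^{-t|\xi|^\alpha}$ for $\xi\in\mathbb{R}^d$; under $\mathbb{P}_x$ (expectation $\mathbb{E}_x$), $Y$, and hence $X$, starts at $x$. A superscript $(1)$ denotes the first coordinate. "Increasing" means non-decreasing. The quotient in the hypothesis is understood with $\mathbb{E}[U_t^{1/\alpha}]>0$ for $t>0$. The spectral heat content of a bounded open set $\Omega\subset\mathbb{R}^d$ is $Q^X_\Omega(t)=\int_\Omega\mathbb{P}_x(\tau^X_\Omega>t)\,dx$, where $\tau^X_\Omega=\inf\{t\ge0:X_t\notin\Omega\}$. $\mathrm{Vol}(\Omega)$ is the Lebesgue measure of $\Omega$. The perimeter is $\mathrm{Per}(\Omega)=\sup\{\int_\Omega\sum_{i=1}^dD_i\varphi_i\,dx:\ \varphi_i\in C_c^\infty(\mathbb{R}^d),\ \sum_{i=1}^d\varphi_i^2\le1\}$ (equal to the $(d-1)$-dimensional Hausdorff measure of $\partial\Omega$ when $\partial\Omega$ is $C^1$). A function $f$ is $C^{1,\kappa}$ ($\kappa>0$) if it is $C^1$ and there is $L>0$ with $|\nabla f(x)-\nabla f(y)|\le L|x-y|^\kappa$ for all $x,y$. $\Omega$ has $C^{1,\kappa}$ boundary if for every $x\in\partial\Omega$ there are a neighborhood $V_x$ of $x$ and a $C^{1,\kappa}$ function $\gamma:\mathbb{R}^{d-1}\to\mathbb{R}$ such that, in suitable orthonormal coordinates (depending on $x$), $\Omega\cap V_x=\{(y_1,\dots,y_d):y_d>\gamma(y_1,\dots,y_{d-1})\}\cap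 V_x$. *)

theory Defs
  imports "HOL-Probability.Probability"
begin

section \<open>Processes\<close>

text \<open>
  A process is a map from times to random variables on a sample space \<open>M\<close>; only its
  values at times \<open>t \<ge> 0\<close> are relevant.
\<close>

definition cadlag :: "(real \<Rightarrow> 'b::topological_space) \<Rightarrow> bool" where
  "cadlag f \<longleftrightarrow>
     (\<forall>t\<ge>0. (f \<longlongrightarrow> f t) (at_right t)) \<and> (\<forall>t>0. \<exists>l. (f \<longlongrightarrow> l) (at_left t))"

text \<open>Stochastic continuity is implied by cadlag paths and stationary increments.\<close>

definition levy_process :: "'w measure \<Rightarrow> (real \<Rightarrow> 'w \<Rightarrow> 'b::euclidean_space) \<Rightarrow> bool" where
  "levy_process M Y \<longleftrightarrow>
     prob_space M \<and>
     (\<forall>t\<ge>0. Y t \<in> borel_measurable M) \<and>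
     (AE \<omega> in M. Y 0 \<omega> = 0) \<and>
     (AE \<omega> in M. cadlag (\<lambda>t. Y t \<omega>)) \<and>
     (\<forall>s t. 0 \<le> s \<longrightarrow> s \<le> t \<longrightarrow>
        distr M borel (\<lambda>\<omega>. Y t \<omega> - Y s \<omega>) = distr M borel (Y (t - s))) \<and>
     (\<forall>n (t :: nat \<Rightarrow> real). 0 \<le> t 0 \<longrightarrow> (\<forall>i<n. t i \<le> t (Suc i)) \<longrightarrow>
        prob_space.indep_vars M (\<lambda>_. borel) (\<lambda>i \<omega>. Y (t (Suc i)) \<omega> - Y (t i) \<omega>) {..<n})"

definition isotropic_stable_process ::
    "'w measure \<Rightarrow> real \<Rightarrow> (real \<Rightarrow> 'w \<Rightarrow> 'b::euclidean_space) \<Rightarrow> bool" where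
  "isotropic_stable_process M \<alpha> Y \<longleftrightarrow>
     levy_process M Y \<and>
     (\<forall>t\<ge>0. \<forall>\<xi>. (\<integral>\<omega>. iexp (\<xi> \<bullet> Y t \<omega>) \<partial>M) = complex_of_real (exp (- t * norm \<xi> powr \<alpha>)))"

text \<open>The \<open>\<sigma>\<close>-algebra on the sample space generated by the variables \<open>Z t\<close>, \<open>t \<ge> 0\<close>.\<close>

definition process_events ::
    "'w measure \<Rightarrow> (real \<Rightarrow> 'w \<Rightarrow> 'b::topological_space) \<Rightarrow> 'w set set" where
  "process_events M Z =
     sets (vimage_algebra (space M) (\<lambda>\<omega>. \<lambda>t\<in>{0..}. Z t \<omega>) (Pi\<^sub>M {0..} (\<lambda>_. borel)))"

definition indep_processes ::
    "'w measure \<Rightarrow> (real \<Rightarrow> 'w \<Rightarrow> 'b::topological_space) \<Rightarrow>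
       (real \<Rightarrow> 'w \<Rightarrow> 'c::topological_space) \<Rightarrow> bool" where
  "indep_processes M Y U \<longleftrightarrow>
     prob_space.indep_set M (process_events M Y) (process_events M U)"

definition time_change :: "(real \<Rightarrow> 'w \<Rightarrow> 'b) \<Rightarrow> (real \<Rightarrow> 'w \<Rightarrow> real) \<Rightarrow> real \<Rightarrow> 'w \<Rightarrow> 'b" where
  "time_change Y U t \<omega> = Y (U t \<omega>) \<omega>"

text \<open>First time a path leaves \<open>\<Omega>\<close>; it is \<open>\<infinity>\<close> if the path never does.\<close>

definition exit_time :: "'b set \<Rightarrow> (real \<Rightarrow> 'b) \<Rightarrow> ereal" where
  "exit_time \<Omega> f = Inf (ereal ` {t. 0 \<le> t \<and> f t \<notin> \<Omega>})"

text \<open>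
  \<open>X\<close> is the process started at \<open>0\<close>, and its law under \<open>\<P>\<^sub>x\<close> is the law of \<open>x + X\<close>.
  The first exit from an open set by a cadlag path is in general measurable only with respect
  to the completed measure, and its tail is then measurable in \<open>x\<close> only in the Lebesgue sense;
  hence \<^const>\<open>completion\<close> and \<^const>\<open>lebesgue\<close>.
\<close>

definition spectral_heat_content ::
    "'w measure \<Rightarrow> (real \<Rightarrow> 'w \<Rightarrow> 'b::euclidean_space) \<Rightarrow> 'b set \<Rightarrow> real \<Rightarrow> real" where
  "spectral_heat_content M X \<Omega> t =
     (LINT x:\<Omega>|lebesgue.
        measure (completion M) {\<omega> \<in> space M. exit_time \<Omega> (\<lambda>s. x + X s \<omega>) > ereal t})"

text \<open>
  Mean of the running supremum of the \<open>k\<close>-th coordinate. Paths are only almost surely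
  cadlag, so the supremum is measurable with respect to the completed measure.
\<close>

definition mean_sup ::
    "'w measure \<Rightarrow> 'd \<Rightarrow> (real \<Rightarrow> 'w \<Rightarrow> real^'d) \<Rightarrow> real \<Rightarrow> real" where
  "mean_sup M k X t = (\<integral>\<omega>. (SUP s\<in>{0..t}. X s \<omega> $ k) \<partial>completion M)"


section \<open>Sets\<close>

definition partial_deriv :: "'d::finite \<Rightarrow> (real^'d \<Rightarrow> real) \<Rightarrow> real^'d \<Rightarrow> real" where
  "partial_deriv i f x = frechet_derivative f (at x) (axis i 1)"

fun cont_diff :: "nat \<Rightarrow> (real^'d::finite \<Rightarrow> real) \<Rightarrow> bool" where
  "cont_diff 0 f \<longleftrightarrow> continuous_on UNIV f"
| "cont_diff (Suc n) f \<longleftrightarrow>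
     (\<forall>x. f differentiable (at x)) \<and> (\<forall>i. cont_diff n (partial_deriv i f))"

definition test_function :: "(real^'d::finite \<Rightarrow> real) \<Rightarrow> bool" where
  "test_function f \<longleftrightarrow> (\<forall>n. cont_diff n f) \<and> compact (closure {x. f x \<noteq> 0})"

text \<open>The perimeter may be infinite, so the supremum is taken in the extended reals.\<close>

definition perimeter :: "(real^'d::finite) set \<Rightarrow> ereal" where
  "perimeter \<Omega> =
     (SUP \<phi> \<in> {\<phi> :: 'd \<Rightarrow> real^'d \<Rightarrow> real.
                 (\<forall>i. test_function (\<phi> i)) \<and> (\<forall>x. (\<Sum>i\<in>UNIV. (\<phi> i x)\<^sup>2) \<le> 1)}.
        ereal (LINT x:\<Omega>|lebesgue. (\<Sum>i\<in>UNIV. partial_deriv i (\<phi> i) x)))"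

definition C1_holder :: "real \<Rightarrow> ('b::euclidean_space \<Rightarrow> real) \<Rightarrow> bool" where
  "C1_holder \<kappa> f \<longleftrightarrow>
     (\<exists>g. (\<forall>x. GDERIV f x :> g x) \<and> continuous_on UNIV g \<and>
          (\<exists>L>0. \<forall>x y. norm (g x - g y) \<le> L * norm (x - y) powr \<kappa>))"

text \<open>
  The orthogonal map \<open>T\<close> sends a point to its coordinates and \<open>k\<close> is the index of the
  distinguished (last) coordinate. A function of the other \<open>d - 1\<close> coordinates is encoded as a
  function \<open>\<gamma>\<close> on the whole space that does not depend on coordinate \<open>k\<close>; its gradient has
  vanishing \<open>k\<close>-th component, so being \<open>C\<^sup>1\<^sup>,\<^sup>\<kappa>\<close> means the same in both pictures. Translations of
  the coordinate system are absorbed in \<open>\<gamma>\<close>.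
\<close>

definition C1_holder_boundary :: "real \<Rightarrow> (real^'d::finite) set \<Rightarrow> bool" where
  "C1_holder_boundary \<kappa> \<Omega> \<longleftrightarrow>
     (\<forall>x\<in>frontier \<Omega>. \<exists>V (T :: real^'d \<Rightarrow> real^'d) k \<gamma>.
        open V \<and> x \<in> V \<and> orthogonal_transformation T \<and>
        C1_holder \<kappa> \<gamma> \<and> (\<forall>y z. (\<forall>j. j \<noteq> k \<longrightarrow> y $ j = z $ j) \<longrightarrow> \<gamma> y = \<gamma> z) \<and>
        \<Omega> \<inter> V = {z. T z $ k > \<gamma> (T z)} \<inter> V)"

end

theory Submission
  imports Defs
begin

text \<open>A \<open>C\<^sup>1\<^sup>,\<^sup>1\<close> domain has interior and exterior tangent balls of a uniform radius. For a start
  point \<open>x\<close> at distance \<open>\<delta>\<close> from the boundary, whose nearest boundary point has outer normal \<open>\<nu>\<close>, this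
  makes the exit before time \<open>t\<close> equivalent to \<open>sup (\<nu> \<bullet> X) \<ge> \<delta>\<close> up to a relative error in \<open>\<delta>\<close> and an
  error which is quadratic in the displacement. By isotropy the law of that supremum does not depend
  on \<open>\<nu>\<close>, so by Fubini the heat loss is close to the mean of \<open>G (S t)\<close>, where \<open>S t\<close> is the supremum
  of the first coordinate and \<open>G r\<close> the volume of the inner layer of width \<open>r\<close>.

  Testing the divergence of a field against the Lipschitz cutoff \<open>min 1 (\<delta> / r)\<close>, whose gradient
  is \<open>- \<nu> / r\<close> on the layer, shows that \<open>G r / r\<close> tends to the perimeter: every admissible field has
  flux at most \<open>lim G r / r\<close>, and smooth fields close to \<open>\<nu>\<close> near the boundary almost attain it.

  Levy's maximal inequality and scaling bound the \<open>q\<close>-th moment of \<open>S t\<close> by that of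
  \<open>(U t) powr (1 / \<alpha>)\<close> for \<open>1 < q < \<alpha>\<close>, and the mean of \<open>S t\<close> from below by that of
  \<open>(U t) powr (1 / \<alpha>)\<close>; so the moment hypothesis makes the quadratic errors negligible.\<close>

section \<open>Uniform tangent balls\<close>

text \<open>The obstacles are jumps and missing moments. A path that stays in \<Omega> may have a
  left limit on the frontier, so staying inside is not a condition on countably many times. For a
  fixed path this happens only for start points in countably many translates of the null frontier,
  and Fubini removes it for almost every start point. When \<open>U\<close> jumps, \<open>X\<close>
  skips parts of \<open>Y\<close>, so its supremum is only trapped between the terminal value and
  the supremum of \<open>Y\<close> over a slightly longer interval; for the error terms the order of
  the moments is enough. Independence is a statement about path \<sigma>-algebras on an uncountable
  product, so \<open>Y (U t)\<close> is rebuilt from dyadic times as a measurable function of both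
  paths. For \<alpha> < 2 the stable law has moments only below \<alpha>, while p is arbitrary, so p
  is first lowered to a q between 1 and \<alpha>. Integrated over x, the error event
  \<open>\<epsilon> * r0 * \<delta> x \<le> (norm k)\<^sup>2\<close> gives the mean volume of a
  layer whose width is comparable to the squared displacement; as q is at most 2, this is at most of
  the order of the q-th moment.\<close>

definition two_sided_ball :: "real \<Rightarrow> 'a::euclidean_space set \<Rightarrow> bool" where
  "two_sided_ball r \<Omega> \<longleftrightarrow>
     (\<forall>y\<in>frontier \<Omega>. \<exists>n. norm n = 1 \<and> ball (y - r *\<^sub>R n) r \<subseteq> \<Omega> \<and> ball (y + r *\<^sub>R n) r \<inter> \<Omega> = {})"

text \<open>Subtracting the linear function \<open>g y \<bullet> x\<close> leaves a function whose
  gradient on the segment from y to z is at most \<open>L * norm (z - y)\<close>; the mean value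
  inequality contributes the second factor.\<close>

lemma gradient_taylor_bound:
  fixes f :: "'a::euclidean_space \<Rightarrow> real"
  assumes d: "\<And>x. GDERIV f x :> g x" and L: "0 \<le> L" "\<And>x y. norm (g x - g y) \<le> L * norm (x - y)"
  shows "\<bar>f z - f y - g y \<bullet> (z - y)\<bar> \<le> L * (norm (z - y))\<^sup>2"
proof -
  define h where "h x = f x - g y \<bullet> x" for x
  have dh: "(h has_derivative (\<lambda>v. (g x - g y) \<bullet> v)) (at x within closed_segment y z)" for x
  proof -
    have "(h has_derivative (\<lambda>v. v \<bullet> g x - g y \<bullet> v)) (at x)"
      unfolding h_def using d[of x] unfolding gderiv_def
      by (intro has_derivative_diff has_derivative_inner_right has_derivative_ident)
    then show ?thesis
      by (simp add: has_derivative_at_withinI inner_diff_left inner_commute[of _ "g x"])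
  qed
  have "norm (h z - h y) \<le> (L * norm (z - y)) * norm (z - y)"
  proof (rule differentiable_bound[OF _ dh])
    fix x assume x: "x \<in> closed_segment y z"
    have "norm (x - y) \<le> norm (z - y)"
      using segment_bound1[OF x] by (simp add: norm_minus_commute)
    then have "norm (g x - g y) \<le> L * norm (z - y)"
      using L(2)[of x y] L(1) by (meson mult_left_mono order_trans)
    then have "\<bar>(g x - g y) \<bullet> v\<bar> \<le> L * norm (z - y) * norm v" for v
      using Cauchy_Schwarz_ineq2[of "g x - g y" v] mult_right_mono[OF _ norm_ge_zero[of v]]
      by (meson order_trans)
    then show "onorm (\<lambda>v. (g x - g y) \<bullet> v) \<le> L * norm (z - y)"
      using L(1) by (intro onorm_bound) auto
  qed auto
  then show ?thesis by (simp add: h_def power2_eq_square inner_diff_right algebra_simps)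
qed

text \<open>Replaces the chart by a defining function, the graph function minus the distinguished
  coordinate, both composed with the rotation. Since \<gamma> is constant in direction k, that
  component of the rotated gradient is exactly -1, so the gradient of \<open>F\<close> never gets
  shorter than 1.\<close>

lemma C1_holder_boundary_local:
  fixes \<Omega> :: "(real^'d::finite) set"
  assumes "open \<Omega>" "C1_holder_boundary 1 \<Omega>" "x \<in> frontier \<Omega>"
  obtains V F g L where "open V" "x \<in> V" "\<And>z. GDERIV F z :> g z" "0 < L"
    "\<And>y z. norm (g y - g z) \<le> L * norm (y - z)"
    "\<And>z. 1 \<le> norm (g z)" "\<Omega> \<inter> V = {z. F z < 0} \<inter> V" "negligible {z. F z = (0::real)}"
proof -
  obtain V T k \<gamma> where V: "open V" "x \<in> V" and T: "orthogonal_transformation (T :: real^'d \<Rightarrow> real^'d)"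
    and \<gamma>: "C1_holder 1 \<gamma>" and dep: "\<And>y z. (\<forall>j. j \<noteq> k \<longrightarrow> y $ j = z $ j) \<Longrightarrow> \<gamma> y = \<gamma> z"
    and eq: "\<Omega> \<inter> V = {z. T z $ k > \<gamma> (T z)} \<inter> V"
    using assms(2,3) unfolding C1_holder_boundary_def by (elim ballE[of _ _ x]) blast+
  obtain G L where G: "\<And>x. GDERIV \<gamma> x :> G x" and L: "L > 0" "\<And>x y. norm (G x - G y) \<le> L * norm (x - y)"
    using \<gamma> unfolding C1_holder_def by (auto simp: powr_one')
  define S where "S = inv T"
  have S: "linear S" "S (T x) = x" "T (S x) = x" for x
    using orthogonal_transformation_inv[OF T] orthogonal_transformation_bij[OF T]
    by (auto simp: S_def orthogonal_transformation_linear bij_is_inj bij_is_surj surj_f_inv_f)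
  have TT: "T u \<bullet> T v = u \<bullet> v" "norm (T u) = norm u" for u v
    using T by (auto simp: orthogonal_transformation_def orthogonal_transformation_norm)
  have ST: "S u \<bullet> v = u \<bullet> T v" "norm (S u) = norm u" for u v
    using TT(1)[of "S u" v] TT(2)[of "S u"] S by auto
  have linT: "linear T" using T by (simp add: orthogonal_transformation_linear)
  have Gk: "G x $ k = 0" for x
  proof -
    have "((\<lambda>s. \<gamma> (x + s *\<^sub>R axis k 1)) has_derivative (\<lambda>s. (s *\<^sub>R axis k 1) \<bullet> G x)) (at 0)"
    proof -
      have "(\<gamma> has_derivative (\<lambda>h. h \<bullet> G x)) (at (x + 0 *\<^sub>R axis k 1))" using G[of x] by (simp add: gderiv_def)
      moreover have "((\<lambda>s. x + s *\<^sub>R axis k 1) has_derivative (\<lambda>s. s *\<^sub>R axis k 1)) (at 0)"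
        by (auto intro!: derivative_eq_intros)
      ultimately show ?thesis by (rule has_derivative_compose[rotated])
    qed
    moreover have "(\<lambda>s. \<gamma> (x + s *\<^sub>R axis k 1)) = (\<lambda>s. \<gamma> x)"
      by (rule ext, rule dep) (auto simp: axis_def)
    ultimately have "((\<lambda>s::real. \<gamma> x) has_derivative (\<lambda>s. (s *\<^sub>R axis k 1) \<bullet> G x)) (at 0)" by simp
    then have "(\<lambda>s. (s *\<^sub>R axis k 1) \<bullet> G x) = (\<lambda>s::real. 0)"
      using has_derivative_const has_derivative_unique by blast
    then have "(1 *\<^sub>R axis k 1) \<bullet> G x = 0" by (rule fun_cong)
    then show ?thesis by (simp add: inner_axis inner_commute)
  qed
  define F where "F z = \<gamma> (T z) - T z $ k" for z
  define g where "g z = S (G (T z) - axis k 1)" for z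
  have "GDERIV F z :> g z" for z
  proof -
    have "((\<lambda>z. \<gamma> (T z)) has_derivative (\<lambda>h. T h \<bullet> G (T z))) (at z)"
      using has_derivative_compose[OF linear_imp_has_derivative[OF linT], of \<gamma> "\<lambda>h. h \<bullet> G (T z)" z UNIV] G[of "T z"]
      by (simp add: gderiv_def)
    moreover have "((\<lambda>z. T z $ k) has_derivative (\<lambda>h. T h $ k)) (at z)"
      by (intro bounded_linear_imp_has_derivative bounded_linear_vec_nth[THEN bounded_linear_compose] linear_conv_bounded_linear[THEN iffD1] linT)
    ultimately have "(F has_derivative (\<lambda>h. T h \<bullet> G (T z) - T h $ k)) (at z)"
      unfolding F_def by (rule has_derivative_diff)
    moreover have "(\<lambda>h. T h \<bullet> G (T z) - T h $ k) = (\<lambda>h. h \<bullet> g z)"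
    proof
      fix h
      have "h \<bullet> g z = g z \<bullet> h" by (rule inner_commute)
      also have "\<dots> = G (T z) \<bullet> T h - T h $ k"
        by (simp only: g_def ST inner_diff_left inner_axis' real_inner_1_left)
      finally show "T h \<bullet> G (T z) - T h $ k = h \<bullet> g z" by (simp add: inner_commute)
    qed
    ultimately show ?thesis by (simp add: gderiv_def)
  qed
  moreover have "norm (g y - g z) \<le> L * norm (y - z)" for y z
  proof -
    have "g y - g z = S (G (T y) - G (T z))" by (simp add: g_def linear_diff[OF S(1)])
    then show ?thesis using L(2)[of "T y" "T z"] by (simp add: ST TT flip: linear_diff[OF linT])
  qed
  moreover have "1 \<le> norm (g z)" for z
  proof -
    have "\<bar>(G (T z) - axis k 1) $ k\<bar> \<le> norm (G (T z) - axis k 1)" by (rule component_le_norm_cart)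
    then show ?thesis by (simp add: g_def ST Gk axis_def)
  qed
  moreover have "\<Omega> \<inter> V = {z. F z < 0} \<inter> V" using eq by (auto simp: F_def)
  moreover have "negligible {z. F z = 0}"
  proof -
    \<comment> \<open>The graph is the image of the hyperplane orthogonal to the distinguished
      direction \<open>a\<close> under a differentiable shift along \<open>a\<close>.\<close>
    define a where "a = S (axis k 1)"
    define H where "H = {z::real^'d. a \<bullet> z = 0}"
    have a: "a \<noteq> 0" "T a = axis k 1" using ST(2)[of "axis k 1"] S by (auto simp: a_def)
    have "negligible ((\<lambda>z. z + \<gamma> (T z) *\<^sub>R a) ` H)"
    proof (rule negligible_differentiable_image_negligible)
      show "negligible H" unfolding H_def using a by (intro negligible_hyperplane) auto
      have "(\<lambda>z. \<gamma> (T z)) differentiable (at z)" for z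
        using has_derivative_compose[OF linear_imp_has_derivative[OF linT], of \<gamma> "\<lambda>h. h \<bullet> G (T z)" z UNIV] G[of "T z"]
        unfolding gderiv_def differentiable_def by blast
      then show "(\<lambda>z. z + \<gamma> (T z) *\<^sub>R a) differentiable_on H"
        by (intro differentiable_at_imp_differentiable_on) (auto intro!: derivative_intros)
    qed simp
    moreover have "{z. F z = 0} \<subseteq> (\<lambda>z. z + \<gamma> (T z) *\<^sub>R a) ` H"
    proof
      fix z assume "z \<in> {z. F z = 0}"
      then have Fz: "\<gamma> (T z) = T z $ k" by (simp add: F_def)
      define w where "w = z - (T z $ k) *\<^sub>R a"
      have Tw: "T w = T z - (T z $ k) *\<^sub>R axis k 1"
        by (simp add: w_def linear_diff[OF linT] linear_scale[OF linT] a)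
      have "\<gamma> (T w) = \<gamma> (T z)" by (rule dep) (auto simp: Tw axis_def)
      moreover have "w \<in> H" by (simp add: H_def a_def ST Tw inner_axis')
      ultimately show "z \<in> (\<lambda>z. z + \<gamma> (T z) *\<^sub>R a) ` H" using Fz by (auto intro!: image_eqI[of _ _ w] simp: w_def)
    qed
    ultimately show ?thesis by (rule negligible_subset)
  qed
  ultimately show thesis using that V L(1) by blast
qed

text \<open>A point z of a ball of radius r tangent to the frontier at y satisfies \<open>(norm (z -
  y))\<^sup>2 < 2 * r * \<bar>n \<bullet> (z - y)\<bar>\<close>. The quadratic Taylor error of
  \<open>F\<close> is therefore dominated by its linear term once \<open>2 * L * r \<le> 1\<close>,
  and \<open>F\<close> has a constant sign on the ball. The claim is made for every r up to \<rho>,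
  so that a minimum of radii can be taken later.\<close>

lemma two_sided_ball_local:
  fixes \<Omega> :: "(real^'d::finite) set"
  assumes "open \<Omega>" "C1_holder_boundary 1 \<Omega>" "x \<in> frontier \<Omega>"
  obtains \<rho> where "0 < \<rho>"
    "\<And>y r. y \<in> frontier \<Omega> \<Longrightarrow> y \<in> ball x \<rho> \<Longrightarrow> 0 < r \<Longrightarrow> r \<le> \<rho> \<Longrightarrow>
       \<exists>n. norm n = 1 \<and> ball (y - r *\<^sub>R n) r \<subseteq> \<Omega> \<and> ball (y + r *\<^sub>R n) r \<inter> \<Omega> = {}"
    "negligible (frontier \<Omega> \<inter> ball x \<rho>)"
proof -
  obtain V F g L where V: "open V" "x \<in> V" and F: "\<And>z. GDERIV F z :> g z" and L: "0 < L"
    "\<And>y z. norm (g y - g z) \<le> L * norm (y - z)"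
    and g: "\<And>z. 1 \<le> norm (g z)" and eq: "\<Omega> \<inter> V = {z. F z < 0} \<inter> V" and neg: "negligible {z. F z = (0::real)}"
    using C1_holder_boundary_local[OF assms] by blast
  obtain e where e: "e > 0" "ball x e \<subseteq> V" using V openE by blast
  \<comment> \<open>A third of e: y is within \<rho> of x and the points of both balls are within 2
    * \<rho> of y. The other bound lets the linear term dominate the Taylor error.\<close>
  define \<rho> where "\<rho> = min (e/3) (1 / (2*L))"
  have \<rho>: "0 < \<rho>" "3 * \<rho> \<le> e" "2 * L * \<rho> \<le> 1" using e L by (auto simp: \<rho>_def min_def field_simps)
  have contF: "continuous_on UNIV F" 
    using F by (metis GDERIV_DERIV_compose continuous_at_imp_continuous_on gderiv_def has_derivative_continuous)
  have zero: "F y = 0" if "y \<in> frontier \<Omega>" "y \<in> V" for y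
  proof -
    have "y \<notin> \<Omega>" using that \<open>open \<Omega>\<close> by (simp add: frontier_def interior_open)
    then have "\<not> F y < 0" using eq that by blast
    moreover have "\<not> F y > 0"
    proof
      assume "F y > 0"
      define W where "W = {z. F z > 0} \<inter> V"
      have "open W" unfolding W_def using contF V by (intro open_Int open_Collect_less) auto
      moreover have "y \<in> W" using \<open>F y > 0\<close> that by (simp add: W_def)
      moreover have "y \<in> closure \<Omega>" using that by (simp add: frontier_def)
      ultimately obtain z where "z \<in> W" "z \<in> \<Omega>" using open_Int_closure_eq_empty[of W \<Omega>] by blast
      moreover have "z \<in> {z. F z < 0} \<inter> V" using \<open>z \<in> W\<close> \<open>z \<in> \<Omega>\<close> eq by (auto simp only: W_def)
      ultimately show False by (simp add: W_def)
    qed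
    ultimately show ?thesis by simp
  qed
  have ball_V: "z \<in> V" if "y \<in> ball x \<rho>" "0 < r" "r \<le> \<rho>" "dist z y < 2 * r" for y z r
  proof -
    have "dist x z \<le> dist x y + dist z y" using dist_triangle[of x z y] by (simp add: dist_commute)
    moreover have "dist x y < \<rho>" using that by simp
    ultimately have "dist x z < e" using that(3,4) \<rho>(2) by linarith
    then show ?thesis using e by auto
  qed
  have main: "\<exists>n. norm n = 1 \<and> ball (y - r *\<^sub>R n) r \<subseteq> \<Omega> \<and> ball (y + r *\<^sub>R n) r \<inter> \<Omega> = {}"
    if y: "y \<in> frontier \<Omega>" "y \<in> ball x \<rho>" and r: "0 < r" "r \<le> \<rho>" for y r
  proof -
    define n where "n = g y /\<^sub>R norm (g y)"
    have ng: "norm (g y) > 0" using g[of y] by linarith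
    have n: "norm n = 1" "g y = norm (g y) *\<^sub>R n" using ng by (auto simp: n_def)
    have "y \<in> V" using y e \<rho> by auto
    have Fy: "F y = 0" using zero y \<open>y \<in> V\<close> by blast
    \<comment> \<open>\<sigma> = 1 is the inner ball and \<sigma> = -1 the outer one; the
      computation is the same up to this sign.\<close>
    have key: "\<sigma> * F z < 0 \<and> z \<in> V" if \<sigma>: "\<sigma> = 1 \<or> \<sigma> = -1" and z: "z \<in> ball (y - (\<sigma> * r) *\<^sub>R n) r" for \<sigma> z
    proof -
      have zr: "norm (z - y + (\<sigma> * r) *\<^sub>R n) < r" using z by (simp add: dist_norm norm_minus_commute algebra_simps)
      have s2: "\<sigma>\<^sup>2 = 1" using \<sigma> by auto
      have "(norm (z - y + (\<sigma> * r) *\<^sub>R n))\<^sup>2 < r\<^sup>2" using zr by (simp add: power_strict_mono)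
      moreover have "(norm (z - y + (\<sigma> * r) *\<^sub>R n))\<^sup>2 = (norm (z - y))\<^sup>2 + 2 * (\<sigma> * r) * (n \<bullet> (z - y)) + r\<^sup>2"
        using n(1) s2 by (simp add: power2_norm_eq_inner inner_add_left inner_add_right inner_commute norm_eq_1 power_mult_distrib)
           (simp add: power2_eq_square)
      ultimately have a: "(norm (z - y))\<^sup>2 < - 2 * r * (\<sigma> * (n \<bullet> (z - y)))" by (simp add: algebra_simps)
      then have "0 < (2 * r) * (- (\<sigma> * (n \<bullet> (z - y))))"
        using le_less_trans[OF zero_le_power2 a] by (simp add: mult_ac)
      then have "0 < - (\<sigma> * (n \<bullet> (z - y)))" using r by (simp add: zero_less_mult_iff mult_less_0_iff)
      then have "1 * (- (\<sigma> * (n \<bullet> (z - y)))) \<le> norm (g y) * (- (\<sigma> * (n \<bullet> (z - y))))"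
        using g[of y] by (intro mult_right_mono) auto
      then have b: "- (\<sigma> * (n \<bullet> (z - y))) \<le> - (\<sigma> * (g y \<bullet> (z - y)))"
        by (subst n(2)) (simp add: mult.left_commute)
      have c: "\<bar>F z - F y - g y \<bullet> (z - y)\<bar> \<le> L * (norm (z - y))\<^sup>2"
        using gradient_taylor_bound[OF F] L by (meson less_imp_le)
      have "z \<noteq> y" using a by auto
      then have "0 < (norm (z - y))\<^sup>2" by simp
      have "L * (norm (z - y))\<^sup>2 < L * (- 2 * r * (\<sigma> * (n \<bullet> (z - y))))" by (rule mult_strict_left_mono[OF a L(1)])
      also have "\<dots> = (2 * L * r) * (- (\<sigma> * (n \<bullet> (z - y))))" by (simp add: algebra_simps)
      also have "\<dots> \<le> 1 * (- (\<sigma> * (n \<bullet> (z - y))))"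
      proof (rule mult_right_mono)
        have "2 * L * r \<le> 2 * L * \<rho>" using r L by simp
        then show "2 * L * r \<le> 1" using \<rho> by linarith
      qed (use \<open>0 < - _\<close> in simp)
      finally have "L * (norm (z - y))\<^sup>2 < - (\<sigma> * (g y \<bullet> (z - y)))" using b by simp
      then have "\<sigma> * F z < 0" using c Fy \<sigma> by auto
      moreover have "z \<in> V"
      proof (rule ball_V[OF y(2) r])
        have "norm (z - y) \<le> norm (z - y + (\<sigma> * r) *\<^sub>R n) + norm ((\<sigma> * r) *\<^sub>R n)"
          by (metis add_diff_cancel_right' norm_triangle_ineq4)
        then show "dist z y < 2 * r" using zr n r \<sigma> by (auto simp: dist_norm)
      qed
      ultimately show ?thesis by blast
    qed
    have "ball (y - r *\<^sub>R n) r \<subseteq> \<Omega>" using key[of 1] eq by auto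
    moreover have "ball (y + r *\<^sub>R n) r \<inter> \<Omega> = {}" 
    proof -
      have "z \<notin> \<Omega>" if "z \<in> ball (y + r *\<^sub>R n) r" for z
      proof
        assume "z \<in> \<Omega>"
        moreover have "-1 * F z < 0 \<and> z \<in> V" using key[of "-1" z] that by simp
        ultimately have "z \<in> {z. F z < 0} \<inter> V" using eq by blast
        with \<open>-1 * F z < 0 \<and> z \<in> V\<close> show False by simp
      qed
      then show ?thesis by blast
    qed
    ultimately show ?thesis using n by blast
  qed
  have "frontier \<Omega> \<inter> ball x \<rho> \<subseteq> {z. F z = 0}"
  proof
    fix z assume z: "z \<in> frontier \<Omega> \<inter> ball x \<rho>"
    then have "z \<in> ball x e" using \<rho> by auto
    then show "z \<in> {z. F z = 0}" using zero[of z] z e by auto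
  qed
  then have "negligible (frontier \<Omega> \<inter> ball x \<rho>)" using neg negligible_subset by blast
  then show thesis using that[OF \<rho>(1)] main by blast
qed

text \<open>Compactness of the frontier: the local radii of a finite cover have a positive minimum,
  which is admissible at every frontier point.\<close>

lemma C1_holder_boundary_two_sided_ball:
  fixes \<Omega> :: "(real^'d::finite) set"
  assumes "open \<Omega>" "bounded \<Omega>" "C1_holder_boundary 1 \<Omega>"
  obtains r where "0 < r" "two_sided_ball r \<Omega>" "negligible (frontier \<Omega>)"
proof -
  define P where "P x \<rho> \<longleftrightarrow> 0 < \<rho> \<and> (\<forall>y r. y \<in> frontier \<Omega> \<longrightarrow> y \<in> ball x \<rho> \<longrightarrow> 0 < r \<longrightarrow> r \<le> \<rho> \<longrightarrow>
       (\<exists>n. norm n = 1 \<and> ball (y - r *\<^sub>R n) r \<subseteq> \<Omega> \<and> ball (y + r *\<^sub>R n) r \<inter> \<Omega> = {})) \<and>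
    negligible (frontier \<Omega> \<inter> ball x \<rho>)" for x \<rho>
  have "\<exists>\<rho>. P x \<rho>" if "x \<in> frontier \<Omega>" for x
    using two_sided_ball_local[OF assms(1,3) that] unfolding P_def by metis
  then obtain \<rho> where \<rho>: "\<And>x. x \<in> frontier \<Omega> \<Longrightarrow> P x (\<rho> x)" by metis
  have "compact (frontier \<Omega>)" using assms by (simp add: compact_frontier_bounded)
  then obtain C where C: "C \<subseteq> frontier \<Omega>" "finite C" "frontier \<Omega> \<subseteq> (\<Union>x\<in>C. ball x (\<rho> x))"
    by (rule compactE_image[of _ "frontier \<Omega>" "\<lambda>x. ball x (\<rho> x)"]) (use \<rho> P_def in auto)
  \<comment> \<open>The extra 1 covers an empty frontier, where \<open>C\<close> may be
    empty.\<close>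
  define r where "r = Min (insert 1 (\<rho> ` C))"
  have r: "0 < r" "\<And>x. x \<in> C \<Longrightarrow> r \<le> \<rho> x"
    using C \<rho> by (auto simp: r_def P_def Min_gr_iff)
  have "two_sided_ball r \<Omega>" unfolding two_sided_ball_def
  proof
    fix y assume y: "y \<in> frontier \<Omega>"
    then obtain x where x: "x \<in> C" "y \<in> ball x (\<rho> x)" using C by auto
    then have "P x (\<rho> x)" using \<rho> C by auto
    then show "\<exists>n. norm n = 1 \<and> ball (y - r *\<^sub>R n) r \<subseteq> \<Omega> \<and> ball (y + r *\<^sub>R n) r \<inter> \<Omega> = {}"
      using r x y unfolding P_def by blast
  qed
  moreover have "negligible (frontier \<Omega>)"
  proof -
    have "negligible (\<Union>x\<in>C. frontier \<Omega> \<inter> ball x (\<rho> x))"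
      using C \<rho> unfolding P_def by (intro negligible_Union) auto
    then show ?thesis by (rule negligible_subset) (use C in auto)
  qed
  ultimately show thesis using that r by blast
qed

section \<open>The distance to the boundary\<close>

text \<open>The distance is measured to the complement and not to the frontier: inside \<Omega> the
  two agree, and this version vanishes outside and is 1-Lipschitz on the whole space, which makes
  the cutoff globally Lipschitz.\<close>

definition frontier_dist :: "'a::euclidean_space set \<Rightarrow> 'a \<Rightarrow> real" where
  "frontier_dist \<Omega> x = infdist x (- \<Omega>)"

lemma frontier_dist_lipschitz: "\<bar>frontier_dist \<Omega> x - frontier_dist \<Omega> y\<bar> \<le> norm (x - y)"
  using infdist_triangle_abs[of x "-\<Omega>" y] by (simp add: frontier_dist_def dist_norm)

lemma frontier_dist_nonneg: "0 \<le> frontier_dist \<Omega> x"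
  by (simp add: frontier_dist_def infdist_nonneg)

lemma continuous_frontier_dist: "continuous_on UNIV (frontier_dist \<Omega>)"
  unfolding frontier_dist_def by (intro continuous_intros)

lemma borel_measurable_frontier_dist [measurable]: "frontier_dist \<Omega> \<in> borel_measurable borel"
  using continuous_frontier_dist by (rule borel_measurable_continuous_onI)

lemma frontier_dist_outside: "x \<notin> \<Omega> \<Longrightarrow> frontier_dist \<Omega> x = 0"
  by (simp add: frontier_dist_def)

lemma bounded_compl_nonempty: "bounded (\<Omega> :: 'a::euclidean_space set) \<Longrightarrow> - \<Omega> \<noteq> {}"
  using not_bounded_UNIV by (metis Compl_UNIV_eq double_complement)

lemma frontier_dist_pos_iff:
  assumes "open \<Omega>" "bounded \<Omega>"
  shows "0 < frontier_dist \<Omega> x \<longleftrightarrow> x \<in> \<Omega>"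
  using in_closed_iff_infdist_zero[of "- \<Omega>" x] assms bounded_compl_nonempty[OF assms(2)]
    frontier_dist_nonneg[of \<Omega> x]
  by (auto simp: frontier_dist_def closed_def less_le)

lemma frontier_dist_le: "y \<notin> \<Omega> \<Longrightarrow> frontier_dist \<Omega> x \<le> norm (x - y)"
  by (simp add: frontier_dist_def dist_norm infdist_le2)

lemma frontier_dist_ge:
  assumes "bounded \<Omega>" "ball c s \<subseteq> \<Omega>"
  shows "s - norm (x - c) \<le> frontier_dist \<Omega> x"
proof -
  have "s \<le> infdist c (- \<Omega>)"
  proof (cases "s > 0")
    case True
    have "s \<le> dist c y" if "y \<in> - \<Omega>" for y using assms(2) that by force
    then show ?thesis
      unfolding infdist_def using bounded_compl_nonempty[OF assms(1)] by (auto intro!: cINF_greatest)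
  qed (use infdist_nonneg[of c "-\<Omega>"] in linarith)
  then show ?thesis using frontier_dist_lipschitz[of \<Omega> x c] by (auto simp: frontier_dist_def)
qed

text \<open>A nearest point y of the complement lies in the closure of \<Omega>, because moving it
  slightly towards x brings it closer to x than any point of the complement can be.\<close>

lemma nearest_frontier_point:
  assumes "open \<Omega>" "bounded \<Omega>" "x \<in> \<Omega>"
  obtains y where "y \<in> frontier \<Omega>" "norm (x - y) = frontier_dist \<Omega> x"
proof -
  have "closed (- \<Omega>)" using assms by (simp add: closed_Compl)
  then obtain y where y: "y \<in> - \<Omega>" "infdist x (- \<Omega>) = dist x y"
    using infdist_attains_inf bounded_compl_nonempty[OF assms(2)] by metis
  have "y \<in> closure \<Omega>"
  proof (rule closure_approachable[THEN iffD2], intro allI impI)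
    fix e :: real assume e: "e > 0"
    have d: "dist x y > 0" using y assms by auto
    define s where "s = min (e / 2) (dist x y) / dist x y"
    have s: "0 < s" "s \<le> 1" "s * dist x y < e" using e d by (auto simp: s_def min_def)
    define z where "z = y + s *\<^sub>R (x - y)"
    have "dist z y = s * dist x y" using s by (simp add: z_def dist_norm)
    have xz: "x - z = (1 - s) *\<^sub>R (x - y)" by (simp add: z_def algebra_simps)
    then have "dist x z = (1 - s) * dist x y" using s by (simp add: dist_norm)
    also have "\<dots> < dist x y" using s d by (simp add: algebra_simps)
    finally have "z \<in> \<Omega>" using infdist_le[of z "- \<Omega>" x] y by (auto simp: dist_commute)
    then show "\<exists>z\<in>\<Omega>. dist z y < e" using \<open>dist z y = _\<close> s by metis
  qed
  then have "y \<in> frontier \<Omega>" using y assms by (simp add: frontier_def interior_open)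
  then show thesis using that y by (simp add: frontier_dist_def dist_norm)
qed

lemma has_derivative_norm_diff:
  fixes x y :: "'a::euclidean_space"
  assumes "x \<noteq> y"
  shows "((\<lambda>z. norm (z - y)) has_derivative (\<lambda>h. (x - y) \<bullet> h / norm (x - y))) (at x)"
proof -
  have "(norm has_derivative (\<lambda>h. h \<bullet> sgn (x - y))) (at (x - y))"
    using GDERIV_norm[of "x - y"] assms by (simp add: gderiv_def)
  moreover have "((\<lambda>z. z - y) has_derivative (\<lambda>h. h)) (at x)" by (auto intro!: derivative_eq_intros)
  ultimately have "((\<lambda>z. norm (z - y)) has_derivative (\<lambda>h. h \<bullet> sgn (x - y))) (at x)"
    by (rule has_derivative_compose[rotated])
  then show ?thesis by (simp add: sgn_div_norm divide_inverse inner_commute mult.commute)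
qed

section \<open>Normals, nearest points and the gradient of the distance\<close>

definition outer_normal :: "real \<Rightarrow> 'a::euclidean_space set \<Rightarrow> 'a \<Rightarrow> 'a" where
  "outer_normal r \<Omega> y =
     (SOME n. norm n = 1 \<and> ball (y - r *\<^sub>R n) r \<subseteq> \<Omega> \<and> ball (y + r *\<^sub>R n) r \<inter> \<Omega> = {})"

locale two_ball_domain =
  fixes \<Omega> :: "'a::euclidean_space set" and r0 :: real
  assumes open_domain: "open \<Omega>" and bounded_domain: "bounded \<Omega>"
    and r0: "0 < r0" and balls: "two_sided_ball r0 \<Omega>"
    and null_frontier: "negligible (frontier \<Omega>)"
begin

abbreviation \<delta> where "\<delta> \<equiv> frontier_dist \<Omega>"
abbreviation \<nu> where "\<nu> \<equiv> outer_normal r0 \<Omega>"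

text \<open>The exterior ball may be closed: an open set that misses a ball misses its closure. Thus
  a displacement that lands exactly on the sphere also counts as an exit.\<close>

lemma outer_normal:
  assumes "y \<in> frontier \<Omega>"
  shows "norm (\<nu> y) = 1" "ball (y - r0 *\<^sub>R \<nu> y) r0 \<subseteq> \<Omega>" "cball (y + r0 *\<^sub>R \<nu> y) r0 \<inter> \<Omega> = {}"
proof -
  have *: "norm (\<nu> y) = 1 \<and> ball (y - r0 *\<^sub>R \<nu> y) r0 \<subseteq> \<Omega> \<and> ball (y + r0 *\<^sub>R \<nu> y) r0 \<inter> \<Omega> = {}"
    unfolding outer_normal_def by (rule someI_ex) (use balls assms two_sided_ball_def in blast)
  then show "norm (\<nu> y) = 1" "ball (y - r0 *\<^sub>R \<nu> y) r0 \<subseteq> \<Omega>" by auto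
  have "closure (ball (y + r0 *\<^sub>R \<nu> y) r0) \<inter> \<Omega> = {}"
    using open_Int_closure_eq_empty[OF open_domain, of "ball (y + r0 *\<^sub>R \<nu> y) r0"] * by blast
  then show "cball (y + r0 *\<^sub>R \<nu> y) r0 \<inter> \<Omega> = {}" using r0 by simp
qed

text \<open>Otherwise the point dividing the segment of the centres in the ratio of the radii would
  lie in both balls.\<close>

lemma (in -) disjoint_balls_dist:
  fixes a b :: "'b::real_normed_vector"
  assumes "0 < s" "0 < t" "ball a s \<inter> ball b t = {}"
  shows "s + t \<le> dist a b"
proof (rule ccontr)
  assume n: "\<not> s + t \<le> dist a b"
  define c where "c = a + (s / (s + t)) *\<^sub>R (b - a)"
  have "c - a = (s / (s + t)) *\<^sub>R (b - a)" by (simp add: c_def)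
  then have "dist a c = s / (s + t) * dist a b" using assms by (simp add: dist_norm norm_minus_commute[of a])
  also have "\<dots> < s / (s + t) * (s + t)" using n assms by (intro mult_strict_left_mono) auto
  finally have 1: "dist a c < s" using assms by simp
  have "b - c = (1 - s / (s + t)) *\<^sub>R (b - a)" by (simp add: c_def algebra_simps)
  also have "1 - s / (s + t) = t / (s + t)" using assms by (simp add: field_simps)
  finally have "dist b c = t / (s + t) * dist a b" using assms by (simp add: dist_norm norm_minus_commute[of a])
  also have "\<dots> < t / (s + t) * (s + t)" using n assms by (intro mult_strict_left_mono) auto
  finally have 2: "dist b c < t" using assms by simp
  show False using 1 2 assms by auto
qed

text \<open>The inner ball at either point is disjoint from the outer ball at the other, so both
  diagonals \<open>a + b\<close> and \<open>a - b\<close> have length at least 2 * r0. The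
  parallelogram law turns this into a lower bound for the sum of the squared lengths of
  \<open>a\<close> and \<open>b\<close>, and the length of \<open>\<nu> y + \<nu> z\<close>
  determines that of \<open>\<nu> y - \<nu> z\<close>.\<close>

lemma outer_normal_lipschitz:
  assumes y: "y \<in> frontier \<Omega>" and z: "z \<in> frontier \<Omega>"
  shows "norm (\<nu> y - \<nu> z) \<le> norm (y - z) / r0"
proof -
  define a where "a = r0 *\<^sub>R (\<nu> y + \<nu> z)"
  define b where "b = y - z"
  have "ball (z - r0 *\<^sub>R \<nu> z) r0 \<inter> ball (y + r0 *\<^sub>R \<nu> y) r0 = {}"
    using outer_normal(2)[OF z] outer_normal(3)[OF y] by force
  then have "2 * r0 \<le> dist (z - r0 *\<^sub>R \<nu> z) (y + r0 *\<^sub>R \<nu> y)" using disjoint_balls_dist r0 by fastforce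
  also have "\<dots> = norm (a + b)" by (simp add: dist_norm a_def b_def norm_minus_commute algebra_simps)
  finally have 1: "(2 * r0)\<^sup>2 \<le> (norm (a + b))\<^sup>2" using r0 by (intro power_mono) auto
  have "ball (y - r0 *\<^sub>R \<nu> y) r0 \<inter> ball (z + r0 *\<^sub>R \<nu> z) r0 = {}"
    using outer_normal(2)[OF y] outer_normal(3)[OF z] by force
  then have "2 * r0 \<le> dist (y - r0 *\<^sub>R \<nu> y) (z + r0 *\<^sub>R \<nu> z)" using disjoint_balls_dist r0 by fastforce
  also have "\<dots> = norm (a - b)" by (simp add: dist_norm a_def b_def norm_minus_commute algebra_simps)
  finally have 2: "(2 * r0)\<^sup>2 \<le> (norm (a - b))\<^sup>2" using r0 by (intro power_mono) auto
  have par: "(norm (u + v))\<^sup>2 + (norm (u - v))\<^sup>2 = 2 * (norm u)\<^sup>2 + 2 * (norm v)\<^sup>2" for u v :: 'a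
    by (simp add: power2_norm_eq_inner algebra_simps inner_add_left inner_diff_left inner_add_right inner_diff_right inner_commute)
  have "(norm a)\<^sup>2 = r0\<^sup>2 * (norm (\<nu> y + \<nu> z))\<^sup>2" by (simp add: a_def power_mult_distrib)
  also have "\<dots> = r0\<^sup>2 * (4 - (norm (\<nu> y - \<nu> z))\<^sup>2)" using par[of "\<nu> y" "\<nu> z"] outer_normal(1) y z by simp
  finally have "(r0 * norm (\<nu> y - \<nu> z))\<^sup>2 \<le> (norm b)\<^sup>2"
    using 1 2 par[of a b] by (simp add: power_mult_distrib algebra_simps)
  then have "r0 * norm (\<nu> y - \<nu> z) \<le> norm b" by (rule power2_le_imp_le) simp
  then show ?thesis using r0 by (simp add: b_def field_simps)
qed

lemma continuous_outer_normal: "continuous_on (frontier \<Omega>) \<nu>"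
proof (rule continuous_onI)
  fix y e :: real and x assume "x \<in> frontier \<Omega>" "0 < e"
  then show "\<exists>d>0. \<forall>x'\<in>frontier \<Omega>. dist x' x < d \<longrightarrow> dist (\<nu> x') (\<nu> x) \<le> e"
    using outer_normal_lipschitz r0
    by (intro exI[of _ "e * r0"]) (auto simp: dist_norm field_simps intro: order_trans[OF outer_normal_lipschitz])
qed

text \<open>The ball around x of radius \<open>\<delta> x\<close> lies in \<Omega> and misses the
  exterior ball at the nearest point y. The distance of the two centres is then at least
  \<open>\<delta> x + r0\<close>, which is equality in the triangle inequality through y; equality
  forces x - y to be a negative multiple of the normal.\<close>

lemma nearest_point:
  assumes "x \<in> \<Omega>"
  obtains y where "y \<in> frontier \<Omega>" "x = y - \<delta> x *\<^sub>R \<nu> y" "0 < \<delta> x"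
proof -
  obtain y where y: "y \<in> frontier \<Omega>" "norm (x - y) = \<delta> x"
    using nearest_frontier_point[OF open_domain bounded_domain assms] .
  have d: "0 < \<delta> x" using frontier_dist_pos_iff[OF open_domain bounded_domain] assms by simp
  have "z \<in> \<Omega>" if "z \<in> ball x (\<delta> x)" for z
    using that frontier_dist_le[of z \<Omega> x] by (auto simp: dist_norm)
  then have "ball x (\<delta> x) \<inter> ball (y + r0 *\<^sub>R \<nu> y) r0 = {}" using outer_normal(3)[OF y(1)] by force
  then have "\<delta> x + r0 \<le> dist x (y + r0 *\<^sub>R \<nu> y)" using disjoint_balls_dist d r0 by blast
  also have "\<dots> = norm ((x - y) + (- r0 *\<^sub>R \<nu> y))" by (simp add: dist_norm algebra_simps)
  finally have "norm ((x - y) + (- r0 *\<^sub>R \<nu> y)) = norm (x - y) + norm (- r0 *\<^sub>R \<nu> y)"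
    using norm_triangle_ineq[of "x - y" "- r0 *\<^sub>R \<nu> y"] y(2) outer_normal(1)[OF y(1)] r0 by simp
  then have "norm (x - y) *\<^sub>R (- r0 *\<^sub>R \<nu> y) = norm (- r0 *\<^sub>R \<nu> y) *\<^sub>R (x - y)"
    by (simp only: norm_triangle_eq)
  then have "r0 *\<^sub>R (- \<delta> x *\<^sub>R \<nu> y) = r0 *\<^sub>R (x - y)" 
    using y(2) outer_normal(1)[OF y(1)] r0 by (simp add: mult.commute)
  then have "- \<delta> x *\<^sub>R \<nu> y = x - y" using r0 by (metis less_irrefl scaleR_cancel_left)
  then show thesis using that[OF y(1) _ d] by (simp add: algebra_simps)
qed

text \<open>The distance is squeezed between the distance to the sphere of the inner tangent ball
  and the distance to y. All three agree at x and the outer two have the same gradient there. The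
  bound \<open>\<delta> x < r0\<close> keeps x away from the centre of the ball, where the lower
  function has a kink.\<close>

lemma frontier_dist_has_derivative:
  assumes x: "x \<in> \<Omega>" "\<delta> x < r0" and y: "y \<in> frontier \<Omega>" "x = y - \<delta> x *\<^sub>R \<nu> y"
  shows "(\<delta> has_derivative (\<lambda>h. - (\<nu> y \<bullet> h))) (at x)"
proof -
  have d: "0 < \<delta> x" using frontier_dist_pos_iff[OF open_domain bounded_domain] x by simp
  define c where "c = y - r0 *\<^sub>R \<nu> y"
  have n: "norm (\<nu> y) = 1" using outer_normal y by simp
  have xy: "x - y = - \<delta> x *\<^sub>R \<nu> y" and xc: "x - c = (r0 - \<delta> x) *\<^sub>R \<nu> y"
    unfolding c_def by (subst y(2), simp add: algebra_simps)+
  have nxy: "norm (x - y) = \<delta> x" and nxc: "norm (x - c) = r0 - \<delta> x"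
    using n d x by (auto simp: xy xc)
  have "((\<lambda>z. norm (z - y)) has_derivative (\<lambda>h. (x - y) \<bullet> h / norm (x - y))) (at x)"
    using d nxy by (intro has_derivative_norm_diff) auto
  then have U: "((\<lambda>z. norm (z - y)) has_derivative (\<lambda>h. - (\<nu> y \<bullet> h))) (at x)"
    using d by (simp add: nxy) (simp add: xy)
  have "((\<lambda>z. r0 - norm (z - c)) has_derivative (\<lambda>h. - ((x - c) \<bullet> h / norm (x - c)))) (at x)"
  proof -
    have "x \<noteq> c" using nxc x by auto
    from has_derivative_diff[OF has_derivative_const has_derivative_norm_diff[OF this], of r0]
    show ?thesis by simp
  qed
  then have L: "((\<lambda>z. r0 - norm (z - c)) has_derivative (\<lambda>h. - (\<nu> y \<bullet> h))) (at x)"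
    using x by (simp add: nxc) (simp add: xc)
  have up: "\<delta> z \<le> norm (z - y)" for z
    using frontier_dist_le[of y \<Omega> z] y open_domain by (simp add: frontier_def interior_open)
  have lo: "r0 - norm (z - c) \<le> \<delta> z" for z
    using frontier_dist_ge[OF bounded_domain, of c r0 z] outer_normal(2)[OF y(1)] by (simp add: c_def)
  have eqs: "norm (x - y) = \<delta> x" "r0 - norm (x - c) = \<delta> x" using nxy nxc by auto
  show ?thesis
    unfolding has_derivative_at2
  proof
    show "bounded_linear (\<lambda>h. - (\<nu> y \<bullet> h))" by (intro bounded_linear_minus bounded_linear_inner_right)
    let ?q = "\<lambda>f z. (1 / norm (z - x)) *\<^sub>R (f z - (f x + - (\<nu> y \<bullet> (z - x)))) :: real"
    show "(?q \<delta> \<longlongrightarrow> 0) (at x)"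
    proof (rule tendsto_sandwich)
      show "\<forall>\<^sub>F z in at x. ?q (\<lambda>z. r0 - norm (z - c)) z \<le> ?q \<delta> z"
        using lo eqs by (intro always_eventually allI scaleR_left_mono) auto
      show "\<forall>\<^sub>F z in at x. ?q \<delta> z \<le> ?q (\<lambda>z. norm (z - y)) z"
        using up eqs by (intro always_eventually allI scaleR_left_mono) auto
    qed (use U L in \<open>auto simp: has_derivative_at2\<close>)
  qed
qed

end

section \<open>Smooth fields close to the normal\<close>

text \<open>\<open>flat 0\<close> is the classical smooth function that vanishes on the negative
  half-line. The powers in the denominator make the family closed under differentiation up to linear
  combinations.\<close>

definition flat :: "nat \<Rightarrow> real \<Rightarrow> real" where
  "flat k t = (if 0 < t then exp (- (1 / t)) / t ^ k else 0)"

lemma flat_has_derivative: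
  "(flat k has_real_derivative flat (k + 2) t - real k * flat (k + 1) t) (at t)"
proof -
  consider "t > 0" | "t < 0" | "t = 0" by linarith
  then show ?thesis
  proof cases
    case 1
    have "((\<lambda>t. exp (- (1 / t)) / t ^ k) has_real_derivative flat (k + 2) t - real k * flat (k + 1) t) (at t)"
      using 1 by (auto intro!: derivative_eq_intros simp: flat_def field_simps power2_eq_square)
        (cases k; simp add: field_simps)
    then show ?thesis
      by (rule has_field_derivative_transform_within_open[of _ _ _ "{0<..}"]) (use 1 in \<open>auto simp: flat_def\<close>)
  next
    case 2
    have "((\<lambda>t. 0) has_real_derivative 0) (at t)" by simp
    then have "(flat k has_real_derivative 0) (at t)"
      by (rule has_field_derivative_transform_within_open[of _ _ _ "{..<0}"]) (use 2 in \<open>auto simp: flat_def\<close>)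
    then show ?thesis using 2 by (simp add: flat_def)
  next
    case 3
    \<comment> \<open>With u = 1 / h the quotient is u^(k+1) / exp u, which tends to 0 as u
      grows.\<close>
    have "((\<lambda>h. flat k h / h) \<longlongrightarrow> 0) (at_right 0)"
    proof -
      have "((\<lambda>h. inverse h ^ (k + 1) / exp (inverse h)) \<longlongrightarrow> 0) (at_right (0::real))"
        using tendsto_power_div_exp_0 filterlim_inverse_at_top_right by (rule filterlim_compose)
      then show ?thesis
        by (rule Lim_transform_eventually)
           (auto simp: eventually_at_filter flat_def exp_minus field_simps)
    qed
    moreover have "((\<lambda>h. flat k h / h) \<longlongrightarrow> 0) (at_left 0)"
      by (rule Lim_transform_eventually[OF tendsto_const]) (auto simp: eventually_at_filter flat_def)
    ultimately have "((\<lambda>h. flat k h / h) \<longlongrightarrow> 0) (at 0)" by (simp add: filterlim_split_at)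
    then show ?thesis using 3 by (simp add: DERIV_def flat_def)
  qed
qed

text \<open>This class is visibly closed under partial derivatives, and hence consists of smooth functions.\<close>

inductive elementary :: "(real^'d::finite \<Rightarrow> real) \<Rightarrow> bool" where
  linear: "bounded_linear f \<Longrightarrow> elementary f"
| const: "elementary (\<lambda>x. c)"
| add: "elementary f \<Longrightarrow> elementary g \<Longrightarrow> elementary (\<lambda>x. f x + g x)"
| mult: "elementary f \<Longrightarrow> elementary g \<Longrightarrow> elementary (\<lambda>x. f x * g x)"
| flat: "elementary f \<Longrightarrow> elementary (\<lambda>x. flat k (f x))"

lemma partial_deriv_eqI: "(f has_derivative D) (at x) \<Longrightarrow> partial_deriv i f x = D (axis i 1)"
  unfolding partial_deriv_def by (metis frechet_derivative_at)

lemma elementary_partial_deriv: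
  fixes f :: "real^'d::finite \<Rightarrow> real"
  shows "elementary f \<Longrightarrow> (\<forall>x. f differentiable (at x)) \<and> (\<forall>i. elementary (partial_deriv i f))"
proof (induction rule: elementary.induct)
  case (linear f)
  have *: "(f has_derivative f) (at x)" for x using linear by (rule bounded_linear_imp_has_derivative)
  then have "partial_deriv i f = (\<lambda>x. f (axis i 1))" for i using partial_deriv_eqI by blast
  then show ?case using * by (auto simp: differentiable_def intro: elementary.const)
next
  case (const c)
  have "partial_deriv i (\<lambda>x::real^'d. c) = (\<lambda>x. 0)" for i
    by (rule ext, rule partial_deriv_eqI[of _ "\<lambda>_. 0"]) simp
  then show ?case by (simp add: elementary.const)
next
  case (add f g)
  have d: "(f has_derivative frechet_derivative f (at x)) (at x)" "(g has_derivative frechet_derivative g (at x)) (at x)" for x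
    using add.IH by (simp_all add: frechet_derivative_works)
  have "partial_deriv i (\<lambda>x. f x + g x) = (\<lambda>x. partial_deriv i f x + partial_deriv i g x)" for i
    by (rule ext, rule partial_deriv_eqI[OF has_derivative_add[OF d], THEN trans]) (simp add: partial_deriv_def)
  then show ?case using add.IH by (auto intro: elementary.add)
next
  case (mult f g)
  have d: "(f has_derivative frechet_derivative f (at x)) (at x)" "(g has_derivative frechet_derivative g (at x)) (at x)" for x
    using mult.IH by (simp_all add: frechet_derivative_works)
  have "partial_deriv i (\<lambda>x. f x * g x) = (\<lambda>x. f x * partial_deriv i g x + partial_deriv i f x * g x)" for i
    by (rule ext, rule partial_deriv_eqI[OF has_derivative_mult[OF d], THEN trans]) (simp add: partial_deriv_def)
  then show ?case using mult by (simp add: elementary.add elementary.mult)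
next
  case (flat f k)
  have d: "((\<lambda>x. flat k (f x)) has_derivative
      (\<lambda>h. (flat (k + 2) (f x) + (- real k) * flat (k + 1) (f x)) * frechet_derivative f (at x) h)) (at x)" for x
    using has_derivative_compose[OF frechet_derivative_works[THEN iffD1, of f "at x"]
        flat_has_derivative[of k "f x", unfolded has_field_derivative_def]] flat.IH
    by simp
  have "partial_deriv i (\<lambda>x. flat k (f x)) =
      (\<lambda>x. (flat (k + 2) (f x) + (- real k) * flat (k + 1) (f x)) * partial_deriv i f x)" for i
    by (rule ext, rule partial_deriv_eqI[OF d, THEN trans]) (simp add: partial_deriv_def)
  moreover have "elementary (\<lambda>x. (flat (k + 2) (f x) + (- real k) * flat (k + 1) (f x)) * partial_deriv i f x)" for i
    using flat by (intro elementary.mult elementary.add elementary.flat elementary.const) auto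
  ultimately show ?case using d by (auto simp: differentiable_def)
qed

lemma elementary_continuous: "elementary f \<Longrightarrow> continuous_on S f"
  using elementary_partial_deriv differentiable_imp_continuous_within
  by (metis continuous_at_imp_continuous_on)

lemma elementary_cont_diff: "elementary f \<Longrightarrow> cont_diff n f"
proof (induction n arbitrary: f)
  case 0 then show ?case by (simp add: elementary_continuous)
next
  case (Suc n) then show ?case using elementary_partial_deriv[of f] by simp
qed

lemma real_polynomial_function_elementary:
  "real_polynomial_function (f :: real^'d::finite \<Rightarrow> real) \<Longrightarrow> elementary f"
  by (induction rule: real_polynomial_function.induct) (auto intro: elementary.intros)

lemma elementary_sum:
  "finite I \<Longrightarrow> (\<And>i. i \<in> I \<Longrightarrow> elementary (f i)) \<Longrightarrow> elementary (\<lambda>x. \<Sum>i\<in>I. f i x)"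
  by (induction rule: finite_induct) (auto intro: elementary.intros)

lemma elementary_power: "elementary f \<Longrightarrow> elementary (\<lambda>x. f x ^ m)"
  by (induction m) (auto intro: elementary.intros)

lemma elementary_norm_sq: "elementary (\<lambda>x :: real^'d::finite. (norm x)\<^sup>2)"
proof -
  have "elementary (\<lambda>x :: real^'d. \<Sum>i\<in>UNIV. (x $ i)^2)"
    by (intro elementary_sum elementary_power elementary.linear bounded_linear_vec_nth) simp
  then show ?thesis by (simp add: norm_vec_def L2_set_def sum_nonneg)
qed

text \<open>\<open>q\<close> is a polynomial close to a Urysohn function that is 0 on
  \<open>K\<close> and 2 off \<open>W\<close>, but only on a large ball. The summand
  \<open>s x ^ m\<close> makes up for this: it is tiny on \<open>K\<close> and at least 1 outside
  that ball. So \<open>Q\<close> is nearly 0 on \<open>K\<close> and at least 1 off a bounded part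
  of \<open>W\<close>, and \<open>flat 0 (1 - Q)\<close>, normalised by \<open>exp 1\<close>, is the
  cutoff.\<close>

lemma smooth_cutoff:
  fixes K W :: "(real^'d::finite) set"
  assumes K: "compact K" "K \<subseteq> W" "open W" and \<epsilon>: "0 < \<epsilon>" "\<epsilon> < 1"
  obtains \<psi> R where "elementary \<psi>" "\<And>x. 0 \<le> \<psi> x" "\<And>x. \<psi> x \<le> 1" "\<And>x. x \<in> K \<Longrightarrow> 1 - \<epsilon> \<le> \<psi> x"
    "\<And>x. \<psi> x \<noteq> 0 \<Longrightarrow> x \<in> W \<and> norm x \<le> R"
proof -
  obtain R where R: "R > 0" "\<And>x. x \<in> K \<Longrightarrow> norm x \<le> R"
    using compact_imp_bounded[OF K(1)] bounded_pos by blast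
  define D where "D = cball (0::real^'d) (2 * R)"
  \<comment> \<open>On \<open>K\<close> both summands of \<open>Q\<close> are at most \<tau>, so Q
    is at most \<epsilon> / 4, and the exponent \<open>1 - 1 / (1 - Q x)\<close> is at least -2 * Q.
    Off \<open>W\<close> the value of q is at least 2 - \<tau>, hence at least 1.\<close>
  define \<tau> where "\<tau> = \<epsilon> / 8"
  have "K \<inter> - W = {}" using K by auto
  then obtain u where u: "continuous_on UNIV u" "\<And>x. x \<in> K \<Longrightarrow> u x = (0::real)" "\<And>x. x \<in> - W \<Longrightarrow> u x = 2"
    using Urysohn[OF compact_imp_closed[OF K(1)] closed_Compl[OF K(3)], of 0 "2::real"] by metis
  have "compact D" by (simp add: D_def)
  obtain q where q: "real_polynomial_function q" "\<And>x. x \<in> D \<Longrightarrow> \<bar>u x - q x\<bar> < \<tau>"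
    using Stone_Weierstrass_real_polynomial_function[OF \<open>compact D\<close> continuous_on_subset[OF u(1)], of \<tau>] \<epsilon>
    by (auto simp: \<tau>_def)
  obtain m where m: "(1/4::real) ^ m < \<tau>"
    using real_arch_pow_inv[of \<tau> "1/4"] \<epsilon> by (auto simp: \<tau>_def)
  define s where "s x = (norm x)\<^sup>2 * (1 / (2 * R)\<^sup>2)" for x :: "real^'d"
  define Q where "Q x = q x ^ 2 + s x ^ m * 1" for x
  define \<psi> where "\<psi> x = exp 1 * flat 0 (1 + (-1) * Q x)" for x
  have sx: "0 \<le> s x" for x by (simp add: s_def)
  have Q0: "0 \<le> Q x" for x by (simp add: Q_def sx)
  have "elementary s" unfolding s_def[abs_def] by (intro elementary.mult elementary_norm_sq elementary.const)
  then have "elementary Q" unfolding Q_def[abs_def]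
    by (intro elementary.add elementary.mult elementary.const elementary_power
        real_polynomial_function_elementary[OF q(1)])
  then have 1: "elementary \<psi>" unfolding \<psi>_def[abs_def]
    by (intro elementary.mult elementary.flat elementary.add elementary.const)
  have 2: "0 \<le> \<psi> x" for x by (simp add: \<psi>_def flat_def)
  have \<psi>: "\<psi> x = (if Q x < 1 then exp (1 - 1 / (1 - Q x)) else 0)" for x
    by (simp add: \<psi>_def flat_def exp_add[symmetric])
  have 3: "\<psi> x \<le> 1" for x
    using Q0[of x] by (auto simp: \<psi> field_simps)
  have 4: "1 - \<epsilon> \<le> \<psi> x" if "x \<in> K" for x
  proof -
    have xD: "x \<in> D" using R(2)[OF that] R(1) by (simp add: D_def)
    have "\<bar>q x\<bar> \<le> \<tau>" using q(2)[OF xD] u(2)[OF that] by simp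
    then have "q x ^ 2 \<le> \<tau> ^ 2" by (metis abs_ge_zero power2_abs power_mono)
    also have "\<dots> \<le> \<tau>" using \<epsilon> by (simp add: \<tau>_def power2_eq_square mult_le_one field_simps)
    finally have a: "q x ^ 2 \<le> \<tau>" .
    have "s x \<le> R\<^sup>2 * (1 / (2 * R)\<^sup>2)" unfolding s_def using R(2)[OF that] by (intro mult_right_mono power_mono) auto
    also have "\<dots> = 1/4" using R(1) by (simp add: field_simps)
    finally have "s x ^ m \<le> (1/4) ^ m" using sx by (intro power_mono) auto
    then have Qx: "Q x \<le> 2 * \<tau>" using a m by (simp add: Q_def)
    then have lt: "Q x < 1" "1/2 \<le> 1 - Q x" using \<epsilon> by (auto simp: \<tau>_def)
    have "1 / (1 - Q x) - 1 = Q x / (1 - Q x)" using lt by (simp add: field_simps)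
    also have "\<dots> \<le> Q x / (1/2)" using lt Q0[of x] by (intro divide_left_mono) auto
    also have "\<dots> \<le> \<epsilon>" using Qx \<epsilon> by (simp add: \<tau>_def)
    finally have "1 - \<epsilon> \<le> 1 + (1 - 1 / (1 - Q x))" by simp
    also have "\<dots> \<le> exp (1 - 1 / (1 - Q x))" by (rule exp_ge_add_one_self)
    finally show ?thesis using lt by (simp add: \<psi>)
  qed
  have 5: "x \<in> W \<and> norm x \<le> 2 * R" if "\<psi> x \<noteq> 0" for x
  proof -
    have Qx: "Q x < 1" using that by (auto simp: \<psi> split: if_splits)
    have xD: "norm x \<le> 2 * R"
    proof (rule ccontr)
      assume "\<not> ?thesis"
      then have "(2 * R)\<^sup>2 \<le> (norm x)\<^sup>2" using R(1) by (intro power_mono) auto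
      then have "1 \<le> s x" using R(1) by (simp add: s_def)
      then have "1 \<le> s x ^ m" by (rule one_le_power)
      then show False using Qx by (simp add: Q_def) (smt (verit) zero_le_power2)
    qed
    moreover have "x \<in> W"
    proof (rule ccontr)
      assume "x \<notin> W"
      then have "2 - \<tau> \<le> q x" using q(2)[of x] u(3)[of x] xD by (simp add: D_def)
      then have "1 \<le> q x" using \<epsilon> by (simp add: \<tau>_def)
      then have "1 \<le> q x ^ 2" by (rule one_le_power)
      then show False using Qx sx[of x] by (simp add: Q_def) (smt (verit) zero_le_power)
    qed
    ultimately show ?thesis by blast
  qed
  show thesis using that[of \<psi> "2 * R"] 1 2 3 4 5 by blast
qed

lemma test_function_continuous: "test_function f \<Longrightarrow> continuous_on UNIV f"
  by (auto simp: test_function_def dest: spec[of _ 0])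

text \<open>Polynomials approximate the shortened normal
  \<open>(1 - \<epsilon> / 4) *\<^sub>R \<nu>\<close> on the frontier. The shortening exceeds the
  approximation error \<epsilon> / 8, so the polynomial field is shorter than 1 on the frontier and
  hence on an open set \<open>W\<close>; a cutoff living in \<open>W\<close> enforces the norm bound
  everywhere. Uniform continuity then carries the lower bound from the frontier to a neighbourhood
  of fixed width.\<close>

lemma two_ball_domain_normal_field:
  fixes \<Omega> :: "(real^'d::finite) set"
  assumes "two_ball_domain \<Omega> r0" and \<epsilon>: "0 < \<epsilon>" "\<epsilon> < 1"
  obtains \<phi> \<eta> where "\<And>i. test_function (\<phi> i)" "\<And>x. (\<Sum>i\<in>UNIV. (\<phi> i x)\<^sup>2) \<le> 1" "0 < \<eta>"
    "\<And>x y. y \<in> frontier \<Omega> \<Longrightarrow> norm (x - y) < \<eta> \<Longrightarrow>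
       1 - \<epsilon> \<le> (\<Sum>i\<in>UNIV. \<phi> i x * outer_normal r0 \<Omega> y $ i)"
proof -
  interpret two_ball_domain \<Omega> r0 by fact
  define K where "K = frontier \<Omega>"
  have K: "compact K" using bounded_domain by (simp add: K_def compact_frontier_bounded)
  define d where "d = real CARD('d)"
  have d: "d > 0" by (simp add: d_def)
  \<comment> \<open>The error per coordinate is divided by the dimension, since the norm is bounded
    by the sum of the coordinates.\<close>
  have "\<exists>P. real_polynomial_function P \<and> (\<forall>y\<in>K. \<bar>(1 - \<epsilon> / 4) * \<nu> y $ i - P y\<bar> < \<epsilon> / (8 * d))" for i
  proof -
    have "continuous_on K (\<lambda>y. (1 - \<epsilon> / 4) * \<nu> y $ i)"
      using continuous_outer_normal by (auto simp: K_def intro!: continuous_intros)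
    moreover have "0 < \<epsilon> / (8 * d)" using \<epsilon> d by simp
    ultimately obtain g where "real_polynomial_function g"
      "\<And>y. y \<in> K \<Longrightarrow> \<bar>(1 - \<epsilon> / 4) * \<nu> y $ i - g y\<bar> < \<epsilon> / (8 * d)"
      by (rule Stone_Weierstrass_real_polynomial_function[OF K]) blast
    then show ?thesis by blast
  qed
  then obtain p where p: "\<And>i. real_polynomial_function (p i)"
    "\<And>i y. y \<in> K \<Longrightarrow> \<bar>(1 - \<epsilon> / 4) * \<nu> y $ i - p i y\<bar> < \<epsilon> / (8 * d)" by metis
  have pe: "elementary (p i)" for i by (rule real_polynomial_function_elementary[OF p(1)])
  define P where "P x = (\<chi> i. p i x)" for x
  have contP: "continuous_on S P" for S
    unfolding P_def using elementary_continuous[OF pe] by (intro continuous_on_vec_lambda) auto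
  have near: "norm (P y - (1 - \<epsilon> / 4) *\<^sub>R \<nu> y) \<le> \<epsilon> / 8" if "y \<in> K" for y
  proof -
    have "norm (P y - (1 - \<epsilon> / 4) *\<^sub>R \<nu> y) \<le> (\<Sum>i\<in>UNIV. \<bar>(P y - (1 - \<epsilon> / 4) *\<^sub>R \<nu> y) $ i\<bar>)"
      by (rule norm_le_l1_cart)
    also have "\<dots> \<le> (\<Sum>i\<in>(UNIV::'d set). \<epsilon> / (8 * d))"
      using p(2)[OF that] by (intro sum_mono) (auto simp: P_def abs_minus_commute less_imp_le)
    also have "\<dots> = \<epsilon> / 8" using d by (simp add: d_def)
    finally show ?thesis .
  qed
  have nK: "norm (\<nu> y) = 1" if "y \<in> K" for y using outer_normal(1) that by (simp add: K_def)
  have PK: "norm (P y) < 1" if "y \<in> K" for y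
    using norm_triangle_ineq2[of "P y" "(1 - \<epsilon> / 4) *\<^sub>R \<nu> y"] near[OF that] nK[OF that] \<epsilon> by simp
  have PnK: "1 - \<epsilon> / 2 \<le> P y \<bullet> \<nu> y" if "y \<in> K" for y
  proof -
    have "P y \<bullet> \<nu> y = (P y - (1 - \<epsilon> / 4) *\<^sub>R \<nu> y) \<bullet> \<nu> y + (1 - \<epsilon> / 4)"
      using nK[OF that] by (simp add: inner_diff_left norm_eq_1)
    moreover have "\<bar>(P y - (1 - \<epsilon> / 4) *\<^sub>R \<nu> y) \<bullet> \<nu> y\<bar> \<le> \<epsilon> / 8"
      using Cauchy_Schwarz_ineq2[of "P y - (1 - \<epsilon> / 4) *\<^sub>R \<nu> y" "\<nu> y"] near[OF that] nK[OF that] by simp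
    ultimately show ?thesis using \<epsilon> by linarith
  qed
  define W where "W = {x. norm (P x) < 1}"
  have W: "open W" unfolding W_def by (intro open_Collect_less continuous_intros contP)
  have KW: "K \<subseteq> W" using PK by (auto simp: W_def)
  obtain \<psi> R where \<psi>: "elementary \<psi>" "\<And>x. 0 \<le> \<psi> x" "\<And>x. \<psi> x \<le> 1" "\<And>x. x \<in> K \<Longrightarrow> 1 - \<epsilon> / 8 \<le> \<psi> x"
    "\<And>x. \<psi> x \<noteq> 0 \<Longrightarrow> x \<in> W \<and> norm x \<le> R"
    using smooth_cutoff[OF K KW W, of "\<epsilon> / 8"] \<epsilon> by auto
  define \<phi> where "\<phi> i x = p i x * \<psi> x" for i x
  have el: "elementary (\<phi> i)" for i unfolding \<phi>_def[abs_def] by (intro elementary.mult pe \<psi>)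
  have "test_function (\<phi> i)" for i
  proof -
    have "{x. \<phi> i x \<noteq> 0} \<subseteq> cball 0 R" using \<psi>(5) by (auto simp: \<phi>_def)
    then have "bounded {x. \<phi> i x \<noteq> 0}" using bounded_cball bounded_subset by blast
    then show ?thesis using elementary_cont_diff[OF el] by (simp add: test_function_def compact_closure)
  qed
  moreover have "(\<Sum>i\<in>UNIV. (\<phi> i x)\<^sup>2) \<le> 1" for x
  proof -
    have "(\<Sum>i\<in>UNIV. (\<phi> i x)\<^sup>2) = (\<psi> x)\<^sup>2 * (norm (P x))\<^sup>2"
      by (simp add: \<phi>_def power_mult_distrib sum_distrib_left norm_vec_def L2_set_def sum_nonneg P_def mult.commute)
    also have "\<dots> \<le> 1"
    proof (cases "\<psi> x = 0")
      case False
      then have "norm (P x) \<le> 1" using \<psi>(5)[of x] by (simp add: W_def)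
      then show ?thesis using \<psi>(2,3)[of x] by (intro mult_le_one power_le_one) auto
    qed simp
    finally show ?thesis .
  qed
  moreover define \<Phi> where "\<Phi> x = (\<chi> i. \<phi> i x)" for x
  have contPhi: "continuous_on S \<Phi>" for S
    unfolding \<Phi>_def using elementary_continuous[OF el] by (intro continuous_on_vec_lambda) auto
  obtain B where B: "B > 0" "\<And>x. x \<in> K \<Longrightarrow> norm x \<le> B"
    using compact_imp_bounded[OF K] bounded_pos by blast
  \<comment> \<open>The ball contains all points within distance 1 of the frontier, whence the width
    \<open>min 1 \<eta>\<close> below.\<close>
  have "uniformly_continuous_on (cball 0 (B + 1)) \<Phi>"
    by (intro compact_uniformly_continuous contPhi) simp
  then obtain \<eta> where \<eta>: "\<eta> > 0" "\<And>x y. x \<in> cball 0 (B + 1) \<Longrightarrow> y \<in> cball 0 (B + 1) \<Longrightarrow> dist x y < \<eta> \<Longrightarrow> dist (\<Phi> x) (\<Phi> y) < \<epsilon> / 4"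
    by (rule uniformly_continuous_onE[of _ _ "\<epsilon> / 4"]) (use \<epsilon> in \<open>auto simp: dist_commute\<close>)
  have "1 - \<epsilon> \<le> (\<Sum>i\<in>UNIV. \<phi> i x * \<nu> y $ i)" if y: "y \<in> frontier \<Omega>" and xy: "norm (x - y) < min 1 \<eta>" for x y
  proof -
    have yK: "y \<in> K" using y by (simp add: K_def)
    have "norm x \<le> norm (x - y) + norm y" using norm_triangle_ineq[of "x - y" y] by simp
    then have "x \<in> cball 0 (B + 1)" "y \<in> cball 0 (B + 1)" using xy B(2)[OF yK] by auto
    then have a: "norm (\<Phi> x - \<Phi> y) < \<epsilon> / 4" using \<eta>(2)[of x y] xy by (simp add: dist_norm)
    have "\<bar>(\<Phi> x - \<Phi> y) \<bullet> \<nu> y\<bar> \<le> \<epsilon> / 4"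
      using Cauchy_Schwarz_ineq2[of "\<Phi> x - \<Phi> y" "\<nu> y"] nK[OF yK] a by simp
    moreover have "\<Phi> y \<bullet> \<nu> y = \<psi> y * (P y \<bullet> \<nu> y)"
      by (simp add: \<Phi>_def \<phi>_def P_def inner_vec_def sum_distrib_left mult_ac)
    moreover have "(1 - \<epsilon> / 8) * (1 - \<epsilon> / 2) \<le> \<psi> y * (P y \<bullet> \<nu> y)"
      using \<psi>(4)[OF yK] PnK[OF yK] \<epsilon> \<psi>(2)[of y] by (intro mult_mono) auto
    moreover have "1 - 3/4 * \<epsilon> \<le> (1 - \<epsilon> / 8) * (1 - \<epsilon> / 2)" using \<epsilon> by (simp add: algebra_simps)
    ultimately have "1 - \<epsilon> \<le> \<Phi> x \<bullet> \<nu> y" unfolding inner_diff_left by linarith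
    then show ?thesis by (simp add: \<Phi>_def inner_vec_def)
  qed
  ultimately show thesis using that[of \<phi> "min 1 \<eta>"] \<eta>(1) by auto
qed

section \<open>Integration by parts against Lipschitz functions\<close>

lemma integrable_bounded_support:
  fixes f :: "'a::euclidean_space \<Rightarrow> real"
  assumes "f \<in> borel_measurable borel" "\<And>x. \<bar>f x\<bar> \<le> B" "\<And>x. R < norm x \<Longrightarrow> f x = 0"
  shows "integrable lborel f"
proof (rule Bochner_Integration.integrable_bound)
  show "integrable lborel (\<lambda>x::'a. B * indicator (cball 0 R) x)"
    using emeasure_bounded_finite[of "cball (0::'a) R"]
    by (intro integrable_mult_right integrable_real_indicator) (auto simp: less_top)
  show "AE x in lborel. norm (f x) \<le> norm (B * indicator (cball 0 R) x)"
    using assms(2,3) by (intro AE_I2) (auto simp: indicator_def intro: order_trans[OF assms(2)])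
qed (use assms in simp)

lemma integral_lborel_translate:
  fixes f :: "'a::euclidean_space \<Rightarrow> real"
  assumes "f \<in> borel_measurable borel"
  shows "(\<integral>x. f (x + c) \<partial>lborel) = (\<integral>x. f x \<partial>lborel)"
proof -
  have "(\<integral>x. f x \<partial>lborel) = (\<integral>x. f x \<partial>distr lborel borel ((+) c))" by (simp add: lborel_distr_plus)
  also have "\<dots> = (\<integral>x. f (c + x) \<partial>lborel)" using assms by (intro integral_distr) auto
  finally show ?thesis by (simp add: add.commute)
qed

lemma test_function_facts:
  fixes \<phi> :: "real^'d::finite \<Rightarrow> real"
  assumes "test_function \<phi>"
  obtains B R where "continuous_on UNIV \<phi>" "\<And>i. continuous_on UNIV (partial_deriv i \<phi>)"
    "\<And>x. \<phi> differentiable (at x)" "\<And>x. \<bar>\<phi> x\<bar> \<le> B" "\<And>i x. \<bar>partial_deriv i \<phi> x\<bar> \<le> B"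
    "\<And>x. R < norm x \<Longrightarrow> \<phi> x = 0" "\<And>i x. R < norm x \<Longrightarrow> partial_deriv i \<phi> x = 0"
proof -
  have c0: "continuous_on UNIV \<phi>" using assms by (rule test_function_continuous)
  have "cont_diff (Suc 0) \<phi>" using assms by (simp only: test_function_def)
  then have d: "\<And>x. \<phi> differentiable (at x)" and c1: "\<And>i. continuous_on UNIV (partial_deriv i \<phi>)" by auto
  have "bounded {x. \<phi> x \<noteq> 0}" using assms
    by (metis bounded_subset closure_subset compact_imp_bounded test_function_def)
  then obtain R where "\<forall>x\<in>{x. \<phi> x \<noteq> 0}. norm x \<le> R" unfolding bounded_iff by blast
  then have R: "\<phi> x = 0" if "R < norm x" for x using that by (metis (mono_tags, lifting) leD mem_Collect_eq)
  have R': "partial_deriv i \<phi> x = 0" if "R < norm x" for i x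
  proof -
    have o: "open {x. R < norm (x::real^'d)}" by (intro open_Collect_less continuous_intros)
    have "((\<lambda>x. 0) has_derivative (\<lambda>h. 0)) (at x)" by simp
    then have "(\<phi> has_derivative (\<lambda>h. 0)) (at x)"
      by (rule has_derivative_transform_within_open[OF _ o]) (use that R in auto)
    then show ?thesis by (rule partial_deriv_eqI)
  qed
  have bd: "\<exists>B. \<forall>x. \<bar>f x\<bar> \<le> B" if c: "continuous_on UNIV f" and z: "\<And>x. R < norm x \<Longrightarrow> f x = 0" for f :: "real^'d \<Rightarrow> real"
  proof -
    have "bounded (f ` cball 0 R)"
      using c by (intro compact_imp_bounded compact_continuous_image) (auto intro: continuous_on_subset)
    then obtain B where "\<forall>x\<in>cball 0 R. \<bar>f x\<bar> \<le> B" unfolding bounded_iff by auto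
    then have B: "\<bar>f x\<bar> \<le> B" if "x \<in> cball 0 R" for x using that by blast
    have "\<bar>f x\<bar> \<le> max B 0" for x using B[of x] z[of x] by (cases "norm x \<le> R") auto
    then show ?thesis by blast
  qed
  obtain B0 where B0: "\<And>x. \<bar>\<phi> x\<bar> \<le> B0" using bd[OF c0 R] by blast
  obtain B1 where B1: "\<And>i x. \<bar>partial_deriv i \<phi> x\<bar> \<le> B1 i" using bd[OF c1 R'] by metis
  define B where "B = Max (insert B0 (range B1))"
  have "B0 \<le> B" "B1 i \<le> B" for i unfolding B_def by (rule Max_ge; simp)+
  then show thesis using that[of B R] c0 c1 d B0 B1 R R' by (meson order_trans)
qed

text \<open>Forward quotients will be applied to the test function and backward ones to the
  Lipschitz factor; a translation of the integration variable exchanges the two.\<close>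

lemma partial_deriv_quotient:
  assumes "f differentiable (at x)"
  shows "(\<lambda>n. (f (x + (1 / real (Suc n)) *\<^sub>R axis i 1) - f x) * real (Suc n)) \<longlonglongrightarrow> partial_deriv i f x"
    "(\<lambda>n. (f x - f (x - (1 / real (Suc n)) *\<^sub>R axis i 1)) * real (Suc n)) \<longlonglongrightarrow> partial_deriv i f x"
proof -
  let ?e = "axis i (1::real)"
  have "(f has_derivative frechet_derivative f (at x)) (at x)" using assms by (simp add: frechet_derivative_works)
  moreover have "((\<lambda>s. x + s *\<^sub>R ?e) has_derivative (\<lambda>s. s *\<^sub>R ?e)) (at 0)" by (auto intro!: derivative_eq_intros)
  ultimately have "((\<lambda>s. f (x + s *\<^sub>R ?e)) has_derivative (\<lambda>s. frechet_derivative f (at x) (s *\<^sub>R ?e))) (at 0)"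
    by (intro has_derivative_compose[where f = "\<lambda>s. x + s *\<^sub>R ?e" and g = f]) auto
  moreover have "frechet_derivative f (at x) (s *\<^sub>R ?e) = partial_deriv i f x * s" for s
    using linear_frechet_derivative[OF assms] by (simp add: partial_deriv_def linear_cmul)
  ultimately have "((\<lambda>s. f (x + s *\<^sub>R ?e)) has_real_derivative partial_deriv i f x) (at 0)"
    by (simp add: has_field_derivative_def)
  then have q: "((\<lambda>s. (f (x + s *\<^sub>R ?e) - f x) / s) \<longlongrightarrow> partial_deriv i f x) (at 0)"
    by (simp add: DERIV_def)
  have f1: "filterlim (\<lambda>n. 1 / real (Suc n)) (at 0) sequentially"
    unfolding filterlim_at using LIMSEQ_inverse_real_of_nat by (auto simp: inverse_eq_divide)
  have f2: "filterlim (\<lambda>n. - (1 / real (Suc n))) (at 0) sequentially"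
    unfolding filterlim_at using tendsto_minus[OF LIMSEQ_inverse_real_of_nat] by (auto simp: inverse_eq_divide)
  show "(\<lambda>n. (f (x + (1 / real (Suc n)) *\<^sub>R axis i 1) - f x) * real (Suc n)) \<longlonglongrightarrow> partial_deriv i f x"
    using filterlim_compose[OF q f1] by simp
  show "(\<lambda>n. (f x - f (x - (1 / real (Suc n)) *\<^sub>R axis i 1)) * real (Suc n)) \<longlonglongrightarrow> partial_deriv i f x"
    using filterlim_compose[OF q f2] by (simp add: field_simps)
qed

text \<open>As a limit of a sequence of quotients this is Borel measurable for every continuous f,
  and it equals the partial derivative wherever f is differentiable.\<close>

definition lower_partial :: "'d::finite \<Rightarrow> (real^'d \<Rightarrow> real) \<Rightarrow> real^'d \<Rightarrow> real" where
  "lower_partial i f x = lim (\<lambda>n. (f x - f (x - (1 / real (Suc n)) *\<^sub>R axis i 1)) * real (Suc n))"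

text \<open>For difference quotients the formula is exact by translation invariance. Both sides pass
  to the limit by dominated convergence: the quotients of \<phi> are bounded by its derivative,
  those of \<eta> by the Lipschitz constant.\<close>

lemma integration_by_parts_lipschitz:
  fixes \<phi> \<eta> :: "real^'d::finite \<Rightarrow> real"
  assumes \<phi>: "test_function \<phi>"
    and \<eta>: "\<And>x y. \<bar>\<eta> x - \<eta> y\<bar> \<le> L * norm (x - y)" "\<And>x. \<bar>\<eta> x\<bar> \<le> 1"
    and ae: "AE x in lborel. \<eta> differentiable (at x)"
  shows "(\<integral>x. \<eta> x * partial_deriv i \<phi> x \<partial>lborel) = - (\<integral>x. lower_partial i \<eta> x * \<phi> x \<partial>lborel)"
    and "integrable lborel (\<lambda>x. \<eta> x * partial_deriv i \<phi> x)"
    and "integrable lborel (\<lambda>x. lower_partial i \<eta> x * \<phi> x)"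
proof -
  obtain B R where c0: "continuous_on UNIV \<phi>" and c1: "\<And>i. continuous_on UNIV (partial_deriv i \<phi>)"
    and d: "\<And>x. \<phi> differentiable (at x)" and B: "\<And>x. \<bar>\<phi> x\<bar> \<le> B" "\<And>i x. \<bar>partial_deriv i \<phi> x\<bar> \<le> B"
    and R: "\<And>x. R < norm x \<Longrightarrow> \<phi> x = 0" "\<And>i x. R < norm x \<Longrightarrow> partial_deriv i \<phi> x = 0"
    using test_function_facts[OF \<phi>] by metis
  let ?e = "axis i (1::real) :: real^'d"
  define h where "h n = 1 / real (Suc n)" for n
  have h: "0 < h n" "h n \<le> 1" "h n * real (Suc n) = 1" for n by (auto simp: h_def field_simps)
  have B0: "0 \<le> B" using B(1)[of 0] by linarith
  have "L-lipschitz_on UNIV \<eta>" if "0 \<le> L" using \<eta>(1) that by (auto simp: lipschitz_on_def dist_norm)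
  moreover have "0 \<le> L" using \<eta>(1)[of ?e 0] by (simp add: norm_axis_1)
  ultimately have ceta: "continuous_on UNIV \<eta>" using lipschitz_on_continuous_on by blast
  note [measurable] = borel_measurable_continuous_onI[OF c0] borel_measurable_continuous_onI[OF c1]
    borel_measurable_continuous_onI[OF ceta]
  define qf where "qf n x = (\<phi> (x + h n *\<^sub>R ?e) - \<phi> x) * real (Suc n)" for n x
  define qe where "qe n x = (\<eta> x - \<eta> (x - h n *\<^sub>R ?e)) * real (Suc n)" for n x
  have [measurable]: "qf n \<in> borel_measurable borel" "qe n \<in> borel_measurable borel" for n
    unfolding qf_def[abs_def] qe_def[abs_def] by measurable
  have qfB: "\<bar>qf n x\<bar> \<le> B" for n x
  proof -
    define g where "g s = \<phi> (x + s *\<^sub>R ?e)" for s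
    have dg: "(g has_real_derivative partial_deriv i \<phi> (x + s *\<^sub>R ?e)) (at s)" for s
    proof -
      have "(\<phi> has_derivative frechet_derivative \<phi> (at (x + s *\<^sub>R ?e))) (at (x + s *\<^sub>R ?e))" using d by (simp add: frechet_derivative_works)
      moreover have "((\<lambda>s. x + s *\<^sub>R ?e) has_derivative (\<lambda>s. s *\<^sub>R ?e)) (at s)" by (auto intro!: derivative_eq_intros)
      ultimately have "(g has_derivative (\<lambda>u. frechet_derivative \<phi> (at (x + s *\<^sub>R ?e)) (u *\<^sub>R ?e))) (at s)"
        unfolding g_def by (intro has_derivative_compose[where f = "\<lambda>s. x + s *\<^sub>R ?e" and g = \<phi>]) auto
      moreover have "frechet_derivative \<phi> (at (x + s *\<^sub>R ?e)) (u *\<^sub>R ?e) = partial_deriv i \<phi> (x + s *\<^sub>R ?e) * u" for u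
        using linear_frechet_derivative[OF d[of "x + s *\<^sub>R ?e"]] by (simp add: partial_deriv_def linear_cmul)
      ultimately show ?thesis by (simp add: has_field_derivative_def)
    qed
    obtain z where "g (h n) - g 0 = (h n - 0) * partial_deriv i \<phi> (x + z *\<^sub>R ?e)"
      using MVT2[of 0 "h n" g "\<lambda>s. partial_deriv i \<phi> (x + s *\<^sub>R ?e)"] h dg by blast
    then have "qf n x = partial_deriv i \<phi> (x + z *\<^sub>R ?e)" using h by (simp add: qf_def g_def)
    then show ?thesis using B(2) by simp
  qed
  have qeB: "\<bar>qe n x\<bar> \<le> L" for n x
  proof -
    have "\<bar>qe n x\<bar> = \<bar>\<eta> x - \<eta> (x - h n *\<^sub>R ?e)\<bar> * real (Suc n)" by (simp add: qe_def abs_mult)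
    also have "\<dots> \<le> (L * norm (h n *\<^sub>R ?e)) * real (Suc n)" using \<eta>(1)[of x "x - h n *\<^sub>R ?e"] by (intro mult_right_mono) auto
    also have "\<dots> = L" using h[of n] by (simp add: norm_axis_1)
    finally show ?thesis .
  qed
  have L0: "0 \<le> L" by fact
  have qfR: "qf n x = 0" if "R + 1 < norm x" for n x
  proof -
    have "norm x \<le> norm (x + h n *\<^sub>R ?e) + norm (h n *\<^sub>R ?e)"
      by (metis add_diff_cancel_right' norm_triangle_ineq4)
    moreover have "norm (h n *\<^sub>R ?e) \<le> 1" using h[of n] by (simp add: norm_axis_1)
    ultimately have "R < norm (x + h n *\<^sub>R ?e)" "R < norm x" using that by linarith+
    then show ?thesis by (simp add: qf_def R)
  qed
  have parts: "(\<integral>x. \<eta> x * qf n x \<partial>lborel) = - (\<integral>x. qe n x * \<phi> x \<partial>lborel)" for n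
  proof -
    have i1: "integrable lborel (\<lambda>x. \<eta> x * \<phi> (x + h n *\<^sub>R ?e))"
    proof (rule integrable_bounded_support[of _ B "R + 1"])
      show "\<bar>\<eta> x * \<phi> (x + h n *\<^sub>R ?e)\<bar> \<le> B" for x
        using mult_mono[OF \<eta>(2)[of x] B(1)[of "x + h n *\<^sub>R ?e"]] B0 by (simp add: abs_mult)
      fix x :: "real^'d" assume x: "R + 1 < norm x"
      have "norm x \<le> norm (x + h n *\<^sub>R ?e) + norm (h n *\<^sub>R ?e)"
        by (metis add_diff_cancel_right' norm_triangle_ineq4)
      moreover have "norm (h n *\<^sub>R ?e) \<le> 1" using h[of n] by (simp add: norm_axis_1)
      ultimately have "R < norm (x + h n *\<^sub>R ?e)" using x by linarith
      then show "\<eta> x * \<phi> (x + h n *\<^sub>R ?e) = 0" by (simp add: R)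
    qed simp
    have i2: "integrable lborel (\<lambda>x. \<eta> x * \<phi> x)"
      using mult_mono[OF \<eta>(2) B(1)] B0 by (intro integrable_bounded_support[of _ B R]) (auto simp: abs_mult R)
    have i3: "integrable lborel (\<lambda>x. \<eta> (x - h n *\<^sub>R ?e) * \<phi> x)"
      using mult_mono[OF \<eta>(2) B(1)] B0 by (intro integrable_bounded_support[of _ B R]) (auto simp: abs_mult R)
    have t: "(\<integral>x. \<eta> x * \<phi> (x + h n *\<^sub>R ?e) \<partial>lborel) = (\<integral>x. \<eta> (x - h n *\<^sub>R ?e) * \<phi> x \<partial>lborel)"
      using integral_lborel_translate[of "\<lambda>x. \<eta> (x - h n *\<^sub>R ?e) * \<phi> x" "h n *\<^sub>R ?e"] by simp
    have "(\<integral>x. \<eta> x * qf n x \<partial>lborel) = (\<integral>x. (\<eta> x * \<phi> (x + h n *\<^sub>R ?e) - \<eta> x * \<phi> x) * real (Suc n) \<partial>lborel)"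
      by (intro Bochner_Integration.integral_cong) (auto simp: qf_def algebra_simps)
    also have "\<dots> = ((\<integral>x. \<eta> (x - h n *\<^sub>R ?e) * \<phi> x \<partial>lborel) - (\<integral>x. \<eta> x * \<phi> x \<partial>lborel)) * real (Suc n)"
      using i1 i2 t by simp
    also have "\<dots> = - (((\<integral>x. \<eta> x * \<phi> x \<partial>lborel) - (\<integral>x. \<eta> (x - h n *\<^sub>R ?e) * \<phi> x \<partial>lborel)) * real (Suc n))"
      by (simp add: algebra_simps)
    also have "\<dots> = - (\<integral>x. (\<eta> x * \<phi> x - \<eta> (x - h n *\<^sub>R ?e) * \<phi> x) * real (Suc n) \<partial>lborel)"
      using i2 i3 by simp
    also have "\<dots> = - (\<integral>x. qe n x * \<phi> x \<partial>lborel)"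
      by (intro arg_cong[where f = uminus] Bochner_Integration.integral_cong) (auto simp: qe_def algebra_simps)
    finally show ?thesis .
  qed
  have [measurable]: "lower_partial i \<eta> \<in> borel_measurable borel"
    unfolding lower_partial_def[abs_def] by measurable
  have lim1: "(\<lambda>n. qf n x) \<longlonglongrightarrow> partial_deriv i \<phi> x" for x
    unfolding qf_def h_def using partial_deriv_quotient(1)[OF d] .
  have lim2: "AE x in lborel. (\<lambda>n. qe n x) \<longlonglongrightarrow> lower_partial i \<eta> x"
    using ae
  proof eventually_elim
    case (elim x)
    have "(\<lambda>n. qe n x) \<longlonglongrightarrow> partial_deriv i \<eta> x"
      unfolding qe_def h_def using partial_deriv_quotient(2)[OF elim] .
    moreover from limI[OF this] have "lower_partial i \<eta> x = partial_deriv i \<eta> x"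
      by (simp add: lower_partial_def qe_def h_def)
    ultimately show ?case by simp
  qed
  \<comment> \<open>One majorant for both products; the radius \<open>R + 1\<close> allows for
    shifts of length at most 1.\<close>
  define w where "w x = (B + L * B) * indicator (cball 0 (R + 1)) x" for x :: "real^'d"
  have wi: "integrable lborel w" unfolding w_def
    using emeasure_bounded_finite[of "cball (0::real^'d) (R + 1)"]
    by (intro integrable_mult_right integrable_real_indicator) (auto simp: less_top)
  have bd1: "norm (\<eta> x * qf n x) \<le> w x" for n x
  proof (cases "norm x \<le> R + 1")
    case True
    have "\<bar>\<eta> x * qf n x\<bar> \<le> 1 * B" unfolding abs_mult using \<eta>(2) qfB by (intro mult_mono) auto
    then show ?thesis using True B0 L0 by (simp add: w_def) (smt (verit) mult_nonneg_nonneg)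
  qed (simp add: qfR w_def)
  have bd2: "norm (qe n x * \<phi> x) \<le> w x" for n x
  proof (cases "norm x \<le> R + 1")
    case True
    have "\<bar>qe n x * \<phi> x\<bar> \<le> L * B" unfolding abs_mult using qeB B L0 by (intro mult_mono) auto
    then show ?thesis using True B0 by (simp add: w_def)
  qed (simp add: R w_def)
  have lim1': "AE x in lborel. (\<lambda>n. \<eta> x * qf n x) \<longlonglongrightarrow> \<eta> x * partial_deriv i \<phi> x"
    using lim1 by (intro AE_I2 tendsto_mult_left) auto
  have lim2': "AE x in lborel. (\<lambda>n. qe n x * \<phi> x) \<longlonglongrightarrow> lower_partial i \<eta> x * \<phi> x"
    using lim2 by eventually_elim (rule tendsto_mult_right)
  have D1: "(\<lambda>n. \<integral>x. \<eta> x * qf n x \<partial>lborel) \<longlonglongrightarrow> (\<integral>x. \<eta> x * partial_deriv i \<phi> x \<partial>lborel)"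
    by (rule integral_dominated_convergence[OF _ _ wi lim1' AE_I2[OF bd1]]) simp_all
  have D2: "(\<lambda>n. \<integral>x. qe n x * \<phi> x \<partial>lborel) \<longlonglongrightarrow> (\<integral>x. lower_partial i \<eta> x * \<phi> x \<partial>lborel)"
    by (rule integral_dominated_convergence[OF _ _ wi lim2' AE_I2[OF bd2]]) simp_all
  show "integrable lborel (\<lambda>x. \<eta> x * partial_deriv i \<phi> x)"
    by (rule integrable_dominated_convergence[OF _ _ wi lim1' AE_I2[OF bd1]]) simp_all
  show "integrable lborel (\<lambda>x. lower_partial i \<eta> x * \<phi> x)"
    by (rule integrable_dominated_convergence[OF _ _ wi lim2' AE_I2[OF bd2]]) simp_all
  have "(\<lambda>n. - (\<integral>x. qe n x * \<phi> x \<partial>lborel)) \<longlonglongrightarrow> (\<integral>x. \<eta> x * partial_deriv i \<phi> x \<partial>lborel)"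
    using D1 by (simp add: parts)
  then show "(\<integral>x. \<eta> x * partial_deriv i \<phi> x \<partial>lborel) = - (\<integral>x. lower_partial i \<eta> x * \<phi> x \<partial>lborel)"
    using tendsto_minus[OF D2] LIMSEQ_unique by blast
qed

section \<open>Inner layers and the perimeter\<close>

definition layer_volume :: "'a::euclidean_space set \<Rightarrow> real \<Rightarrow> real" where
  "layer_volume \<Omega> r = measure lborel {x \<in> \<Omega>. frontier_dist \<Omega> x \<le> r}"

abbreviation flux :: "(real^'d::finite) set \<Rightarrow> ('d \<Rightarrow> real^'d \<Rightarrow> real) \<Rightarrow> real" where
  "flux \<Omega> \<phi> \<equiv> (LINT x:\<Omega>|lebesgue. (\<Sum>i\<in>UNIV. partial_deriv i (\<phi> i) x))"

section \<open>Null level sets of the distance and the Lipschitz cutoff\<close>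

context two_ball_domain
begin

lemma sets_domain [measurable]: "\<Omega> \<in> sets borel"
  using open_domain by simp

lemma bounded_emeasure_finite: "A \<subseteq> \<Omega> \<Longrightarrow> emeasure lborel A < \<infinity>"
  using bounded_domain bounded_subset by (metis emeasure_bounded_finite)

lemma layer_volume_mono: "r \<le> s \<Longrightarrow> layer_volume \<Omega> r \<le> layer_volume \<Omega> s"
  unfolding layer_volume_def
  using bounded_emeasure_finite[of "{x \<in> \<Omega>. \<delta> x \<le> s}"]
  by (intro measure_mono_fmeasurable) (auto simp: fmeasurable_def)

lemma layer_volume_le: "layer_volume \<Omega> r \<le> measure lborel \<Omega>"
  unfolding layer_volume_def
  using bounded_emeasure_finite[of \<Omega>]
  by (intro measure_mono_fmeasurable) (auto simp: fmeasurable_def)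

lemma layer_volume_nonneg: "0 \<le> layer_volume \<Omega> r"
  by (simp add: layer_volume_def)

text \<open>The volumes of the level sets are the masses of the points under the image of Lebesgue
  measure on \<Omega>, and a finite measure has at most countably many atoms. The cutoff at a level
  of volume zero is differentiable almost everywhere.\<close>

lemma countable_thick_levels: "countable {r. measure lborel {x \<in> \<Omega>. \<delta> x = r} \<noteq> 0}"
proof -
  define D where "D = distr (restrict_space lborel \<Omega>) borel \<delta>"
  have m: "\<delta> \<in> measurable (restrict_space lborel \<Omega>) borel"
    by (intro measurable_restrict_space1) simp
  interpret finite_measure D
    unfolding D_def using m bounded_emeasure_finite[of \<Omega>]
    by (intro finite_measure.finite_measure_distr)
       (auto intro!: finite_measureI simp: emeasure_restrict_space space_restrict_space)
  have "measure D {r} = measure lborel {x \<in> \<Omega>. \<delta> x = r}" for r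
  proof -
    have "measure D {r} = measure (restrict_space lborel \<Omega>) {x \<in> \<Omega>. \<delta> x = r}"
      unfolding D_def using m by (subst measure_distr) (auto simp: space_restrict_space intro!: arg_cong[where f = "measure _"])
    also have "\<dots> = measure lborel {x \<in> \<Omega>. \<delta> x = r}"
      by (rule measure_restrict_space) auto
    finally show ?thesis .
  qed
  then show ?thesis using countable_support by simp
qed

lemma thin_level_exists:
  assumes "a < b"
  obtains r where "a < r" "r < b" "measure lborel {x \<in> \<Omega>. \<delta> x = r} = 0"
proof -
  have "\<not> {a<..<b} \<subseteq> {r. measure lborel {x \<in> \<Omega>. \<delta> x = r} \<noteq> 0}"
    using countable_thick_levels uncountable_open_interval[of a b] assms countable_subset by blast
  then show thesis using that by auto
qed

definition "foot x = (SOME y. y \<in> frontier \<Omega> \<and> x = y - \<delta> x *\<^sub>R \<nu> y)"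

lemma foot:
  assumes "x \<in> \<Omega>"
  shows "foot x \<in> frontier \<Omega>" "x = foot x - \<delta> x *\<^sub>R \<nu> (foot x)"
proof -
  have "foot x \<in> frontier \<Omega> \<and> x = foot x - \<delta> x *\<^sub>R \<nu> (foot x)"
    unfolding foot_def by (rule someI_ex) (use nearest_point[OF assms] in blast)
  then show "foot x \<in> frontier \<Omega>" "x = foot x - \<delta> x *\<^sub>R \<nu> (foot x)" by blast+
qed

definition "cutoff r x = min 1 (\<delta> x / r)"

lemma cutoff_lipschitz:
  assumes "0 < r" shows "\<bar>cutoff r x - cutoff r y\<bar> \<le> 1 / r * norm (x - y)"
proof -
  have "\<bar>cutoff r x - cutoff r y\<bar> \<le> \<bar>\<delta> x / r - \<delta> y / r\<bar>" by (auto simp: cutoff_def min_def)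
  also have "\<dots> = \<bar>\<delta> x - \<delta> y\<bar> / r" using assms by (simp add: diff_divide_distrib[symmetric])
  also have "\<dots> \<le> norm (x - y) / r" using frontier_dist_lipschitz assms by (intro divide_right_mono) auto
  finally show ?thesis by simp
qed

lemma cutoff_bounds:
  assumes "0 < r" shows "0 \<le> cutoff r x" "cutoff r x \<le> 1"
  using assms frontier_dist_nonneg[of \<Omega> x] by (auto simp: cutoff_def)

lemma open_Collect_dist: "open {x. \<delta> x < r}" "open {x. r < \<delta> x}"
  using continuous_frontier_dist by (auto intro!: open_Collect_less continuous_intros)

text \<open>The two excluded sets are where the formula for the cutoff switches. Everywhere else one
  of \<open>\<delta> / r\<close>, 1 and 0 is valid on a whole neighbourhood.\<close>

lemma cutoff_derivative:
  assumes r: "0 < r" "r < r0" and x: "x \<notin> frontier \<Omega>" "\<not> (x \<in> \<Omega> \<and> \<delta> x = r)"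
  shows "(cutoff r has_derivative
     (\<lambda>h. if x \<in> \<Omega> \<and> \<delta> x < r then - (\<nu> (foot x) \<bullet> h) / r else 0)) (at x)"
proof -
  consider "x \<in> \<Omega>" "\<delta> x < r" | "x \<in> \<Omega>" "r < \<delta> x" | "x \<notin> closure \<Omega>"
    using x open_domain by (force simp: frontier_def interior_open)
  then show ?thesis
  proof cases
    case 1
    have "(\<delta> has_derivative (\<lambda>h. - (\<nu> (foot x) \<bullet> h))) (at x)"
      using frontier_dist_has_derivative foot 1 r by (meson less_trans)
    then have "((\<lambda>x. \<delta> x / r) has_derivative (\<lambda>h. - (\<nu> (foot x) \<bullet> h) / r)) (at x)"
      using r by (auto intro!: derivative_eq_intros)
    then have "(cutoff r has_derivative (\<lambda>h. - (\<nu> (foot x) \<bullet> h) / r)) (at x)"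
      by (rule has_derivative_transform_within_open[OF _ open_Collect_dist(1)[of r]])
         (use 1 r in \<open>auto simp: cutoff_def min_def field_simps\<close>)
    then show ?thesis using 1 by simp
  next
    case 2
    have "((\<lambda>x. 1) has_derivative (\<lambda>h. 0)) (at x)" by simp
    then have "(cutoff r has_derivative (\<lambda>h. 0)) (at x)"
      by (rule has_derivative_transform_within_open[OF _ open_Collect_dist(2)[of r]])
         (use 2 r in \<open>auto simp: cutoff_def min_def field_simps\<close>)
    then show ?thesis using 2 by simp
  next
    case 3
    have o: "open (- closure \<Omega>)" by auto
    have "((\<lambda>x. 0) has_derivative (\<lambda>h. 0)) (at x)" by simp
    then have "(cutoff r has_derivative (\<lambda>h. 0)) (at x)"
      proof (rule has_derivative_transform_within_open[OF _ o])
      show "x \<in> - closure \<Omega>" using 3 by simp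
      fix z assume "z \<in> - closure \<Omega>"
      then have "z \<notin> \<Omega>" using closure_subset by blast
      then show "0 = cutoff r z" by (simp add: cutoff_def frontier_dist_outside)
    qed
    moreover have "x \<notin> \<Omega>" using 3 closure_subset by blast
    ultimately show ?thesis by simp
  qed
qed

lemma AE_off_levels:
  assumes "measure lborel {x \<in> \<Omega>. \<delta> x = r} = 0"
  shows "AE x in lborel. x \<notin> frontier \<Omega> \<and> \<not> (x \<in> \<Omega> \<and> \<delta> x = r)"
proof -
  have "frontier \<Omega> \<in> null_sets lborel"
    using null_frontier by (simp add: negligible_iff_null_sets null_sets_completion_iff)
  moreover have "{x \<in> \<Omega>. \<delta> x = r} \<in> null_sets lborel"
  proof -
    have "emeasure lborel {x \<in> \<Omega>. \<delta> x = r} = 0"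
      using assms bounded_emeasure_finite[of "{x \<in> \<Omega>. \<delta> x = r}"] 
      by (auto simp: measure_eq_0_null_sets emeasure_eq_ennreal_measure)
    then show ?thesis by (intro null_setsI) auto
  qed
  ultimately have "AE x in lborel. x \<notin> frontier \<Omega>" "AE x in lborel. x \<notin> {x \<in> \<Omega>. \<delta> x = r}"
    using AE_not_in by blast+
  then show ?thesis by eventually_elim auto
qed

end

text \<open>Integration by parts turns J into the integral of the normal component of \<phi> over
  the layer, divided by r. The first bound is then Cauchy-Schwarz; the second holds because each
  point of the layer is within r < \<eta> of its foot.\<close>

lemma layer_flux:
  fixes \<Omega> :: "(real^'d::finite) set"
  assumes "two_ball_domain \<Omega> r0"
    and r: "0 < r" "r < r0" "measure lborel {x \<in> \<Omega>. frontier_dist \<Omega> x = r} = 0"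
    and \<phi>: "\<And>i. test_function (\<phi> i)"
  defines "J \<equiv> (\<integral>x. two_ball_domain.cutoff \<Omega> r x * (\<Sum>i\<in>UNIV. partial_deriv i (\<phi> i) x) \<partial>lborel)"
  shows "(\<And>x. (\<Sum>i\<in>UNIV. (\<phi> i x)\<^sup>2) \<le> 1) \<Longrightarrow> J \<le> layer_volume \<Omega> r / r"
    and "(\<And>x y. y \<in> frontier \<Omega> \<Longrightarrow> norm (x - y) < \<eta> \<Longrightarrow> c \<le> (\<Sum>i\<in>UNIV. \<phi> i x * outer_normal r0 \<Omega> y $ i))
      \<Longrightarrow> r < \<eta> \<Longrightarrow> c * layer_volume \<Omega> r / r \<le> J"
proof -
  interpret two_ball_domain \<Omega> r0 by fact
  define S where "S = {x \<in> \<Omega>. \<delta> x \<le> r}"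
  define N where "N x = (\<Sum>i\<in>UNIV. \<phi> i x * \<nu> (foot x) $ i)" for x
  define D where "D x = (\<Sum>i\<in>UNIV. lower_partial i (cutoff r) x * \<phi> i x)" for x
  have Sfin: "emeasure lborel S < \<infinity>" using bounded_emeasure_finite[of S] by (auto simp: S_def)
  have Ssets: "S \<in> sets lborel" by (simp add: S_def)
  have ae: "AE x in lborel. x \<notin> frontier \<Omega> \<and> \<not> (x \<in> \<Omega> \<and> \<delta> x = r)" by (rule AE_off_levels[OF r(3)])
  have dif: "AE x in lborel. cutoff r differentiable (at x)"
    using ae by eventually_elim (use cutoff_derivative r in \<open>auto simp: differentiable_def\<close>)
  have cb: "\<bar>cutoff r x\<bar> \<le> 1" for x using cutoff_bounds r by (simp add: abs_le_iff)
  note ibp = integration_by_parts_lipschitz[OF \<phi> cutoff_lipschitz[OF r(1)] cb dif]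
  have J: "J = - (\<integral>x. D x \<partial>lborel)"
  proof -
    have "J = (\<Sum>i\<in>UNIV. \<integral>x. cutoff r x * partial_deriv i (\<phi> i) x \<partial>lborel)"
      unfolding J_def sum_distrib_left using ibp(2) by (intro Bochner_Integration.integral_sum) auto
    also have "\<dots> = - (\<Sum>i\<in>UNIV. \<integral>x. lower_partial i (cutoff r) x * \<phi> i x \<partial>lborel)"
      by (simp add: ibp(1) sum_negf)
    also have "(\<Sum>i\<in>UNIV. \<integral>x. lower_partial i (cutoff r) x * \<phi> i x \<partial>lborel) = (\<integral>x. D x \<partial>lborel)"
      unfolding D_def using ibp(3) by (intro Bochner_Integration.integral_sum[symmetric]) auto
    finally show ?thesis .
  qed
  have iD: "integrable lborel D" unfolding D_def using ibp(3) by (intro Bochner_Integration.integrable_sum) auto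
  have aeD: "AE x in lborel. - D x = indicator S x * N x / r"
    using ae
  proof eventually_elim
    case (elim x)
    have dx: "(cutoff r has_derivative (\<lambda>h. if x \<in> \<Omega> \<and> \<delta> x < r then - (\<nu> (foot x) \<bullet> h) / r else 0)) (at x)"
      using cutoff_derivative r elim by blast
    have "lower_partial i (cutoff r) x = partial_deriv i (cutoff r) x" for i
      unfolding lower_partial_def
      by (rule limI, rule partial_deriv_quotient(2)) (use dx in \<open>auto simp: differentiable_def\<close>)
    moreover have "partial_deriv i (cutoff r) x = (if x \<in> \<Omega> \<and> \<delta> x < r then - \<nu> (foot x) $ i / r else 0)" for i
      using partial_deriv_eqI[OF dx] by (simp add: inner_axis)
    ultimately show ?case
      using elim by (auto simp: D_def N_def S_def indicator_def sum_negf sum_divide_distrib sum_distrib_left mult.commute intro!: sum.cong)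
  qed
  have iS: "integrable lborel (\<lambda>x. indicator S x * c / r)" for c :: real
    using Sfin Ssets by (intro integrable_divide integrable_mult_left integrable_real_indicator) auto
  have IS: "(\<integral>x. indicator S x * c / r \<partial>lborel) = c * layer_volume \<Omega> r / r" for c :: real
    using Sfin Ssets by (simp add: layer_volume_def S_def[symmetric])
  have J': "J = (\<integral>x. - D x \<partial>lborel)" using J by simp
  { assume u: "\<And>x. (\<Sum>i\<in>UNIV. (\<phi> i x)\<^sup>2) \<le> 1"
    have "AE x in lborel. - D x \<le> indicator S x * 1 / r"
      using aeD
    proof eventually_elim
      case (elim x)
      have "N x \<le> 1" if "x \<in> S"
      proof -
        define w where "w = (\<chi> i. \<phi> i x)"
        have "N x = w \<bullet> \<nu> (foot x)" by (simp add: N_def w_def inner_vec_def)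
        also have "\<dots> \<le> norm w * norm (\<nu> (foot x))" by (rule norm_cauchy_schwarz)
        also have "norm (\<nu> (foot x)) = 1" using outer_normal(1) foot(1) that by (simp add: S_def)
        also have "norm w \<le> 1" using u[of x] by (simp add: w_def norm_vec_def L2_set_def)
        finally show ?thesis by simp
      qed
      then show ?case using elim r by (auto simp: indicator_def divide_right_mono)
    qed
    then have "J \<le> 1 * layer_volume \<Omega> r / r"
      unfolding J' IS[symmetric] using iD iS[of 1] by (intro integral_mono_AE) auto
    then show "J \<le> layer_volume \<Omega> r / r" by simp }
  { assume u: "\<And>x y. y \<in> frontier \<Omega> \<Longrightarrow> norm (x - y) < \<eta> \<Longrightarrow> c \<le> (\<Sum>i\<in>UNIV. \<phi> i x * \<nu> y $ i)" and "r < \<eta>"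
    have "AE x in lborel. indicator S x * c / r \<le> - D x"
      using aeD
    proof eventually_elim
      case (elim x)
      have "c \<le> N x" if "x \<in> S"
      proof -
        have xO: "x \<in> \<Omega>" and "\<delta> x \<le> r" using that by (auto simp: S_def)
        have "x - foot x = - (\<delta> x *\<^sub>R \<nu> (foot x))" by (subst foot(2)[OF xO]) simp
        then have "norm (x - foot x) = \<delta> x"
          using outer_normal(1)[OF foot(1)[OF xO]] frontier_dist_nonneg[of \<Omega> x] by simp
        then show ?thesis unfolding N_def using u[OF foot(1)[OF xO]] \<open>\<delta> x \<le> r\<close> \<open>r < \<eta>\<close> by simp
      qed
      then show ?case using elim r by (auto simp: indicator_def divide_right_mono)
    qed
    then show "c * layer_volume \<Omega> r / r \<le> J"
      unfolding J' IS[symmetric] using iD iS by (intro integral_mono_AE) auto }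
qed

text \<open>The cutoff differs from the indicator of \<Omega> by at most 1 and only on the layer.
  The second bound is uniform in r, and it shows that the layer volume is at most linear in r before
  any limit is known.\<close>

lemma flux_cutoff:
  fixes \<Omega> :: "(real^'d::finite) set"
  assumes "two_ball_domain \<Omega> r0" and \<phi>: "\<And>i. test_function (\<phi> i)"
  obtains B where "0 \<le> B" "\<And>r. 0 < r \<Longrightarrow>
    \<bar>(\<integral>x. two_ball_domain.cutoff \<Omega> r x * (\<Sum>i\<in>UNIV. partial_deriv i (\<phi> i) x) \<partial>lborel) - flux \<Omega> \<phi>\<bar>
      \<le> B * layer_volume \<Omega> r"
    "\<And>r. 0 < r \<Longrightarrow> \<bar>\<integral>x. two_ball_domain.cutoff \<Omega> r x * (\<Sum>i\<in>UNIV. partial_deriv i (\<phi> i) x) \<partial>lborel\<bar> \<le> B"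
proof -
  interpret two_ball_domain \<Omega> r0 by fact
  have "\<exists>B R. continuous_on UNIV (partial_deriv i (\<phi> i)) \<and> (\<forall>x. \<bar>partial_deriv i (\<phi> i) x\<bar> \<le> B)" for i
    using test_function_facts[OF \<phi>[of i]] by metis
  then obtain C where C: "\<And>i. continuous_on UNIV (partial_deriv i (\<phi> i))" "\<And>i x. \<bar>partial_deriv i (\<phi> i) x\<bar> \<le> C i" by metis
  define B where "B = (\<Sum>i\<in>UNIV. C i)"
  define d where "d x = (\<Sum>i\<in>UNIV. partial_deriv i (\<phi> i) x)" for x
  have dB: "\<bar>d x\<bar> \<le> B" for x unfolding d_def B_def using C by (intro order_trans[OF sum_abs] sum_mono) auto
  have B0: "0 \<le> B" using dB[of 0] by linarith
  have [measurable]: "d \<in> borel_measurable borel"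
    unfolding d_def[abs_def] using C(1) by (intro borel_measurable_continuous_onI continuous_intros)
  obtain R where R: "\<And>x. x \<in> \<Omega> \<Longrightarrow> norm x \<le> R" using bounded_domain bounded_iff by metis
  have fl: "flux \<Omega> \<phi> = (\<integral>x. indicator \<Omega> x * d x \<partial>lborel)"
    unfolding set_lebesgue_integral_def d_def[symmetric]
    by (subst integral_completion) auto
  have [measurable]: "cutoff r \<in> borel_measurable borel" for r unfolding cutoff_def[abs_def] by measurable
  have c0: "cutoff r x = 0" if "x \<notin> \<Omega>" "0 < r" for r x using that by (simp add: cutoff_def frontier_dist_outside)
  have i1: "integrable lborel (\<lambda>x. indicator \<Omega> x * d x)"
    using dB R B0 by (intro integrable_bounded_support[of _ B R]) (force simp: indicator_def)+
  have i2: "integrable lborel (\<lambda>x. cutoff r x * d x)" if r: "0 < r" for r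
  proof (rule integrable_bounded_support[of _ B R])
    show "\<bar>cutoff r x * d x\<bar> \<le> B" for x
      using mult_mono[of "cutoff r x" 1 "\<bar>d x\<bar>" B] dB[of x] cutoff_bounds[OF r, of x] by (simp add: abs_mult)
    show "cutoff r x * d x = 0" if "R < norm x" for x using c0[of x r] R[of x] that r by fastforce
  qed simp
  have fin: "integrable lborel (\<lambda>x. indicator A x * B)" if "A \<in> sets borel" "A \<subseteq> \<Omega>" for A
    using bounded_emeasure_finite[OF that(2)] that(1) by (intro integrable_mult_left integrable_real_indicator) auto
  show thesis
  \<comment> \<open>The first summand serves the comparison with the flux, the second the uniform
    bound.\<close>
  proof (rule that[of "B + B * measure lborel \<Omega>"])
    fix r :: real assume r: "0 < r"
    have "\<bar>(\<integral>x. cutoff r x * d x \<partial>lborel) - flux \<Omega> \<phi>\<bar> = \<bar>\<integral>x. cutoff r x * d x - indicator \<Omega> x * d x \<partial>lborel\<bar>"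
      using i1 i2[OF r] by (simp add: fl)
    also have "\<dots> \<le> (\<integral>x. \<bar>cutoff r x * d x - indicator \<Omega> x * d x\<bar> \<partial>lborel)" by (rule integral_abs_bound)
    also have "\<dots> \<le> (\<integral>x. indicator {x \<in> \<Omega>. \<delta> x \<le> r} x * B \<partial>lborel)"
    proof (rule integral_mono)
      show "integrable lborel (\<lambda>x. \<bar>cutoff r x * d x - indicator \<Omega> x * d x\<bar>)" using i1 i2[OF r] by simp
      show "integrable lborel (\<lambda>x. indicator {x \<in> \<Omega>. \<delta> x \<le> r} x * B)" by (rule fin) auto
      fix x
      have "\<bar>cutoff r x - 1\<bar> * \<bar>d x\<bar> \<le> 1 * B"
        using dB[of x] cutoff_bounds[OF r, of x] by (intro mult_mono) auto
      moreover have "cutoff r x * d x - d x = (cutoff r x - 1) * d x" by (simp add: algebra_simps)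
      moreover have "cutoff r x = 1" if "r < \<delta> x" using that r by (simp add: cutoff_def field_simps)
      ultimately show "\<bar>cutoff r x * d x - indicator \<Omega> x * d x\<bar> \<le> indicator {x \<in> \<Omega>. \<delta> x \<le> r} x * B"
        using c0[OF _ r, of x] B0 by (auto simp: indicator_def abs_mult not_le)
    qed
    also have "\<dots> = B * layer_volume \<Omega> r"
      using bounded_emeasure_finite[of "{x \<in> \<Omega>. \<delta> x \<le> r}"] by (simp add: layer_volume_def)
    also have "\<dots> \<le> (B + B * measure lborel \<Omega>) * layer_volume \<Omega> r"
      using B0 by (intro mult_right_mono layer_volume_nonneg) simp
    finally show "\<bar>(\<integral>x. cutoff r x * (\<Sum>i\<in>UNIV. partial_deriv i (\<phi> i) x) \<partial>lborel) - flux \<Omega> \<phi>\<bar> \<le> (B + B * measure lborel \<Omega>) * layer_volume \<Omega> r"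
      by (simp add: d_def)
    have "\<bar>\<integral>x. cutoff r x * d x \<partial>lborel\<bar> \<le> (\<integral>x. \<bar>cutoff r x * d x\<bar> \<partial>lborel)" by (rule integral_abs_bound)
    also have "\<dots> \<le> (\<integral>x. indicator \<Omega> x * B \<partial>lborel)"
    proof (rule integral_mono)
      show "integrable lborel (\<lambda>x. indicator \<Omega> x * B)" by (rule fin) auto
      fix x show "\<bar>cutoff r x * d x\<bar> \<le> indicator \<Omega> x * B"
        using mult_mono[of "cutoff r x" 1 "\<bar>d x\<bar>" B] dB[of x] cutoff_bounds[OF r, of x] c0[OF _ r, of x]
        by (auto simp: abs_mult indicator_def)
    qed (use i2[OF r] in simp)
    also have "\<dots> = B * measure lborel \<Omega>" using bounded_emeasure_finite[of \<Omega>] by simp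
    finally show "\<bar>\<integral>x. cutoff r x * (\<Sum>i\<in>UNIV. partial_deriv i (\<phi> i) x) \<partial>lborel\<bar> \<le> B + B * measure lborel \<Omega>"
      using B0 by (simp add: d_def)
  qed (use B0 in simp)
qed

lemma test_function_zero: "test_function (\<lambda>x :: real^'d::finite. 0)"
proof -
  have "elementary (\<lambda>x :: real^'d. 0)" by (rule elementary.const)
  then show ?thesis using elementary_cont_diff by (auto simp: test_function_def)
qed

text \<open>The supremum of the fluxes bounds the limit of the volume ratios from above through
  fields nearly equal to the normal, and from below through fields of nearly maximal flux. Both
  estimates hold at null levels only; monotonicity of the layer volume carries them to an arbitrary
  r from a null level nearby, at the cost of a factor close to 1.\<close>

theorem layer_volume_tendsto_perimeter:
  fixes \<Omega> :: "(real^'d::finite) set"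
  assumes "two_ball_domain \<Omega> r0"
  obtains P where "0 \<le> P" "perimeter \<Omega> = ereal P"
    "((\<lambda>r. layer_volume \<Omega> r / r) \<longlongrightarrow> P) (at_right 0)"
proof -
  interpret two_ball_domain \<Omega> r0 by fact
  define thin where "thin r \<longleftrightarrow> measure lborel {x \<in> \<Omega>. \<delta> x = r} = 0" for r
  define \<F> where "\<F> = {\<phi> :: 'd \<Rightarrow> real^'d \<Rightarrow> real. (\<forall>i. test_function (\<phi> i)) \<and> (\<forall>x. (\<Sum>i\<in>UNIV. (\<phi> i x)\<^sup>2) \<le> 1)}"
  define J where "J \<phi> r = (\<integral>x. cutoff r x * (\<Sum>i\<in>UNIV. partial_deriv i (\<phi> i) x) \<partial>lborel)"
    for \<phi> :: "'d \<Rightarrow> real^'d \<Rightarrow> real" and r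
  have up: "J \<phi> r \<le> layer_volume \<Omega> r / r" if "\<phi> \<in> \<F>" "0 < r" "r < r0" "thin r" for \<phi> r
    using layer_flux(1)[OF two_ball_domain_axioms, of r \<phi>] that by (auto simp: J_def thin_def \<F>_def)
  have fc: "\<exists>B\<ge>0. \<forall>r>0. \<bar>J \<phi> r - flux \<Omega> \<phi>\<bar> \<le> B * layer_volume \<Omega> r \<and> \<bar>J \<phi> r\<bar> \<le> B" if "\<phi> \<in> \<F>" for \<phi>
  proof -
    have "test_function (\<phi> i)" for i using that by (simp add: \<F>_def)
    then obtain B where "0 \<le> B" "\<And>r. 0 < r \<Longrightarrow> \<bar>J \<phi> r - flux \<Omega> \<phi>\<bar> \<le> B * layer_volume \<Omega> r"
      "\<And>r. 0 < r \<Longrightarrow> \<bar>J \<phi> r\<bar> \<le> B"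
      using flux_cutoff[OF two_ball_domain_axioms, of \<phi>] unfolding J_def by blast
    then show ?thesis by blast
  qed
  have low: "\<exists>\<phi>\<in>\<F>. \<exists>\<eta>>0. \<eta> \<le> r0 \<and> (\<forall>r. 0 < r \<longrightarrow> r < \<eta> \<longrightarrow> thin r \<longrightarrow> (1 - \<epsilon>) * layer_volume \<Omega> r / r \<le> J \<phi> r)"
    if \<epsilon>: "0 < \<epsilon>" "\<epsilon> < 1" for \<epsilon>
  proof -
    obtain \<phi> \<eta> where \<phi>: "\<And>i. test_function (\<phi> i)" "\<And>x. (\<Sum>i\<in>UNIV. (\<phi> i x)\<^sup>2) \<le> 1" "0 < \<eta>"
      "\<And>x y. y \<in> frontier \<Omega> \<Longrightarrow> norm (x - y) < \<eta> \<Longrightarrow> 1 - \<epsilon> \<le> (\<Sum>i\<in>UNIV. \<phi> i x * \<nu> y $ i)"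
      using two_ball_domain_normal_field[OF two_ball_domain_axioms \<epsilon>] by blast
    have "(1 - \<epsilon>) * layer_volume \<Omega> r / r \<le> J \<phi> r" if "0 < r" "r < min \<eta> r0" "thin r" for r
      unfolding J_def using layer_flux(2)[OF two_ball_domain_axioms that(1) _ _ \<phi>(1) \<phi>(4)] that by (auto simp: thin_def)
    then show ?thesis using \<phi> r0 by (intro bexI[of _ \<phi>] exI[of _ "min \<eta> r0"]) (auto simp: \<F>_def)
  qed
  \<comment> \<open>A crude linear bound, from the field with \<epsilon> = 1 / 2. It makes the
    fluxes bounded and the cutoff error \<open>B * layer_volume \<Omega> r\<close> vanish with
    r.\<close>
  obtain C \<rho> where C: "0 \<le> C" "0 < \<rho>" "\<rho> \<le> r0" and Cbd: "\<And>r. 0 < r \<Longrightarrow> r < \<rho> \<Longrightarrow> thin r \<Longrightarrow> layer_volume \<Omega> r \<le> C * r"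
  proof -
    obtain \<phi> \<eta> where \<phi>: "\<phi> \<in> \<F>" "0 < \<eta>" "\<eta> \<le> r0"
      "\<And>r. 0 < r \<Longrightarrow> r < \<eta> \<Longrightarrow> thin r \<Longrightarrow> (1 - 1/2) * layer_volume \<Omega> r / r \<le> J \<phi> r" using low[of "1/2"] by auto
    obtain B where B: "B \<ge> 0" "\<And>r. 0 < r \<Longrightarrow> \<bar>J \<phi> r\<bar> \<le> B" using fc[OF \<phi>(1)] by blast
    have "layer_volume \<Omega> r \<le> (2 * B) * r" if "0 < r" "r < \<eta>" "thin r" for r
    proof -
      have "(1 - 1/2) * layer_volume \<Omega> r / r \<le> B" using \<phi>(4)[OF that] B(2)[OF that(1)] by linarith
      then show ?thesis using that(1) by (simp add: field_simps)
    qed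
    then show thesis using that[of "2 * B" \<eta>] B \<phi> by auto
  qed
  have fbd: "flux \<Omega> \<phi> \<le> C" if "\<phi> \<in> \<F>" for \<phi>
  proof (rule field_le_epsilon)
    fix e :: real assume e: "0 < e"
    obtain B where B: "B \<ge> 0" "\<And>r. 0 < r \<Longrightarrow> \<bar>J \<phi> r - flux \<Omega> \<phi>\<bar> \<le> B * layer_volume \<Omega> r" using fc[OF \<open>\<phi> \<in> \<F>\<close>] by blast
    define s where "s = min \<rho> (e / (B * C + 1))"
    have BC: "0 < B * C + 1" using B C by (simp add: add_nonneg_pos)
    have s: "0 < s" using e C BC by (simp add: s_def)
    obtain r where r: "0 < r" "r < s" "thin r" using thin_level_exists[OF s] by (auto simp: thin_def)
    have G: "layer_volume \<Omega> r \<le> C * r" using Cbd r by (simp add: s_def)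
    have "flux \<Omega> \<phi> \<le> J \<phi> r + B * layer_volume \<Omega> r" using B(2)[OF r(1)] by linarith
    also have "J \<phi> r \<le> layer_volume \<Omega> r / r" using up that r C by (simp add: s_def)
    also have "\<dots> \<le> C" using G r by (simp add: field_simps)
    also have "B * layer_volume \<Omega> r \<le> B * (C * r)" using G B by (intro mult_left_mono)
    also have "\<dots> \<le> (B * C + 1) * r" using r by (simp add: algebra_simps)
    also have "\<dots> \<le> (B * C + 1) * (e / (B * C + 1))" using r BC by (intro mult_left_mono) (auto simp: s_def)
    also have "\<dots> = e" using BC by simp
    finally show "flux \<Omega> \<phi> \<le> C + e" by simp
  qed
  have "partial_deriv i (\<lambda>x::real^'d. 0) x = 0" for i x
    by (rule partial_deriv_eqI[of _ "\<lambda>_. 0"]) simp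
  then have zero: "(\<lambda>i x. 0) \<in> \<F>" "flux \<Omega> (\<lambda>i x. 0) = 0"
    by (simp_all add: \<F>_def test_function_zero set_lebesgue_integral_def)
  define P where "P = (SUP \<phi>\<in>\<F>. flux \<Omega> \<phi>)"
  have bdd: "bdd_above (flux \<Omega> ` \<F>)" using fbd by (auto simp: bdd_above_def)
  have Pge: "flux \<Omega> \<phi> \<le> P" if "\<phi> \<in> \<F>" for \<phi> unfolding P_def using that bdd by (rule cSUP_upper)
  have P0: "0 \<le> P" using Pge[OF zero(1)] zero(2) by simp
  have per: "perimeter \<Omega> = ereal P"
  proof -
    have "perimeter \<Omega> = (SUP \<phi>\<in>\<F>. ereal (flux \<Omega> \<phi>))" by (simp add: perimeter_def \<F>_def)
    also have "\<dots> = ereal P" unfolding P_def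
    proof (rule ereal_SUP[symmetric])
      have "(SUP \<phi>\<in>\<F>. ereal (flux \<Omega> \<phi>)) \<le> ereal C" using fbd by (intro SUP_least) auto
      moreover have "ereal 0 \<le> (SUP \<phi>\<in>\<F>. ereal (flux \<Omega> \<phi>))" using zero by (intro SUP_upper2[OF zero(1)]) auto
      ultimately show "\<bar>SUP \<phi>\<in>\<F>. ereal (flux \<Omega> \<phi>)\<bar> \<noteq> \<infinity>" by (cases "SUP \<phi>\<in>\<F>. ereal (flux \<Omega> \<phi>)") auto
    qed
    finally show ?thesis .
  qed
  have "((\<lambda>r. layer_volume \<Omega> r / r) \<longlongrightarrow> P) (at_right 0)"
  proof (rule order_tendstoI)
    fix a assume a: "P < a"
    \<comment> \<open>1 + e comes from replacing r by a null level q, 1 - e from the deviation of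
      the field from the normal, and the e added to P from the cutoff.\<close>
    have "((\<lambda>e. (1 + e) / (1 - e) * (P + e)) \<longlongrightarrow> (1 + 0) / (1 - 0) * (P + 0)) (at_right 0)"
      by (intro tendsto_intros) auto
    then have "\<forall>\<^sub>F e in at_right 0. (1 + e) / (1 - e) * (P + e) < a" using a by (intro order_tendstoD) simp_all
    then obtain b where b: "b > 0" "\<And>e. 0 < e \<Longrightarrow> e < b \<Longrightarrow> (1 + e) / (1 - e) * (P + e) < a"
      unfolding eventually_at_right_field by auto
    define e where "e = min (b / 2) (1 / 2)"
    have e: "0 < e" "e < 1" "e < b" using b by (auto simp: e_def)
    obtain \<phi> \<eta> where \<phi>: "\<phi> \<in> \<F>" "0 < \<eta>" "\<eta> \<le> r0"
      "\<And>r. 0 < r \<Longrightarrow> r < \<eta> \<Longrightarrow> thin r \<Longrightarrow> (1 - e) * layer_volume \<Omega> r / r \<le> J \<phi> r" using low[of e] e by auto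
    obtain B where B: "B \<ge> 0" "\<And>r. 0 < r \<Longrightarrow> \<bar>J \<phi> r - flux \<Omega> \<phi>\<bar> \<le> B * layer_volume \<Omega> r" using fc[OF \<phi>(1)] by blast
    have BC: "0 < B * C + 1" using B C by (simp add: add_nonneg_pos)
    \<comment> \<open>The division by 1 + e keeps the null level q, which lies between r and (1 + e)
      * r, below all three thresholds.\<close>
    define s where "s = Min {\<eta>, \<rho>, e / (B * C + 1)} / (1 + e)"
    have s: "0 < s" using e C BC \<phi> by (simp add: s_def)
    have "layer_volume \<Omega> r / r < a" if r: "0 < r" "r < s" for r
    proof -
      have "r < (1 + e) * r" using r e by simp
      from thin_level_exists[OF this] obtain q where q: "r < q" "q < (1 + e) * r" "thin q" by (auto simp: thin_def)
      have "(1 + e) * r < Min {\<eta>, \<rho>, e / (B * C + 1)}" using r e by (simp add: s_def field_simps)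
      then have q': "0 < q" "q < \<eta>" "q < \<rho>" "q < e / (B * C + 1)" using q r by auto
      have G: "layer_volume \<Omega> q \<le> C * q" using Cbd q q' by simp
      have "B * layer_volume \<Omega> q \<le> B * (C * q)" using G B by (intro mult_left_mono)
      also have "\<dots> \<le> (B * C + 1) * q" using q' by (simp add: algebra_simps)
      also have "\<dots> \<le> (B * C + 1) * (e / (B * C + 1))" using q' BC by (intro mult_left_mono) auto
      also have "\<dots> = e" using BC by simp
      finally have "(1 - e) * layer_volume \<Omega> q / q \<le> P + e"
        using \<phi>(4)[OF q'(1,2) q(3)] B(2)[OF q'(1)] Pge[OF \<phi>(1)] by linarith
      then have 1: "layer_volume \<Omega> q / q \<le> (P + e) / (1 - e)" using e by (simp add: field_simps)
      have "layer_volume \<Omega> r / r \<le> layer_volume \<Omega> q / r" using layer_volume_mono[of r q] q r by (intro divide_right_mono) auto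
      also have "\<dots> \<le> layer_volume \<Omega> q * ((1 + e) / q)"
      proof -
        have "1 / r \<le> (1 + e) / q" using q q' r by (simp add: field_simps)
        then show ?thesis using mult_left_mono[OF _ layer_volume_nonneg, of "1 / r" "(1 + e) / q"] by simp
      qed
      also have "\<dots> = (1 + e) * (layer_volume \<Omega> q / q)" by simp
      also have "\<dots> \<le> (1 + e) * ((P + e) / (1 - e))" using 1 e by (intro mult_left_mono) auto
      also have "\<dots> < a" using b(2)[OF e(1,3)] by simp
      finally show ?thesis .
    qed
    then show "\<forall>\<^sub>F r in at_right 0. layer_volume \<Omega> r / r < a" unfolding eventually_at_right_field using s by auto
  next
    fix a assume a: "a < P"
    then obtain \<phi> where \<phi>: "\<phi> \<in> \<F>" "a < flux \<Omega> \<phi>" using less_cSUP_iff[OF _ bdd] zero(1) unfolding P_def by blast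
    define p where "p = flux \<Omega> \<phi>"
    have "((\<lambda>e. (1 - e) * (p - e)) \<longlongrightarrow> (1 - 0) * (p - 0)) (at_right 0)" by (intro tendsto_intros)
    then have "\<forall>\<^sub>F e in at_right 0. a < (1 - e) * (p - e)" using \<phi> by (intro order_tendstoD) (simp_all add: p_def)
    then obtain b where b: "b > 0" "\<And>e. 0 < e \<Longrightarrow> e < b \<Longrightarrow> a < (1 - e) * (p - e)"
      unfolding eventually_at_right_field by auto
    define e where "e = min (b / 2) (1 / 2)"
    have e: "0 < e" "e < 1" "e < b" using b by (auto simp: e_def)
    obtain B where B: "B \<ge> 0" "\<And>r. 0 < r \<Longrightarrow> \<bar>J \<phi> r - flux \<Omega> \<phi>\<bar> \<le> B * layer_volume \<Omega> r" using fc[OF \<phi>(1)] by blast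
    have BC: "0 < B * C + 1" using B C by (simp add: add_nonneg_pos)
    define s where "s = min \<rho> (e / (B * C + 1))"
    have s: "0 < s" using e C BC by (simp add: s_def)
    have "a < layer_volume \<Omega> r / r" if r: "0 < r" "r < s" for r
    proof -
      \<comment> \<open>For the lower bound the null level is taken below r, so that its layer is
        contained in the one of width r.\<close>
      have "(1 - e) * r < r" using r e by simp
      from thin_level_exists[OF this] obtain q where q: "(1 - e) * r < q" "q < r" "thin q" by (auto simp: thin_def)
      have "0 < (1 - e) * r" using e r by simp
      then have q': "0 < q" "q < r0" "q < \<rho>" "q < e / (B * C + 1)" using q r C by (auto simp: s_def)
      have G: "layer_volume \<Omega> q \<le> C * q" using Cbd q q' by simp
      have "B * layer_volume \<Omega> q \<le> B * (C * q)" using G B by (intro mult_left_mono)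
      also have "\<dots> \<le> (B * C + 1) * q" using q' by (simp add: algebra_simps)
      also have "\<dots> \<le> (B * C + 1) * (e / (B * C + 1))" using q' BC by (intro mult_left_mono) auto
      also have "\<dots> = e" using BC by simp
      finally have 1: "p - e \<le> layer_volume \<Omega> q / q"
        using up[OF \<phi>(1) q'(1,2) q(3)] B(2)[OF q'(1)] unfolding p_def by linarith
      have "a < (1 - e) * (p - e)" using b e by blast
      also have "\<dots> \<le> (1 - e) * (layer_volume \<Omega> q / q)" using 1 e by (intro mult_left_mono) auto
      also have "\<dots> = layer_volume \<Omega> q * ((1 - e) / q)" by simp
      also have "\<dots> \<le> layer_volume \<Omega> q * (1 / r)"
        using q q' r by (intro mult_left_mono layer_volume_nonneg) (auto simp: field_simps)
      also have "\<dots> \<le> layer_volume \<Omega> r / r" using layer_volume_mono[of q r] q r by (simp add: divide_right_mono)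
      finally show ?thesis .
    qed
    then show "\<forall>\<^sub>F r in at_right 0. a < layer_volume \<Omega> r / r" unfolding eventually_at_right_field using s by auto
  qed
  then show thesis using that P0 per by blast
qed

section \<open>The law of a one-dimensional stable process\<close>

lemma isotropic_stable_processD:
  assumes "isotropic_stable_process M \<alpha> Y"
  shows "prob_space M" "\<And>t. 0 \<le> t \<Longrightarrow> Y t \<in> borel_measurable M" "AE \<omega> in M. Y 0 \<omega> = 0"
    "AE \<omega> in M. cadlag (\<lambda>t. Y t \<omega>)"
    "\<And>s t. 0 \<le> s \<Longrightarrow> s \<le> t \<Longrightarrow> distr M borel (\<lambda>\<omega>. Y t \<omega> - Y s \<omega>) = distr M borel (Y (t - s))"
    "\<And>n t. 0 \<le> t 0 \<Longrightarrow> (\<And>i. i < n \<Longrightarrow> t i \<le> t (Suc i)) \<Longrightarrow>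
        prob_space.indep_vars M (\<lambda>_. borel) (\<lambda>i \<omega>. Y (t (Suc i)) \<omega> - Y (t i) \<omega>) {..<n}"
    "\<And>t \<xi>. 0 \<le> t \<Longrightarrow> (\<integral>\<omega>. iexp (\<xi> \<bullet> Y t \<omega>) \<partial>M) = complex_of_real (exp (- t * norm \<xi> powr \<alpha>))"
  using assms unfolding isotropic_stable_process_def levy_process_def by blast+

text \<open>Isotropy in the form used later: the characteristic function of the projection depends
  on the vector only through its norm, so all unit directions give the same one-dimensional process
  in law.\<close>

lemma isotropic_stable_process_inner:
  fixes Y :: "real \<Rightarrow> 'w \<Rightarrow> 'b::euclidean_space"
  assumes Y: "isotropic_stable_process M \<alpha> Y" and v: "norm v = 1"
  shows "isotropic_stable_process M \<alpha> (\<lambda>t \<omega>. v \<bullet> Y t \<omega>)"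
proof -
  note [measurable] = isotropic_stable_processD(2)[OF Y]
  interpret prob_space M using isotropic_stable_processD(1)[OF Y] .
  have "cadlag (\<lambda>t. v \<bullet> f t)" if "cadlag f" for f :: "real \<Rightarrow> 'b"
    unfolding cadlag_def
  proof (intro conjI allI impI)
    fix t :: real assume "0 \<le> t"
    then show "((\<lambda>t. v \<bullet> f t) \<longlongrightarrow> v \<bullet> f t) (at_right t)"
      using that by (intro tendsto_inner tendsto_const) (simp add: cadlag_def)
  next
    fix t :: real assume "0 < t"
    then have "\<exists>l. (f \<longlongrightarrow> l) (at_left t)" using that unfolding cadlag_def by blast
    then obtain l where "(f \<longlongrightarrow> l) (at_left t)" by blast
    from tendsto_inner[OF tendsto_const this] show "\<exists>l. ((\<lambda>t. v \<bullet> f t) \<longlongrightarrow> l) (at_left t)" by blast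
  qed
  then have "AE \<omega> in M. cadlag (\<lambda>t. v \<bullet> Y t \<omega>)"
    using isotropic_stable_processD(4)[OF Y] by (auto elim: eventually_mono)
  moreover have "AE \<omega> in M. v \<bullet> Y 0 \<omega> = 0"
    using isotropic_stable_processD(3)[OF Y] by (auto elim: eventually_mono)
  moreover have "distr M borel (\<lambda>\<omega>. v \<bullet> Y t \<omega> - v \<bullet> Y s \<omega>) = distr M borel (\<lambda>\<omega>. v \<bullet> Y (t - s) \<omega>)"
    if st: "0 \<le> s" "s \<le> t" for s t
  proof -
    have [measurable]: "Y t \<in> borel_measurable M" "Y s \<in> borel_measurable M" "Y (t - s) \<in> borel_measurable M" using st by auto
    have "distr M borel (\<lambda>\<omega>. v \<bullet> Y t \<omega> - v \<bullet> Y s \<omega>) = distr (distr M borel (\<lambda>\<omega>. Y t \<omega> - Y s \<omega>)) borel ((\<bullet>) v)"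
      by (subst distr_distr) (auto simp: o_def inner_diff_right)
    also have "\<dots> = distr M borel (\<lambda>\<omega>. v \<bullet> Y (t - s) \<omega>)"
      unfolding isotropic_stable_processD(5)[OF Y st] by (subst distr_distr) (auto simp: o_def)
    finally show ?thesis .
  qed
  moreover have "indep_vars (\<lambda>_. borel) (\<lambda>i \<omega>. v \<bullet> Y (t (Suc i)) \<omega> - v \<bullet> Y (t i) \<omega>) {..<n}"
    if "0 \<le> t 0" "\<And>i. i < n \<Longrightarrow> t i \<le> t (Suc i)" for n t
    using indep_vars_compose2[OF isotropic_stable_processD(6)[OF Y that], where Y = "\<lambda>_. (\<bullet>) v" and N = "\<lambda>_. borel"]
    by (simp add: inner_diff_right)
  moreover have "(\<integral>\<omega>. iexp (\<xi> * (v \<bullet> Y t \<omega>)) \<partial>M) = complex_of_real (exp (- t * norm \<xi> powr \<alpha>))" if "0 \<le> t" for t \<xi>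
    using isotropic_stable_processD(7)[OF Y that, of "\<xi> *\<^sub>R v"] v by simp
  ultimately show ?thesis
    unfolding isotropic_stable_process_def levy_process_def using prob_space_axioms by (auto simp: isotropic_stable_processD(2)[OF Y])
qed

lemma filterlim_mult_pos_at_right: "0 < (c::real) \<Longrightarrow> filterlim (\<lambda>x. c * x) (at_right (c * t)) (at_right t)"
  unfolding filterlim_at by (auto intro!: tendsto_intros simp: eventually_at_filter)

lemma filterlim_mult_pos_at_left: "0 < (c::real) \<Longrightarrow> filterlim (\<lambda>x. c * x) (at_left (c * t)) (at_left t)"
  unfolding filterlim_at by (auto intro!: tendsto_intros simp: eventually_at_filter)

text \<open>Self-similarity: in the exponent \<open>t * norm \<xi> powr \<alpha>\<close> the factor
  c of the time is cancelled by dividing the space variable by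
  \<open>c powr (1 / \<alpha>)\<close>.\<close>

lemma isotropic_stable_process_scale:
  fixes Z :: "real \<Rightarrow> 'w \<Rightarrow> real"
  assumes Z: "isotropic_stable_process M \<alpha> Z" and c: "0 < c" and \<alpha>: "0 < \<alpha>"
  shows "isotropic_stable_process M \<alpha> (\<lambda>t \<omega>. Z (c * t) \<omega> / c powr (1 / \<alpha>))"
proof -
  define b where "b = 1 / c powr (1 / \<alpha>)"
  have b: "0 < b" "b powr \<alpha> = 1 / c" using c \<alpha> by (auto simp: b_def powr_divide powr_powr)
  interpret prob_space M using isotropic_stable_processD(1)[OF Z] .
  note m = isotropic_stable_processD(2)[OF Z]
  have "cadlag (\<lambda>t. f (c * t) * b)" if f: "cadlag f" for f :: "real \<Rightarrow> real"
    unfolding cadlag_def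
  proof (intro conjI allI impI)
    fix t :: real assume "0 \<le> t"
    then have "(f \<longlongrightarrow> f (c * t)) (at_right (c * t))" using f c by (simp add: cadlag_def)
    then show "((\<lambda>t. f (c * t) * b) \<longlongrightarrow> f (c * t) * b) (at_right t)"
      by (intro tendsto_mult_right filterlim_compose[OF _ filterlim_mult_pos_at_right[OF c]])
  next
    fix t :: real assume "0 < t"
    then obtain l where "(f \<longlongrightarrow> l) (at_left (c * t))" using f c unfolding cadlag_def by force
    then have "((\<lambda>t. f (c * t) * b) \<longlongrightarrow> l * b) (at_left t)"
      by (intro tendsto_mult_right filterlim_compose[OF _ filterlim_mult_pos_at_left[OF c]])
    then show "\<exists>l. ((\<lambda>t. f (c * t) * b) \<longlongrightarrow> l) (at_left t)" by blast
  qed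
  then have "AE \<omega> in M. cadlag (\<lambda>t. Z (c * t) \<omega> * b)"
    using isotropic_stable_processD(4)[OF Z] by (auto elim: eventually_mono)
  moreover have "AE \<omega> in M. Z (c * 0) \<omega> * b = 0"
    using isotropic_stable_processD(3)[OF Z] by (auto elim: eventually_mono)
  moreover have "distr M borel (\<lambda>\<omega>. Z (c * t) \<omega> * b - Z (c * s) \<omega> * b) = distr M borel (\<lambda>\<omega>. Z (c * (t - s)) \<omega> * b)"
    if st: "0 \<le> s" "s \<le> t" for s t
  proof -
    have st': "0 \<le> c * s" "c * s \<le> c * t" "0 \<le> c * t" "0 \<le> c * (t - s)" using st c by auto
    note [measurable] = m[OF st'(1)] m[OF st'(3)] m[OF st'(4)]
    have "distr M borel (\<lambda>\<omega>. Z (c * t) \<omega> * b - Z (c * s) \<omega> * b) = distr (distr M borel (\<lambda>\<omega>. Z (c * t) \<omega> - Z (c * s) \<omega>)) borel (\<lambda>x. x * b)"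
      by (subst distr_distr) (auto simp: o_def left_diff_distrib)
    also have "\<dots> = distr (distr M borel (Z (c * (t - s)))) borel (\<lambda>x. x * b)"
      using isotropic_stable_processD(5)[OF Z st'(1,2)] by (simp add: right_diff_distrib)
    also have "\<dots> = distr M borel (\<lambda>\<omega>. Z (c * (t - s)) \<omega> * b)"
      by (subst distr_distr) (auto simp: o_def)
    finally show ?thesis .
  qed
  moreover have "indep_vars (\<lambda>_. borel) (\<lambda>i \<omega>. Z (c * t (Suc i)) \<omega> * b - Z (c * t i) \<omega> * b) {..<n}"
    if t: "0 \<le> t 0" "\<And>i. i < n \<Longrightarrow> t i \<le> t (Suc i)" for n t
  proof -
    have "indep_vars (\<lambda>_. borel) (\<lambda>i \<omega>. Z (c * t (Suc i)) \<omega> - Z (c * t i) \<omega>) {..<n}"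
      using t c isotropic_stable_processD(6)[OF Z, of "\<lambda>i. c * t i"] by simp
    from indep_vars_compose2[OF this, where Y = "\<lambda>_ x. x * b" and N = "\<lambda>_. borel"] show ?thesis
      by (simp add: left_diff_distrib)
  qed
  moreover have "(\<integral>\<omega>. iexp (\<xi> * (Z (c * t) \<omega> * b)) \<partial>M) = complex_of_real (exp (- t * norm \<xi> powr \<alpha>))" if "0 \<le> t" for t \<xi>
  proof -
    have "c * t * \<bar>\<xi> * b\<bar> powr \<alpha> = t * \<bar>\<xi>\<bar> powr \<alpha>" using b c by (simp add: abs_mult powr_mult)
    then show ?thesis using isotropic_stable_processD(7)[OF Z, of "c * t" "\<xi> * b"] c that by (simp add: mult_ac)
  qed
  ultimately have "isotropic_stable_process M \<alpha> (\<lambda>t \<omega>. Z (c * t) \<omega> * b)"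
    unfolding isotropic_stable_process_def levy_process_def using prob_space_axioms m c by (auto simp: zero_le_mult_iff)
  then show ?thesis by (simp add: b_def)
qed

lemma stable_law_unique:
  fixes Z :: "real \<Rightarrow> 'w \<Rightarrow> real" and Z' :: "real \<Rightarrow> 'v \<Rightarrow> real"
  assumes Z: "isotropic_stable_process M \<alpha> Z" and Z': "isotropic_stable_process M' \<alpha> Z'" and t: "0 \<le> t"
  shows "distr M borel (Z t) = distr M' borel (Z' t)"
proof (rule Levy_uniqueness)
  note m = isotropic_stable_processD(2)[OF Z t] isotropic_stable_processD(2)[OF Z' t]
  show "real_distribution (distr M borel (Z t))" "real_distribution (distr M' borel (Z' t))"
    using m isotropic_stable_processD(1)[OF Z] isotropic_stable_processD(1)[OF Z']
    by (simp_all add: prob_space.real_distribution_distr)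
  have "char (distr M borel (Z t)) \<xi> = complex_of_real (exp (- t * norm \<xi> powr \<alpha>))" for \<xi>
    using isotropic_stable_processD(7)[OF Z t, of \<xi>] m by (simp add: char_def integral_distr)
  moreover have "char (distr M' borel (Z' t)) \<xi> = complex_of_real (exp (- t * norm \<xi> powr \<alpha>))" for \<xi>
    using isotropic_stable_processD(7)[OF Z' t, of \<xi>] m by (simp add: char_def integral_distr)
  ultimately show "char (distr M borel (Z t)) = char (distr M' borel (Z' t))" by auto
qed

text \<open>The index set is the one of \<open>process_events\<close>, so that the independence
  hypothesis becomes independence of two random elements of this space.\<close>

definition path_space :: "(real \<Rightarrow> real) measure" where
  "path_space = Pi\<^sub>M {0..} (\<lambda>_. borel)"

definition sample_path :: "(real \<Rightarrow> 'w \<Rightarrow> real) \<Rightarrow> 'w \<Rightarrow> real \<Rightarrow> real" where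
  "sample_path Z \<omega> = (\<lambda>t\<in>{0..}. Z t \<omega>)"

lemma measurable_sample_path:
  "(\<And>t. 0 \<le> t \<Longrightarrow> Z t \<in> borel_measurable M) \<Longrightarrow> sample_path Z \<in> measurable M path_space"
  unfolding sample_path_def[abs_def] path_space_def by (rule measurable_restrict) auto

lemma sample_path_apply: "0 \<le> t \<Longrightarrow> sample_path Z \<omega> t = Z t \<omega>"
  by (simp add: sample_path_def)

lemma measurable_path_space_eval [measurable]: "0 \<le> t \<Longrightarrow> (\<lambda>z. z t) \<in> borel_measurable path_space"
  unfolding path_space_def by (rule measurable_component_singleton) auto

lemma increments_law:
  fixes Z :: "real \<Rightarrow> 'w \<Rightarrow> real"
  assumes Z: "isotropic_stable_process M \<alpha> Z" and t: "t 0 = 0" "\<And>i. i < n \<Longrightarrow> t i \<le> t (Suc i)" and n: "0 < n"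
  shows "distr M (Pi\<^sub>M {..<n} (\<lambda>_. borel)) (\<lambda>\<omega>. \<lambda>i\<in>{..<n}. Z (t (Suc i)) \<omega> - Z (t i) \<omega>) =
         Pi\<^sub>M {..<n} (\<lambda>i. distr M borel (Z (t (Suc i) - t i)))"
proof -
  interpret prob_space M using isotropic_stable_processD(1)[OF Z] .
  have t0: "0 \<le> t i" if "i \<le> n" for i
    using that by (induction i) (use t in \<open>auto intro: order_trans\<close>)
  have "indep_vars (\<lambda>_. borel) (\<lambda>i \<omega>. Z (t (Suc i)) \<omega> - Z (t i) \<omega>) {..<n}"
    using isotropic_stable_processD(6)[OF Z, of t n] t by simp
  then have "distr M (Pi\<^sub>M {..<n} (\<lambda>_. borel)) (\<lambda>\<omega>. \<lambda>i\<in>{..<n}. Z (t (Suc i)) \<omega> - Z (t i) \<omega>) =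
         Pi\<^sub>M {..<n} (\<lambda>i. distr M borel (\<lambda>\<omega>. Z (t (Suc i)) \<omega> - Z (t i) \<omega>))"
    using n t0 isotropic_stable_processD(2)[OF Z] by (subst (asm) indep_vars_iff_distr_eq_PiM') auto
  also have "\<dots> = Pi\<^sub>M {..<n} (\<lambda>i. distr M borel (Z (t (Suc i) - t i)))"
    using t t0 by (intro PiM_cong isotropic_stable_processD(5)[OF Z]) auto
  finally show ?thesis .
qed

lemma increments_sum:
  fixes Z :: "real \<Rightarrow> 'w \<Rightarrow> real"
  assumes "Z (t 0) \<omega> = 0" "j \<le> n"
  shows "(\<Sum>l<j. (\<lambda>i\<in>{..<n}. Z (t (Suc i)) \<omega> - Z (t i) \<omega>) l) = Z (t j) \<omega>"
proof -
  have "(\<Sum>l<j. (\<lambda>i\<in>{..<n}. Z (t (Suc i)) \<omega> - Z (t i) \<omega>) l) = (\<Sum>l<j. Z (t (Suc l)) \<omega> - Z (t l) \<omega>)"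
    using assms by (intro sum.cong) auto
  also have "\<dots> = Z (t j) \<omega>" using assms by (subst sum_lessThan_telescope) simp
  finally show ?thesis .
qed

text \<open>Cylinder sets determine a law on the product. The values at finitely many times are
  partial sums of independent increments, and the law of each increment is fixed by its
  characteristic function.\<close>

lemma stable_path_law_unique:
  fixes Z :: "real \<Rightarrow> 'w \<Rightarrow> real" and Z' :: "real \<Rightarrow> 'v \<Rightarrow> real"
  assumes Z: "isotropic_stable_process M \<alpha> Z" and Z': "isotropic_stable_process M' \<alpha> Z'"
  shows "distr M path_space (sample_path Z) = distr M' path_space (sample_path Z')"
proof -
  note mp = measurable_sample_path[OF isotropic_stable_processD(2)[OF Z]] measurable_sample_path[OF isotropic_stable_processD(2)[OF Z']]
  interpret M: prob_space M using isotropic_stable_processD(1)[OF Z] .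
  interpret M': prob_space M' using isotropic_stable_processD(1)[OF Z'] .
  show ?thesis
  proof (rule measure_eqI_PiM_infinite[where I = "{0..}" and M = "\<lambda>_. borel"])
    show "finite_measure (distr M path_space (sample_path Z))"
      using mp by (intro prob_space.finite_measure M.prob_space_distr)
    fix A :: "real \<Rightarrow> real set" and J assume J: "finite J" "J \<subseteq> {0::real..}" and A: "\<And>i. i \<in> J \<Longrightarrow> A i \<in> sets borel"
    define E where "E = prod_emb {0..} (\<lambda>_. borel::real measure) J (Pi\<^sub>E J A)"
    have E: "E \<in> sets path_space" unfolding E_def path_space_def using J A by (intro sets_PiM_I) auto
    define n where "n = card J"
    define js where "js = sorted_list_of_set J"
    have js: "set js = J" "sorted js" "length js = n" using J by (auto simp: js_def n_def)
    \<comment> \<open>Time 0 is put in front, shifting the indices by one: every value is then a sum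
      of increments, almost surely, because the process starts at 0 only almost surely.\<close>
    define t where "t i = (if i = 0 then 0 else js ! (i - 1))" for i
    have tS: "t (Suc i) = js ! i" for i by (simp add: t_def)
    have t: "t 0 = 0" "\<And>i. i < n \<Longrightarrow> t i \<le> t (Suc i)"
    proof -
      show "t 0 = 0" by (simp add: t_def)
      fix i assume i: "i < n"
      show "t i \<le> t (Suc i)"
      proof (cases i)
        case 0
        have "js ! 0 \<in> J" using js i by (metis gr_zeroI nth_mem not_less_zero 0)
        then show ?thesis using J 0 by (auto simp: t_def)
      next
        case (Suc l)
        then show ?thesis using js(2,3) i by (auto simp: t_def sorted_iff_nth_mono)
      qed
    qed
    \<comment> \<open>The right-hand side depends on the process through its increment laws only.
      The empty cylinder is separate, since the product law of the increments is available for a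
      nonempty index set.\<close>
    have key: "emeasure (distr N path_space (sample_path W)) E =
        (if n = 0 then 1 else emeasure (Pi\<^sub>M {..<n} (\<lambda>i. distr N borel (W (t (Suc i) - t i))))
          {x \<in> space (Pi\<^sub>M {..<n} (\<lambda>_. borel)). \<forall>i<n. (\<Sum>l<Suc i. x l) \<in> A (js ! i)})"
      if W: "isotropic_stable_process N \<alpha> W" for N :: "'z measure" and W
    proof -
      interpret N: prob_space N using isotropic_stable_processD(1)[OF W] .
      note mW = isotropic_stable_processD(2)[OF W]
      have 1: "emeasure (distr N path_space (sample_path W)) E = emeasure N (sample_path W -` E \<inter> space N)"
        using E measurable_sample_path[OF mW] by (intro emeasure_distr)
      have 2: "sample_path W -` E \<inter> space N = {\<omega> \<in> space N. \<forall>i<n. W (js ! i) \<omega> \<in> A (js ! i)}"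
      proof -
        have "sample_path W \<omega> \<in> E \<longleftrightarrow> (\<forall>j\<in>J. W j \<omega> \<in> A j)" for \<omega>
          using J(2) by (auto simp: E_def prod_emb_iff sample_path_def PiE_iff)
        also have "(\<forall>j\<in>J. W j \<omega> \<in> A j) \<longleftrightarrow> (\<forall>i<n. W (js ! i) \<omega> \<in> A (js ! i))" for \<omega>
          unfolding js(1)[symmetric] js(3)[symmetric] by (rule all_set_conv_all_nth)
        finally show ?thesis by auto
      qed
      show ?thesis
      proof (cases "n = 0")
        case True then show ?thesis by (simp add: 1 2 N.emeasure_space_1)
      next
        case False
        let ?D = "\<lambda>\<omega>. \<lambda>i\<in>{..<n}. W (t (Suc i)) \<omega> - W (t i) \<omega>"
        let ?B = "{x \<in> space (Pi\<^sub>M {..<n} (\<lambda>_. borel)). \<forall>i<n. (\<Sum>l<Suc i. x l) \<in> A (js ! i)}"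
        have t0: "0 \<le> t i" if "i \<le> n" for i
          using that by (induction i) (use t in \<open>auto intro: order_trans\<close>)
        have mD: "?D \<in> measurable N (Pi\<^sub>M {..<n} (\<lambda>_. borel))"
          using t0 mW by (intro measurable_restrict borel_measurable_diff) auto
        have mA: "A (js ! i) \<in> sets borel" if "i < n" for i using A js that by (metis nth_mem)
        have B: "?B \<in> sets (Pi\<^sub>M {..<n} (\<lambda>_. borel))"
        proof -
          have "?B = (\<Inter>i\<in>{..<n}. (\<lambda>x. \<Sum>l<Suc i. x l) -` A (js ! i) \<inter> space (Pi\<^sub>M {..<n} (\<lambda>_. borel)))"
            using False by auto
          also have "\<dots> \<in> sets (Pi\<^sub>M {..<n} (\<lambda>_. borel))"
          proof (intro sets.finite_INT)
            fix i assume i: "i \<in> {..<n}"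
            have "(\<lambda>x. \<Sum>l<Suc i. x l) \<in> borel_measurable (Pi\<^sub>M {..<n} (\<lambda>_. borel::real measure))"
              using i by (intro borel_measurable_sum measurable_component_singleton) auto
            then show "(\<lambda>x. \<Sum>l<Suc i. x l) -` A (js ! i) \<inter> space (Pi\<^sub>M {..<n} (\<lambda>_. borel)) \<in> sets (Pi\<^sub>M {..<n} (\<lambda>_. borel))"
              using mA[of i] i by (intro measurable_sets[of _ _ borel]) auto
          qed (use False in auto)
          finally show ?thesis .
        qed
        have "emeasure N (sample_path W -` E \<inter> space N) = emeasure N (?D -` ?B \<inter> space N)"
        proof (rule emeasure_eq_AE)
          show "sample_path W -` E \<inter> space N \<in> sets N" using E measurable_sample_path[OF mW] by (intro measurable_sets)
          show "?D -` ?B \<inter> space N \<in> sets N" using mD B by (rule measurable_sets)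
          show "AE \<omega> in N. (\<omega> \<in> sample_path W -` E \<inter> space N) = (\<omega> \<in> ?D -` ?B \<inter> space N)"
            using isotropic_stable_processD(3)[OF W]
          proof eventually_elim
            case (elim \<omega>)
            then have w0: "W (t 0) \<omega> = 0" by (simp add: t_def)
            have "(\<Sum>l<Suc i. ?D \<omega> l) = W (js ! i) \<omega>" if "i < n" for i
              using increments_sum[of W t \<omega>, OF w0, of "Suc i" n] that by (simp only: tS Suc_le_eq)
            then show ?case unfolding 2 by (auto simp: space_PiM)
          qed
        qed
        also have "\<dots> = emeasure (distr N (Pi\<^sub>M {..<n} (\<lambda>_. borel)) ?D) ?B"
          using mD B by (intro emeasure_distr[symmetric])
        also have "distr N (Pi\<^sub>M {..<n} (\<lambda>_. borel)) ?D = Pi\<^sub>M {..<n} (\<lambda>i. distr N borel (W (t (Suc i) - t i)))"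
          using increments_law[OF W t] False by simp
        finally show ?thesis using False 1 by simp
      qed
    qed
    have "Pi\<^sub>M {..<n} (\<lambda>i. distr M borel (Z (t (Suc i) - t i))) = Pi\<^sub>M {..<n} (\<lambda>i. distr M' borel (Z' (t (Suc i) - t i)))"
      using t by (intro PiM_cong stable_law_unique[OF Z Z']) auto
    then show "emeasure (distr M path_space (sample_path Z)) (prod_emb {0..} (\<lambda>_. borel) J (Pi\<^sub>E J A)) =
         emeasure (distr M' path_space (sample_path Z')) (prod_emb {0..} (\<lambda>_. borel) J (Pi\<^sub>E J A))"
      using key[OF Z] key[OF Z'] by (simp add: E_def)
  qed (simp_all add: path_space_def)
qed

section \<open>Levy's maximal inequality\<close>

lemma stable_symmetric:
  fixes Z :: "real \<Rightarrow> 'w \<Rightarrow> real"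
  assumes Z: "isotropic_stable_process M \<alpha> Z" and t: "0 \<le> t"
  shows "distr M borel (\<lambda>\<omega>. - Z t \<omega>) = distr M borel (Z t)"
proof -
  have "isotropic_stable_process M \<alpha> (\<lambda>t \<omega>. (-1) \<bullet> Z t \<omega>)"
    by (rule isotropic_stable_process_inner[OF Z]) simp
  then have "isotropic_stable_process M \<alpha> (\<lambda>t \<omega>. - Z t \<omega>)" by simp
  from stable_law_unique[OF this Z t] show ?thesis .
qed

lemma stable_prob_nonneg:
  fixes Z :: "real \<Rightarrow> 'w \<Rightarrow> real"
  assumes Z: "isotropic_stable_process M \<alpha> Z" and t: "0 \<le> t"
  shows "1 / 2 \<le> measure M {\<omega> \<in> space M. 0 \<le> Z t \<omega>}"
proof -
  interpret prob_space M using isotropic_stable_processD(1)[OF Z] .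
  note [measurable] = isotropic_stable_processD(2)[OF Z t]
  have "measure M {\<omega> \<in> space M. 0 \<le> Z t \<omega>} = measure (distr M borel (Z t)) {0..}"
    by (subst measure_distr) (auto intro!: arg_cong[where f = "measure M"])
  also have "\<dots> = measure (distr M borel (\<lambda>\<omega>. - Z t \<omega>)) {0..}" by (simp add: stable_symmetric[OF Z t])
  also have "\<dots> = measure M {\<omega> \<in> space M. Z t \<omega> \<le> 0}"
    by (subst measure_distr) (auto intro!: arg_cong[where f = "measure M"])
  finally have eq: "measure M {\<omega> \<in> space M. 0 \<le> Z t \<omega>} = measure M {\<omega> \<in> space M. Z t \<omega> \<le> 0}" .
  have "1 = measure M ({\<omega> \<in> space M. 0 \<le> Z t \<omega>} \<union> {\<omega> \<in> space M. Z t \<omega> \<le> 0})"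
    by (subst prob_space[symmetric]) (auto intro!: arg_cong[where f = "measure M"])
  also have "\<dots> \<le> measure M {\<omega> \<in> space M. 0 \<le> Z t \<omega>} + measure M {\<omega> \<in> space M. Z t \<omega> \<le> 0}"
    by (intro measure_Un_le) measurable
  finally show ?thesis using eq by simp
qed

text \<open>E depends on the increments up to \<open>t i\<close>. The remaining increment up to T is
  independent of them, and by stationarity and symmetry it is nonnegative with probability at least
  one half.\<close>

lemma stable_past_indep_increment:
  fixes Z :: "real \<Rightarrow> 'w \<Rightarrow> real" and h :: real
  assumes Z: "isotropic_stable_process M \<alpha> Z"
    and t: "t 0 = 0" "\<And>j. j < i \<Longrightarrow> t j \<le> t (Suc j)" "t i \<le> T"
  defines "E \<equiv> {\<omega> \<in> space M. (\<forall>j\<in>{..<i}. Z (t j) \<omega> \<le> h) \<and> h < Z (t i) \<omega>}"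
  shows "measure M E \<le> 2 * measure M (E \<inter> {\<omega> \<in> space M. 0 \<le> Z T \<omega> - Z (t i) \<omega>})"
proof -
  interpret prob_space M using isotropic_stable_processD(1)[OF Z] .
  have t0: "0 \<le> t j" if "j \<le> i" for j
    using that by (induction j) (use t in \<open>auto intro: order_trans\<close>)
  have T0: "0 \<le> T" using t0[of i] t(3) by simp
  note m = isotropic_stable_processD(2)[OF Z]
  \<comment> \<open>T is appended as time i + 1, so that past and remainder are functions of
    disjoint blocks of a single independent family.\<close>
  define s where "s j = (if j \<le> i then t j else T)" for j
  define D where "D j \<omega> = Z (s (Suc j)) \<omega> - Z (s j) \<omega>" for j \<omega>
  have s0: "0 \<le> s j" for j using t0 T0 by (simp add: s_def)
  have mD: "D j \<in> borel_measurable M" for j unfolding D_def[abs_def] using m s0 by simp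
  have ind: "indep_vars (\<lambda>_. borel) D {..<Suc i}"
    unfolding D_def[abs_def] using t s0 by (intro isotropic_stable_processD(6)[OF Z]) (auto simp: s_def less_Suc_eq)
  have iv: "indep_var (Pi\<^sub>M {..<i} (\<lambda>_. borel)) (\<lambda>\<omega>. restrict (\<lambda>j. D j \<omega>) {..<i})
      (Pi\<^sub>M {i} (\<lambda>_. borel)) (\<lambda>\<omega>. restrict (\<lambda>j. D j \<omega>) {i})"
    by (rule indep_var_restrict[OF ind]) auto
  define a where "a = {x \<in> space (Pi\<^sub>M {..<i} (\<lambda>_. borel)). (\<forall>j\<in>{..<i}. (\<Sum>l<j. x l) \<le> h) \<and> h < (\<Sum>l<i. x l :: real)}"
  define b where "b = {x \<in> space (Pi\<^sub>M {i} (\<lambda>_. borel)). 0 \<le> (x i :: real)}"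
  have ms: "(\<lambda>x. \<Sum>l<j. x l) \<in> borel_measurable (Pi\<^sub>M {..<i} (\<lambda>_. borel::real measure))" if "j \<le> i" for j
    using that by (intro borel_measurable_sum measurable_component_singleton) auto
  have a: "a \<in> sets (Pi\<^sub>M {..<i} (\<lambda>_. borel))"
    unfolding a_def using ms
    by (intro sets.sets_Collect_conj sets.sets_Collect_finite_All borel_measurable_le borel_measurable_less) auto
  have b: "b \<in> sets (Pi\<^sub>M {i} (\<lambda>_. borel))"
    unfolding b_def by (intro borel_measurable_le measurable_component_singleton) auto
  define FA where "FA = (\<lambda>\<omega>. restrict (\<lambda>j. D j \<omega>) {..<i}) -` a \<inter> space M"
  define FB where "FB = (\<lambda>\<omega>. restrict (\<lambda>j. D j \<omega>) {i}) -` b \<inter> space M"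
  have FB: "FB = {\<omega> \<in> space M. 0 \<le> Z T \<omega> - Z (t i) \<omega>}"
    by (auto simp: FB_def b_def space_PiM D_def s_def)
  have Es: "E \<in> sets M" unfolding E_def using m t0
    by (intro sets.sets_Collect_conj sets.sets_Collect_finite_All borel_measurable_le borel_measurable_less) auto
  have FAs: "FA \<in> sets M" unfolding FA_def using a mD by (intro measurable_sets[OF _ a] measurable_restrict) auto
  have FBs: "FB \<in> sets M" unfolding FB_def using b mD by (intro measurable_sets[OF _ b] measurable_restrict) auto
  have ae: "AE \<omega> in M. \<omega> \<in> E \<longleftrightarrow> \<omega> \<in> FA"
    using isotropic_stable_processD(3)[OF Z] AE_space
  proof eventually_elim
    case (elim \<omega>)
    have sm: "(\<Sum>l<j. restrict (\<lambda>j. D j \<omega>) {..<i} l) = Z (t j) \<omega>" if "j \<le> i" for j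
    proof -
      have "(\<Sum>l<j. restrict (\<lambda>j. D j \<omega>) {..<i} l) = (\<Sum>l<j. Z (s (Suc l)) \<omega> - Z (s l) \<omega>)"
        using that by (intro sum.cong) (auto simp: D_def)
      also have "\<dots> = Z (s j) \<omega> - Z (s 0) \<omega>" by (rule sum_lessThan_telescope)
      finally show ?thesis using elim that t(1) by (simp add: s_def)
    qed
    show ?case unfolding E_def FA_def a_def using elim sm by (auto simp: space_PiM)
  qed
  have "prob (FA \<inter> FB) = prob FA * prob FB"
  proof -
    have "prob ((\<lambda>x. (restrict (\<lambda>j. D j x) {..<i}, restrict (\<lambda>j. D j x) {i})) -` (a \<times> b) \<inter> space M) = prob FA * prob FB"
      unfolding FA_def FB_def by (rule indep_varD[OF iv a b])
    moreover have "(\<lambda>x. (restrict (\<lambda>j. D j x) {..<i}, restrict (\<lambda>j. D j x) {i})) -` (a \<times> b) \<inter> space M = FA \<inter> FB"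
      by (auto simp: FA_def FB_def)
    ultimately show ?thesis by simp
  qed
  moreover have "prob FA = prob E" using ae Es FAs by (intro measure_eq_AE) auto
  moreover have "prob (FA \<inter> FB) = prob (E \<inter> FB)" 
    using Es FAs FBs by (intro measure_eq_AE) (use ae in \<open>auto elim: eventually_mono\<close>)
  moreover have "1 / 2 \<le> prob FB"
  proof -
    have Tt: "0 \<le> T - t i" using t by simp
    have [measurable]: "Z (t i) \<in> borel_measurable M" "Z T \<in> borel_measurable M" "Z (T - t i) \<in> borel_measurable M"
      using m t0 T0 Tt by auto
    have "prob FB = measure (distr M borel (\<lambda>\<omega>. Z T \<omega> - Z (t i) \<omega>)) {0..}"
      unfolding FB by (subst measure_distr) (auto intro!: arg_cong[where f = "measure M"])
    also have "\<dots> = measure (distr M borel (Z (T - t i))) {0..}"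
      using isotropic_stable_processD(5)[OF Z t0[of i] t(3)] by simp
    also have "\<dots> = prob {\<omega> \<in> space M. 0 \<le> Z (T - t i) \<omega>}"
      by (subst measure_distr) (auto intro!: arg_cong[where f = "measure M"])
    finally show ?thesis using stable_prob_nonneg[OF Z Tt] by simp
  qed
  ultimately have "prob E * (1 / 2) \<le> prob (E \<inter> FB)"
    by (metis measure_nonneg mult_left_mono)
  then show ?thesis by (simp add: FB)
qed

text \<open>Levy's maximal inequality: decompose by the first passage above \<open>h\<close>; afterwards the
  symmetric remainder is nonnegative with probability at least one half.\<close>

lemma levy_maximal_finite:
  fixes Z :: "real \<Rightarrow> 'w \<Rightarrow> real"
  assumes Z: "isotropic_stable_process M \<alpha> Z" and F: "finite F" "F \<subseteq> {0..T}" and T: "0 \<le> T"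
  shows "measure M {\<omega> \<in> space M. \<exists>r\<in>F. h < Z r \<omega>} \<le> 2 * measure M {\<omega> \<in> space M. h < Z T \<omega>}"
proof -
  interpret prob_space M using isotropic_stable_processD(1)[OF Z] .
  note m = isotropic_stable_processD(2)[OF Z]
  \<comment> \<open>0 is inserted because the increments have to start at time 0; this can only
    enlarge the event.\<close>
  define js where "js = sorted_list_of_set (insert 0 F)"
  have js: "set js = insert 0 F" "sorted js" "js \<noteq> []"
  proof -
    have "finite (insert 0 F)" using F by simp
    then show "set js = insert 0 F" unfolding js_def by (rule set_sorted_list_of_set)
    then show "js \<noteq> []" by auto
    show "sorted js" unfolding js_def by (rule sorted_sorted_list_of_set)
  qed
  define n where "n = length js - 1"
  define t where "t i = js ! i" for i
  have len: "length js = Suc n" using js by (simp add: n_def)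
  have tin: "t i \<in> {0..T}" if "i \<le> n" for i
  proof -
    have "t i \<in> set js" using that len by (simp add: t_def)
    then show ?thesis using js F T by auto
  qed
  have tm: "t i \<le> t j" if "i \<le> j" "j \<le> n" for i j
    using js(2) that len by (simp add: t_def sorted_iff_nth_mono)
  have t0: "t 0 = 0"
  proof -
    have "0 \<in> set js" using js by simp
    then obtain i where i: "i < length js" "js ! i = 0" by (metis in_set_conv_nth)
    then have "t 0 \<le> 0" using tm[of 0 i] len by (simp add: t_def)
    then show ?thesis using tin[of 0] by simp
  qed
  define E where "E i = {\<omega> \<in> space M. (\<forall>j\<in>{..<i}. Z (t j) \<omega> \<le> h) \<and> h < Z (t i) \<omega>}" for i
  define B where "B i = E i \<inter> {\<omega> \<in> space M. 0 \<le> Z T \<omega> - Z (t i) \<omega>}" for i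
  have Es: "E i \<in> sets M" if "i \<le> n" for i
    unfolding E_def using m tin that
    by (intro sets.sets_Collect_conj sets.sets_Collect_finite_All borel_measurable_le borel_measurable_less) auto
  have Bs: "B i \<in> sets M" if "i \<le> n" for i
    unfolding B_def using Es[OF that] m[OF T] m[of "t i"] tin[OF that] by (intro sets.Int borel_measurable_le) auto
  have sub: "{\<omega> \<in> space M. \<exists>r\<in>F. h < Z r \<omega>} \<subseteq> (\<Union>i\<le>n. E i)"
  proof
    fix \<omega> assume \<omega>: "\<omega> \<in> {\<omega> \<in> space M. \<exists>r\<in>F. h < Z r \<omega>}"
    then obtain r where "r \<in> set js" "h < Z r \<omega>" using js by auto
    then obtain i where i: "i \<le> n" "h < Z (t i) \<omega>" using len by (metis in_set_conv_nth less_Suc_eq_le t_def)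
    define i0 where "i0 = (LEAST i. h < Z (t i) \<omega>)"
    have "h < Z (t i0) \<omega>" unfolding i0_def using i(2) by (rule LeastI)
    moreover have "i0 \<le> i" unfolding i0_def using i(2) by (rule Least_le)
    moreover have "Z (t j) \<omega> \<le> h" if "j < i0" for j using not_less_Least[of j "\<lambda>i. h < Z (t i) \<omega>"] that by (auto simp: i0_def)
    ultimately show "\<omega> \<in> (\<Union>i\<le>n. E i)" using \<omega> i by (auto simp: E_def intro!: bexI[of _ i0])
  qed
  have dj: "disjoint_family_on B {..n}"
    unfolding disjoint_family_on_def
  proof (intro ballI impI)
    fix i j :: nat assume "i \<noteq> j"
    then show "B i \<inter> B j = {}" by (cases i j rule: linorder_cases) (force simp: B_def E_def)+
  qed
  have "prob {\<omega> \<in> space M. \<exists>r\<in>F. h < Z r \<omega>} \<le> prob (\<Union>i\<le>n. E i)"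
    using sub Es by (intro finite_measure_mono) auto
  also have "\<dots> \<le> (\<Sum>i\<le>n. prob (E i))"
    using Es by (intro finite_measure_subadditive_finite) auto
  also have "\<dots> \<le> (\<Sum>i\<le>n. 2 * prob (B i))"
    unfolding E_def B_def using t0 tm tin by (intro sum_mono stable_past_indep_increment[OF Z]) auto
  also have "\<dots> = 2 * prob (\<Union>i\<le>n. B i)"
    using Bs by (subst finite_measure_finite_Union[OF _ _ dj]) (auto simp: sum_distrib_left)
  also have "prob (\<Union>i\<le>n. B i) \<le> prob {\<omega> \<in> space M. h < Z T \<omega>}"
  proof (rule finite_measure_mono)
    show "{\<omega> \<in> space M. h < Z T \<omega>} \<in> events" using m[OF T] by measurable
  qed (force simp: B_def E_def)
  finally show ?thesis by simp
qed

lemma levy_maximal_countable: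
  fixes Z :: "real \<Rightarrow> 'w \<Rightarrow> real"
  assumes Z: "isotropic_stable_process M \<alpha> Z" and F: "countable F" "F \<subseteq> {0..T}" and T: "0 \<le> T"
  shows "measure M {\<omega> \<in> space M. \<exists>r\<in>F. h < Z r \<omega>} \<le> 2 * measure M {\<omega> \<in> space M. h < Z T \<omega>}"
proof (cases "F = {}")
  case False
  interpret prob_space M using isotropic_stable_processD(1)[OF Z] .
  note m = isotropic_stable_processD(2)[OF Z]
  define f where "f = from_nat_into F"
  have f: "range f = F" using False F(1) by (simp add: f_def range_from_nat_into)
  define A where "A n = {\<omega> \<in> space M. \<exists>r\<in>f ` {..n}. h < Z r \<omega>}" for n :: nat
  have fp: "0 \<le> f i" for i
  proof -
    have "f i \<in> F" using f by blast
    then show ?thesis using F by auto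
  qed
  have As: "A n \<in> sets M" for n
    unfolding A_def using m[OF fp] by (intro sets.sets_Collect_finite_Ex borel_measurable_less) auto
  have "(\<lambda>n. prob (A n)) \<longlonglongrightarrow> prob (\<Union>n. A n)"
  proof (rule finite_Lim_measure_incseq)
    show "range A \<subseteq> events" using As by blast
    show "incseq A" unfolding incseq_def A_def by (auto; meson order_trans)
  qed
  moreover have "(\<Union>n. A n) = {\<omega> \<in> space M. \<exists>r\<in>F. h < Z r \<omega>}"
    unfolding A_def f[symmetric] by auto
  moreover have "prob (A n) \<le> 2 * measure M {\<omega> \<in> space M. h < Z T \<omega>}" for n
    unfolding A_def using f F by (intro levy_maximal_finite[OF Z _ _ T]) auto
  ultimately show ?thesis using LIMSEQ_le_const2[of "\<lambda>n. prob (A n)"] by auto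
qed simp

section \<open>Moments of the stable law\<close>

text \<open>Layer cake formula: the integral is the integral of the tails, so an inequality between
  tails integrates to one between means. It converts the maximal inequality into a moment
  bound.\<close>

lemma nn_integral_le_by_tails:
  fixes f g :: "'a \<Rightarrow> ennreal"
  assumes M: "sigma_finite_measure M" and f[measurable]: "f \<in> borel_measurable M" and g[measurable]: "g \<in> borel_measurable M"
    and c: "\<And>s. 0 \<le> s \<Longrightarrow> emeasure M {x \<in> space M. ennreal s < f x} \<le> c * emeasure M {x \<in> space M. ennreal s < g x}"
  shows "(\<integral>\<^sup>+x. f x \<partial>M) \<le> c * (\<integral>\<^sup>+x. g x \<partial>M)"
proof -
  interpret M: sigma_finite_measure M by fact
  interpret P: pair_sigma_finite lborel M by standard
  have cake: "(\<integral>\<^sup>+x. h x \<partial>M) = (\<integral>\<^sup>+s. indicator {0..} s * emeasure M {x \<in> space M. ennreal s < h x} \<partial>lborel)"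
    if h[measurable]: "h \<in> borel_measurable M" for h :: "'a \<Rightarrow> ennreal"
  proof -
    have len: "(\<integral>\<^sup>+s. indicator {s. 0 \<le> s \<and> ennreal s < a} s \<partial>lborel) = a" for a :: ennreal
    proof (cases a)
      case (real r)
      have "{s. 0 \<le> s \<and> ennreal s < a} = {0..<r}" using real by (auto simp: ennreal_less_iff)
      then show ?thesis using real by simp
    next
      case top
      have "{s. 0 \<le> s \<and> ennreal s < a} = {0::real..}" using top by auto
      moreover have "emeasure lborel {0::real..} = \<infinity>" 
      proof (rule ccontr)
        assume "emeasure lborel {0::real..} \<noteq> \<infinity>"
        then obtain r where r: "0 \<le> r" "emeasure lborel {0::real..} = ennreal r" by (cases "emeasure lborel {0::real..}") auto
        have "emeasure lborel {0..r+1} \<le> emeasure lborel {0::real..}" by (intro emeasure_mono) auto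
        then show False using r by (simp add: ennreal_le_iff2)
      qed
      ultimately show ?thesis using top by simp
    qed
    have "(\<integral>\<^sup>+x. h x \<partial>M) = (\<integral>\<^sup>+x. (\<integral>\<^sup>+s. indicator {s. 0 \<le> s \<and> ennreal s < h x} s \<partial>lborel) \<partial>M)"
      by (simp add: len)
    also have "\<dots> = (\<integral>\<^sup>+x. (\<integral>\<^sup>+s. (case (s, x) of (s, x) \<Rightarrow> if 0 \<le> s \<and> ennreal s < h x then 1 else 0) \<partial>lborel) \<partial>M)"
      by (intro nn_integral_cong) (auto simp: indicator_def)
    also have "\<dots> = (\<integral>\<^sup>+s. (\<integral>\<^sup>+x. (case (s, x) of (s, x) \<Rightarrow> if 0 \<le> s \<and> ennreal s < h x then 1 else 0) \<partial>M) \<partial>lborel)"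
      by (rule P.Fubini) measurable
    also have "\<dots> = (\<integral>\<^sup>+s. indicator {0..} s * emeasure M {x \<in> space M. ennreal s < h x} \<partial>lborel)"
    proof (intro nn_integral_cong)
      fix s :: real
      have "(\<integral>\<^sup>+x. (case (s, x) of (s, x) \<Rightarrow> if 0 \<le> s \<and> ennreal s < h x then 1 else 0) \<partial>M)
          = (\<integral>\<^sup>+x. indicator {0..} s * indicator {x \<in> space M. ennreal s < h x} x \<partial>M)"
        by (intro nn_integral_cong) (auto simp: indicator_def)
      also have "\<dots> = indicator {0..} s * emeasure M {x \<in> space M. ennreal s < h x}"
        by (subst nn_integral_cmult_indicator) auto
      finally show "(\<integral>\<^sup>+x. (case (s, x) of (s, x) \<Rightarrow> if 0 \<le> s \<and> ennreal s < h x then 1 else 0) \<partial>M)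
          = indicator {0..} s * emeasure M {x \<in> space M. ennreal s < h x}" .
    qed
    finally show ?thesis .
  qed
  have "(\<integral>\<^sup>+x. f x \<partial>M) \<le> (\<integral>\<^sup>+s. c * (indicator {0..} s * emeasure M {x \<in> space M. ennreal s < g x}) \<partial>lborel)"
    unfolding cake[OF f] using c by (intro nn_integral_mono) (auto simp: indicator_def)
  also have "\<dots> = c * (\<integral>\<^sup>+s. indicator {0..} s * emeasure M {x \<in> space M. ennreal s < g x} \<partial>lborel)"
  proof (rule nn_integral_cmult)
    have "(\<lambda>s. \<integral>\<^sup>+x. (if ennreal s < g x then 1 else 0) \<partial>M) \<in> borel_measurable lborel" by measurable
    moreover have "(\<integral>\<^sup>+x. (if ennreal s < g x then 1 else 0) \<partial>M) = emeasure M {x \<in> space M. ennreal s < g x}" for s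
    proof -
      have "(\<integral>\<^sup>+x. (if ennreal s < g x then 1 else 0) \<partial>M) = (\<integral>\<^sup>+x. indicator {x \<in> space M. ennreal s < g x} x \<partial>M)"
        by (intro nn_integral_cong) (auto simp: indicator_def)
      then show ?thesis by simp
    qed
    ultimately show "(\<lambda>s. indicator {0..} s * emeasure M {x \<in> space M. ennreal s < g x}) \<in> borel_measurable lborel"
      by simp
  qed
  also have "\<dots> = c * (\<integral>\<^sup>+x. g x \<partial>M)" by (simp add: cake[OF g])
  finally show ?thesis .
qed

lemma stable_cos_expectation:
  fixes Z :: "real \<Rightarrow> 'w \<Rightarrow> real"
  assumes Z: "isotropic_stable_process M \<alpha> Z" 
  shows "(\<integral>\<omega>. 1 - cos (\<xi> * Z 1 \<omega>) \<partial>M) = 1 - exp (- (\<bar>\<xi>\<bar> powr \<alpha>))"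
proof -
  interpret prob_space M using isotropic_stable_processD(1)[OF Z] .
  have [measurable]: "Z 1 \<in> borel_measurable M" using isotropic_stable_processD(2)[OF Z] by simp
  have i: "complex_integrable M (\<lambda>\<omega>. iexp (\<xi> * Z 1 \<omega>))"
    by (rule integrable_const_bound[of _ 1]) auto
  have "(\<integral>\<omega>. cos (\<xi> * Z 1 \<omega>) \<partial>M) = (\<integral>\<omega>. Re (iexp (\<xi> * Z 1 \<omega>)) \<partial>M)"
    by (intro Bochner_Integration.integral_cong) (auto simp: Re_exp)
  also have "\<dots> = Re (\<integral>\<omega>. iexp (\<xi> * Z 1 \<omega>) \<partial>M)" using i by (rule integral_Re)
  also have "\<dots> = exp (- (\<bar>\<xi>\<bar> powr \<alpha>))"
    using isotropic_stable_processD(7)[OF Z, of 1 \<xi>] by (simp add: Re_exp)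
  finally have "(\<integral>\<omega>. cos (\<xi> * Z 1 \<omega>) \<partial>M) = exp (- (\<bar>\<xi>\<bar> powr \<alpha>))" .
  moreover have "integrable M (\<lambda>\<omega>. cos (\<xi> * Z 1 \<omega>))" by (rule integrable_const_bound[of _ 1]) auto
  ultimately show ?thesis by (simp add: prob_space)
qed

text \<open>The moments come from
  \<open>C * \<bar>x\<bar> powr q = \<integral> (1 - cos (\<xi> * x)) * \<xi> powr (- 1 - q)\<close> over \<open>\<xi> > 0\<close>.\<close>

lemma stable_moment_finite:
  fixes Z :: "real \<Rightarrow> 'w \<Rightarrow> real"
  assumes Z: "isotropic_stable_process M \<alpha> Z" and q: "0 < q" "q < \<alpha>"
  shows "(\<integral>\<^sup>+\<omega>. ennreal (\<bar>Z 1 \<omega>\<bar> powr q) \<partial>M) < \<infinity>"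
proof -
  interpret prob_space M using isotropic_stable_processD(1)[OF Z] .
  interpret P: pair_sigma_finite lborel M by standard
  have [measurable]: "Z 1 \<in> borel_measurable M" using isotropic_stable_processD(2)[OF Z] by simp
  define k where "k x \<xi> = (if 0 < \<xi> then (1 - cos (\<xi> * x)) * \<xi> powr (- 1 - q) else 0)" for x \<xi> :: real
  have k0: "0 \<le> k x \<xi>" for x \<xi> by (simp add: k_def)
  have km[measurable]: "(\<lambda>p. k (f p) (g p)) \<in> borel_measurable N"
    if [measurable]: "f \<in> borel_measurable N" "g \<in> borel_measurable N" for f g and N :: "'n measure"
    unfolding k_def by measurable
  \<comment> \<open>That C is not 0 allows division by it at the end.\<close>
  define C where "C = (\<integral>\<^sup>+\<xi>. ennreal (k 1 \<xi>) \<partial>lborel)"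
  have C: "C \<noteq> 0"
  proof
    assume "C = 0"
    then have "AE \<xi> in lborel. ennreal (k 1 \<xi>) = 0" unfolding C_def by (subst (asm) nn_integral_0_iff_AE) auto
    then have "AE \<xi> in lborel. \<xi> \<notin> {1..2::real}"
    proof eventually_elim
      case (elim \<xi>)
      show ?case
      proof
        assume \<xi>: "\<xi> \<in> {1..2}"
        have "cos \<xi> < 1"
          using cos_monotone_0_pi[of 0 \<xi>] \<xi> pi_gt3 by auto
        then have "0 < k 1 \<xi>" using \<xi> by (simp add: k_def)
        then show False using elim by simp
      qed
    qed
    then have "emeasure lborel {1..2::real} = 0" 
      using emeasure_eq_0_AE[of "\<lambda>\<xi>::real. \<xi> \<in> {1..2}" lborel] by (simp del: atLeastAtMost_iff)
    then show False by simp
  qed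
  have scale: "(\<integral>\<^sup>+\<xi>. ennreal (k x \<xi>) \<partial>lborel) = ennreal (\<bar>x\<bar> powr q) * C" for x
  proof (cases "x = 0")
    case True
    have "k 0 \<xi> = 0" for \<xi> by (simp add: k_def)
    then show ?thesis using q True by simp
  next
    \<comment> \<open>Substitution \<xi> = \<eta> / \<bar>x\<bar>: the weight contributes
      \<open>\<bar>x\<bar> powr (1 + q)\<close> and the Jacobian the inverse of
      \<bar>x\<bar>.\<close>
    case False
    have "(\<integral>\<^sup>+\<xi>. ennreal (k x \<xi>) \<partial>lborel) = ennreal \<bar>1 / \<bar>x\<bar>\<bar> * (\<integral>\<^sup>+\<eta>. ennreal (k x (0 + (1 / \<bar>x\<bar>) * \<eta>)) \<partial>lborel)"
      using False by (intro nn_integral_real_affine) auto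
    also have "(\<lambda>\<eta>. ennreal (k x (0 + (1 / \<bar>x\<bar>) * \<eta>))) = (\<lambda>\<eta>. ennreal (\<bar>x\<bar> powr (1 + q)) * ennreal (k 1 \<eta>))"
    proof
      fix \<eta>
      have c: "cos (\<eta> * x / \<bar>x\<bar>) = cos \<eta>" using False by (cases "x > 0") (auto simp: abs_if)
      have "k x (0 + (1 / \<bar>x\<bar>) * \<eta>) = \<bar>x\<bar> powr (1 + q) * k 1 \<eta>"
      proof (cases "\<eta> > 0")
        case True
        have "(\<eta> / \<bar>x\<bar>) powr (- 1 - q) = \<eta> powr (- 1 - q) * \<bar>x\<bar> powr (1 + q)"
          using True False powr_minus_divide[of "\<bar>x\<bar>" "1 + q"] by (simp add: powr_divide)
        then show ?thesis using True False c by (simp add: k_def)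
      qed (use False in \<open>simp add: k_def field_simps zero_less_divide_iff\<close>)
      then show "ennreal (k x (0 + (1 / \<bar>x\<bar>) * \<eta>)) = ennreal (\<bar>x\<bar> powr (1 + q)) * ennreal (k 1 \<eta>)"
        by (simp add: ennreal_mult k0)
    qed
    also have "(\<integral>\<^sup>+\<eta>. ennreal (\<bar>x\<bar> powr (1 + q)) * ennreal (k 1 \<eta>) \<partial>lborel) = ennreal (\<bar>x\<bar> powr (1 + q)) * C"
      unfolding C_def by (rule nn_integral_cmult) simp
    also have "ennreal \<bar>1 / \<bar>x\<bar>\<bar> * (ennreal (\<bar>x\<bar> powr (1 + q)) * C) = ennreal (\<bar>x\<bar> powr q) * C"
      using False by (simp add: mult.assoc[symmetric] ennreal_mult[symmetric] powr_add)
    finally show ?thesis .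
  qed
  have "(\<integral>\<^sup>+\<omega>. ennreal (\<bar>Z 1 \<omega>\<bar> powr q) \<partial>M) * C = (\<integral>\<^sup>+\<omega>. (\<integral>\<^sup>+\<xi>. ennreal (k (Z 1 \<omega>) \<xi>) \<partial>lborel) \<partial>M)"
    by (simp add: scale nn_integral_multc)
  also have "\<dots> = (\<integral>\<^sup>+\<omega>. (\<integral>\<^sup>+\<xi>. (case (\<xi>, \<omega>) of (\<xi>, \<omega>) \<Rightarrow> ennreal (k (Z 1 \<omega>) \<xi>)) \<partial>lborel) \<partial>M)" by simp
  also have "\<dots> = (\<integral>\<^sup>+\<xi>. (\<integral>\<^sup>+\<omega>. (case (\<xi>, \<omega>) of (\<xi>, \<omega>) \<Rightarrow> ennreal (k (Z 1 \<omega>) \<xi>)) \<partial>M) \<partial>lborel)"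
    by (rule P.Fubini) measurable
  \<comment> \<open>The mean of \<open>1 - cos (\<xi> * Z 1 \<omega>)\<close> is at most both
    \<open>\<xi> powr \<alpha>\<close> and 1. Against the weight the former is integrable at 0
    because q < \<alpha>, the latter at infinity because q > 0.\<close>
  also have "\<dots> \<le> (\<integral>\<^sup>+\<xi>. ennreal (indicator {0..1} \<xi> * \<xi> powr (\<alpha> - 1 - q)) + ennreal (indicator {1..} \<xi> * \<xi> powr (- 1 - q)) \<partial>lborel)"
  proof (intro nn_integral_mono)
    fix \<xi> :: real
    show "(\<integral>\<^sup>+\<omega>. (case (\<xi>, \<omega>) of (\<xi>, \<omega>) \<Rightarrow> ennreal (k (Z 1 \<omega>) \<xi>)) \<partial>M)
        \<le> ennreal (indicator {0..1} \<xi> * \<xi> powr (\<alpha> - 1 - q)) + ennreal (indicator {1..} \<xi> * \<xi> powr (- 1 - q))"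
    proof (cases "0 < \<xi>")
      case True
      have "(\<integral>\<^sup>+\<omega>. ennreal (k (Z 1 \<omega>) \<xi>) \<partial>M) = (\<integral>\<^sup>+\<omega>. ennreal (1 - cos (\<xi> * Z 1 \<omega>)) * ennreal (\<xi> powr (- 1 - q)) \<partial>M)"
        using True by (intro nn_integral_cong) (simp add: k_def ennreal_mult)
      also have "\<dots> = (\<integral>\<^sup>+\<omega>. ennreal (1 - cos (\<xi> * Z 1 \<omega>)) \<partial>M) * ennreal (\<xi> powr (- 1 - q))"
        by (rule nn_integral_multc) simp
      also have "(\<integral>\<^sup>+\<omega>. ennreal (1 - cos (\<xi> * Z 1 \<omega>)) \<partial>M) = ennreal (1 - exp (- (\<xi> powr \<alpha>)))"
      proof (subst nn_integral_eq_integral)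
        show "integrable M (\<lambda>\<omega>. 1 - cos (\<xi> * Z 1 \<omega>))"
          by (intro Bochner_Integration.integrable_diff integrable_const integrable_const_bound[of _ 1]) auto
        show "ennreal (\<integral>\<omega>. 1 - cos (\<xi> * Z 1 \<omega>) \<partial>M) = ennreal (1 - exp (- (\<xi> powr \<alpha>)))"
          using stable_cos_expectation[OF Z, of \<xi>] True by simp
      qed auto
      also have "ennreal (1 - exp (- (\<xi> powr \<alpha>))) * ennreal (\<xi> powr (- 1 - q)) = ennreal ((1 - exp (- (\<xi> powr \<alpha>))) * \<xi> powr (- 1 - q))"
        by (rule ennreal_mult[symmetric]) auto
      also have "\<dots> \<le> ennreal (indicator {0..1} \<xi> * \<xi> powr (\<alpha> - 1 - q) + indicator {1..} \<xi> * \<xi> powr (- 1 - q))"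
      proof (rule ennreal_leI, cases "\<xi> \<le> 1")
        case le: True
        have "1 - exp (- (\<xi> powr \<alpha>)) \<le> \<xi> powr \<alpha>" using exp_ge_add_one_self[of "- (\<xi> powr \<alpha>)"] by linarith
        then have "(1 - exp (- (\<xi> powr \<alpha>))) * \<xi> powr (- 1 - q) \<le> \<xi> powr \<alpha> * \<xi> powr (- 1 - q)"
          by (intro mult_right_mono) auto
        also have "\<dots> = \<xi> powr (\<alpha> - 1 - q)" by (simp add: powr_add[symmetric] algebra_simps)
        also have "\<dots> \<le> indicator {0..1} \<xi> * \<xi> powr (\<alpha> - 1 - q) + indicator {1..} \<xi> * \<xi> powr (- 1 - q)"
          using le True by (simp add: indicator_def)
        finally show "(1 - exp (- (\<xi> powr \<alpha>))) * \<xi> powr (- 1 - q) \<le> indicator {0..1} \<xi> * \<xi> powr (\<alpha> - 1 - q) + indicator {1..} \<xi> * \<xi> powr (- 1 - q)" .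
      next
        case False
        have "(1 - exp (- (\<xi> powr \<alpha>))) * \<xi> powr (- 1 - q) \<le> 1 * \<xi> powr (- 1 - q)"
          by (intro mult_right_mono) auto
        then show "(1 - exp (- (\<xi> powr \<alpha>))) * \<xi> powr (- 1 - q) \<le> indicator {0..1} \<xi> * \<xi> powr (\<alpha> - 1 - q) + indicator {1..} \<xi> * \<xi> powr (- 1 - q)"
          using False by (simp add: indicator_def)
      qed
      also have "\<dots> = ennreal (indicator {0..1} \<xi> * \<xi> powr (\<alpha> - 1 - q)) + ennreal (indicator {1..} \<xi> * \<xi> powr (- 1 - q))"
        by (rule ennreal_plus) auto
      finally show ?thesis by simp
    qed (simp add: k_def)
  qed
  also have "\<dots> = (\<integral>\<^sup>+\<xi>. ennreal (indicator {0..1} \<xi> * \<xi> powr (\<alpha> - 1 - q)) \<partial>lborel) + (\<integral>\<^sup>+\<xi>. ennreal (indicator {1..} \<xi> * \<xi> powr (- 1 - q)) \<partial>lborel)"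
    by (rule nn_integral_add) auto
  also have "(\<integral>\<^sup>+\<xi>. ennreal (indicator {0..1} \<xi> * \<xi> powr (\<alpha> - 1 - q)) \<partial>lborel) = ennreal (1 powr (\<alpha> - 1 - q + 1) / (\<alpha> - 1 - q + 1))"
    using q by (intro nn_integral_has_integral_lebesgue has_integral_powr_from_0) auto
  also have "(\<integral>\<^sup>+\<xi>. ennreal (indicator {1..} \<xi> * \<xi> powr (- 1 - q)) \<partial>lborel) = ennreal (- (1 powr (- 1 - q + 1)) / (- 1 - q + 1))"
    using q by (intro nn_integral_has_integral_lebesgue has_integral_powr_to_inf) auto
  also have "ennreal (1 powr (\<alpha> - 1 - q + 1) / (\<alpha> - 1 - q + 1)) + ennreal (- (1 powr (- 1 - q + 1)) / (- 1 - q + 1)) < \<infinity>"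
    by simp
  finally have "(\<integral>\<^sup>+\<omega>. ennreal (\<bar>Z 1 \<omega>\<bar> powr q) \<partial>M) * C < \<infinity>" .
  then show ?thesis using C by (metis ennreal_mult_eq_top_iff infinity_ennreal_def less_top mult.commute)
qed

text \<open>If the positive part had mean 0, symmetry would make \<open>Z 1\<close> vanish almost
  surely, but its characteristic function at 1 is exp (-1).\<close>

lemma stable_positive_part:
  fixes Z :: "real \<Rightarrow> 'w \<Rightarrow> real"
  assumes Z: "isotropic_stable_process M \<alpha> Z"
  shows "0 < (\<integral>\<^sup>+\<omega>. ennreal (Z 1 \<omega>) \<partial>M)"
proof (rule ccontr)
  interpret prob_space M using isotropic_stable_processD(1)[OF Z] .
  have m[measurable]: "Z 1 \<in> borel_measurable M" using isotropic_stable_processD(2)[OF Z] by simp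
  assume "\<not> 0 < (\<integral>\<^sup>+\<omega>. ennreal (Z 1 \<omega>) \<partial>M)"
  then have "(\<integral>\<^sup>+\<omega>. ennreal (Z 1 \<omega>) \<partial>M) = 0" by (simp add: not_less)
  then have neg: "AE \<omega> in M. Z 1 \<omega> \<le> 0"
    by (subst (asm) nn_integral_0_iff_AE) (auto elim!: eventually_mono simp: ennreal_eq_0_iff)
  then have "AE x in distr M borel (Z 1). x \<le> 0" by (subst AE_distr_iff) auto
  then have "AE x in distr M borel (\<lambda>\<omega>. - Z 1 \<omega>). x \<le> 0" unfolding stable_symmetric[OF Z zero_le_one] .
  then have "AE \<omega> in M. - Z 1 \<omega> \<le> 0" by (subst (asm) AE_distr_iff) auto
  with neg have zero: "AE \<omega> in M. Z 1 \<omega> = 0" by eventually_elim simp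
  have "(\<integral>\<omega>. 1 - cos (1 * Z 1 \<omega>) \<partial>M) = (\<integral>\<omega>. 0 \<partial>M)"
    using zero by (intro integral_cong_AE) (auto elim: eventually_mono)
  then show False using stable_cos_expectation[OF Z, of 1] by simp
qed

section \<open>Cadlag paths and running suprema\<close>

lemma cadlag_right_cont: "cadlag f \<Longrightarrow> 0 \<le> t \<Longrightarrow> (f \<longlongrightarrow> f t) (at_right t)"
  by (simp add: cadlag_def)

lemma cadlag_left_lim: "cadlag f \<Longrightarrow> 0 < t \<Longrightarrow> \<exists>l. (f \<longlongrightarrow> l) (at_left t)"
  by (simp add: cadlag_def)

text \<open>One-sided limits bound the path near each time, and finitely many such neighbourhoods
  cover the compact interval. At time 0 there is nothing to control on the left.\<close>

lemma cadlag_bounded: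
  fixes f :: "real \<Rightarrow> 'b::real_normed_vector"
  assumes f: "cadlag f"
  shows "bounded (f ` {0..t})"
proof -
  have "\<exists>d>0. bounded (f ` (ball s d \<inter> {0..}))" if s: "0 \<le> s" for s
  proof -
    have "\<forall>\<^sub>F x in at_right s. dist (f x) (f s) < 1"
      using cadlag_right_cont[OF f s] by (rule tendstoD) simp
    then obtain b where b: "b > s" "\<And>x. s < x \<Longrightarrow> x < b \<Longrightarrow> dist (f x) (f s) < 1"
      unfolding eventually_at_right_field by auto
    have "\<exists>a l. a < s \<and> (\<forall>x\<ge>0. a < x \<longrightarrow> x < s \<longrightarrow> dist (f x) l < 1)"
    proof (cases "s = 0")
      case True then show ?thesis by (intro exI[of _ "-1"]) auto
    next
      case False
      then have "0 < s" using s by simp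
      then obtain l where "(f \<longlongrightarrow> l) (at_left s)" using cadlag_left_lim[OF f] by blast
      then have "\<forall>\<^sub>F x in at_left s. dist (f x) l < 1" by (rule tendstoD) simp
      then show ?thesis unfolding eventually_at_left_field by auto
    qed
    then obtain a l where a: "a < s" "\<And>x. 0 \<le> x \<Longrightarrow> a < x \<Longrightarrow> x < s \<Longrightarrow> dist (f x) l < 1" by blast
    define d where "d = min (b - s) (s - a)"
    have "f ` (ball s d \<inter> {0..}) \<subseteq> ball (f s) 1 \<union> ball l 1"
    proof
      fix y assume "y \<in> f ` (ball s d \<inter> {0..})"
      then obtain x where x: "y = f x" "\<bar>s - x\<bar> < d" "0 \<le> x" by (auto simp: dist_real_def)
      consider "x = s" | "s < x" | "x < s" by linarith
      then show "y \<in> ball (f s) 1 \<union> ball l 1"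
        using a(2)[of x] b(2)[of x] x by cases (auto simp: d_def dist_commute)
    qed
    then have "bounded (f ` (ball s d \<inter> {0..}))" using bounded_subset bounded_Un bounded_ball by metis
    then show ?thesis using a(1) b(1) by (intro exI[of _ d]) (auto simp: d_def)
  qed
  then obtain d where d: "\<And>s. 0 \<le> s \<Longrightarrow> 0 < d s" "\<And>s. 0 \<le> s \<Longrightarrow> bounded (f ` (ball s (d s) \<inter> {0..}))" by metis
  have "compact {0..t}" by simp
  then obtain C where C: "C \<subseteq> {0..t}" "finite C" "{0..t} \<subseteq> (\<Union>s\<in>C. ball s (d s))"
    by (rule compactE_image[of _ "{0..t}" "\<lambda>s. ball s (d s)"]) (use d in auto)
  have "f ` {0..t} \<subseteq> (\<Union>s\<in>C. f ` (ball s (d s) \<inter> {0..}))" using C(3) by fastforce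
  moreover have "bounded (\<Union>s\<in>C. f ` (ball s (d s) \<inter> {0..}))" using C d by (intro bounded_UN) auto
  ultimately show ?thesis using bounded_subset by blast
qed

definition good_paths :: "(real \<Rightarrow> 'b::real_normed_vector) \<Rightarrow> (real \<Rightarrow> real) \<Rightarrow> bool" where
  "good_paths f u \<longleftrightarrow> cadlag f \<and> f 0 = 0 \<and> u 0 = 0 \<and> (\<forall>t\<ge>0. 0 \<le> u t) \<and> mono_on {0..} u \<and> cadlag u"

lemma good_pathsD:
  assumes "good_paths f u"
  shows "cadlag f" "f 0 = 0" "u 0 = 0" "\<And>t. 0 \<le> t \<Longrightarrow> 0 \<le> u t" "\<And>s t. 0 \<le> s \<Longrightarrow> s \<le> t \<Longrightarrow> u s \<le> u t" "cadlag u"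
  using assms by (auto simp: good_paths_def mono_on_def)

text \<open>For the left limit at t, let l be the left limit of the clock. Either the clock reaches
  l before t and is constant from then on, giving the value f l, or it approaches l strictly from
  below, giving the left limit of f at l.\<close>

lemma good_paths_cadlag:
  fixes f :: "real \<Rightarrow> 'b::real_normed_vector"
  assumes g: "good_paths f u"
  shows "cadlag (\<lambda>s. f (u s))"
  unfolding cadlag_def
proof (intro conjI allI impI)
  note G = good_pathsD[OF g]
  fix t :: real assume t: "0 \<le> t"
  show "((\<lambda>s. f (u s)) \<longlongrightarrow> f (u t)) (at_right t)"
  proof (rule tendstoI)
    fix e :: real assume e: "0 < e"
    have "\<forall>\<^sub>F x in at_right (u t). dist (f x) (f (u t)) < e"
      using cadlag_right_cont[OF G(1) G(4)[OF t]] e by (rule tendstoD)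
    then obtain b where b: "b > u t" "\<And>x. u t < x \<Longrightarrow> x < b \<Longrightarrow> dist (f x) (f (u t)) < e"
      unfolding eventually_at_right_field by auto
    have "\<forall>\<^sub>F s in at_right t. u s < b" using cadlag_right_cont[OF G(6) t] b(1) by (rule order_tendstoD)
    moreover have "\<forall>\<^sub>F s in at_right t. t < s" by (simp add: eventually_at_filter)
    ultimately show "\<forall>\<^sub>F s in at_right t. dist (f (u s)) (f (u t)) < e"
    proof eventually_elim
      case (elim s)
      then have "u t \<le> u s" using G(5)[OF t] by simp
      then show ?case using b(2)[of "u s"] elim e by (cases "u s = u t") auto
    qed
  qed
next
  note G = good_pathsD[OF g]
  fix t :: real assume t: "0 < t"
  obtain l where l: "(u \<longlongrightarrow> l) (at_left t)" using cadlag_left_lim[OF G(6) t] by blast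
  have evt: "\<forall>\<^sub>F r in at_left t. s < r \<and> r < t" if "s < t" for s
    using that by (auto simp: eventually_at_left_field intro!: exI[of _ s])
  have le: "u s \<le> l" if s: "0 \<le> s" "s < t" for s
  proof (rule tendsto_lowerbound[OF l])
    show "\<forall>\<^sub>F r in at_left t. u s \<le> u r" using evt[OF s(2)] by eventually_elim (use G(5) s in auto)
  qed simp
  show "\<exists>l. ((\<lambda>s. f (u s)) \<longlongrightarrow> l) (at_left t)"
  proof (cases "\<exists>s\<in>{0..<t}. u s = l")
    case True
    then obtain s where s: "0 \<le> s" "s < t" "u s = l" by auto
    have "\<forall>\<^sub>F r in at_left t. f l = f (u r)"
      using evt[OF s(2)]
    proof eventually_elim
      case (elim r)
      then have "l \<le> u r" "u r \<le> l" using G(5)[of s r] le[of r] s by auto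
      then show ?case by simp
    qed
    then have "((\<lambda>s. f (u s)) \<longlongrightarrow> f l) (at_left t)" by (rule Lim_transform_eventually[OF tendsto_const])
    then show ?thesis by blast
  next
    case False
    then have lt: "u s < l" if "0 \<le> s" "s < t" for s
    proof -
      have "u s \<noteq> l" using False that by auto
      with le[OF that] show ?thesis by simp
    qed
    then have "0 < l" using lt[of 0] G(3) t by simp
    then obtain m where m: "(f \<longlongrightarrow> m) (at_left l)" using cadlag_left_lim[OF G(1)] by blast
    have "filterlim u (at_left l) (at_left t)"
      unfolding filterlim_at
    proof
      show "\<forall>\<^sub>F r in at_left t. u r \<in> {..<l} \<and> u r \<noteq> l"
        using evt[OF t]
      proof eventually_elim
        case (elim r)
        then have "u r < l" by (intro lt) auto
        then show ?case by simp
      qed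
    qed (rule l)
    from filterlim_compose[OF m this] show ?thesis by blast
  qed
qed

text \<open>For nonnegative v, the least multiple of 1 / 2^n that is strictly above v. Strictness
  makes right-continuity applicable; the countable range makes evaluation of a process at a random
  time measurable.\<close>

definition grid_above :: "nat \<Rightarrow> real \<Rightarrow> real" where
  "grid_above n v = (real (nat \<lfloor>2 ^ n * v\<rfloor>) + 1) / 2 ^ n"

lemma grid_above_at_right:
  assumes "0 \<le> v" shows "filterlim (\<lambda>n. grid_above n v) (at_right v) sequentially"
  unfolding filterlim_at
proof
  have b: "v < grid_above n v" "grid_above n v \<le> v + (1 / 2) ^ n" for n
  proof -
    have "0 \<le> \<lfloor>2 ^ n * v\<rfloor>" using assms by simp
    then have e: "real (nat \<lfloor>2 ^ n * v\<rfloor>) = of_int \<lfloor>2 ^ n * v\<rfloor>" by simp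
    have "2 ^ n * v < real (nat \<lfloor>2 ^ n * v\<rfloor>) + 1" "real (nat \<lfloor>2 ^ n * v\<rfloor>) \<le> 2 ^ n * v" unfolding e by linarith+
    then show "v < grid_above n v"
      unfolding grid_above_def by (simp add: pos_less_divide_eq mult.commute)
    have "grid_above n v \<le> (2 ^ n * v + 1) / 2 ^ n"
      unfolding grid_above_def using \<open>real (nat \<lfloor>2 ^ n * v\<rfloor>) \<le> 2 ^ n * v\<close> by (intro divide_right_mono) auto
    also have "\<dots> = v + (1 / 2) ^ n" by (simp add: add_divide_distrib power_one_over)
    finally show "grid_above n v \<le> v + (1 / 2) ^ n" .
  qed
  have "v \<noteq> grid_above n v" for n using b(1)[of n] by simp
  then show "\<forall>\<^sub>F n in sequentially. grid_above n v \<in> {v<..} \<and> grid_above n v \<noteq> v" using b(1) by (intro always_eventually) (simp add: eq_commute)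
  have "(\<lambda>n. v + (1 / 2 :: real) ^ n) \<longlonglongrightarrow> v + 0" by (intro tendsto_intros LIMSEQ_power_zero) auto
  then have lim: "(\<lambda>n. v + (1 / 2 :: real) ^ n) \<longlonglongrightarrow> v" by (simp only: add_0_right)
  show "(\<lambda>n. grid_above n v) \<longlonglongrightarrow> v"
  proof (rule tendsto_sandwich[OF _ _ tendsto_const lim])
    show "\<forall>\<^sub>F n in sequentially. v \<le> grid_above n v"
      using less_imp_le[OF b(1)] by (intro always_eventually) simp
    show "\<forall>\<^sub>F n in sequentially. grid_above n v \<le> v + (1 / 2) ^ n"
      using b(2) by (intro always_eventually) simp
  qed
qed

lemma cadlag_grid_lim:
  assumes "cadlag f" "0 \<le> v" shows "(\<lambda>n. f (grid_above n v)) \<longlonglongrightarrow> f v"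
  using filterlim_compose[OF cadlag_right_cont[OF assms] grid_above_at_right[OF assms(2)]] .

section \<open>Suprema over countable dense sets of times\<close>

lemma right_cont_dense_SUP:
  fixes h :: "real \<Rightarrow> ennreal"
  assumes h: "\<And>u. 0 \<le> u \<Longrightarrow> u < v \<Longrightarrow> (h \<longlongrightarrow> h u) (at_right u)"
  shows "(SUP r\<in>\<rat> \<inter> {0..<v}. h r) = (SUP u\<in>{0..<v}. h u)"
proof (rule antisym)
  show "(SUP r\<in>\<rat> \<inter> {0..<v}. h r) \<le> (SUP u\<in>{0..<v}. h u)" by (intro SUP_subset_mono) auto
  show "(SUP u\<in>{0..<v}. h u) \<le> (SUP r\<in>\<rat> \<inter> {0..<v}. h r)"
  proof (rule SUP_least, rule ccontr)
    fix u assume u: "u \<in> {0..<v}" and n: "\<not> h u \<le> (SUP r\<in>\<rat> \<inter> {0..<v}. h r)"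
    have "\<forall>\<^sub>F x in at_right u. (SUP r\<in>\<rat> \<inter> {0..<v}. h r) < h x"
      using h[of u] u n by (intro order_tendstoD(1)) auto
    then obtain b where b: "b > u" "\<And>x. u < x \<Longrightarrow> x < b \<Longrightarrow> (SUP r\<in>\<rat> \<inter> {0..<v}. h r) < h x"
      unfolding eventually_at_right_field by auto
    obtain r where r: "r \<in> \<rat>" "u < r" "r < min b v" using Rats_dense_in_real[of u "min b v"] b u by auto
    then have "h r \<le> (SUP r\<in>\<rat> \<inter> {0..<v}. h r)" using u by (intro SUP_upper) auto
    moreover have "(SUP r\<in>\<rat> \<inter> {0..<v}. h r) < h r" using b(2)[of r] r by simp
    ultimately show False by (simp add: leD)
  qed
qed

text \<open>The right end point has to be added to the dense set: no later times are available to
  approximate it from the right.\<close>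

lemma right_cont_dense_SUP_closed:
  fixes h :: "real \<Rightarrow> ennreal"
  assumes h: "\<And>u. 0 \<le> u \<Longrightarrow> (h \<longlongrightarrow> h u) (at_right u)" and t: "0 \<le> t"
  shows "(SUP r\<in>insert t (\<rat> \<inter> {0..<t}). h r) = (SUP u\<in>{0..t}. h u)"
proof -
  have "(SUP r\<in>insert t (\<rat> \<inter> {0..<t}). h r) = sup (h t) (SUP u\<in>{0..<t}. h u)"
    using right_cont_dense_SUP[of t h] h by (simp add: SUP_insert)
  also have "\<dots> = (SUP u\<in>insert t {0..<t}. h u)" by (simp add: SUP_insert)
  also have "insert t {0..<t} = {0..t}" using t by auto
  finally show ?thesis .
qed

definition pos_powr :: "real \<Rightarrow> real \<Rightarrow> ennreal" where
  "pos_powr q x = ennreal (max 0 x powr q)"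

lemma pos_powr_tendsto: "0 < q \<Longrightarrow> (f \<longlongrightarrow> a) F \<Longrightarrow> ((\<lambda>x. pos_powr q (f x)) \<longlongrightarrow> pos_powr q a) F"
  unfolding pos_powr_def
  by (intro tendsto_ennrealI tendsto_powr' tendsto_max tendsto_const) auto

lemma measurable_pos_powr [measurable]: "pos_powr q \<in> borel_measurable borel"
  unfolding pos_powr_def[abs_def] by measurable

lemma pos_powr_one: "pos_powr 1 x = ennreal x"
  by (cases "0 \<le> x") (auto simp: pos_powr_def max_def ennreal_neg)

lemma pos_powr_mult: "0 \<le> c \<Longrightarrow> pos_powr q (x * c) = ennreal (c powr q) * pos_powr q x"
  unfolding pos_powr_def by (cases "0 \<le> x")
    (auto simp: max_def powr_mult ennreal_mult mult.commute mult_le_0_iff zero_le_mult_iff)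

text \<open>For cadlag paths, the supremum over the half-open interval up to v. The bound v is moved
  from the index set into the values, so that the expression is measurable in v as well.\<close>

definition run_sup :: "real \<Rightarrow> (real \<Rightarrow> real) \<Rightarrow> real \<Rightarrow> ennreal" where
  "run_sup q z v = (SUP r\<in>\<rat> \<inter> {0..}. if r < v then pos_powr q (z r) else 0)"

lemma run_sup_eq:
  assumes f: "cadlag f" and q: "0 < q"
  shows "run_sup q f v = (SUP u\<in>{0..<v}. pos_powr q (f u))"
proof -
  have "run_sup q f v = (SUP r\<in>\<rat> \<inter> {0..<v}. pos_powr q (f r))"
    unfolding run_sup_def
  proof (rule antisym)
    show "(SUP r\<in>\<rat> \<inter> {0..}. if r < v then pos_powr q (f r) else 0) \<le> (SUP r\<in>\<rat> \<inter> {0..<v}. pos_powr q (f r))"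
      by (intro SUP_least) (auto intro: SUP_upper)
    show "(SUP r\<in>\<rat> \<inter> {0..<v}. pos_powr q (f r)) \<le> (SUP r\<in>\<rat> \<inter> {0..}. if r < v then pos_powr q (f r) else 0)"
    proof (intro SUP_least)
      fix r assume "r \<in> \<rat> \<inter> {0..<v}"
      then show "pos_powr q (f r) \<le> (SUP r\<in>\<rat> \<inter> {0..}. if r < v then pos_powr q (f r) else 0)"
        by (intro SUP_upper2[of r]) auto
    qed
  qed
  also have "\<dots> = (SUP u\<in>{0..<v}. pos_powr q (f u))"
    by (rule right_cont_dense_SUP) (use cadlag_right_cont[OF f] q in \<open>auto intro: pos_powr_tendsto\<close>)
  finally show ?thesis .
qed

lemma run_sup_cong: "(\<And>r. 0 \<le> r \<Longrightarrow> f r = g r) \<Longrightarrow> run_sup q f v = run_sup q g v"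
  unfolding run_sup_def by (intro SUP_cong) auto

text \<open>Multiplication by v need not preserve the rationals, so the identity is proved for the
  supremum over all times, which is the same for a cadlag path.\<close>

lemma run_sup_scale:
  assumes f: "cadlag f" and q: "0 < q" and v: "0 < v"
  shows "run_sup q f v = run_sup q (\<lambda>u. f (v * u)) 1"
proof -
  have c: "cadlag (\<lambda>u. f (v * u))"
    unfolding cadlag_def
  proof (intro conjI allI impI)
    fix t :: real assume "0 \<le> t"
    then have "(f \<longlongrightarrow> f (v * t)) (at_right (v * t))" using f v by (simp add: cadlag_def)
    then show "((\<lambda>t. f (v * t)) \<longlongrightarrow> f (v * t)) (at_right t)"
      by (intro filterlim_compose[OF _ filterlim_mult_pos_at_right[OF v]])
  next
    fix t :: real assume "0 < t"
    then obtain l where "(f \<longlongrightarrow> l) (at_left (v * t))" using f v unfolding cadlag_def by force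
    then show "\<exists>l. ((\<lambda>t. f (v * t)) \<longlongrightarrow> l) (at_left t)"
      by (blast intro: filterlim_compose[OF _ filterlim_mult_pos_at_left[OF v]])
  qed
  have im: "(*) v ` {0..<1} = {0..<v}"
  proof (intro equalityI subsetI)
    fix x assume "x \<in> {0..<v}"
    then show "x \<in> (*) v ` {0..<1}" using v by (intro image_eqI[of _ _ "x / v"]) auto
  qed (use v in \<open>auto simp: field_simps\<close>)
  have "run_sup q (\<lambda>u. f (v * u)) 1 = (SUP u\<in>{0..<1}. pos_powr q (f (v * u)))" by (rule run_sup_eq[OF c q])
  also have "\<dots> = (SUP u\<in>(*) v ` {0..<1}. pos_powr q (f u))" by (simp add: image_image)
  finally show ?thesis using run_sup_eq[OF f q] by (simp only: im)
qed

lemma measurable_run_sup [measurable (raw)]: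
  assumes z: "\<And>r. 0 \<le> r \<Longrightarrow> (\<lambda>x. z x r) \<in> borel_measurable N" and [measurable]: "v \<in> borel_measurable N"
  shows "(\<lambda>x. run_sup q (z x) (v x)) \<in> borel_measurable N"
  unfolding run_sup_def
proof (rule borel_measurable_SUP)
  show "countable (\<rat> \<inter> {0::real..})" using countable_rat by (rule countable_subset[rotated]) auto
  fix r :: real assume "r \<in> \<rat> \<inter> {0..}"
  then have [measurable]: "(\<lambda>x. z x r) \<in> borel_measurable N" using z by simp
  show "(\<lambda>x. if r < v x then pos_powr q (z x r) else 0) \<in> borel_measurable N" by measurable
qed

section \<open>Subordinated stable processes\<close>

lemma borel_measurable_completion_AE:
  fixes f g :: "'a \<Rightarrow> 'b::topological_space"
  assumes f: "f \<in> borel_measurable M" and ae: "AE x in M. f x = g x"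
  shows "g \<in> borel_measurable (completion M)"
proof (rule measurableI)
  fix A :: "'b set" assume A: "A \<in> sets borel"
  show "g -` A \<inter> space (completion M) \<in> sets (completion M)"
  proof (rule completion.in_sets_AE)
    show "f -` A \<inter> space M \<in> sets (completion M)" using measurable_sets[OF f A] by (rule sets_completionI_sets)
    show "AE x in completion M. (x \<in> f -` A \<inter> space M) = (x \<in> g -` A \<inter> space (completion M))"
      using ae by (intro AE_completion) (auto elim!: eventually_mono)
  qed simp
qed simp

lemma integral_completion_AE:
  fixes f g :: "'a \<Rightarrow> real"
  assumes f: "f \<in> borel_measurable M" and ae: "AE x in M. f x = g x"
  shows "(\<integral>x. g x \<partial>completion M) = (\<integral>x. f x \<partial>M)"
proof -
  have "(\<integral>x. g x \<partial>completion M) = (\<integral>x. f x \<partial>completion M)"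
    using borel_measurable_completion_AE[OF f ae] measurable_completion[OF f] AE_completion[OF ae]
    by (intro integral_cong_AE) (auto elim: eventually_mono)
  then show ?thesis using integral_completion[OF f] by simp
qed

text \<open>\<open>G\<close> is a measurable event of full measure on which the path properties hold
  without exception; this lets pathwise arguments be made for single sample points.\<close>

locale subordinated_stable =
  fixes M :: "'w measure" and \<alpha> :: real and Y :: "real \<Rightarrow> 'w \<Rightarrow> 'b::euclidean_space"
    and U :: "real \<Rightarrow> 'w \<Rightarrow> real" and G :: "'w set"
  assumes \<alpha>: "1 < \<alpha>"
    and Y: "isotropic_stable_process M \<alpha> Y"
    and mU: "\<And>t. 0 \<le> t \<Longrightarrow> U t \<in> borel_measurable M"
    and indep: "indep_processes M Y U"
    and G: "G \<in> sets M" "AE \<omega> in M. \<omega> \<in> G"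
    and good: "\<And>\<omega>. \<omega> \<in> G \<Longrightarrow> good_paths (\<lambda>t. Y t \<omega>) (\<lambda>t. U t \<omega>)"
begin

sublocale prob_space M
  using isotropic_stable_processD(1)[OF Y] .

abbreviation "X t \<omega> \<equiv> Y (U t \<omega>) \<omega>"

abbreviation "proj v t \<omega> \<equiv> v \<bullet> Y t \<omega>"

lemma proj: "norm v = 1 \<Longrightarrow> isotropic_stable_process M \<alpha> (proj v)"
  by (rule isotropic_stable_process_inner[OF Y])

lemma mY: "0 \<le> t \<Longrightarrow> Y t \<in> borel_measurable M"
  by (rule isotropic_stable_processD(2)[OF Y])

lemma m_proj: "sample_path (proj v) \<in> measurable M path_space"
  using mY by (intro measurable_sample_path) auto

lemma m_U: "sample_path U \<in> measurable M path_space"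
  using mU by (rule measurable_sample_path)

text \<open>The projected path is a measurable function of the path of \<open>Y\<close>, so it
  generates a smaller \<sigma>-algebra, which inherits the independence.\<close>

lemma indep_proj: "indep_var path_space (sample_path (proj v)) path_space (sample_path U)"
proof -
  let ?P = "Pi\<^sub>M {0..} (\<lambda>_. borel :: 'b measure)"
  define Yp where "Yp \<omega> = (\<lambda>t\<in>{0..}. Y t \<omega>)" for \<omega>
  have Yp: "Yp \<in> measurable M ?P" unfolding Yp_def[abs_def] using mY by (intro measurable_restrict) auto
  define h where "h y = (\<lambda>t\<in>{0..}. v \<bullet> y t)" for y :: "real \<Rightarrow> 'b"
  have h: "h \<in> measurable ?P path_space"
    unfolding h_def[abs_def] path_space_def
    by (intro measurable_restrict borel_measurable_inner borel_measurable_const measurable_component_singleton)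
  have comp: "sample_path (proj v) \<omega> = h (Yp \<omega>)" for \<omega>
    by (auto simp: sample_path_def h_def Yp_def)
  have pY: "process_events M Y = sigma_sets (space M) {Yp -` A \<inter> space M |A. A \<in> sets ?P}"
    unfolding process_events_def sets_vimage_algebra Yp_def[abs_def] ..
  have pU: "process_events M U = sigma_sets (space M) {sample_path U -` A \<inter> space M |A. A \<in> sets path_space}"
    unfolding process_events_def sets_vimage_algebra sample_path_def[abs_def] path_space_def ..
  have "{sample_path (proj v) -` A \<inter> space M |A. A \<in> sets path_space} \<subseteq> {Yp -` A \<inter> space M |A. A \<in> sets ?P}"
  proof
    fix B assume "B \<in> {sample_path (proj v) -` A \<inter> space M |A. A \<in> sets path_space}"
    then obtain A where A: "A \<in> sets path_space" "B = sample_path (proj v) -` A \<inter> space M" by blast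
    have "B = Yp -` (h -` A \<inter> space ?P) \<inter> space M"
      using measurable_space[OF Yp] by (auto simp: A comp)
    then show "B \<in> {Yp -` A \<inter> space M |A. A \<in> sets ?P}" using measurable_sets[OF h A(1)] by blast
  qed
  then have sub: "sigma_sets (space M) {sample_path (proj v) -` A \<inter> space M |A. A \<in> sets path_space} \<subseteq> process_events M Y"
    unfolding pY by (rule sigma_sets_mono')
  have "indep_set (process_events M Y) (process_events M U)" using indep by (simp add: indep_processes_def)
  then have "indep_set (sigma_sets (space M) {sample_path (proj v) -` A \<inter> space M |A. A \<in> sets path_space}) (process_events M U)"
    unfolding indep_sets2_eq using sub by blast
  then show ?thesis unfolding indep_var_eq using m_proj m_U by (simp add: pU)
qed

lemma joint_law:
  "distr M (path_space \<Otimes>\<^sub>M path_space) (\<lambda>\<omega>. (sample_path (proj v) \<omega>, sample_path U \<omega>)) =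
     distr M path_space (sample_path (proj v)) \<Otimes>\<^sub>M distr M path_space (sample_path U)"
  using indep_proj[of v] by (simp add: indep_var_distribution_eq)

lemma joint_law_isotropic:
  assumes "norm v = 1" "norm w = 1"
  shows "distr M (path_space \<Otimes>\<^sub>M path_space) (\<lambda>\<omega>. (sample_path (proj v) \<omega>, sample_path U \<omega>)) =
     distr M (path_space \<Otimes>\<^sub>M path_space) (\<lambda>\<omega>. (sample_path (proj w) \<omega>, sample_path U \<omega>))"
  unfolding joint_law using stable_path_law_unique[OF proj[OF assms(1)] proj[OF assms(2)]] by simp

text \<open>Fubini for the product law: the clock is frozen at \<omega>' while the stable path runs
  over an independent copy.\<close>

lemma joint_nn_integral:
  assumes \<Phi>: "\<Phi> \<in> borel_measurable (path_space \<Otimes>\<^sub>M path_space)"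
  shows "(\<integral>\<^sup>+\<omega>. \<Phi> (sample_path (proj v) \<omega>, sample_path U \<omega>) \<partial>M) =
    (\<integral>\<^sup>+\<omega>'. (\<integral>\<^sup>+\<omega>. \<Phi> (sample_path (proj v) \<omega>, sample_path U \<omega>') \<partial>M) \<partial>M)"
proof -
  let ?A = "distr M path_space (sample_path (proj v))" and ?B = "distr M path_space (sample_path U)"
  interpret A: prob_space ?A by (rule prob_space_distr[OF m_proj])
  interpret B: prob_space ?B by (rule prob_space_distr[OF m_U])
  interpret P: pair_sigma_finite ?A ?B by standard
  have \<Phi>': "\<Phi> \<in> borel_measurable (?A \<Otimes>\<^sub>M ?B)" using \<Phi> by (simp cong: measurable_cong_sets)
  have "(\<integral>\<^sup>+\<omega>. \<Phi> (sample_path (proj v) \<omega>, sample_path U \<omega>) \<partial>M) =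
      integral\<^sup>N (distr M (path_space \<Otimes>\<^sub>M path_space) (\<lambda>\<omega>. (sample_path (proj v) \<omega>, sample_path U \<omega>))) \<Phi>"
    using m_proj m_U \<Phi> by (subst nn_integral_distr) (auto intro: measurable_Pair)
  also have "\<dots> = integral\<^sup>N (?A \<Otimes>\<^sub>M ?B) \<Phi>" by (simp only: joint_law)
  also have "\<dots> = (\<integral>\<^sup>+u. (\<integral>\<^sup>+z. \<Phi> (z, u) \<partial>?A) \<partial>?B)"
    using P.nn_integral_snd[OF \<Phi>'] by simp
  also have "\<dots> = (\<integral>\<^sup>+\<omega>'. (\<integral>\<^sup>+z. \<Phi> (z, sample_path U \<omega>') \<partial>?A) \<partial>M)"
  proof (rule nn_integral_distr[OF m_U])
    have "(\<lambda>(u, z). \<Phi> (z, u)) \<in> borel_measurable (?B \<Otimes>\<^sub>M ?A)"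
      using measurable_compose[OF measurable_pair_swap' \<Phi>'] by (simp add: case_prod_beta)
    then show "(\<lambda>u. \<integral>\<^sup>+z. \<Phi> (z, u) \<partial>?A) \<in> borel_measurable ?B" by (rule A.borel_measurable_nn_integral)
  qed
  also have "\<dots> = (\<integral>\<^sup>+\<omega>'. (\<integral>\<^sup>+\<omega>. \<Phi> (sample_path (proj v) \<omega>, sample_path U \<omega>') \<partial>M) \<partial>M)"
  proof (intro nn_integral_cong nn_integral_distr[OF m_proj])
    fix \<omega>' assume "\<omega>' \<in> space M"
    then have "sample_path U \<omega>' \<in> space path_space" using measurable_space[OF m_U] by blast
    then have "(\<lambda>z. \<Phi> (z, sample_path U \<omega>')) \<in> borel_measurable path_space"
      using \<Phi> by (rule measurable_compose[OF measurable_Pair2'])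
    then show "(\<lambda>z. \<Phi> (z, sample_path U \<omega>')) \<in> borel_measurable ?A" by simp
  qed
  finally show ?thesis .
qed

section \<open>The running maximum as a functional of two paths\<close>

definition "sup_times t = insert t (\<rat> \<inter> {0..<t})" for t :: real

lemma countable_sup_times: "countable (sup_times t)"
  unfolding sup_times_def using countable_subset[OF _ countable_rat, of "\<rat> \<inter> {0..<t}"] by simp

lemma sup_times_nonneg: "0 \<le> t \<Longrightarrow> s \<in> sup_times t \<Longrightarrow> 0 \<le> s"
  by (auto simp: sup_times_def)

text \<open>For right-continuous \<open>z\<close> this is \<open>z (u s)\<close>; the limit makes it jointly measurable in \<open>z\<close> and \<open>u\<close>.\<close>

definition "changed z u s = lim (\<lambda>n. z (grid_above n (u s)) :: real)" for z u :: "real \<Rightarrow> real"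

text \<open>The conversion to \<open>ennreal\<close> cuts off negative values. Paths that start at 0
  have a nonnegative supremum, so for them nothing is lost.\<close>

definition "sup_functional t = (\<lambda>(z, u). SUP s\<in>sup_times t. ennreal (changed z u s))"

text \<open>The grid point takes countably many values, so evaluating the path there is a countable
  case distinction between evaluations at fixed times.\<close>

lemma measurable_changed:
  assumes "0 \<le> s"
  shows "(\<lambda>(z, u). changed z u s) \<in> borel_measurable (path_space \<Otimes>\<^sub>M path_space)"
proof -
  have [measurable]: "(\<lambda>zu. snd zu s) \<in> borel_measurable (path_space \<Otimes>\<^sub>M path_space)"
    using assms by (intro measurable_compose[OF measurable_snd]) measurable
  have "(\<lambda>zu. fst zu (grid_above n (snd zu s))) \<in> borel_measurable (path_space \<Otimes>\<^sub>M path_space)" for n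
    unfolding grid_above_def
  proof (rule measurable_compose_countable[where f = "\<lambda>i zu. fst zu ((real i + 1) / 2 ^ n)" and g = "\<lambda>zu. nat \<lfloor>2 ^ n * snd zu s\<rfloor>"])
    show "(\<lambda>zu. nat \<lfloor>2 ^ n * snd zu s\<rfloor>) \<in> path_space \<Otimes>\<^sub>M path_space \<rightarrow>\<^sub>M count_space UNIV" by measurable
    show "(\<lambda>zu. fst zu ((real i + 1) / 2 ^ n)) \<in> borel_measurable (path_space \<Otimes>\<^sub>M path_space)" for i
      by (intro measurable_compose[OF measurable_fst]) measurable
  qed
  then show ?thesis unfolding changed_def case_prod_beta by (rule borel_measurable_lim_metric)
qed

lemma measurable_sup_functional:
  "0 \<le> t \<Longrightarrow> sup_functional t \<in> borel_measurable (path_space \<Otimes>\<^sub>M path_space)"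
  unfolding sup_functional_def case_prod_beta
  using measurable_changed[OF sup_times_nonneg[of t]] countable_sup_times
  by (intro borel_measurable_SUP) (auto simp: case_prod_beta)

lemma good_proj:
  assumes "\<omega> \<in> G"
  shows "cadlag (\<lambda>t. proj v t \<omega>)" "good_paths (\<lambda>t. proj v t \<omega>) (\<lambda>t. U t \<omega>)"
proof -
  have c: "cadlag (\<lambda>t. v \<bullet> f t)" if "cadlag f" for f :: "real \<Rightarrow> 'b"
    unfolding cadlag_def
  proof (intro conjI allI impI)
    fix t :: real assume "0 \<le> t"
    then show "((\<lambda>t. v \<bullet> f t) \<longlongrightarrow> v \<bullet> f t) (at_right t)"
      using that by (intro tendsto_inner tendsto_const) (simp add: cadlag_def)
  next
    fix t :: real assume "0 < t"
    then have "\<exists>l. (f \<longlongrightarrow> l) (at_left t)" using that unfolding cadlag_def by blast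
    then obtain l where "(f \<longlongrightarrow> l) (at_left t)" by blast
    from tendsto_inner[OF tendsto_const this] show "\<exists>l. ((\<lambda>t. v \<bullet> f t) \<longlongrightarrow> l) (at_left t)" by blast
  qed
  show "cadlag (\<lambda>t. proj v t \<omega>)" using c good_pathsD(1)[OF good[OF assms]] by blast
  then show "good_paths (\<lambda>t. proj v t \<omega>) (\<lambda>t. U t \<omega>)"
    using good[OF assms] by (simp add: good_paths_def)
qed

lemma changed_good:
  assumes "\<omega> \<in> G" "\<omega>' \<in> G" "0 \<le> s"
  shows "changed (sample_path (proj v) \<omega>) (sample_path U \<omega>') s = proj v (U s \<omega>') \<omega>"
proof -
  have u: "0 \<le> U s \<omega>'" using good_pathsD(4)[OF good[OF assms(2)]] assms(3) by simp
  have g: "0 \<le> grid_above n x" for n x by (simp add: grid_above_def)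
  have "(\<lambda>n. proj v (grid_above n (U s \<omega>')) \<omega>) \<longlonglongrightarrow> proj v (U s \<omega>') \<omega>"
    by (rule cadlag_grid_lim[OF good_proj(1)[OF assms(1)] u])
  then show ?thesis unfolding changed_def using assms(3) g by (intro limI) (simp add: sample_path_apply)
qed

lemma sup_functional_good:
  assumes \<omega>: "\<omega> \<in> G" and t: "0 \<le> t"
  shows "sup_functional t (sample_path (proj v) \<omega>, sample_path U \<omega>) = (SUP s\<in>{0..t}. ennreal (v \<bullet> X s \<omega>))"
proof -
  have "sup_functional t (sample_path (proj v) \<omega>, sample_path U \<omega>) = (SUP s\<in>sup_times t. ennreal (v \<bullet> X s \<omega>))"
    unfolding sup_functional_def using changed_good[OF \<omega> \<omega>] sup_times_nonneg[OF t] by simp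
  also have "\<dots> = (SUP s\<in>{0..t}. ennreal (v \<bullet> X s \<omega>))"
    unfolding sup_times_def
    by (rule right_cont_dense_SUP_closed[OF _ t])
       (use cadlag_right_cont[OF good_paths_cadlag[OF good_proj(2)[OF \<omega>]]] in \<open>auto intro: tendsto_ennrealI\<close>)
  finally show ?thesis .
qed

text \<open>Written through the pair of paths and not as a supremum over an interval: it is
  measurable at once, and its law depends only on the joint law of the two paths, hence not on the
  unit vector v.\<close>

definition "max_proj v t \<omega> = enn2real (sup_functional t (sample_path (proj v) \<omega>, sample_path U \<omega>))"

lemma measurable_max_proj [measurable]: "0 \<le> t \<Longrightarrow> max_proj v t \<in> borel_measurable M"
  unfolding max_proj_def[abs_def]
  using measurable_compose[OF measurable_Pair[OF m_proj m_U] measurable_sup_functional[of t]] by measurable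

lemma max_proj_nonneg: "0 \<le> max_proj v t \<omega>"
  by (simp add: max_proj_def)

lemma X_zero: "\<omega> \<in> G \<Longrightarrow> X 0 \<omega> = 0"
  using good_pathsD(2,3)[OF good] by simp

lemma X_cadlag: "\<omega> \<in> G \<Longrightarrow> cadlag (\<lambda>s. X s \<omega>)"
  using good_paths_cadlag[OF good] .

lemma max_proj_bdd: 
  assumes "\<omega> \<in> G" shows "bdd_above ((\<lambda>s. v \<bullet> X s \<omega>) ` {0..t})"
  by (rule bounded_imp_bdd_above[OF cadlag_bounded[OF good_paths_cadlag[OF good_proj(2)[OF assms]]]])

lemma max_proj_good:
  assumes \<omega>: "\<omega> \<in> G" and t: "0 \<le> t"
  shows "max_proj v t \<omega> = (SUP s\<in>{0..t}. v \<bullet> X s \<omega>)"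
    "ennreal (max_proj v t \<omega>) = sup_functional t (sample_path (proj v) \<omega>, sample_path U \<omega>)"
proof -
  let ?S = "SUP s\<in>{0..t}. v \<bullet> X s \<omega>"
  have "v \<bullet> X 0 \<omega> \<le> ?S" using t by (intro cSUP_upper max_proj_bdd[OF \<omega>]) auto
  then have S0: "0 \<le> ?S" using X_zero[OF \<omega>] by simp
  have "ennreal ?S = (SUP s\<in>{0..t}. ennreal (v \<bullet> X s \<omega>))"
  proof (rule antisym)
    show "(SUP s\<in>{0..t}. ennreal (v \<bullet> X s \<omega>)) \<le> ennreal ?S"
      using max_proj_bdd[OF \<omega>] by (intro SUP_least ennreal_leI cSUP_upper) auto
    show "ennreal ?S \<le> (SUP s\<in>{0..t}. ennreal (v \<bullet> X s \<omega>))"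
    proof (rule ccontr)
      assume "\<not> ?thesis"
      then have lt: "(SUP s\<in>{0..t}. ennreal (v \<bullet> X s \<omega>)) < ennreal ?S" by simp
      then obtain c where c: "0 \<le> c" "(SUP s\<in>{0..t}. ennreal (v \<bullet> X s \<omega>)) = ennreal c"
        by (cases "SUP s\<in>{0..t}. ennreal (v \<bullet> X s \<omega>)") auto
      have "v \<bullet> X s \<omega> \<le> c" if "s \<in> {0..t}" for s
      proof -
        have "ennreal (v \<bullet> X s \<omega>) \<le> ennreal c" unfolding c(2)[symmetric] using that by (intro SUP_upper)
        then show ?thesis using c(1) by (simp add: ennreal_le_iff)
      qed
      then have "?S \<le> c" using t by (intro cSUP_least) auto
      then show False using lt c by (simp add: ennreal_less_iff)
    qed
  qed
  then have *: "sup_functional t (sample_path (proj v) \<omega>, sample_path U \<omega>) = ennreal ?S"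
    using sup_functional_good[OF \<omega> t] by simp
  show "max_proj v t \<omega> = ?S" unfolding max_proj_def * using S0 by simp
  then show "ennreal (max_proj v t \<omega>) = sup_functional t (sample_path (proj v) \<omega>, sample_path U \<omega>)"
    by (simp add: *)
qed

lemma max_proj_upper: "\<omega> \<in> G \<Longrightarrow> 0 \<le> s \<Longrightarrow> s \<le> t \<Longrightarrow> v \<bullet> X s \<omega> \<le> max_proj v t \<omega>"
  using max_proj_bdd by (subst max_proj_good(1)) (auto intro: cSUP_upper)

lemma max_proj_attains:
  assumes "\<omega> \<in> G" "0 \<le> t" "a < max_proj v t \<omega>"
  obtains s where "0 \<le> s" "s \<le> t" "a < v \<bullet> X s \<omega>"
  using assms less_cSUP_iff[of "{0..t}" "\<lambda>s. v \<bullet> X s \<omega>" a] max_proj_bdd[OF assms(1)]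
  by (auto simp: max_proj_good(1))

lemma max_proj_law:
  assumes "norm v = 1" "norm w = 1" "0 \<le> t"
  shows "distr M borel (max_proj v t) = distr M borel (max_proj w t)"
proof -
  have *: "distr M borel (max_proj v t) = distr (distr M (path_space \<Otimes>\<^sub>M path_space) (\<lambda>\<omega>. (sample_path (proj v) \<omega>, sample_path U \<omega>)))
      borel (\<lambda>p. enn2real (sup_functional t p))" for v
    using m_proj m_U measurable_sup_functional[OF assms(3)]
    by (subst distr_distr) (auto simp: o_def max_proj_def[abs_def])
  show ?thesis unfolding * joint_law_isotropic[OF assms(1,2)] ..
qed

end

section \<open>Moments of the running maximum\<close>

lemma pos_powr_less_iff:
  assumes "0 \<le> s" "0 < q" shows "ennreal s < pos_powr q x \<longleftrightarrow> s powr (1 / q) < x"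
proof (cases "0 < x")
  case True
  have "s < x powr q \<longleftrightarrow> s powr (1 / q) < x"
  proof
    assume "s < x powr q"
    then have "s powr (1 / q) < (x powr q) powr (1 / q)" using assms by (intro powr_less_mono2) auto
    then show "s powr (1 / q) < x" using True assms by (simp add: powr_powr)
  next
    assume "s powr (1 / q) < x"
    then have "(s powr (1 / q)) powr q < x powr q" using assms by (intro powr_less_mono2) auto
    then show "s < x powr q" using assms by (cases "s = 0") (simp_all add: powr_powr)
  qed
  then show ?thesis using True assms by (simp add: pos_powr_def max_def ennreal_less_iff)
next
  case False
  then have "\<not> s powr (1 / q) < x" by (meson dual_order.trans less_le_not_le linorder_not_less powr_ge_zero)
  then show ?thesis using False by (simp add: pos_powr_def max_def)
qed

lemma run_sup_less_iff:
  assumes "0 \<le> s" "0 < q"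
  shows "ennreal s < run_sup q z v \<longleftrightarrow> (\<exists>r\<in>\<rat> \<inter> {0..<v}. s powr (1 / q) < z r)"
proof -
  have "ennreal s < (if r < v then pos_powr q (z r) else 0) \<longleftrightarrow> r < v \<and> s powr (1 / q) < z r" for r
    by (simp add: pos_powr_less_iff[OF assms])
  then have "ennreal s < run_sup q z v \<longleftrightarrow> (\<exists>r\<in>\<rat> \<inter> {0..}. r < v \<and> s powr (1 / q) < z r)"
    unfolding run_sup_def less_SUP_iff by (simp only:)
  then show ?thesis by force
qed

lemma run_sup_zero: "v \<le> 0 \<Longrightarrow> run_sup q z v = 0"
  unfolding run_sup_def by (auto intro!: antisym SUP_least)

lemma run_sup_mult:
  assumes "0 \<le> c" shows "run_sup q (\<lambda>r. z r * c) v = ennreal (c powr q) * run_sup q z v"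
proof -
  have "run_sup q (\<lambda>r. z r * c) v = (SUP r\<in>\<rat> \<inter> {0..}. ennreal (c powr q) * (if r < v then pos_powr q (z r) else 0))"
    unfolding run_sup_def using assms by (intro SUP_cong) (auto simp: pos_powr_mult)
  also have "\<dots> = ennreal (c powr q) * run_sup q z v"
    unfolding run_sup_def by (rule SUP_mult_left_ennreal[symmetric])
  finally show ?thesis .
qed

lemma measurable_run_sup_path [measurable]: "(\<lambda>z. run_sup q z v) \<in> borel_measurable path_space"
  by (intro measurable_run_sup) auto

context subordinated_stable
begin

definition "sup_moment e q = (\<integral>\<^sup>+\<omega>. run_sup q (sample_path (proj e) \<omega>) 1 \<partial>M)"

lemma measurable_run_sup_proj [measurable]: "(\<lambda>\<omega>. run_sup q (sample_path (proj e) \<omega>) v) \<in> borel_measurable M"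
  using measurable_compose[OF m_proj measurable_run_sup_path] by simp

lemma run_sup_sample_path: "run_sup q (sample_path Z \<omega>) v = run_sup q (\<lambda>t. Z t \<omega>) v"
  by (rule run_sup_cong) (simp add: sample_path_apply)

text \<open>The rescaled process is again stable with the same exponent, so it has the same path
  law, and a supremum up to v becomes a multiple of one up to 1.\<close>

lemma run_sup_scaling:
  assumes e: "norm e = 1" and q: "0 < q" and v: "0 \<le> v"
  shows "(\<integral>\<^sup>+\<omega>. run_sup q (sample_path (proj e) \<omega>) v \<partial>M) = ennreal (v powr (q / \<alpha>)) * sup_moment e q"
proof (cases "v = 0")
  case True then show ?thesis using q \<alpha> by (simp add: run_sup_zero)
next
  case False
  then have v: "0 < v" using v by simp
  define c where "c = v powr (1 / \<alpha>)"
  have c: "0 < c" "c powr q = v powr (q / \<alpha>)" using v by (auto simp: c_def powr_powr)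
  define Z where "Z t \<omega> = proj e (v * t) \<omega> / c" for t \<omega>
  have Z: "isotropic_stable_process M \<alpha> Z"
    unfolding Z_def[abs_def] c_def using isotropic_stable_process_scale[OF proj[OF e] v] \<alpha> by simp
  have mZ: "sample_path Z \<in> measurable M path_space" by (rule measurable_sample_path[OF isotropic_stable_processD(2)[OF Z]])
  have "AE \<omega> in M. run_sup q (sample_path (proj e) \<omega>) v = ennreal (c powr q) * run_sup q (sample_path Z \<omega>) 1"
    using G(2)
  proof eventually_elim
    case (elim \<omega>)
    have "run_sup q (\<lambda>t. proj e t \<omega>) v = run_sup q (\<lambda>u. proj e (v * u) \<omega>) 1"
      by (rule run_sup_scale[OF good_proj(1)[OF elim] q v])
    also have "(\<lambda>u. proj e (v * u) \<omega>) = (\<lambda>u. Z u \<omega> * c)" using c by (simp add: Z_def)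
    also have "run_sup q (\<lambda>u. Z u \<omega> * c) 1 = ennreal (c powr q) * run_sup q (\<lambda>u. Z u \<omega>) 1"
      using c by (intro run_sup_mult) auto
    finally show ?case by (simp add: run_sup_sample_path)
  qed
  then have "(\<integral>\<^sup>+\<omega>. run_sup q (sample_path (proj e) \<omega>) v \<partial>M) = (\<integral>\<^sup>+\<omega>. ennreal (c powr q) * run_sup q (sample_path Z \<omega>) 1 \<partial>M)"
    by (rule nn_integral_cong_AE)
  also have "\<dots> = ennreal (c powr q) * (\<integral>\<^sup>+\<omega>. run_sup q (sample_path Z \<omega>) 1 \<partial>M)"
    using measurable_compose[OF mZ measurable_run_sup_path] by (intro nn_integral_cmult) simp
  also have "(\<integral>\<^sup>+\<omega>. run_sup q (sample_path Z \<omega>) 1 \<partial>M) = (\<integral>\<^sup>+z. run_sup q z 1 \<partial>distr M path_space (sample_path Z))"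
    by (rule nn_integral_distr[symmetric, OF mZ]) simp
  also have "\<dots> = (\<integral>\<^sup>+z. run_sup q z 1 \<partial>distr M path_space (sample_path (proj e)))"
    by (simp only: stable_path_law_unique[OF Z proj[OF e]])
  also have "\<dots> = sup_moment e q" unfolding sup_moment_def by (rule nn_integral_distr[OF m_proj]) simp
  finally show ?thesis by (simp add: c)
qed

text \<open>Levy's inequality compares the tails of the supremum with those of the value at time 1,
  whose q-th moment is finite.\<close>

lemma sup_moment_finite:
  assumes e: "norm e = 1" and q: "0 < q" "q < \<alpha>"
  shows "sup_moment e q < \<infinity>"
proof -
  let ?Z = "proj e"
  note Z = proj[OF e]
  have [measurable]: "?Z 1 \<in> borel_measurable M" using mY[of 1] by simp
  have "sup_moment e q \<le> 2 * (\<integral>\<^sup>+\<omega>. pos_powr q (?Z 1 \<omega>) \<partial>M)"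
    unfolding sup_moment_def
  proof (rule nn_integral_le_by_tails)
    show "sigma_finite_measure M" by unfold_locales
    fix s :: real assume s: "0 \<le> s"
    have 1: "{\<omega> \<in> space M. ennreal s < run_sup q (sample_path ?Z \<omega>) 1} = {\<omega> \<in> space M. \<exists>r\<in>\<rat> \<inter> {0..<1}. s powr (1 / q) < ?Z r \<omega>}"
      using run_sup_less_iff[OF s q(1)] by (auto simp: sample_path_apply)
    have 2: "{\<omega> \<in> space M. ennreal s < pos_powr q (?Z 1 \<omega>)} = {\<omega> \<in> space M. s powr (1 / q) < ?Z 1 \<omega>}"
      using pos_powr_less_iff[OF s q(1)] by auto
    have "measure M {\<omega> \<in> space M. \<exists>r\<in>\<rat> \<inter> {0..<1}. s powr (1 / q) < ?Z r \<omega>} \<le> 2 * measure M {\<omega> \<in> space M. s powr (1 / q) < ?Z 1 \<omega>}"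
      by (rule levy_maximal_countable[OF Z countable_subset[OF _ countable_rat]]) auto
    then have "ennreal (measure M {\<omega> \<in> space M. \<exists>r\<in>\<rat> \<inter> {0..<1}. s powr (1 / q) < ?Z r \<omega>}) \<le> ennreal (2 * measure M {\<omega> \<in> space M. s powr (1 / q) < ?Z 1 \<omega>})"
      by (rule ennreal_leI)
    then show "emeasure M {\<omega> \<in> space M. ennreal s < run_sup q (sample_path ?Z \<omega>) 1} \<le> 2 * emeasure M {\<omega> \<in> space M. ennreal s < pos_powr q (?Z 1 \<omega>)}"
      unfolding 1 2 emeasure_eq_measure by (simp add: ennreal_mult)
  qed measurable
  also have "(\<integral>\<^sup>+\<omega>. pos_powr q (?Z 1 \<omega>) \<partial>M) \<le> (\<integral>\<^sup>+\<omega>. ennreal (\<bar>?Z 1 \<omega>\<bar> powr q) \<partial>M)"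
    unfolding pos_powr_def using q by (intro nn_integral_mono ennreal_leI powr_mono2) auto
  also have "2 * (\<integral>\<^sup>+\<omega>. ennreal (\<bar>?Z 1 \<omega>\<bar> powr q) \<partial>M) < \<infinity>"
    using stable_moment_finite[OF Z q] by (simp add: ennreal_mult_less_top)
  finally show ?thesis by (simp add: mult_left_mono)
qed

lemma run_sup_subordinator:
  assumes e: "norm e = 1" and q: "0 < q" and t: "0 \<le> t" and c: "0 < c"
  shows "(\<integral>\<^sup>+\<omega>. run_sup q (sample_path (proj e) \<omega>) (c * U t \<omega>) \<partial>M) =
    ennreal (c powr (q / \<alpha>)) * sup_moment e q * (\<integral>\<^sup>+\<omega>. ennreal (U t \<omega> powr (q / \<alpha>)) \<partial>M)"
proof -
  have [measurable]: "U t \<in> borel_measurable M" by (rule mU[OF t])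
  define \<Phi> where "\<Phi> = (\<lambda>(z, u). run_sup q z (c * u t))"
  have [measurable]: "(\<lambda>p. snd p t) \<in> borel_measurable (path_space \<Otimes>\<^sub>M path_space)"
    using t by (intro measurable_compose[OF measurable_snd]) measurable
  have \<Phi>: "\<Phi> \<in> borel_measurable (path_space \<Otimes>\<^sub>M path_space)"
    unfolding \<Phi>_def case_prod_beta
    by (rule measurable_run_sup) (auto intro!: measurable_compose[OF measurable_fst])
  have "(\<integral>\<^sup>+\<omega>. run_sup q (sample_path (proj e) \<omega>) (c * U t \<omega>) \<partial>M) =
      (\<integral>\<^sup>+\<omega>'. (\<integral>\<^sup>+\<omega>. run_sup q (sample_path (proj e) \<omega>) (c * U t \<omega>') \<partial>M) \<partial>M)"
    using joint_nn_integral[OF \<Phi>, of e] t by (simp add: \<Phi>_def sample_path_apply)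
  also have "\<dots> = (\<integral>\<^sup>+\<omega>'. (ennreal (c powr (q / \<alpha>)) * sup_moment e q) * ennreal (U t \<omega>' powr (q / \<alpha>)) \<partial>M)"
  proof (rule nn_integral_cong_AE)
    show "AE \<omega>' in M. (\<integral>\<^sup>+\<omega>. run_sup q (sample_path (proj e) \<omega>) (c * U t \<omega>') \<partial>M) =
        (ennreal (c powr (q / \<alpha>)) * sup_moment e q) * ennreal (U t \<omega>' powr (q / \<alpha>))"
      using G(2)
    proof eventually_elim
      case (elim \<omega>')
      have u: "0 \<le> U t \<omega>'" using good_pathsD(4)[OF good[OF elim] t] .
      then have "(\<integral>\<^sup>+\<omega>. run_sup q (sample_path (proj e) \<omega>) (c * U t \<omega>') \<partial>M) = ennreal ((c * U t \<omega>') powr (q / \<alpha>)) * sup_moment e q"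
        using c by (intro run_sup_scaling[OF e q]) simp
      then show ?case using u c by (simp add: powr_mult ennreal_mult mult_ac)
    qed
  qed
  also have "\<dots> = ennreal (c powr (q / \<alpha>)) * sup_moment e q * (\<integral>\<^sup>+\<omega>. ennreal (U t \<omega> powr (q / \<alpha>)) \<partial>M)"
    by (rule nn_integral_cmult) measurable
  finally show ?thesis .
qed

text \<open>The values of \<open>X\<close> are values of \<open>Y\<close> at clock times up to and
  including \<open>U t\<close>, whereas \<open>run_sup\<close> stops strictly before its bound; the
  factor c > 1 makes room. If the clock stands at 0, the value is 0 and the claim is
  trivial.\<close>

lemma max_proj_le_run_sup:
  assumes \<omega>: "\<omega> \<in> G" and q: "0 < q" and t: "0 \<le> t" and c: "1 < c"
  shows "ennreal (max_proj e t \<omega> powr q) \<le> run_sup q (sample_path (proj e) \<omega>) (c * U t \<omega>)"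
proof (rule ccontr)
  assume n: "\<not> ?thesis"
  then obtain b where b: "0 \<le> b" "run_sup q (sample_path (proj e) \<omega>) (c * U t \<omega>) = ennreal b"
    by (cases "run_sup q (sample_path (proj e) \<omega>) (c * U t \<omega>)") auto
  have "b < max_proj e t \<omega> powr q" using n b by (simp add: not_le ennreal_less_iff)
  then have "ennreal b < pos_powr q (max_proj e t \<omega>)" using b(1) max_proj_nonneg[of e t \<omega>] by (simp add: pos_powr_def ennreal_less_iff max_def)
  then have "b powr (1 / q) < max_proj e t \<omega>" by (simp add: pos_powr_less_iff[OF b(1) q])
  then obtain s where s: "0 \<le> s" "s \<le> t" "b powr (1 / q) < e \<bullet> X s \<omega>" using max_proj_attains[OF \<omega> t] by blast
  note g = good_pathsD[OF good[OF \<omega>]]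
  have us: "0 \<le> U s \<omega>" "U s \<omega> \<le> U t \<omega>" using g(4,5) s by auto
  have "U s \<omega> \<noteq> 0"
  proof
    assume "U s \<omega> = 0"
    then have "b powr (1 / q) < 0" using s(3) g(2) by simp
    then show False by (simp add: not_less[symmetric])
  qed
  then have "0 < U t \<omega>" using us by simp
  then have "1 * U t \<omega> < c * U t \<omega>" using c by (intro mult_strict_right_mono)
  then have "U s \<omega> < c * U t \<omega>" using us by simp
  then have "pos_powr q (e \<bullet> X s \<omega>) \<le> run_sup q (\<lambda>t. proj e t \<omega>) (c * U t \<omega>)"
    unfolding run_sup_eq[OF good_proj(1)[OF \<omega>] q] using us by (intro SUP_upper2[of "U s \<omega>"]) auto
  also have "\<dots> = ennreal b" using b by (simp add: run_sup_sample_path)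
  finally show False using pos_powr_less_iff[OF b(1) q] s(3) by (simp add: not_less[symmetric])
qed

lemma max_proj_moment:
  assumes e: "norm e = 1" and q: "0 < q" and t: "0 \<le> t" and c: "1 < c"
  shows "(\<integral>\<^sup>+\<omega>. ennreal (max_proj e t \<omega> powr q) \<partial>M) \<le>
    ennreal (c powr (q / \<alpha>)) * sup_moment e q * (\<integral>\<^sup>+\<omega>. ennreal (U t \<omega> powr (q / \<alpha>)) \<partial>M)"
proof -
  have "AE \<omega> in M. ennreal (max_proj e t \<omega> powr q) \<le> run_sup q (sample_path (proj e) \<omega>) (c * U t \<omega>)"
    using G(2) by eventually_elim (rule max_proj_le_run_sup[OF _ q t c])
  then have "(\<integral>\<^sup>+\<omega>. ennreal (max_proj e t \<omega> powr q) \<partial>M) \<le> (\<integral>\<^sup>+\<omega>. run_sup q (sample_path (proj e) \<omega>) (c * U t \<omega>) \<partial>M)"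
    by (rule nn_integral_mono_AE)
  then show ?thesis using run_sup_subordinator[OF e q t, of c] c by simp
qed

lemma proj_scaling:
  assumes e: "norm e = 1" and v: "0 \<le> v"
  shows "(\<integral>\<^sup>+\<omega>. ennreal (proj e v \<omega>) \<partial>M) = ennreal (v powr (1 / \<alpha>)) * (\<integral>\<^sup>+\<omega>. ennreal (proj e 1 \<omega>) \<partial>M)"
proof (cases "v = 0")
  case True
  have "(\<integral>\<^sup>+\<omega>. ennreal (proj e 0 \<omega>) \<partial>M) = (\<integral>\<^sup>+\<omega>. 0 \<partial>M)"
    using isotropic_stable_processD(3)[OF Y] by (intro nn_integral_cong_AE) (auto elim: eventually_mono)
  then show ?thesis using True \<alpha> by simp
next
  case False
  then have v: "0 < v" using v by simp
  define c where "c = v powr (1 / \<alpha>)"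
  have c: "0 < c" using v by (auto simp: c_def)
  define Z where "Z t \<omega> = proj e (v * t) \<omega> / c" for t \<omega>
  have Z: "isotropic_stable_process M \<alpha> Z"
    unfolding Z_def[abs_def] c_def using isotropic_stable_process_scale[OF proj[OF e] v] \<alpha> by simp
  have mZ: "Z 1 \<in> borel_measurable M" "proj e 1 \<in> borel_measurable M" "proj e v \<in> borel_measurable M"
    using isotropic_stable_processD(2)[OF Z] mY[of 1] mY[of v] v by auto
  have "(\<integral>\<^sup>+\<omega>. ennreal (proj e v \<omega>) \<partial>M) = (\<integral>\<^sup>+\<omega>. ennreal c * ennreal (Z 1 \<omega>) \<partial>M)"
    using c by (intro nn_integral_cong) (simp add: Z_def ennreal_mult'[symmetric])
  also have "\<dots> = ennreal c * (\<integral>\<^sup>+\<omega>. ennreal (Z 1 \<omega>) \<partial>M)" using mZ by (intro nn_integral_cmult) simp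
  also have "(\<integral>\<^sup>+\<omega>. ennreal (Z 1 \<omega>) \<partial>M) = (\<integral>\<^sup>+x. ennreal x \<partial>distr M borel (Z 1))"
    using mZ by (subst nn_integral_distr) auto
  also have "\<dots> = (\<integral>\<^sup>+x. ennreal x \<partial>distr M borel (proj e 1))"
    by (simp only: stable_law_unique[OF Z proj[OF e] zero_le_one])
  also have "\<dots> = (\<integral>\<^sup>+\<omega>. ennreal (proj e 1 \<omega>) \<partial>M)" using mZ by (subst nn_integral_distr) auto
  finally show ?thesis by (simp add: c_def)
qed

text \<open>The maximum is at least the positive part of the terminal value. With the clock frozen,
  self-similarity evaluates the mean of that positive part.\<close>

lemma max_proj_mean_lower:
  assumes e: "norm e = 1" and t: "0 \<le> t"
  shows "(\<integral>\<^sup>+\<omega>. ennreal (proj e 1 \<omega>) \<partial>M) * (\<integral>\<^sup>+\<omega>. ennreal (U t \<omega> powr (1 / \<alpha>)) \<partial>M) \<le> (\<integral>\<^sup>+\<omega>. ennreal (max_proj e t \<omega>) \<partial>M)"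
proof -
  have [measurable]: "U t \<in> borel_measurable M" by (rule mU[OF t])
  let ?\<Phi> = "\<lambda>(z, u). ennreal (changed z u t)"
  have \<Phi>: "?\<Phi> \<in> borel_measurable (path_space \<Otimes>\<^sub>M path_space)"
    using measurable_changed[OF t] unfolding case_prod_beta by measurable
  have "(\<integral>\<^sup>+\<omega>. ennreal (proj e 1 \<omega>) \<partial>M) * (\<integral>\<^sup>+\<omega>. ennreal (U t \<omega> powr (1 / \<alpha>)) \<partial>M) =
      (\<integral>\<^sup>+\<omega>'. (\<integral>\<^sup>+\<omega>. ennreal (proj e 1 \<omega>) \<partial>M) * ennreal (U t \<omega>' powr (1 / \<alpha>)) \<partial>M)"
    by (rule nn_integral_cmult[symmetric]) measurable
  also have "\<dots> = (\<integral>\<^sup>+\<omega>'. (\<integral>\<^sup>+\<omega>. ?\<Phi> (sample_path (proj e) \<omega>, sample_path U \<omega>') \<partial>M) \<partial>M)"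
  proof (rule nn_integral_cong_AE)
    show "AE \<omega>' in M. (\<integral>\<^sup>+\<omega>. ennreal (proj e 1 \<omega>) \<partial>M) * ennreal (U t \<omega>' powr (1 / \<alpha>)) = (\<integral>\<^sup>+\<omega>. ?\<Phi> (sample_path (proj e) \<omega>, sample_path U \<omega>') \<partial>M)"
      using G(2)
    proof eventually_elim
      case (elim \<omega>')
      have "(\<integral>\<^sup>+\<omega>. ?\<Phi> (sample_path (proj e) \<omega>, sample_path U \<omega>') \<partial>M) = (\<integral>\<^sup>+\<omega>. ennreal (proj e (U t \<omega>') \<omega>) \<partial>M)"
        using G(2) by (intro nn_integral_cong_AE) (auto elim!: eventually_mono simp: changed_good[OF _ elim t])
      then show ?case using proj_scaling[OF e good_pathsD(4)[OF good[OF elim] t]] by (simp add: mult.commute)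
    qed
  qed
  also have "\<dots> = (\<integral>\<^sup>+\<omega>. ?\<Phi> (sample_path (proj e) \<omega>, sample_path U \<omega>) \<partial>M)" by (rule joint_nn_integral[OF \<Phi>, symmetric])
  also have "\<dots> \<le> (\<integral>\<^sup>+\<omega>. ennreal (max_proj e t \<omega>) \<partial>M)"
    using G(2) t by (intro nn_integral_mono_AE) (auto elim!: eventually_mono simp: changed_good intro!: ennreal_leI max_proj_upper)
  finally show ?thesis .
qed

text \<open>A continuous clock passes through every time below \<open>U t\<close>, so the maximum of
  \<open>X\<close> reaches the supremum of \<open>Y\<close> over the half-open interval. The other
  inequality is \<open>max_proj_moment\<close> in the limit of c decreasing to 1.\<close>

lemma max_proj_mean_continuous:
  assumes e: "norm e = 1" and t: "0 \<le> t" and cont: "AE \<omega> in M. continuous_on {0..} (\<lambda>t. U t \<omega>)"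
    and fin: "(\<integral>\<^sup>+\<omega>. ennreal (U t \<omega> powr (1 / \<alpha>)) \<partial>M) < \<infinity>"
  shows "(\<integral>\<^sup>+\<omega>. ennreal (max_proj e t \<omega>) \<partial>M) = sup_moment e 1 * (\<integral>\<^sup>+\<omega>. ennreal (U t \<omega> powr (1 / \<alpha>)) \<partial>M)"
proof (rule antisym)
  let ?u = "\<integral>\<^sup>+\<omega>. ennreal (U t \<omega> powr (1 / \<alpha>)) \<partial>M"
  have "AE \<omega> in M. run_sup 1 (sample_path (proj e) \<omega>) (1 * U t \<omega>) \<le> ennreal (max_proj e t \<omega>)"
    using G(2) cont
  proof eventually_elim
    case (elim \<omega>)
    note g = good_pathsD[OF good[OF elim(1)]]
    have "pos_powr 1 (proj e u \<omega>) \<le> ennreal (max_proj e t \<omega>)" if "u \<in> {0..<U t \<omega>}" for u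
    proof -
      have "\<exists>s\<ge>0. s \<le> t \<and> U s \<omega> = u"
        using IVT'[of "\<lambda>t. U t \<omega>" 0 u t] that t g(3) continuous_on_subset[OF elim(2), of "{0..t}"] by auto
      then obtain s where "0 \<le> s" "s \<le> t" "U s \<omega> = u" by blast
      then show ?thesis using max_proj_upper[OF elim(1), of s t e] by (simp add: pos_powr_one ennreal_leI)
    qed
    then have "(SUP u\<in>{0..<U t \<omega>}. pos_powr 1 (proj e u \<omega>)) \<le> ennreal (max_proj e t \<omega>)" by (rule SUP_least)
    then show ?case by (simp add: run_sup_sample_path run_sup_eq[OF good_proj(1)[OF elim(1)]])
  qed
  then have "(\<integral>\<^sup>+\<omega>. run_sup 1 (sample_path (proj e) \<omega>) (1 * U t \<omega>) \<partial>M) \<le> (\<integral>\<^sup>+\<omega>. ennreal (max_proj e t \<omega>) \<partial>M)"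
    by (rule nn_integral_mono_AE)
  then show "sup_moment e 1 * ?u \<le> (\<integral>\<^sup>+\<omega>. ennreal (max_proj e t \<omega>) \<partial>M)"
    using run_sup_subordinator[OF e _ t, of 1 1] by simp
  have up: "(\<integral>\<^sup>+\<omega>. ennreal (max_proj e t \<omega>) \<partial>M) \<le> ennreal (c powr (1 / \<alpha>)) * (sup_moment e 1 * ?u)" if "1 < c" for c
    using max_proj_moment[OF e _ t that, of 1] max_proj_nonneg by (simp add: mult.assoc)
  have "sup_moment e 1 * ?u < \<infinity>" using sup_moment_finite[OF e, of 1] \<alpha> fin by (simp add: ennreal_mult_less_top)
  then obtain k where k: "0 \<le> k" "sup_moment e 1 * ?u = ennreal k" by (cases "sup_moment e 1 * ?u") auto
  have "((\<lambda>c. ennreal (c powr (1 / \<alpha>) * k)) \<longlongrightarrow> ennreal (1 powr (1 / \<alpha>) * k)) (at_right 1)"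
    by (intro tendsto_intros) auto
  then have "(\<integral>\<^sup>+\<omega>. ennreal (max_proj e t \<omega>) \<partial>M) \<le> ennreal (1 powr (1 / \<alpha>) * k)"
    by (rule tendsto_lowerbound)
       (use up k in \<open>auto simp: eventually_at_filter ennreal_mult\<close>)
  then show "(\<integral>\<^sup>+\<omega>. ennreal (max_proj e t \<omega>) \<partial>M) \<le> sup_moment e 1 * ?u" using k by simp
qed

end

section \<open>Exit times of cadlag paths\<close>

definition jumps :: "(real \<Rightarrow> 'b::euclidean_space) \<Rightarrow> real set" where
  "jumps f = {s. 0 < s \<and> Lim (at_left s) f \<noteq> f s}"

lemma cadlag_Lim_left: "cadlag f \<Longrightarrow> 0 < s \<Longrightarrow> (f \<longlongrightarrow> Lim (at_left s) f) (at_left s)" for f :: "real \<Rightarrow> 'b::euclidean_space"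
  using cadlag_left_lim[of f s] tendsto_Lim[of "at_left s" f] by auto

lemma cadlag_right_near:
  fixes f :: "real \<Rightarrow> 'b::euclidean_space"
  assumes "cadlag f" "0 \<le> s" "0 < e"
  obtains d where "0 < d" "\<And>a. s \<le> a \<Longrightarrow> a < s + d \<Longrightarrow> norm (f a - f s) < e"
proof -
  have "\<forall>\<^sub>F x in at_right s. dist (f x) (f s) < e" using cadlag_right_cont[OF assms(1,2)] assms(3) by (rule tendstoD)
  then obtain b where b: "b > s" "\<And>x. s < x \<Longrightarrow> x < b \<Longrightarrow> dist (f x) (f s) < e"
    unfolding eventually_at_right_field by auto
  have "norm (f a - f s) < e" if "s \<le> a" "a < s + (b - s)" for a
    using b(2)[of a] that assms(3) by (cases "a = s") (auto simp: dist_norm)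
  then show thesis using that[of "b - s"] b by auto
qed

lemma cadlag_left_near:
  fixes f :: "real \<Rightarrow> 'b::euclidean_space"
  assumes "cadlag f" "0 < s" "0 < e"
  obtains d where "0 < d" "\<And>a. s - d < a \<Longrightarrow> a < s \<Longrightarrow> norm (f a - Lim (at_left s) f) < e"
proof -
  have "\<forall>\<^sub>F x in at_left s. dist (f x) (Lim (at_left s) f) < e" using cadlag_Lim_left[OF assms(1,2)] assms(3) by (rule tendstoD)
  then obtain b where b: "b < s" "\<And>x. b < x \<Longrightarrow> x < s \<Longrightarrow> dist (f x) (Lim (at_left s) f) < e"
    unfolding eventually_at_left_field by auto
  then show thesis using that[of "s - b"] by (auto simp: dist_norm)
qed

text \<open>Jumps of size at least e cannot accumulate: next to any time the path and its left
  limits stay within e / 3 of a one-sided limit. So there are finitely many on each compact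
  interval, and the jump sizes are exhausted by e = 1 / (n + 1).\<close>

lemma countable_jumps:
  fixes f :: "real \<Rightarrow> 'b::euclidean_space"
  assumes f: "cadlag f"
  shows "countable (jumps f)"
proof -
  define L where "L s = Lim (at_left s) f" for s
  define J where "J e = {s. 0 < s \<and> e \<le> norm (f s - L s)}" for e :: real
  have near: "norm (L a - z) \<le> e" if "0 < a" "c < a" "\<And>x. c < x \<Longrightarrow> x < a \<Longrightarrow> norm (f x - z) \<le> e" for a c z e
  proof -
    have "(f \<longlongrightarrow> L a) (at_left a)" unfolding L_def using f that(1) by (rule cadlag_Lim_left)
    then have "((\<lambda>x. norm (f x - z)) \<longlongrightarrow> norm (L a - z)) (at_left a)" by (intro tendsto_intros)
    then show ?thesis
      by (rule tendsto_upperbound) (use that in \<open>auto simp: eventually_at_left_field intro!: exI[of _ c]\<close>)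
  qed
  have isol: "\<exists>d>0. J e \<inter> ball s d \<subseteq> {s}" if e: "0 < e" and s: "0 \<le> s" for e s
  proof -
    obtain d1 where d1: "0 < d1" "\<And>a. s \<le> a \<Longrightarrow> a < s + d1 \<Longrightarrow> norm (f a - f s) < e / 3"
      using cadlag_right_near[OF f s, of "e / 3"] e by auto
    have r: "a \<notin> J e" if "s < a" "a < s + d1" for a
    proof
      assume "a \<in> J e"
      have "norm (L a - f s) \<le> e / 3" using that s by (intro near[of a s] less_imp_le[OF d1(2)]) auto
      moreover have "norm (f a - f s) < e / 3" using d1(2) that by simp
      moreover have "norm (f a - L a) \<le> norm (f a - f s) + norm (L a - f s)"
        using norm_triangle_ineq4[of "f a - f s" "L a - f s"] by simp
      ultimately show False using \<open>a \<in> J e\<close> e by (auto simp: J_def)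
    qed
    have "\<exists>d2>0. \<forall>a. s - d2 < a \<longrightarrow> a < s \<longrightarrow> a \<notin> J e"
    proof (cases "s = 0")
      case True then show ?thesis by (intro exI[of _ 1]) (auto simp: J_def)
    next
      case False
      then have s0: "0 < s" using s by simp
      obtain d2 where d2: "0 < d2" "\<And>a. s - d2 < a \<Longrightarrow> a < s \<Longrightarrow> norm (f a - L s) < e / 3"
        using cadlag_left_near[OF f s0, of "e / 3"] e unfolding L_def by auto
      have "a \<notin> J e" if "s - d2 < a" "a < s" for a
      proof
        assume a: "a \<in> J e"
        then have "0 < a" by (simp add: J_def)
        then have "norm (L a - L s) \<le> e / 3" using that by (intro near[of a "s - d2"] less_imp_le[OF d2(2)]) auto
        moreover have "norm (f a - L s) < e / 3" using d2(2) that by simp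
        moreover have "norm (f a - L a) \<le> norm (f a - L s) + norm (L a - L s)"
          using norm_triangle_ineq4[of "f a - L s" "L a - L s"] by simp
        ultimately show False using a e by (auto simp: J_def)
      qed
      then show ?thesis using d2(1) by blast
    qed
    then obtain d2 where d2: "0 < d2" "\<And>a. s - d2 < a \<Longrightarrow> a < s \<Longrightarrow> a \<notin> J e" by blast
    have "J e \<inter> ball s (min d1 d2) \<subseteq> {s}"
    proof
      fix a assume a: "a \<in> J e \<inter> ball s (min d1 d2)"
      then have "\<bar>s - a\<bar> < d1" "\<bar>s - a\<bar> < d2" by (auto simp: dist_real_def)
      then show "a \<in> {s}" using r[of a] d2(2)[of a] a by (cases a s rule: linorder_cases) auto
    qed
    then show ?thesis using d1(1) d2(1) by (intro exI[of _ "min d1 d2"]) auto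
  qed
  have fin: "finite (J e \<inter> {0..T})" if e: "0 < e" for e T
  proof -
    obtain d where d: "\<And>s. 0 \<le> s \<Longrightarrow> 0 < d s" "\<And>s. 0 \<le> s \<Longrightarrow> J e \<inter> ball s (d s) \<subseteq> {s}" using isol[OF e] by metis
    have "compact {0..T}" by simp
    then obtain C where C: "C \<subseteq> {0..T}" "finite C" "{0..T} \<subseteq> (\<Union>s\<in>C. ball s (d s))"
      by (rule compactE_image[of _ "{0..T}" "\<lambda>s. ball s (d s)"]) (use d in auto)
    have "J e \<inter> {0..T} \<subseteq> C"
    proof
      fix a assume a: "a \<in> J e \<inter> {0..T}"
      then obtain s where s: "s \<in> C" "a \<in> ball s (d s)" using C(3) by blast
      have "0 \<le> s" using s C(1) by auto
      from d(2)[OF this] have "a \<in> {s}" using s a by blast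
      then show "a \<in> C" using s by simp
    qed
    then show ?thesis using C(2) finite_subset by blast
  qed
  have "jumps f \<subseteq> (\<Union>n. \<Union>N. J (1 / real (Suc n)) \<inter> {0..real N})"
  proof
    fix s assume s: "s \<in> jumps f"
    then have p: "0 < norm (f s - L s)" by (auto simp: jumps_def L_def)
    obtain n where n: "1 / real (Suc n) < norm (f s - L s)" using nat_approx_posE[OF p] by auto
    obtain N where N: "s \<le> real N" using real_arch_simple by blast
    have "s \<in> J (1 / real (Suc n)) \<inter> {0..real N}" using n N s by (auto simp: J_def jumps_def)
    then show "s \<in> (\<Union>n. \<Union>N. J (1 / real (Suc n)) \<inter> {0..real N})" by blast
  qed
  moreover have "countable (\<Union>n. \<Union>N. J (1 / real (Suc n)) \<inter> {0..real N})"
  proof -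
    have "finite (J (1 / real (Suc n)) \<inter> {0..real N})" for n N by (rule fin) simp
    then show ?thesis by (intro countable_UN) (auto intro: countable_finite)
  qed
  ultimately show ?thesis by (rule countable_subset)
qed

text \<open>The infimum exceeds t strictly, because a right-continuous path that is in an open set
  at time t remains there for a while.\<close>

lemma exit_time_gt_iff:
  fixes f :: "real \<Rightarrow> 'b::euclidean_space"
  assumes f: "cadlag f" and \<Omega>: "open \<Omega>" and t: "0 \<le> t"
  shows "ereal t < exit_time \<Omega> (\<lambda>s. x + f s) \<longleftrightarrow> (\<forall>s\<in>{0..t}. x + f s \<in> \<Omega>)"
proof
  assume gt: "ereal t < exit_time \<Omega> (\<lambda>s. x + f s)"
  show "\<forall>s\<in>{0..t}. x + f s \<in> \<Omega>"
  proof (rule ccontr)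
    assume "\<not> ?thesis"
    then obtain s where s: "0 \<le> s" "s \<le> t" "x + f s \<notin> \<Omega>" by auto
    then have "exit_time \<Omega> (\<lambda>s. x + f s) \<le> ereal s" unfolding exit_time_def by (intro Inf_lower) auto
    then show False using gt s(2) by (metis ereal_less_eq(3) leD order_trans)
  qed
next
  assume in\<Omega>: "\<forall>s\<in>{0..t}. x + f s \<in> \<Omega>"
  then have "x + f t \<in> \<Omega>" using t by simp
  then obtain e where e: "0 < e" "ball (x + f t) e \<subseteq> \<Omega>" using \<Omega> openE by blast
  obtain d where d: "0 < d" "\<And>a. t \<le> a \<Longrightarrow> a < t + d \<Longrightarrow> norm (f a - f t) < e" using cadlag_right_near[OF f t e(1)] by blast
  have "ereal (t + d) \<le> exit_time \<Omega> (\<lambda>s. x + f s)"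
    unfolding exit_time_def
  proof (rule Inf_greatest)
    fix b assume "b \<in> ereal ` {s. 0 \<le> s \<and> x + f s \<notin> \<Omega>}"
    then obtain s where s: "b = ereal s" "0 \<le> s" "x + f s \<notin> \<Omega>" by blast
    have "\<not> s \<le> t" using in\<Omega> s by auto
    moreover have "x + f s \<in> ball (x + f t) e" if "t \<le> s" "s < t + d"
      using d(2)[OF that] by (simp add: dist_norm norm_minus_commute)
    ultimately have "t + d \<le> s" using e(2) s(3) by (meson linorder_not_le subsetD less_imp_le)
    then show "ereal (t + d) \<le> b" using s(1) by simp
  qed
  moreover have "ereal t < ereal (t + d)" using d(1) by simp
  ultimately show "ereal t < exit_time \<Omega> (\<lambda>s. x + f s)" by (rule less_le_trans[rotated])
qed

text \<open>The path oscillates at arbitrarily small scales while its translate is close to the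
  frontier: a measurable way of saying that a jump starts from the frontier.\<close>

definition frontier_jump :: "'b::euclidean_space set \<Rightarrow> real set \<Rightarrow> 'b \<Rightarrow> (real \<Rightarrow> 'b) \<Rightarrow> bool" where
  "frontier_jump \<Omega> T x f \<longleftrightarrow> (\<exists>n::nat. \<forall>m::nat. \<exists>r\<in>T. \<exists>r'\<in>T. r < r' \<and> r' - r < 1 / real (Suc m) \<and>
     1 / real (Suc n) \<le> norm (f r - f r') \<and> infdist (x + f r) (frontier \<Omega>) < 1 / real (Suc m))"

text \<open>Along a subsequence both times converge to the same s. They cannot lie on the same side
  of s, since the path has one-sided limits but the oscillation stays bounded below; hence the
  earlier time sees the left limit and the later one the value at s.\<close>

lemma frontier_jump_imp:
  fixes f :: "real \<Rightarrow> 'b::euclidean_space"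
  assumes f: "cadlag f" and ne: "frontier \<Omega> \<noteq> {}" and T: "T \<subseteq> {0..t}" and j: "frontier_jump \<Omega> T x f"
  shows "\<exists>s\<in>jumps f. x + Lim (at_left s) f \<in> frontier \<Omega>"
proof -
  obtain n where "\<forall>m. \<exists>r\<in>T. \<exists>r'\<in>T. r < r' \<and> r' - r < 1 / real (Suc m) \<and>
     1 / real (Suc n) \<le> norm (f r - f r') \<and> infdist (x + f r) (frontier \<Omega>) < 1 / real (Suc m)"
    using j unfolding frontier_jump_def by blast
  then obtain r r' where r: "\<And>m. r m \<in> T" "\<And>m. r' m \<in> T" "\<And>m. r m < r' m" "\<And>m. r' m - r m < 1 / real (Suc m)"
    "\<And>m. 1 / real (Suc n) \<le> norm (f (r m) - f (r' m))" "\<And>m. infdist (x + f (r m)) (frontier \<Omega>) < 1 / real (Suc m)"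
    by metis
  define e where "e = 1 / real (Suc n)"
  have e: "0 < e" by (simp add: e_def)
  have "\<forall>m. r m \<in> {0..t}" using r(1) T by blast
  then obtain s \<phi> where s: "s \<in> {0..t}" "strict_mono \<phi>" "(r \<circ> \<phi>) \<longlonglongrightarrow> s"
    using compact_Icc[of 0 t] unfolding compact_def by metis
  have s0: "0 \<le> s" using s by simp
  have inv: "(\<lambda>m. 1 / real (Suc (\<phi> m))) \<longlonglongrightarrow> 0"
    using LIMSEQ_subseq_LIMSEQ[OF LIMSEQ_inverse_real_of_nat s(2)] by (simp add: o_def inverse_eq_divide)
  have lr: "(\<lambda>m. r (\<phi> m)) \<longlonglongrightarrow> s" using s(3) by (simp add: o_def)
  have "(\<lambda>m. r' (\<phi> m) - r (\<phi> m)) \<longlonglongrightarrow> 0"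
    by (rule tendsto_sandwich[OF _ _ tendsto_const inv]) (use r(3,4) in \<open>auto intro!: always_eventually less_imp_le simp del: of_nat_Suc\<close>)
  from tendsto_add[OF this lr] have lr': "(\<lambda>m. r' (\<phi> m)) \<longlonglongrightarrow> s" by simp
  obtain d where d: "0 < d" "\<And>a. s \<le> a \<Longrightarrow> a < s + d \<Longrightarrow> norm (f a - f s) < e / 2"
    using cadlag_right_near[OF f s0, of "e / 2"] e by auto
  have ev1: "\<forall>\<^sub>F m in sequentially. r (\<phi> m) < s"
    using order_tendstoD(2)[OF lr less_add_same_cancel1[THEN iffD2, OF d(1)]]
      order_tendstoD(2)[OF lr' less_add_same_cancel1[THEN iffD2, OF d(1)]]
  proof eventually_elim
    case (elim m)
    show ?case
    proof (rule ccontr)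
      assume "\<not> r (\<phi> m) < s"
      then have "s \<le> r (\<phi> m)" "s \<le> r' (\<phi> m)" using r(3)[of "\<phi> m"] by auto
      then have "norm (f (r (\<phi> m)) - f s) < e / 2" "norm (f (r' (\<phi> m)) - f s) < e / 2" using d(2) elim by auto
      then have "norm (f (r (\<phi> m)) - f (r' (\<phi> m))) < e"
        using norm_triangle_ineq4[of "f (r (\<phi> m)) - f s" "f (r' (\<phi> m)) - f s"] by simp
      then show False using r(5)[of "\<phi> m"] by (simp add: e_def)
    qed
  qed
  then obtain m0 where "r (\<phi> m0) < s" unfolding eventually_sequentially by blast
  then have sp: "0 < s" using r(1)[of "\<phi> m0"] T by force
  define l where "l = Lim (at_left s) f"
  obtain d' where d': "0 < d'" "\<And>a. s - d' < a \<Longrightarrow> a < s \<Longrightarrow> norm (f a - l) < e / 2"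
    using cadlag_left_near[OF f sp, of "e / 2"] e unfolding l_def by auto
  have ev2: "\<forall>\<^sub>F m in sequentially. s \<le> r' (\<phi> m)"
    using order_tendstoD(1)[OF lr diff_less_eq[THEN iffD2, OF less_add_same_cancel1[THEN iffD2, OF d'(1)]]] ev1
  proof eventually_elim
    case (elim m)
    show ?case
    proof (rule ccontr)
      assume "\<not> s \<le> r' (\<phi> m)"
      then have "norm (f (r (\<phi> m)) - l) < e / 2" "norm (f (r' (\<phi> m)) - l) < e / 2"
        using d'(2) elim r(3)[of "\<phi> m"] by auto
      then have "norm (f (r (\<phi> m)) - f (r' (\<phi> m))) < e"
        using norm_triangle_ineq4[of "f (r (\<phi> m)) - l" "f (r' (\<phi> m)) - l"] by simp
      then show False using r(5)[of "\<phi> m"] by (simp add: e_def)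
    qed
  qed
  have "filterlim (\<lambda>m. r (\<phi> m)) (at_left s) sequentially"
    unfolding filterlim_at using lr ev1 by (auto elim!: eventually_mono)
  from filterlim_compose[OF cadlag_Lim_left[OF f sp] this] have fl: "(\<lambda>m. f (r (\<phi> m))) \<longlonglongrightarrow> l" by (simp add: l_def)
  have fr: "(\<lambda>m. f (r' (\<phi> m))) \<longlonglongrightarrow> f s"
  proof (rule tendstoI)
    fix k :: real assume k: "0 < k"
    obtain b where b: "0 < b" "\<And>a. s \<le> a \<Longrightarrow> a < s + b \<Longrightarrow> norm (f a - f s) < k" using cadlag_right_near[OF f s0 k] by blast
    show "\<forall>\<^sub>F m in sequentially. dist (f (r' (\<phi> m))) (f s) < k"
      using ev2 order_tendstoD(2)[OF lr' less_add_same_cancel1[THEN iffD2, OF b(1)]]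
      by eventually_elim (auto simp: dist_norm b(2))
  qed
  have "(\<lambda>m. norm (f (r (\<phi> m)) - f (r' (\<phi> m)))) \<longlonglongrightarrow> norm (l - f s)" by (intro tendsto_intros fl fr)
  then have "e \<le> norm (l - f s)" by (rule LIMSEQ_le_const) (use r(5) in \<open>auto simp: e_def\<close>)
  then have "s \<in> jumps f" using e sp by (auto simp: jumps_def l_def)
  moreover have "x + l \<in> frontier \<Omega>"
  proof -
    have "(\<lambda>m. infdist (x + f (r (\<phi> m))) (frontier \<Omega>)) \<longlonglongrightarrow> infdist (x + l) (frontier \<Omega>)" by (intro tendsto_intros fl)
    moreover have "(\<lambda>m. infdist (x + f (r (\<phi> m))) (frontier \<Omega>)) \<longlonglongrightarrow> 0"
      by (rule tendsto_sandwich[OF _ _ tendsto_const inv])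
         (use r(6) in \<open>auto intro!: always_eventually less_imp_le infdist_nonneg simp del: of_nat_Suc\<close>)
    ultimately have "infdist (x + l) (frontier \<Omega>) = 0" by (rule LIMSEQ_unique)
    then show ?thesis using in_closed_iff_infdist_zero[OF frontier_closed ne] by simp
  qed
  ultimately show ?thesis unfolding l_def by blast
qed

text \<open>Times at which the distance to the complement tends to 0 accumulate at some s. They do
  so from the left, since right-continuity keeps the path away from the complement from s on. The
  left limit is then on the frontier while the value at s is inside, so s is a jump.\<close>

lemma stays_inside_cases:
  fixes f :: "real \<Rightarrow> 'b::euclidean_space"
  assumes f: "cadlag f" and \<Omega>: "open \<Omega>" "bounded \<Omega>" and t: "0 \<le> t"
    and T: "T = insert t (\<rat> \<inter> {0..<t})"
    and inside: "\<forall>s\<in>{0..t}. x + f s \<in> \<Omega>"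
    and close: "\<And>n. \<exists>s\<in>T. infdist (x + f s) (- \<Omega>) < 1 / real (Suc n)"
  shows "frontier_jump \<Omega> T x f"
proof -
  have T': "T \<subseteq> {0..t}" using t T by auto
  have cl: "closed (- \<Omega>)" "- \<Omega> \<noteq> {}" using \<Omega> bounded_compl_nonempty[OF \<Omega>(2)] by (auto simp: closed_Compl)
  obtain r where r: "\<And>n. r n \<in> T" "\<And>n. infdist (x + f (r n)) (- \<Omega>) < 1 / real (Suc n)" using close by metis
  have "\<forall>m. r m \<in> {0..t}" using r(1) T' by blast
  then obtain s \<phi> where s: "s \<in> {0..t}" "strict_mono \<phi>" "(r \<circ> \<phi>) \<longlonglongrightarrow> s"
    using compact_Icc[of 0 t] unfolding compact_def by metis
  have s0: "0 \<le> s" using s by simp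
  have inv: "(\<lambda>m. 1 / real (Suc (\<phi> m))) \<longlonglongrightarrow> 0"
    using LIMSEQ_subseq_LIMSEQ[OF LIMSEQ_inverse_real_of_nat s(2)] by (simp add: o_def inverse_eq_divide)
  have lr: "(\<lambda>m. r (\<phi> m)) \<longlonglongrightarrow> s" using s(3) by (simp add: o_def)
  define e where "e = infdist (x + f s) (- \<Omega>) / 2"
  have "x + f s \<notin> - \<Omega>" using inside s by simp
  then have "infdist (x + f s) (- \<Omega>) \<noteq> 0" using in_closed_iff_infdist_zero[OF cl] by blast
  then have e: "0 < e" using infdist_nonneg[of "x + f s" "-\<Omega>"] by (simp add: e_def)
  obtain d where d: "0 < d" "\<And>a. s \<le> a \<Longrightarrow> a < s + d \<Longrightarrow> norm (f a - f s) < e" using cadlag_right_near[OF f s0 e] by blast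
  have far: "e < infdist (x + f a) (- \<Omega>)" if "s \<le> a" "a < s + d" for a
  proof -
    have "\<bar>infdist (x + f a) (- \<Omega>) - infdist (x + f s) (- \<Omega>)\<bar> \<le> norm (f a - f s)"
      using infdist_triangle_abs[of "x + f a" "-\<Omega>" "x + f s"] by (simp add: dist_norm)
    then show ?thesis using d(2)[OF that] unfolding e_def by linarith
  qed
  have ev1: "\<forall>\<^sub>F m in sequentially. r (\<phi> m) < s"
    using order_tendstoD(2)[OF lr less_add_same_cancel1[THEN iffD2, OF d(1)]] order_tendstoD(2)[OF inv e]
  proof eventually_elim
    case (elim m)
    then show ?case using far[of "r (\<phi> m)"] r(2)[of "\<phi> m"] by force
  qed
  then obtain m0 where "r (\<phi> m0) < s" unfolding eventually_sequentially by blast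
  then have sp: "0 < s" using r(1)[of "\<phi> m0"] T' by force
  define l where "l = Lim (at_left s) f"
  have "filterlim (\<lambda>m. r (\<phi> m)) (at_left s) sequentially"
    unfolding filterlim_at using lr ev1 by (auto elim!: eventually_mono)
  from filterlim_compose[OF cadlag_Lim_left[OF f sp] this] have fl: "(\<lambda>m. f (r (\<phi> m))) \<longlonglongrightarrow> l" by (simp add: l_def)
  have "(\<lambda>m. infdist (x + f (r (\<phi> m))) (- \<Omega>)) \<longlonglongrightarrow> infdist (x + l) (- \<Omega>)" by (intro tendsto_intros fl)
  moreover have "(\<lambda>m. infdist (x + f (r (\<phi> m))) (- \<Omega>)) \<longlonglongrightarrow> 0"
    by (rule tendsto_sandwich[OF _ _ tendsto_const inv])
       (use r(2) in \<open>auto intro!: always_eventually less_imp_le infdist_nonneg simp del: of_nat_Suc\<close>)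
  ultimately have "infdist (x + l) (- \<Omega>) = 0" by (rule LIMSEQ_unique)
  then have xl: "x + l \<notin> \<Omega>" using in_closed_iff_infdist_zero[OF cl] by simp
  have "x + l \<in> closure \<Omega>"
    unfolding closure_sequential
    using inside r(1) T' by (intro exI[of _ "\<lambda>m. x + f (r (\<phi> m))"]) (auto intro!: tendsto_intros fl)
  then have xf: "x + l \<in> frontier \<Omega>" using xl \<Omega> by (simp add: frontier_def interior_open)
  \<comment> \<open>The size of the jump. Being within k / 4 of the left limit and of the value at s
    leaves an oscillation above k / 2.\<close>
  define k where "k = norm (f s - l)"
  have "f s \<noteq> l" using xl inside s by auto
  then have k: "0 < k" by (simp add: k_def)
  obtain n where n: "1 / real (Suc n) < k / 2" using nat_approx_posE[of "k / 2"] k by auto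
  have "\<exists>a\<in>T. \<exists>b\<in>T. a < b \<and> b - a < 1 / real (Suc m) \<and> 1 / real (Suc n) \<le> norm (f a - f b) \<and>
      infdist (x + f a) (frontier \<Omega>) < 1 / real (Suc m)" for m
  proof -
    define w where "w = 1 / real (Suc m)"
    have w: "0 < w" by (simp add: w_def)
    have "\<forall>\<^sub>F j in sequentially. dist (f (r (\<phi> j))) l < min w (k / 4)" using fl w k by (intro tendstoD) auto
    moreover have "\<forall>\<^sub>F j in sequentially. s - w / 2 < r (\<phi> j)" using order_tendstoD(1)[OF lr, of "s - w / 2"] w by simp
    ultimately have "\<forall>\<^sub>F j in sequentially. r (\<phi> j) < s \<and> s - w / 2 < r (\<phi> j) \<and> dist (f (r (\<phi> j))) l < min w (k / 4)"
      using ev1 by eventually_elim auto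
    then obtain j where j: "r (\<phi> j) < s" "s - w / 2 < r (\<phi> j)" "dist (f (r (\<phi> j))) l < min w (k / 4)"
      unfolding eventually_sequentially by blast
    obtain d' where d': "0 < d'" "\<And>a. s \<le> a \<Longrightarrow> a < s + d' \<Longrightarrow> norm (f a - f s) < k / 4" using cadlag_right_near[OF f s0, of "k / 4"] k by auto
    \<comment> \<open>A dense time at or just after s; if s = t, only t itself is available.\<close>
    obtain b where b: "b \<in> T" "s \<le> b" "b < s + d'" "b < s + w / 2"
    proof (cases "s = t")
      case True then show ?thesis using that[of t] T d' w by auto
    next
      case False
      then have "s < min t (min (s + d') (s + w / 2))" using s d' w by auto
      then obtain b where "b \<in> \<rat>" "s < b" "b < min t (min (s + d') (s + w / 2))" using Rats_dense_in_real by blast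
      then show ?thesis using that[of b] T s0 by auto
    qed
    have "k \<le> norm (f (r (\<phi> j)) - f b) + norm (f (r (\<phi> j)) - l) + norm (f b - f s)"
    proof -
      have "norm (f s - l) = norm ((f (r (\<phi> j)) - l) - (f (r (\<phi> j)) - f b) - (f b - f s))" by simp
      then show ?thesis unfolding k_def
        using norm_triangle_ineq4[of "(f (r (\<phi> j)) - l) - (f (r (\<phi> j)) - f b)" "f b - f s"]
          norm_triangle_ineq4[of "f (r (\<phi> j)) - l" "f (r (\<phi> j)) - f b"] by linarith
    qed
    then have "1 / real (Suc n) \<le> norm (f (r (\<phi> j)) - f b)"
      using j(3) d'(2)[OF b(2,3)] n by (simp add: dist_norm)
    moreover have "infdist (x + f (r (\<phi> j))) (frontier \<Omega>) < 1 / real (Suc m)"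
      using infdist_le2[OF xf, of "x + f (r (\<phi> j))" "dist (f (r (\<phi> j))) l"] j(3) by (simp add: dist_norm w_def)
    moreover have "r (\<phi> j) < b" "b - r (\<phi> j) < 1 / real (Suc m)" using b j(1,2) unfolding w_def[symmetric] by linarith+
    ultimately show ?thesis using r(1) b(1) by blast
  qed
  then show ?thesis unfolding frontier_jump_def by blast
qed

text \<open>For a fixed path the exceptional start points lie in one translate of the frontier per
  jump, hence in a countable union of null sets.\<close>

lemma frontier_jump_null:
  fixes f :: "real \<Rightarrow> 'b::euclidean_space"
  assumes f: "cadlag f" and null: "negligible (frontier \<Omega>)" and ne: "frontier \<Omega> \<noteq> {}" and T: "T \<subseteq> {0..t}"
  shows "negligible {x. frontier_jump \<Omega> T x f}"
proof -
  have "{x. frontier_jump \<Omega> T x f} \<subseteq> (\<Union>s\<in>jumps f. (+) (- Lim (at_left s) f) ` frontier \<Omega>)"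
  proof
    fix x assume "x \<in> {x. frontier_jump \<Omega> T x f}"
    then obtain s where "s \<in> jumps f" "x + Lim (at_left s) f \<in> frontier \<Omega>" using frontier_jump_imp[OF f ne T] by blast
    then show "x \<in> (\<Union>s\<in>jumps f. (+) (- Lim (at_left s) f) ` frontier \<Omega>)"
      by (intro UN_I[of s] image_eqI[of _ _ "x + Lim (at_left s) f"]) auto
  qed
  moreover have "negligible (\<Union>s\<in>jumps f. (+) (- Lim (at_left s) f) ` frontier \<Omega>)"
  proof (intro negligible_countable_Union countable_image countable_jumps[OF f])
    fix S assume "S \<in> (\<lambda>s. (+) (- Lim (at_left s) f) ` frontier \<Omega>) ` jumps f"
    then obtain s where "S = (+) (- Lim (at_left s) f) ` frontier \<Omega>" by blast
    then show "negligible S" by (simp only: negligible_translation[OF null])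
  qed
  ultimately show ?thesis using negligible_subset by blast
qed

lemma sets_Collect_Bex:
  assumes "countable T" "\<And>s. s \<in> T \<Longrightarrow> {p \<in> space N. Q s p} \<in> sets N"
  shows "{p \<in> space N. \<exists>s\<in>T. Q s p} \<in> sets N"
proof -
  have "{p \<in> space N. \<exists>s\<in>T. Q s p} = (\<Union>s\<in>T. {p \<in> space N. Q s p})" by auto
  then show ?thesis using assms by (auto intro: sets.countable_UN'')
qed

lemma sets_Collect_Ball:
  assumes "countable T" "\<And>s. s \<in> T \<Longrightarrow> {p \<in> space N. Q s p} \<in> sets N"
  shows "{p \<in> space N. \<forall>s\<in>T. Q s p} \<in> sets N"
proof -
  have "{p \<in> space N. \<forall>s\<in>T. Q s p} = space N - {p \<in> space N. \<exists>s\<in>T. \<not> Q s p}" by auto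
  also have "\<dots> \<in> sets N" using assms by (intro sets.Diff sets_Collect_Bex sets.sets_Collect_neg) auto
  finally show ?thesis .
qed

lemma stays_inside_if_far:
  fixes f :: "real \<Rightarrow> 'b::euclidean_space"
  assumes f: "cadlag f" and c: "0 < c" and far: "\<And>s. s \<in> insert t (\<rat> \<inter> {0..<t}) \<Longrightarrow> c \<le> infdist (x + f s) (- \<Omega>)"
    and s: "0 \<le> s" "s \<le> t"
  shows "x + f s \<in> \<Omega>"
proof (rule ccontr)
  assume n: "x + f s \<notin> \<Omega>"
  show False
  proof (cases "s = t")
    case True then show ?thesis using far[of t] n c by simp
  next
    case False
    then have st: "s < t" using s by simp
    obtain d where d: "0 < d" "\<And>a. s \<le> a \<Longrightarrow> a < s + d \<Longrightarrow> norm (f a - f s) < c" using cadlag_right_near[OF f s(1) c] by blast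
    have "s < min t (s + d)" using st d by simp
    then obtain r where r: "r \<in> \<rat>" "s < r" "r < min t (s + d)" using Rats_dense_in_real by blast
    have "infdist (x + f r) (- \<Omega>) \<le> dist (x + f r) (x + f s)" using n by (intro infdist_le) simp
    also have "\<dots> < c" using d(2)[of r] r by (simp add: dist_norm)
    finally show False using far[of r] r s by simp
  qed
qed

section \<open>The exit event up to null sets\<close>

context subordinated_stable
begin

text \<open>Off \<open>G\<close> the process is replaced by 0, which makes it measurable and every
  path cadlag.\<close>

definition "Xm s \<omega> = (if \<omega> \<in> G then X s \<omega> else 0)"

lemma measurable_Xm [measurable]:
  assumes s: "0 \<le> s" shows "Xm s \<in> borel_measurable M"
proof (rule borel_measurable_LIMSEQ_metric)
  have [measurable]: "U s \<in> borel_measurable M" "G \<in> sets M" using mU[OF s] G by auto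
  show "(\<lambda>\<omega>. if \<omega> \<in> G then Y (grid_above n (U s \<omega>)) \<omega> else 0) \<in> borel_measurable M" for n
  proof -
    have "(\<lambda>\<omega>. Y (grid_above n (U s \<omega>)) \<omega>) \<in> borel_measurable M"
      unfolding grid_above_def
    proof (rule measurable_compose_countable[where f = "\<lambda>i. Y ((real i + 1) / 2 ^ n)" and g = "\<lambda>\<omega>. nat \<lfloor>2 ^ n * U s \<omega>\<rfloor>"])
      show "(\<lambda>\<omega>. nat \<lfloor>2 ^ n * U s \<omega>\<rfloor>) \<in> M \<rightarrow>\<^sub>M count_space UNIV" by measurable
      show "Y ((real i + 1) / 2 ^ n) \<in> borel_measurable M" for i by (rule mY) simp
    qed
    then show ?thesis by measurable
  qed
  fix \<omega> assume "\<omega> \<in> space M"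
  show "(\<lambda>n. if \<omega> \<in> G then Y (grid_above n (U s \<omega>)) \<omega> else 0) \<longlonglongrightarrow> Xm s \<omega>"
    using cadlag_grid_lim[OF good_pathsD(1)[OF good] good_pathsD(4)[OF good s]] by (auto simp: Xm_def)
qed

lemma Xm_cadlag: "cadlag (\<lambda>s. Xm s \<omega>)"
  using X_cadlag[of \<omega>] by (cases "\<omega> \<in> G") (auto simp: Xm_def cadlag_def)

definition "stays \<Omega> t x = {\<omega> \<in> space M. ereal t < exit_time \<Omega> (\<lambda>s. x + X s \<omega>)}"

text \<open>\<open>far\<close> asks for a positive lower bound on the distance to the complement
  along countably many times, a jointly measurable condition. It implies staying inside, and the
  converse fails only where a jump starts from the frontier.\<close>

lemma stays_measurable:
  assumes \<Omega>: "open \<Omega>" "bounded \<Omega>" "negligible (frontier \<Omega>)" "frontier \<Omega> \<noteq> {}" and t: "0 \<le> t"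
  obtains g where "g \<in> borel_measurable borel"
    "AE x in lborel. stays \<Omega> t x \<in> sets (completion M) \<and> measure (completion M) (stays \<Omega> t x) = g x"
proof -
  interpret P: pair_sigma_finite lborel M by standard
  define T where "T = sup_times t"
  have T: "T = insert t (\<rat> \<inter> {0..<t})" "countable T" "\<And>s. s \<in> T \<Longrightarrow> 0 \<le> s" "T \<subseteq> {0..t}"
    using countable_sup_times sup_times_nonneg[OF t] t by (auto simp: T_def sup_times_def)
  let ?N = "lborel \<Otimes>\<^sub>M M :: ('b \<times> 'w) measure"
  define far where "far p \<longleftrightarrow> (\<exists>n::nat. \<forall>s\<in>T. 1 / real (Suc n) \<le> infdist (fst p + Xm s (snd p)) (- \<Omega>))" for p
  have mx: "(\<lambda>p. fst p + Xm s (snd p)) \<in> borel_measurable ?N" if "s \<in> T" for s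
    using measurable_Xm[OF T(3)[OF that]] by measurable
  have mi: "(\<lambda>p. infdist (fst p + Xm s (snd p)) A) \<in> borel_measurable ?N" if "s \<in> T" for s A
  proof -
    have "(\<lambda>x. infdist x A) \<in> borel_measurable borel" by (intro borel_measurable_continuous_onI continuous_intros)
    from measurable_compose[OF mx[OF that] this] show ?thesis .
  qed
  have mfar: "{p \<in> space ?N. far p} \<in> sets ?N"
    unfolding far_def using mi T(2)
    by (intro sets.sets_Collect_countable_Ex sets_Collect_Ball borel_measurable_le borel_measurable_const)
  have mjump: "{p \<in> space ?N. frontier_jump \<Omega> T (fst p) (\<lambda>s. Xm s (snd p))} \<in> sets ?N"
  proof -
    have mm: "(\<lambda>p. norm (Xm r (snd p) - Xm r' (snd p))) \<in> borel_measurable ?N" if "r \<in> T" "r' \<in> T" for r r'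
      using measurable_Xm[OF T(3)[OF that(1)]] measurable_Xm[OF T(3)[OF that(2)]] by measurable
    show ?thesis
      unfolding frontier_jump_def
      by (intro sets.sets_Collect_countable_Ex sets.sets_Collect_countable_All sets_Collect_Bex T(2)
          sets.sets_Collect_conj sets.sets_Collect_const borel_measurable_le borel_measurable_less borel_measurable_const mi mm)
  qed
  have mnj: "{p \<in> space ?N. \<not> frontier_jump \<Omega> T (fst p) (\<lambda>s. Xm s (snd p))} \<in> sets ?N"
    using mjump by (rule sets.sets_Collect_neg)
  have "AE x in lborel. \<not> frontier_jump \<Omega> T x (\<lambda>s. Xm s \<omega>)" for \<omega>
  proof -
    have "negligible {x. frontier_jump \<Omega> T x (\<lambda>s. Xm s \<omega>)}"
      by (rule frontier_jump_null[OF Xm_cadlag \<Omega>(3,4) T(4)])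
    then have "AE x in lebesgue. \<not> frontier_jump \<Omega> T x (\<lambda>s. Xm s \<omega>)"
      using AE_not_in[of "{x. frontier_jump \<Omega> T x (\<lambda>s. Xm s \<omega>)}" lebesgue] by (simp add: negligible_iff_null_sets)
    then show ?thesis by (simp add: AE_completion_iff)
  qed
  then have "AE \<omega> in M. AE x in lborel. \<not> frontier_jump \<Omega> T x (\<lambda>s. Xm s \<omega>)" by simp
  \<comment> \<open>Fubini exchanges the quantifiers: a null set of start points for each path
    becomes a null set of paths for almost every start point.\<close>
  then have nj: "AE x in lborel. AE \<omega> in M. \<not> frontier_jump \<Omega> T x (\<lambda>s. Xm s \<omega>)"
    using P.AE_commute[of "\<lambda>x \<omega>. \<not> frontier_jump \<Omega> T x (\<lambda>s. Xm s \<omega>)"] mnj by simp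
  define g where "g x = measure M (Pair x -` {p \<in> space ?N. far p})" for x
  have g: "g \<in> borel_measurable borel"
    using measurable_emeasure_Pair[OF mfar] unfolding g_def[abs_def] measure_def by measurable
  have "AE x in lborel. stays \<Omega> t x \<in> sets (completion M) \<and> measure (completion M) (stays \<Omega> t x) = g x"
    using nj
  proof eventually_elim
    case (elim x)
    let ?B = "Pair x -` {p \<in> space ?N. far p}"
    have B: "?B \<in> sets M" using sets_Pair1[OF mfar] .
    have ae: "AE \<omega> in M. (\<omega> \<in> ?B) = (\<omega> \<in> stays \<Omega> t x)"
      using elim G(2) AE_space
    proof eventually_elim
      case (elim \<omega>)
      have Xe: "Xm s \<omega> = X s \<omega>" for s using elim by (simp add: Xm_def)
      have "\<omega> \<in> stays \<Omega> t x \<longleftrightarrow> (\<forall>s\<in>{0..t}. x + X s \<omega> \<in> \<Omega>)"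
        using exit_time_gt_iff[OF X_cadlag \<Omega>(1) t] elim by (simp add: stays_def)
      also have "\<dots> \<longleftrightarrow> (\<exists>n::nat. \<forall>s\<in>T. 1 / real (Suc n) \<le> infdist (x + X s \<omega>) (- \<Omega>))"
      proof
        assume ins: "\<forall>s\<in>{0..t}. x + X s \<omega> \<in> \<Omega>"
        show "\<exists>n::nat. \<forall>s\<in>T. 1 / real (Suc n) \<le> infdist (x + X s \<omega>) (- \<Omega>)"
        proof (rule ccontr)
          assume "\<not> ?thesis"
          then have "\<exists>s\<in>T. infdist (x + X s \<omega>) (- \<Omega>) < 1 / real (Suc n)" for n by (auto simp: not_le)
          from stays_inside_cases[OF X_cadlag \<Omega>(1,2) t T(1) ins this] elim
          show False by (simp add: Xe)
        qed
      next
        assume "\<exists>n::nat. \<forall>s\<in>T. 1 / real (Suc n) \<le> infdist (x + X s \<omega>) (- \<Omega>)"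
        then obtain n :: nat where "\<And>s. s \<in> T \<Longrightarrow> 1 / real (Suc n) \<le> infdist (x + X s \<omega>) (- \<Omega>)" by blast
        then show "\<forall>s\<in>{0..t}. x + X s \<omega> \<in> \<Omega>"
          using stays_inside_if_far[OF X_cadlag, of \<omega> "1 / real (Suc n)" t x \<Omega>] elim unfolding T(1) by auto
      qed
      finally show ?case using elim by (auto simp: far_def Xe space_pair_measure)
    qed
    have s: "stays \<Omega> t x \<in> sets (completion M)"
      using AE_completion[OF ae] sets_completionI_sets[OF B]
      by (rule completion.in_sets_AE) (auto simp: stays_def)
    moreover have "measure (completion M) (stays \<Omega> t x) = measure (completion M) ?B"
      using s sets_completionI_sets[OF B] AE_completion[OF ae] by (intro measure_eq_AE) (auto elim: eventually_mono)
    ultimately show ?case using B by (simp add: g_def)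
  qed
  with g that show thesis by blast
qed

lemma prob_max_proj_eq:
  assumes "norm v = 1" "norm w = 1" "0 \<le> t" and A: "A \<in> sets borel"
  shows "prob {\<omega> \<in> space M. max_proj v t \<omega> \<in> A} = prob {\<omega> \<in> space M. max_proj w t \<omega> \<in> A}"
proof -
  have "prob {\<omega> \<in> space M. max_proj u t \<omega> \<in> A} = measure (distr M borel (max_proj u t)) A" for u
    using measurable_max_proj[OF assms(3)] A by (subst measure_distr) (auto intro!: arg_cong[where f = prob])
  then show ?thesis using max_proj_law[OF assms(1-3)] by simp
qed

end

section \<open>Displacements seen from the tangent balls\<close>

context two_ball_domain
begin

text \<open>An exit point lies outside the inner tangent ball at the foot. Expanding the squared
  distance to its centre shows that the normal component or the length of k must be large;
  \<open>\<epsilon> < 1 / 2\<close> gives the surplus term its sign.\<close>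

lemma exit_displacement:
  assumes x: "x \<in> \<Omega>" and out: "x + k \<notin> \<Omega>" and \<epsilon>: "0 < \<epsilon>" "\<epsilon> < 1 / 2"
  shows "(1 - \<epsilon>) * \<delta> x \<le> \<nu> (foot x) \<bullet> k \<or> \<epsilon> * r0 * \<delta> x \<le> (norm k)\<^sup>2"
proof -
  let ?n = "\<nu> (foot x)"
  have d: "0 < \<delta> x" using frontier_dist_pos_iff[OF open_domain bounded_domain] x by simp
  have n1: "norm ?n = 1" using outer_normal(1)[OF foot(1)[OF x]] .
  have dk: "\<delta> x \<le> norm k" using frontier_dist_le[OF out, of x] by simp
  show ?thesis
  \<comment> \<open>Deep inside, the length of k alone is enough: it is at least
    \<open>\<delta> x\<close>, and \<open>\<delta> x\<close> is at least \<epsilon> * r0.\<close>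
  proof (cases "r0 / 2 \<le> \<delta> x")
    case True
    have "\<epsilon> * r0 * \<delta> x \<le> \<delta> x * \<delta> x"
    proof (rule mult_right_mono)
      have "\<epsilon> * r0 \<le> 1 / 2 * r0" using \<epsilon> r0 by (intro mult_right_mono) auto
      then show "\<epsilon> * r0 \<le> \<delta> x" using True by simp
    qed (use d in simp)
    also have "\<dots> \<le> norm k * norm k" using dk d by (intro mult_mono) auto
    finally show ?thesis by (simp add: power2_eq_square)
  next
    case False
    show ?thesis
    proof (rule ccontr)
      assume "\<not> ?thesis"
      then have a: "?n \<bullet> k < (1 - \<epsilon>) * \<delta> x" "(norm k)\<^sup>2 < \<epsilon> * r0 * \<delta> x" by auto
      have "x + k \<notin> ball (foot x - r0 *\<^sub>R ?n) r0" using outer_normal(2)[OF foot(1)[OF x]] out by blast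
      moreover have "x + k - (foot x - r0 *\<^sub>R ?n) = k + (r0 - \<delta> x) *\<^sub>R ?n"
        by (subst foot(2)[OF x]) (simp add: algebra_simps)
      ultimately have "r0 \<le> norm (k + (r0 - \<delta> x) *\<^sub>R ?n)" by (simp add: dist_norm norm_minus_commute)
      then have "r0\<^sup>2 \<le> (norm (k + (r0 - \<delta> x) *\<^sub>R ?n))\<^sup>2" using r0 by (intro power_mono) auto
      also have "\<dots> = (norm k)\<^sup>2 + 2 * (r0 - \<delta> x) * (?n \<bullet> k) + (r0 - \<delta> x)\<^sup>2"
        using n1 by (simp add: power2_norm_eq_inner inner_add_left inner_add_right inner_commute norm_eq_1)
          (simp add: power2_eq_square)
      also have "\<dots> < \<epsilon> * r0 * \<delta> x + 2 * (r0 - \<delta> x) * ((1 - \<epsilon>) * \<delta> x) + (r0 - \<delta> x)\<^sup>2"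
        using a False r0 by (intro add_less_le_mono add_mono mult_left_mono) auto
      also have "\<dots> = r0\<^sup>2 - \<delta> x * (\<epsilon> * r0 + (1 - 2 * \<epsilon>) * \<delta> x)" by (simp add: power2_eq_square algebra_simps)
      also have "\<dots> \<le> r0\<^sup>2" using \<epsilon> r0 d by simp
      finally show False by simp
    qed
  qed
qed

text \<open>The mirror image of the previous expansion: a large normal component with a small total
  length lands in the closed exterior ball.\<close>

lemma displacement_exits:
  assumes x: "x \<in> \<Omega>" and \<epsilon>: "0 < \<epsilon>"
    and k: "(1 + \<epsilon>) * \<delta> x \<le> \<nu> (foot x) \<bullet> k" "(norm k)\<^sup>2 < \<epsilon> * r0 * \<delta> x"
  shows "x + k \<notin> \<Omega>"
proof -
  let ?n = "\<nu> (foot x)"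
  have d: "0 < \<delta> x" using frontier_dist_pos_iff[OF open_domain bounded_domain] x by simp
  have n1: "norm ?n = 1" using outer_normal(1)[OF foot(1)[OF x]] .
  have eq: "x + k - (foot x + r0 *\<^sub>R ?n) = k - (r0 + \<delta> x) *\<^sub>R ?n"
    by (subst foot(2)[OF x]) (simp add: algebra_simps)
  have "(norm (k - (r0 + \<delta> x) *\<^sub>R ?n))\<^sup>2 = (norm k)\<^sup>2 - 2 * (r0 + \<delta> x) * (?n \<bullet> k) + (r0 + \<delta> x)\<^sup>2"
    using n1 by (simp add: power2_norm_eq_inner inner_diff_left inner_diff_right inner_commute norm_eq_1)
      (simp add: power2_eq_square)
  also have "\<dots> \<le> \<epsilon> * r0 * \<delta> x - 2 * (r0 + \<delta> x) * ((1 + \<epsilon>) * \<delta> x) + (r0 + \<delta> x)\<^sup>2"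
    using k d r0 by (intro add_mono diff_mono mult_left_mono) auto
  also have "\<dots> = r0\<^sup>2 - \<delta> x * (\<epsilon> * r0 + (1 + 2 * \<epsilon>) * \<delta> x)" by (simp add: power2_eq_square algebra_simps)
  also have "\<dots> \<le> r0\<^sup>2" using \<epsilon> r0 d by simp
  finally have "norm (k - (r0 + \<delta> x) *\<^sub>R ?n) \<le> r0" by (rule power2_le_imp_le) (use r0 in linarith)
  then have "norm (x + k - (foot x + r0 *\<^sub>R ?n)) \<le> r0" by (simp only: eq)
  then have "x + k \<in> cball (foot x + r0 *\<^sub>R ?n) r0" unfolding mem_cball dist_norm by (subst norm_minus_commute)
  then show ?thesis using outer_normal(3)[OF foot(1)[OF x]] by blast
qed

end

section \<open>Exit probabilities\<close>

text \<open>\<open>Bad\<close> is the event of a large displacement, covered by the 2d signed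
  coordinate directions; by isotropy each has the law of \<open>S\<close>, whence the factor 2d. If
  no signed coordinate reaches \<open>sqrt (b * \<delta> x)\<close>, the norm stays below d times
  this, and b is chosen so that its square is
  \<open>\<epsilon> / 2 * r0 * \<delta> x\<close>.\<close>

lemma exit_probability_bounds:
  fixes Y :: "real \<Rightarrow> 'w \<Rightarrow> real^'d::finite" and \<Omega> :: "(real^'d) set"
  assumes "subordinated_stable M \<alpha> Y U G" and "two_ball_domain \<Omega> r0"
    and t: "0 \<le> t" and e: "norm e = 1" and x: "x \<in> \<Omega>" and \<epsilon>: "0 < \<epsilon>" "\<epsilon> < 1 / 2"
    and st: "subordinated_stable.stays M Y U \<Omega> t x \<in> sets (completion M)"
  defines "b \<equiv> (\<epsilon> / 2) * r0 / (real CARD('d))\<^sup>2"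
    and "S \<equiv> subordinated_stable.max_proj Y U e t"
    and "q \<equiv> 1 - measure (completion M) (subordinated_stable.stays M Y U \<Omega> t x)"
    and "\<delta> \<equiv> frontier_dist \<Omega>"
  shows "q \<le> measure M {\<omega> \<in> space M. (1 - \<epsilon>) * \<delta> x \<le> S \<omega>} + 2 * real CARD('d) * measure M {\<omega> \<in> space M. b * \<delta> x \<le> (S \<omega>)\<^sup>2}"
    and "measure M {\<omega> \<in> space M. (1 + \<epsilon>) * \<delta> x \<le> S \<omega>} - 2 * real CARD('d) * measure M {\<omega> \<in> space M. b * \<delta> x \<le> (S \<omega>)\<^sup>2} \<le> q"
proof -
  interpret subordinated_stable M \<alpha> Y U G by fact
  interpret \<Omega>: two_ball_domain \<Omega> r0 by fact
  interpret C: prob_space "completion M" by (rule prob_space_completion)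
  note mp [measurable] = measurable_max_proj[OF t]
  define d where "d = real CARD('d)"
  have d1: "1 \<le> d" unfolding d_def using Suc_leI[OF zero_less_card_finite[where 'a = 'd]] by simp
  let ?n = "outer_normal r0 \<Omega> (\<Omega>.foot x)"
  have n1: "norm ?n = 1" using \<Omega>.outer_normal(1)[OF \<Omega>.foot(1)[OF x]] .
  have dx: "0 < \<delta> x" unfolding \<delta>_def using frontier_dist_pos_iff[OF \<Omega>.open_domain \<Omega>.bounded_domain] x by simp
  have b0: "0 < b" unfolding b_def using \<epsilon> \<Omega>.r0 by simp
  define I where "I = (UNIV :: 'd set) \<times> {1, - 1 :: real}"
  define Q where "Q p = {\<omega> \<in> space M. b * \<delta> x \<le> (max_proj (axis (fst p) (snd p)) t \<omega>)\<^sup>2}" for p :: "'d \<times> real"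
  define Bad where "Bad = (\<Union>p\<in>I. Q p)"
  have Qs: "Q p \<in> sets M" for p unfolding Q_def by measurable
  have Bs: "Bad \<in> sets M" unfolding Bad_def using Qs by (intro sets.finite_UN) (auto simp: I_def)
  have ax: "norm (axis (fst p) (snd p) :: real^'d) = 1" if "p \<in> I" for p using that by (auto simp: I_def norm_eq_1 inner_axis_axis)
  have eqA: "prob {\<omega> \<in> space M. c \<le> max_proj ?n t \<omega>} = prob {\<omega> \<in> space M. c \<le> S \<omega>}" for c
    using prob_max_proj_eq[OF n1 e t, of "{c..}"] by (simp add: S_def)
  have eqQ: "prob (Q p) = prob {\<omega> \<in> space M. b * \<delta> x \<le> (S \<omega>)\<^sup>2}" if "p \<in> I" for p
  proof -
    have "{y::real. b * \<delta> x \<le> y\<^sup>2} \<in> sets borel" by measurable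
    from prob_max_proj_eq[OF ax[OF that] e t this] show ?thesis by (simp add: Q_def S_def)
  qed
  have "prob Bad \<le> (\<Sum>p\<in>I. prob (Q p))"
    unfolding Bad_def using Qs by (intro finite_measure_subadditive_finite) (auto simp: I_def)
  also have "\<dots> = 2 * d * prob {\<omega> \<in> space M. b * \<delta> x \<le> (S \<omega>)\<^sup>2}"
    using eqQ by (simp add: I_def card_cartesian_product d_def)
  finally have Bad: "prob Bad \<le> 2 * d * prob {\<omega> \<in> space M. b * \<delta> x \<le> (S \<omega>)\<^sup>2}" .
  have small: "(norm (X s \<omega>))\<^sup>2 < \<epsilon> / 2 * r0 * \<delta> x" if \<omega>: "\<omega> \<in> G" "\<omega> \<in> space M" "\<omega> \<notin> Bad" and s: "0 \<le> s" "s \<le> t" for \<omega> s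
  proof -
    define w where "w = sqrt (b * \<delta> x)"
    have w: "0 < w" "w\<^sup>2 = b * \<delta> x" using b0 dx by (auto simp: w_def)
    have comp: "\<bar>X s \<omega> $ i\<bar> < w" for i
    proof -
      have "\<sigma> * X s \<omega> $ i < w" if "\<sigma> \<in> {1, -1}" for \<sigma> :: real
      proof -
        have "(i, \<sigma>) \<in> I" using that by (simp add: I_def)
        then have "\<omega> \<notin> Q (i, \<sigma>)" using \<omega>(3) by (auto simp: Bad_def)
        then have "(max_proj (axis i \<sigma>) t \<omega>)\<^sup>2 < w\<^sup>2" using \<omega>(2) w by (simp add: Q_def)
        then have "max_proj (axis i \<sigma>) t \<omega> < w" using w(1) by (simp add: power2_less_imp_less)
        moreover have "axis i \<sigma> \<bullet> X s \<omega> \<le> max_proj (axis i \<sigma>) t \<omega>" by (rule max_proj_upper[OF \<omega>(1) s])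
        ultimately show ?thesis by (simp add: inner_axis')
      qed
      from this[of 1] this[of "-1"] show ?thesis by simp
    qed
    have "norm (X s \<omega>) \<le> (\<Sum>i\<in>UNIV. \<bar>X s \<omega> $ i\<bar>)" by (rule norm_le_l1_cart)
    also have "\<dots> < (\<Sum>i\<in>(UNIV :: 'd set). w)" using comp by (intro sum_strict_mono) auto
    finally have "norm (X s \<omega>) < d * w" by (simp add: d_def)
    then have "(norm (X s \<omega>))\<^sup>2 < (d * w)\<^sup>2" by (intro power_strict_mono) auto
    also have "\<dots> = \<epsilon> / 2 * r0 * \<delta> x" using d1 by (simp add: power_mult_distrib w b_def d_def[symmetric])
    finally show ?thesis .
  qed
  have sp: "space (completion M) = space M" by simp
  have q: "q = measure (completion M) (space M - stays \<Omega> t x)"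
    using C.prob_compl[OF st] by (simp add: q_def)
  have cs: "space M - stays \<Omega> t x \<in> sets (completion M)" using sets.compl_sets[OF st] by simp
  have stays: "\<omega> \<in> stays \<Omega> t x \<longleftrightarrow> (\<forall>s\<in>{0..t}. x + X s \<omega> \<in> \<Omega>)" if "\<omega> \<in> G" "\<omega> \<in> space M" for \<omega>
    using exit_time_gt_iff[OF X_cadlag \<Omega>.open_domain t] that by (simp add: stays_def)
  define A1 where "A1 = {\<omega> \<in> space M. (1 - \<epsilon>) * \<delta> x \<le> max_proj ?n t \<omega>}"
  define A2 where "A2 = {\<omega> \<in> space M. (1 + \<epsilon>) * \<delta> x \<le> max_proj ?n t \<omega>}"
  have As: "A1 \<in> sets M" "A2 \<in> sets M" unfolding A1_def A2_def by measurable
  have "q \<le> measure (completion M) (A1 \<union> Bad)"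
    unfolding q
  proof (rule C.finite_measure_mono_AE)
    show "AE \<omega> in completion M. \<omega> \<in> space M - stays \<Omega> t x \<longrightarrow> \<omega> \<in> A1 \<union> Bad"
    proof (rule AE_completion)
      show "AE \<omega> in M. \<omega> \<in> space M - stays \<Omega> t x \<longrightarrow> \<omega> \<in> A1 \<union> Bad"
        using G(2)
      proof eventually_elim
        case (elim \<omega>)
        show ?case
        proof
          assume \<omega>: "\<omega> \<in> space M - stays \<Omega> t x"
          then obtain s where s: "0 \<le> s" "s \<le> t" "x + X s \<omega> \<notin> \<Omega>" using stays[OF elim] by auto
          from \<Omega>.exit_displacement[OF x s(3) \<epsilon>] show "\<omega> \<in> A1 \<union> Bad"
          proof
            assume "(1 - \<epsilon>) * frontier_dist \<Omega> x \<le> ?n \<bullet> X s \<omega>"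
            also have "\<dots> \<le> max_proj ?n t \<omega>" by (rule max_proj_upper[OF elim s(1,2)])
            finally show ?thesis using \<omega> by (simp add: A1_def \<delta>_def)
          next
            assume a: "\<epsilon> * r0 * frontier_dist \<Omega> x \<le> (norm (X s \<omega>))\<^sup>2"
            have "\<omega> \<in> Bad"
            proof (rule ccontr)
              assume "\<omega> \<notin> Bad"
              then have "(norm (X s \<omega>))\<^sup>2 < \<epsilon> / 2 * r0 * \<delta> x" using small[OF elim _ _ s(1,2)] \<omega> by simp
              moreover have "0 < \<epsilon> * r0 * \<delta> x" using \<epsilon> \<Omega>.r0 dx by simp
              ultimately show False using a by (simp add: \<delta>_def)
            qed
            then show ?thesis by simp
          qed
        qed
      qed
    qed
    show "A1 \<union> Bad \<in> sets (completion M)" using As Bs by (intro sets_completionI_sets) auto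
  qed
  also have "\<dots> = prob (A1 \<union> Bad)" using As Bs by simp
  also have "\<dots> \<le> prob A1 + prob Bad" using As Bs by (intro measure_Un_le)
  also have "prob A1 = prob {\<omega> \<in> space M. (1 - \<epsilon>) * \<delta> x \<le> S \<omega>}" unfolding A1_def by (rule eqA)
  finally show "q \<le> prob {\<omega> \<in> space M. (1 - \<epsilon>) * \<delta> x \<le> S \<omega>} + 2 * real CARD('d) * prob {\<omega> \<in> space M. b * \<delta> x \<le> (S \<omega>)\<^sup>2}"
    using Bad by (simp add: d_def)
  have "prob {\<omega> \<in> space M. (1 + \<epsilon>) * \<delta> x \<le> S \<omega>} = prob A2" unfolding A2_def by (rule eqA[symmetric])
  also have "\<dots> \<le> prob ((A2 - Bad) \<union> Bad)" using As Bs by (intro finite_measure_mono) auto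
  also have "\<dots> \<le> prob (A2 - Bad) + prob Bad" using As Bs by (intro measure_Un_le) auto
  also have "prob (A2 - Bad) = measure (completion M) (A2 - Bad)" using As Bs by simp
  also have "\<dots> \<le> q"
    unfolding q
  proof (rule C.finite_measure_mono_AE[OF _ cs])
    show "AE \<omega> in completion M. \<omega> \<in> A2 - Bad \<longrightarrow> \<omega> \<in> space M - stays \<Omega> t x"
    proof (rule AE_completion)
      show "AE \<omega> in M. \<omega> \<in> A2 - Bad \<longrightarrow> \<omega> \<in> space M - stays \<Omega> t x"
        using G(2)
      proof eventually_elim
        case (elim \<omega>)
        show ?case
        proof
          assume \<omega>: "\<omega> \<in> A2 - Bad"
          then have \<omega>': "\<omega> \<in> space M" "\<omega> \<notin> Bad" "(1 + \<epsilon>) * \<delta> x \<le> max_proj ?n t \<omega>" by (auto simp: A2_def)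
          \<comment> \<open>The supremum need not be attained. Giving up half of \<epsilon> makes
            the inequality strict, so that some time s realises it; this is the reason for
            \<epsilon> / 2 in b.\<close>
          have "(1 + \<epsilon> / 2) * \<delta> x < (1 + \<epsilon>) * \<delta> x" using dx \<epsilon> by (intro mult_strict_right_mono) auto
          then have "(1 + \<epsilon> / 2) * \<delta> x < max_proj ?n t \<omega>" using \<omega>' by simp
          then obtain s where s: "0 \<le> s" "s \<le> t" "(1 + \<epsilon> / 2) * \<delta> x < ?n \<bullet> X s \<omega>" using max_proj_attains[OF elim t] by blast
          have "x + X s \<omega> \<notin> \<Omega>"
            using small[OF elim \<omega>'(1,2) s(1,2)] s(3) \<epsilon>
            by (intro \<Omega>.displacement_exits[OF x, of "\<epsilon> / 2"]) (auto simp: \<delta>_def)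
          then show "\<omega> \<in> space M - stays \<Omega> t x" using stays[OF elim \<omega>'(1)] s \<omega>' by auto
        qed
      qed
    qed
  qed
  finally show "prob {\<omega> \<in> space M. (1 + \<epsilon>) * \<delta> x \<le> S \<omega>} - 2 * real CARD('d) * prob {\<omega> \<in> space M. b * \<delta> x \<le> (S \<omega>)\<^sup>2} \<le> q"
    using Bad by (simp add: d_def)
qed

context two_ball_domain
begin

lemma measurable_layer_volume [measurable]: "layer_volume \<Omega> \<in> borel_measurable borel"
  by (rule borel_measurable_mono) (simp add: mono_def layer_volume_mono)

text \<open>Both sides are the product measure of the set of pairs with
  \<open>\<delta> x \<le> h \<omega>\<close>, sliced in the two directions.\<close>

lemma layer_volume_fubini:
  assumes M: "prob_space M" and h[measurable]: "h \<in> borel_measurable M"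
  shows "integrable lborel (\<lambda>x. indicator \<Omega> x * measure M {\<omega> \<in> space M. \<delta> x \<le> h \<omega>})"
    and "(\<integral>x. indicator \<Omega> x * measure M {\<omega> \<in> space M. \<delta> x \<le> h \<omega>} \<partial>lborel) = (\<integral>\<omega>. layer_volume \<Omega> (h \<omega>) \<partial>M)"
    and "integrable M (\<lambda>\<omega>. layer_volume \<Omega> (h \<omega>))"
proof -
  interpret prob_space M by fact
  interpret P: pair_sigma_finite lborel M by standard
  define B where "B = {p \<in> space (lborel \<Otimes>\<^sub>M M). fst p \<in> \<Omega> \<and> \<delta> (fst p) \<le> h (snd p)}"
  have B: "B \<in> sets (lborel \<Otimes>\<^sub>M M)" unfolding B_def by measurable
  have 1: "Pair x -` B = (if x \<in> \<Omega> then {\<omega> \<in> space M. \<delta> x \<le> h \<omega>} else {})" for x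
    by (auto simp: B_def space_pair_measure)
  have 2: "(\<lambda>x. (x, \<omega>)) -` B = {x \<in> \<Omega>. \<delta> x \<le> h \<omega>}" if "\<omega> \<in> space M" for \<omega>
    using that by (auto simp: B_def space_pair_measure)
  have p: "ennreal (indicator \<Omega> x * prob {\<omega> \<in> space M. \<delta> x \<le> h \<omega>}) = emeasure M (Pair x -` B)" for x
    by (simp add: 1 emeasure_eq_measure indicator_def)
  have l: "ennreal (layer_volume \<Omega> (h \<omega>)) = emeasure lborel ((\<lambda>x. (x, \<omega>)) -` B)" if "\<omega> \<in> space M" for \<omega>
    unfolding 2[OF that] layer_volume_def
    using bounded_emeasure_finite[of "{x \<in> \<Omega>. \<delta> x \<le> h \<omega>}"] by (intro emeasure_eq_ennreal_measure[symmetric]) auto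
  show il: "integrable M (\<lambda>\<omega>. layer_volume \<Omega> (h \<omega>))"
    by (rule integrable_const_bound[of _ "measure lborel \<Omega>"]) (auto simp: layer_volume_le layer_volume_nonneg)
  have mp: "(\<lambda>x. indicator \<Omega> x * prob {\<omega> \<in> space M. \<delta> x \<le> h \<omega>}) \<in> borel_measurable lborel"
    by measurable
  have eq: "(\<integral>\<^sup>+x. ennreal (indicator \<Omega> x * prob {\<omega> \<in> space M. \<delta> x \<le> h \<omega>}) \<partial>lborel) = (\<integral>\<^sup>+\<omega>. ennreal (layer_volume \<Omega> (h \<omega>)) \<partial>M)"
  proof -
    have "(\<integral>\<^sup>+x. ennreal (indicator \<Omega> x * prob {\<omega> \<in> space M. \<delta> x \<le> h \<omega>}) \<partial>lborel) = emeasure (lborel \<Otimes>\<^sub>M M) B"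
      using B by (simp add: p emeasure_pair_measure_alt)
    also have "\<dots> = (\<integral>\<^sup>+\<omega>. emeasure lborel ((\<lambda>x. (x, \<omega>)) -` B) \<partial>M)" by (rule P.emeasure_pair_measure_alt2[OF B])
    also have "\<dots> = (\<integral>\<^sup>+\<omega>. ennreal (layer_volume \<Omega> (h \<omega>)) \<partial>M)" by (intro nn_integral_cong) (simp add: l)
    finally show ?thesis .
  qed
  show "(\<integral>x. indicator \<Omega> x * prob {\<omega> \<in> space M. \<delta> x \<le> h \<omega>} \<partial>lborel) = (\<integral>\<omega>. layer_volume \<Omega> (h \<omega>) \<partial>M)"
    using eq mp il by (subst (1 2) integral_eq_nn_integral) (auto simp: layer_volume_nonneg)
  have "(\<integral>\<^sup>+\<omega>. ennreal (layer_volume \<Omega> (h \<omega>)) \<partial>M) < \<infinity>"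
    using il layer_volume_nonneg by (simp add: nn_integral_eq_integral)
  then show "integrable lborel (\<lambda>x. indicator \<Omega> x * prob {\<omega> \<in> space M. \<delta> x \<le> h \<omega>})"
    using mp eq by (intro integrableI_bounded) auto
qed

end

text \<open>The pointwise bounds are integrated over the start point. Each condition bounds
  \<open>\<delta> x\<close> by a random variable, so each probability integrates to a mean layer
  volume.\<close>

lemma heat_loss_bounds:
  fixes Y :: "real \<Rightarrow> 'w \<Rightarrow> real^'d::finite" and \<Omega> :: "(real^'d) set"
  assumes "subordinated_stable M \<alpha> Y U G" and "two_ball_domain \<Omega> r0" and ne: "frontier \<Omega> \<noteq> {}"
    and t: "0 \<le> t" and e: "norm e = 1" and \<epsilon>: "0 < \<epsilon>" "\<epsilon> < 1 / 2"
  defines "b \<equiv> (\<epsilon> / 2) * r0 / (real CARD('d))\<^sup>2"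
    and "S \<equiv> subordinated_stable.max_proj Y U e t"
    and "V \<equiv> measure lebesgue \<Omega> - spectral_heat_content M (time_change Y U) \<Omega> t"
  shows "V \<le> (\<integral>\<omega>. layer_volume \<Omega> (S \<omega> / (1 - \<epsilon>)) \<partial>M) + 2 * real CARD('d) * (\<integral>\<omega>. layer_volume \<Omega> ((S \<omega>)\<^sup>2 / b) \<partial>M)"
    and "(\<integral>\<omega>. layer_volume \<Omega> (S \<omega> / (1 + \<epsilon>)) \<partial>M) - 2 * real CARD('d) * (\<integral>\<omega>. layer_volume \<Omega> ((S \<omega>)\<^sup>2 / b) \<partial>M) \<le> V"
proof -
  interpret subordinated_stable M \<alpha> Y U G by fact
  interpret \<Omega>: two_ball_domain \<Omega> r0 by fact
  interpret C: prob_space "completion M" by (rule prob_space_completion)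
  have mS [measurable]: "S \<in> borel_measurable M" unfolding S_def by (rule measurable_max_proj[OF t])
  have b0: "0 < b" unfolding b_def using \<epsilon> \<Omega>.r0 by simp
  obtain g where g [measurable]: "g \<in> borel_measurable borel" and
    ae: "AE x in lborel. stays \<Omega> t x \<in> sets (completion M) \<and> measure (completion M) (stays \<Omega> t x) = g x"
    using stays_measurable[OF \<Omega>.open_domain \<Omega>.bounded_domain \<Omega>.null_frontier ne t] by blast
  have fin: "integrable lborel (\<lambda>x. indicator \<Omega> x :: real)"
    using \<Omega>.bounded_emeasure_finite[of \<Omega>] by (intro integrable_real_indicator) auto
  have ig: "integrable lborel (\<lambda>x. indicator \<Omega> x * g x)"
  proof (rule Bochner_Integration.integrable_bound[OF fin])
    show "AE x in lborel. norm (indicator \<Omega> x * g x) \<le> norm (indicator \<Omega> x :: real)"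
      using ae
    proof eventually_elim
      case (elim x)
      have "0 \<le> g x \<and> g x \<le> 1" using elim C.prob_le_1[of "stays \<Omega> t x"] measure_nonneg[of "completion M" "stays \<Omega> t x"] by simp
      then show ?case by (auto simp: indicator_def)
    qed
  qed measurable
  have "spectral_heat_content M (time_change Y U) \<Omega> t = (\<integral>x. indicator \<Omega> x * measure (completion M) (stays \<Omega> t x) \<partial>lebesgue)"
    by (simp add: spectral_heat_content_def set_lebesgue_integral_def stays_def time_change_def)
  also have "\<dots> = (\<integral>x. indicator \<Omega> x * g x \<partial>lborel)"
    by (rule integral_completion_AE) (use ae in \<open>auto elim: eventually_mono\<close>)
  finally have Q: "spectral_heat_content M (time_change Y U) \<Omega> t = (\<integral>x. indicator \<Omega> x * g x \<partial>lborel)" .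
  have "measure lebesgue \<Omega> = measure lborel \<Omega>" by simp
  then have V: "V = (\<integral>x. indicator \<Omega> x * (1 - g x) \<partial>lborel)"
    using fin ig by (simp add: V_def Q right_diff_distrib)
  have iV: "integrable lborel (\<lambda>x. indicator \<Omega> x * (1 - g x))" using fin ig by (simp add: right_diff_distrib)
  define F where "F c x = measure M {\<omega> \<in> space M. c * frontier_dist \<Omega> x \<le> S \<omega>}" for c x
  define H where "H x = measure M {\<omega> \<in> space M. b * frontier_dist \<Omega> x \<le> (S \<omega>)\<^sup>2}" for x
  have Feq: "F c x = measure M {\<omega> \<in> space M. frontier_dist \<Omega> x \<le> S \<omega> / c}" if "0 < c" for c x
    using that by (simp add: F_def pos_le_divide_eq mult.commute)
  have Heq: "H x = measure M {\<omega> \<in> space M. frontier_dist \<Omega> x \<le> (S \<omega>)\<^sup>2 / b}" for x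
    using b0 by (simp add: H_def pos_le_divide_eq mult.commute)
  have IF: "integrable lborel (\<lambda>x. indicator \<Omega> x * F c x)"
    "(\<integral>x. indicator \<Omega> x * F c x \<partial>lborel) = (\<integral>\<omega>. layer_volume \<Omega> (S \<omega> / c) \<partial>M)" if "0 < c" for c
    using \<Omega>.layer_volume_fubini[OF prob_space_axioms, of "\<lambda>\<omega>. S \<omega> / c"] by (simp_all add: Feq[OF that])
  have IH: "integrable lborel (\<lambda>x. indicator \<Omega> x * H x)"
    "(\<integral>x. indicator \<Omega> x * H x \<partial>lborel) = (\<integral>\<omega>. layer_volume \<Omega> ((S \<omega>)\<^sup>2 / b) \<partial>M)"
    using \<Omega>.layer_volume_fubini[OF prob_space_axioms, of "\<lambda>\<omega>. (S \<omega>)\<^sup>2 / b"] by (simp_all add: Heq)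
  let ?d = "2 * real CARD('d)"
  note bounds = exit_probability_bounds[OF subordinated_stable_axioms \<Omega>.two_ball_domain_axioms t e _ \<epsilon>, folded b_def S_def]
  have "V \<le> (\<integral>x. indicator \<Omega> x * F (1 - \<epsilon>) x + ?d * (indicator \<Omega> x * H x) \<partial>lborel)"
    unfolding V
  proof (rule integral_mono_AE[OF iV])
    show "integrable lborel (\<lambda>x. indicator \<Omega> x * F (1 - \<epsilon>) x + ?d * (indicator \<Omega> x * H x))"
      using IF IH \<epsilon> by (intro Bochner_Integration.integrable_add integrable_mult_right) auto
    show "AE x in lborel. indicator \<Omega> x * (1 - g x) \<le> indicator \<Omega> x * F (1 - \<epsilon>) x + ?d * (indicator \<Omega> x * H x)"
      using ae
    proof eventually_elim
      case (elim x)
      then show ?case using bounds(1)[of x] by (cases "x \<in> \<Omega>") (auto simp: F_def H_def)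
    qed
  qed
  also have "\<dots> = (\<integral>\<omega>. layer_volume \<Omega> (S \<omega> / (1 - \<epsilon>)) \<partial>M) + ?d * (\<integral>\<omega>. layer_volume \<Omega> ((S \<omega>)\<^sup>2 / b) \<partial>M)"
    using IF[of "1 - \<epsilon>"] IH \<epsilon> by simp
  finally show "V \<le> (\<integral>\<omega>. layer_volume \<Omega> (S \<omega> / (1 - \<epsilon>)) \<partial>M) + ?d * (\<integral>\<omega>. layer_volume \<Omega> ((S \<omega>)\<^sup>2 / b) \<partial>M)" .
  have "(\<integral>\<omega>. layer_volume \<Omega> (S \<omega> / (1 + \<epsilon>)) \<partial>M) - ?d * (\<integral>\<omega>. layer_volume \<Omega> ((S \<omega>)\<^sup>2 / b) \<partial>M)
      = (\<integral>x. indicator \<Omega> x * F (1 + \<epsilon>) x - ?d * (indicator \<Omega> x * H x) \<partial>lborel)"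
    using IF[of "1 + \<epsilon>"] IH \<epsilon> by simp
  also have "\<dots> \<le> V"
    unfolding V
  proof (rule integral_mono_AE[OF _ iV])
    show "integrable lborel (\<lambda>x. indicator \<Omega> x * F (1 + \<epsilon>) x - ?d * (indicator \<Omega> x * H x))"
      using IF IH \<epsilon> by (intro Bochner_Integration.integrable_diff integrable_mult_right) auto
    show "AE x in lborel. indicator \<Omega> x * F (1 + \<epsilon>) x - ?d * (indicator \<Omega> x * H x) \<le> indicator \<Omega> x * (1 - g x)"
      using ae
    proof eventually_elim
      case (elim x)
      then show ?case using bounds(2)[of x] by (cases "x \<in> \<Omega>") (auto simp: F_def H_def)
    qed
  qed
  finally show "(\<integral>\<omega>. layer_volume \<Omega> (S \<omega> / (1 + \<epsilon>)) \<partial>M) - ?d * (\<integral>\<omega>. layer_volume \<Omega> ((S \<omega>)\<^sup>2 / b) \<partial>M) \<le> V" .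
qed

section \<open>Asymptotics of the heat loss\<close>

lemma (in two_ball_domain) layer_volume_bounds:
  assumes P: "0 \<le> P" "((\<lambda>r. layer_volume \<Omega> r / r) \<longlongrightarrow> P) (at_right 0)" and q: "1 < q" "q \<le> 2"
  shows "\<And>\<eta>. 0 < \<eta> \<Longrightarrow> \<exists>K\<ge>0. \<forall>r\<ge>0. \<bar>layer_volume \<Omega> r - P * r\<bar> \<le> \<eta> * r + K * r powr q"
    and "\<exists>K\<ge>0. \<forall>r\<ge>0. layer_volume \<Omega> r \<le> K * r powr (q / 2)"
proof -
  define W where "W = measure lborel \<Omega>"
  have W: "0 \<le> W" by (simp add: W_def)
  have G0: "layer_volume \<Omega> 0 = 0"
  proof -
    have "\<not> \<delta> x \<le> 0" if "x \<in> \<Omega>" for x using frontier_dist_pos_iff[OF open_domain bounded_domain, of x] that by simp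
    then have "{x \<in> \<Omega>. \<delta> x \<le> 0} = {}" by blast
    then show ?thesis by (simp only: layer_volume_def measure_empty)
  qed
  have near: "\<exists>r1>0. r1 \<le> 1 \<and> (\<forall>r. 0 < r \<longrightarrow> r < r1 \<longrightarrow> \<bar>layer_volume \<Omega> r - P * r\<bar> \<le> \<eta> * r)" if \<eta>: "0 < \<eta>" for \<eta>
  proof -
    have "\<forall>\<^sub>F r in at_right 0. dist (layer_volume \<Omega> r / r) P < \<eta>" using P(2) \<eta> by (rule tendstoD)
    then obtain r1 where r1: "0 < r1" "\<And>r. 0 < r \<Longrightarrow> r < r1 \<Longrightarrow> dist (layer_volume \<Omega> r / r) P < \<eta>"
      unfolding eventually_at_right_field by auto
    have "\<bar>layer_volume \<Omega> r - P * r\<bar> \<le> \<eta> * r" if r: "0 < r" "r < min r1 1" for r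
    proof -
      have "layer_volume \<Omega> r - P * r = (layer_volume \<Omega> r / r - P) * r" using r by (simp add: left_diff_distrib)
      then have "\<bar>layer_volume \<Omega> r - P * r\<bar> = \<bar>layer_volume \<Omega> r / r - P\<bar> * r" using r by (simp add: abs_mult)
      also have "\<dots> \<le> \<eta> * r" using r1(2)[of r] r by (intro mult_right_mono) (auto simp: dist_real_def)
      finally show ?thesis .
    qed
    then show ?thesis using r1(1) by (intro exI[of _ "min r1 1"]) auto
  qed
  have big: "1 \<le> (r / r1) powr s" if "0 < r1" "r1 \<le> r" "0 \<le> s" for r r1 s :: real
    using powr_mono2[of s 1 "r / r1"] that by simp
  show "\<exists>K\<ge>0. \<forall>r\<ge>0. \<bar>layer_volume \<Omega> r - P * r\<bar> \<le> \<eta> * r + K * r powr q" if \<eta>: "0 < \<eta>" for \<eta>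
  proof -
    obtain r1 where r1: "0 < r1" "r1 \<le> 1" "\<And>r. 0 < r \<Longrightarrow> r < r1 \<Longrightarrow> \<bar>layer_volume \<Omega> r - P * r\<bar> \<le> \<eta> * r" using near[OF \<eta>] by blast
    define K where "K = (W + P * r1) / r1 powr q"
    have K: "0 \<le> K" using W P(1) r1 by (simp add: K_def)
    have "\<bar>layer_volume \<Omega> r - P * r\<bar> \<le> \<eta> * r + K * r powr q" if r: "0 \<le> r" for r
    proof -
      consider "r = 0" | "0 < r" "r < r1" | "r1 \<le> r" using r by linarith
      then show ?thesis
      proof cases
        case 1 then show ?thesis using G0 by simp
      next
        case 2
        have "0 \<le> K * r powr q" using K by simp
        then show ?thesis using r1(3)[OF 2] by linarith
      next
        case 3
        have "\<bar>layer_volume \<Omega> r - P * r\<bar> \<le> W + P * r"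
          using layer_volume_nonneg[of r] layer_volume_le[of r] mult_nonneg_nonneg[OF P(1) r] unfolding W_def abs_le_iff by linarith
        also have "\<dots> \<le> W * (r / r1) powr q + P * r1 * (r / r1) powr q"
        proof (rule add_mono)
          show "W \<le> W * (r / r1) powr q" using mult_left_mono[OF big[OF r1(1) 3, of q] W] q by simp
          have "r / r1 = (r / r1) powr 1" using r1 3 by simp
          also have "\<dots> \<le> (r / r1) powr q" using r1 3 q by (intro powr_mono) auto
          finally have "P * r1 * (r / r1) \<le> P * r1 * (r / r1) powr q" using P(1) r1 by (intro mult_left_mono) auto
          then show "P * r \<le> P * r1 * (r / r1) powr q" using r1 by simp
        qed
        also have "\<dots> = K * r powr q" using r1 r by (simp add: K_def powr_divide add_divide_distrib distrib_right)
        finally show ?thesis using \<eta> r by (simp add: add_increasing)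
      qed
    qed
    then show ?thesis using K by blast
  qed
  show "\<exists>K\<ge>0. \<forall>r\<ge>0. layer_volume \<Omega> r \<le> K * r powr (q / 2)"
  proof -
    obtain r1 where r1: "0 < r1" "r1 \<le> 1" "\<And>r. 0 < r \<Longrightarrow> r < r1 \<Longrightarrow> \<bar>layer_volume \<Omega> r - P * r\<bar> \<le> 1 * r" using near[of 1] by auto
    define K where "K = (P + 1) + W / r1 powr (q / 2)"
    have K: "0 \<le> K" "P + 1 \<le> K" using W P(1) r1 by (auto simp: K_def)
    have "layer_volume \<Omega> r \<le> K * r powr (q / 2)" if r: "0 \<le> r" for r
    proof -
      consider "r = 0" | "0 < r" "r < r1" | "r1 \<le> r" using r by linarith
      then show ?thesis
      proof cases
        case 1 then show ?thesis using G0 by simp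
      next
        case 2
        have "layer_volume \<Omega> r \<le> (P + 1) * r" using r1(3)[OF 2] by (simp add: distrib_right)
        also have "\<dots> \<le> K * r powr (q / 2)"
        proof (rule mult_mono)
          have "r = r powr 1" using 2 by simp
          also have "\<dots> \<le> r powr (q / 2)" using 2 r1 q by (intro powr_mono') auto
          finally show "r \<le> r powr (q / 2)" .
        qed (use K r in auto)
        finally show ?thesis .
      next
        case 3
        have "layer_volume \<Omega> r \<le> W * 1" using layer_volume_le[of r] by (simp add: W_def)
        also have "\<dots> \<le> W * (r / r1) powr (q / 2)" using big[OF r1(1) 3, of "q / 2"] W q by (intro mult_left_mono) auto
        also have "\<dots> = (W / r1 powr (q / 2)) * r powr (q / 2)" using r1 r by (simp add: powr_divide)
        also have "\<dots> \<le> K * r powr (q / 2)" using P(1) by (intro mult_right_mono) (auto simp: K_def)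
        finally show ?thesis .
      qed
    qed
    then show ?thesis using K by blast
  qed
qed

lemma square_powr_half: "0 \<le> (x::real) \<Longrightarrow> (x\<^sup>2) powr (q / 2) = x powr q"
  by (cases "x = 0") (simp_all add: powr_powr flip: powr_numeral)

text \<open>For fixed \<epsilon> the time limit turns the bounds into P / (1 - \<epsilon>) and P /
  (1 + \<epsilon>), and \<epsilon> is arbitrary.\<close>

lemma tendsto_by_squeezing:
  fixes V m :: "real \<Rightarrow> real"
  assumes m: "\<And>t. 0 < t \<Longrightarrow> 0 < m t" and P: "0 \<le> P"
    and up: "\<And>\<epsilon> t. 0 < \<epsilon> \<Longrightarrow> \<epsilon> < 1 / 2 \<Longrightarrow> 0 < t \<Longrightarrow> V t \<le> A (1 - \<epsilon>) t + D * B \<epsilon> t"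
    and low: "\<And>\<epsilon> t. 0 < \<epsilon> \<Longrightarrow> \<epsilon> < 1 / 2 \<Longrightarrow> 0 < t \<Longrightarrow> A (1 + \<epsilon>) t - D * B \<epsilon> t \<le> V t"
    and A: "\<And>c. 0 < c \<Longrightarrow> ((\<lambda>t. A c t / m t) \<longlongrightarrow> P / c) (at_right 0)"
    and B: "\<And>\<epsilon>. 0 < \<epsilon> \<Longrightarrow> \<epsilon> < 1 / 2 \<Longrightarrow> ((\<lambda>t. B \<epsilon> t / m t) \<longlongrightarrow> 0) (at_right 0)"
  shows "((\<lambda>t. V t / m t) \<longlongrightarrow> P) (at_right 0)"
proof (rule order_tendstoI)
  have pos: "\<forall>\<^sub>F t in at_right 0. (0::real) < t" by (simp add: eventually_at_filter)
  have pick: "\<exists>\<epsilon>. 0 < \<epsilon> \<and> \<epsilon> < 1 / 2 \<and> Q \<epsilon>" if ev: "\<forall>\<^sub>F \<epsilon> in at_right 0. Q \<epsilon>" for Q :: "real \<Rightarrow> bool"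
  proof -
    obtain b where b: "b > 0" "\<And>e. 0 < e \<Longrightarrow> e < b \<Longrightarrow> Q e" using ev unfolding eventually_at_right_field by auto
    then show ?thesis by (intro exI[of _ "min (b / 2) (1 / 4)"]) auto
  qed
  fix a
  { assume a: "P < a"
    have "((\<lambda>e. P / (1 - e)) \<longlongrightarrow> P / (1 - 0)) (at_right 0)" by (intro tendsto_intros) auto
    then have "\<forall>\<^sub>F e in at_right 0. P / (1 - e) < a" using a by (intro order_tendstoD) simp_all
    then obtain e where e: "0 < e" "e < 1 / 2" "P / (1 - e) < a" using pick by blast
    have "((\<lambda>t. A (1 - e) t / m t + D * (B e t / m t)) \<longlongrightarrow> P / (1 - e) + D * 0) (at_right 0)"
      using e by (intro tendsto_intros A B) auto
    then have "\<forall>\<^sub>F t in at_right 0. A (1 - e) t / m t + D * (B e t / m t) < a" using e by (intro order_tendstoD) simp_all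
    then show "\<forall>\<^sub>F t in at_right 0. V t / m t < a"
      using pos
    proof eventually_elim
      case (elim t)
      have "V t / m t \<le> (A (1 - e) t + D * B e t) / m t" using up[OF e(1,2) elim(2)] m[OF elim(2)] by (intro divide_right_mono) auto
      then show ?case using elim(1) by (simp add: add_divide_distrib)
    qed }
  { assume a: "a < P"
    have "((\<lambda>e. P / (1 + e)) \<longlongrightarrow> P / (1 + 0)) (at_right 0)" by (intro tendsto_intros) auto
    then have "\<forall>\<^sub>F e in at_right 0. a < P / (1 + e)" using a by (intro order_tendstoD) simp_all
    then obtain e where e: "0 < e" "e < 1 / 2" "a < P / (1 + e)" using pick by blast
    have "((\<lambda>t. A (1 + e) t / m t - D * (B e t / m t)) \<longlongrightarrow> P / (1 + e) - D * 0) (at_right 0)"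
      using e by (intro tendsto_intros A B) auto
    then have "\<forall>\<^sub>F t in at_right 0. a < A (1 + e) t / m t - D * (B e t / m t)" using e by (intro order_tendstoD) simp_all
    then show "\<forall>\<^sub>F t in at_right 0. a < V t / m t"
      using pos
    proof eventually_elim
      case (elim t)
      have "(A (1 + e) t - D * B e t) / m t \<le> V t / m t" using low[OF e(1,2) elim(2)] m[OF elim(2)] by (intro divide_right_mono) auto
      then show ?case using elim(1) by (simp add: diff_divide_distrib)
    qed }
qed

section \<open>Moments of the maximum against moments of the clock\<close>

context subordinated_stable
begin

text \<open>The 2 is an arbitrary choice of c > 1 in \<open>max_proj_moment\<close>.\<close>

lemma max_proj_integrable:
  assumes e: "norm e = 1" and q: "0 < q" "q < \<alpha>" and t: "0 \<le> t" and i: "integrable M (\<lambda>\<omega>. U t \<omega> powr (q / \<alpha>))"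
  shows "integrable M (\<lambda>\<omega>. max_proj e t \<omega> powr q)"
    "(\<integral>\<omega>. max_proj e t \<omega> powr q \<partial>M) \<le> enn2real (ennreal (2 powr (q / \<alpha>)) * sup_moment e q) * (\<integral>\<omega>. U t \<omega> powr (q / \<alpha>) \<partial>M)"
proof -
  note [measurable] = measurable_max_proj[OF t]
  let ?K = "ennreal (2 powr (q / \<alpha>)) * sup_moment e q"
  have u: "(\<integral>\<^sup>+\<omega>. ennreal (U t \<omega> powr (q / \<alpha>)) \<partial>M) = ennreal (\<integral>\<omega>. U t \<omega> powr (q / \<alpha>) \<partial>M)"
    using i by (intro nn_integral_eq_integral) auto
  have K: "?K < \<infinity>" using sup_moment_finite[OF e q] by (simp add: ennreal_mult_less_top)
  then obtain k where k: "0 \<le> k" "?K = ennreal k" by (cases ?K) auto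
  have u0: "0 \<le> (\<integral>\<omega>. U t \<omega> powr (q / \<alpha>) \<partial>M)" by (intro integral_nonneg_AE) auto
  have "(\<integral>\<^sup>+\<omega>. ennreal (max_proj e t \<omega> powr q) \<partial>M) \<le> ?K * ennreal (\<integral>\<omega>. U t \<omega> powr (q / \<alpha>) \<partial>M)"
    using max_proj_moment[OF e q(1) t, of 2] by (simp add: u)
  then have le: "(\<integral>\<^sup>+\<omega>. ennreal (max_proj e t \<omega> powr q) \<partial>M) \<le> ennreal (enn2real ?K * (\<integral>\<omega>. U t \<omega> powr (q / \<alpha>) \<partial>M))"
    unfolding k(2) using k(1) u0 by (simp add: ennreal_mult)
  then have "(\<integral>\<^sup>+\<omega>. ennreal (max_proj e t \<omega> powr q) \<partial>M) < \<infinity>" by (rule le_less_trans) simp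
  then show int: "integrable M (\<lambda>\<omega>. max_proj e t \<omega> powr q)" by (intro integrableI_bounded) auto
  have "0 \<le> (\<integral>\<omega>. U t \<omega> powr (q / \<alpha>) \<partial>M)" by (intro integral_nonneg_AE) auto
  then show "(\<integral>\<omega>. max_proj e t \<omega> powr q \<partial>M) \<le> enn2real ?K * (\<integral>\<omega>. U t \<omega> powr (q / \<alpha>) \<partial>M)"
    using le nn_integral_eq_integral[OF int] by (simp add: ennreal_le_iff)
qed

lemma max_proj_mean_ge:
  assumes e: "norm e = 1"
  obtains c where "0 < c" "\<And>t. 0 \<le> t \<Longrightarrow> integrable M (\<lambda>\<omega>. U t \<omega> powr (1 / \<alpha>)) \<Longrightarrow>
    c * (\<integral>\<omega>. U t \<omega> powr (1 / \<alpha>) \<partial>M) \<le> (\<integral>\<omega>. max_proj e t \<omega> \<partial>M)"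
proof -
  define c where "c = (\<integral>\<^sup>+\<omega>. ennreal (proj e 1 \<omega>) \<partial>M)"
  have c0: "0 < c" unfolding c_def by (rule stable_positive_part[OF proj[OF e]])
  have "c \<le> (\<integral>\<^sup>+\<omega>. ennreal (\<bar>proj e 1 \<omega>\<bar> powr 1) \<partial>M)" unfolding c_def by (intro nn_integral_mono ennreal_leI) simp
  also have "\<dots> < \<infinity>" using \<alpha> by (intro stable_moment_finite[OF proj[OF e]]) auto
  finally have c: "c = ennreal (enn2real c)" by simp
  show thesis
  proof (rule that)
    show "0 < enn2real c" using c0 c by (metis ennreal_less_zero_iff)
    fix t :: real assume t: "0 \<le> t" and i: "integrable M (\<lambda>\<omega>. U t \<omega> powr (1 / \<alpha>))"
    have im: "integrable M (\<lambda>\<omega>. max_proj e t \<omega>)"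
      using max_proj_integrable(1)[OF e _ _ t, of 1] \<alpha> i max_proj_nonneg by simp
    have u: "(\<integral>\<^sup>+\<omega>. ennreal (U t \<omega> powr (1 / \<alpha>)) \<partial>M) = ennreal (\<integral>\<omega>. U t \<omega> powr (1 / \<alpha>) \<partial>M)"
      using i by (intro nn_integral_eq_integral) auto
    have "ennreal (enn2real c) * ennreal (\<integral>\<omega>. U t \<omega> powr (1 / \<alpha>) \<partial>M) \<le> (\<integral>\<^sup>+\<omega>. ennreal (max_proj e t \<omega>) \<partial>M)"
      using max_proj_mean_lower[OF e t] by (simp only: c_def[symmetric] c[symmetric] u)
    also have "\<dots> = ennreal (\<integral>\<omega>. max_proj e t \<omega> \<partial>M)" using im max_proj_nonneg by (intro nn_integral_eq_integral) auto
    finally show "enn2real c * (\<integral>\<omega>. U t \<omega> powr (1 / \<alpha>) \<partial>M) \<le> (\<integral>\<omega>. max_proj e t \<omega> \<partial>M)"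
      by (simp add: ennreal_mult[symmetric] ennreal_le_iff max_proj_nonneg)
  qed
qed

end

theorem heat_loss_asymptotics:
  fixes Y :: "real \<Rightarrow> 'w \<Rightarrow> real^'d::finite" and \<Omega> :: "(real^'d) set"
  assumes "subordinated_stable M \<alpha> Y U G" and "two_ball_domain \<Omega> r0" and ne: "frontier \<Omega> \<noteq> {}"
    and e: "norm e = 1" and q: "1 < q" "q < \<alpha>" "q \<le> 2"
    and i1: "\<And>t. 0 \<le> t \<Longrightarrow> integrable M (\<lambda>\<omega>. U t \<omega> powr (1 / \<alpha>))"
    and iq: "\<And>t. 0 \<le> t \<Longrightarrow> integrable M (\<lambda>\<omega>. U t \<omega> powr (q / \<alpha>))"
    and pos: "\<And>t. 0 < t \<Longrightarrow> 0 < (\<integral>\<omega>. U t \<omega> powr (1 / \<alpha>) \<partial>M)"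
    and lim: "((\<lambda>t. (\<integral>\<omega>. U t \<omega> powr (q / \<alpha>) \<partial>M) / (\<integral>\<omega>. U t \<omega> powr (1 / \<alpha>) \<partial>M)) \<longlongrightarrow> 0) (at_right 0)"
    and P: "0 \<le> P" "((\<lambda>r. layer_volume \<Omega> r / r) \<longlongrightarrow> P) (at_right 0)"
  defines "m \<equiv> \<lambda>t. \<integral>\<omega>. subordinated_stable.max_proj Y U e t \<omega> \<partial>M"
  shows "((\<lambda>t. (measure lebesgue \<Omega> - spectral_heat_content M (time_change Y U) \<Omega> t) / m t) \<longlongrightarrow> P) (at_right 0)"
proof -
  interpret subordinated_stable M \<alpha> Y U G by fact
  interpret \<Omega>: two_ball_domain \<Omega> r0 by fact
  define S where "S = max_proj e"
  have S0: "0 \<le> S t \<omega>" for t \<omega> by (simp add: S_def max_proj_nonneg)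
  have mS: "S t \<in> borel_measurable M" if "0 \<le> t" for t unfolding S_def by (rule measurable_max_proj[OF that])
  obtain c where c: "0 < c" "\<And>t. 0 \<le> t \<Longrightarrow> c * (\<integral>\<omega>. U t \<omega> powr (1 / \<alpha>) \<partial>M) \<le> m t"
    using max_proj_mean_ge[OF e] i1 unfolding m_def by metis
  have m0: "0 < m t" if "0 < t" for t
    using c(2)[of t] mult_pos_pos[OF c(1) pos[OF that]] that by linarith
  define K where "K = enn2real (ennreal (2 powr (q / \<alpha>)) * sup_moment e q)"
  define s where "s t = (\<integral>\<omega>. S t \<omega> powr q \<partial>M)" for t
  have iS: "integrable M (S t)" if "0 \<le> t" for t
    using max_proj_integrable(1)[OF e _ _ that, of 1] \<alpha> i1[OF that] max_proj_nonneg by (simp add: S_def)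
  have iSq: "integrable M (\<lambda>\<omega>. S t \<omega> powr q)" if "0 \<le> t" for t
    unfolding S_def using q by (intro max_proj_integrable(1)[OF e _ _ that iq[OF that]]) auto
  have mt: "m t = (\<integral>\<omega>. S t \<omega> \<partial>M)" for t by (simp add: m_def S_def)
  have s0: "0 \<le> s t" for t unfolding s_def by (intro integral_nonneg_AE) auto
  have evp: "\<forall>\<^sub>F t in at_right 0. (0::real) < t" by (simp add: eventually_at_filter)
  \<comment> \<open>The q-th moment of the maximum is at most a multiple of that of
    \<open>(U t) powr (1 / \<alpha>)\<close>, and its mean at least a multiple of the corresponding
    mean, so the hypothesis on \<open>U\<close> passes to the maximum. Both the main term and the
    error term reduce to this.\<close>
  have slim: "((\<lambda>t. s t / m t) \<longlongrightarrow> 0) (at_right 0)"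
  proof (rule tendsto_sandwich[of "\<lambda>_. 0"])
    show "((\<lambda>t. (K / c) * ((\<integral>\<omega>. U t \<omega> powr (q / \<alpha>) \<partial>M) / (\<integral>\<omega>. U t \<omega> powr (1 / \<alpha>) \<partial>M))) \<longlongrightarrow> 0) (at_right 0)"
      using tendsto_mult_left[OF lim, of "K / c"] by simp
    show "\<forall>\<^sub>F t in at_right 0. 0 \<le> s t / m t"
      using evp by eventually_elim (simp add: s0 less_imp_le[OF m0])
    show "\<forall>\<^sub>F t in at_right 0. s t / m t \<le> (K / c) * ((\<integral>\<omega>. U t \<omega> powr (q / \<alpha>) \<partial>M) / (\<integral>\<omega>. U t \<omega> powr (1 / \<alpha>) \<partial>M))"
      using evp
    proof eventually_elim
      case (elim t)
      then have t: "0 \<le> t" by simp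
      let ?u = "\<integral>\<omega>. U t \<omega> powr (1 / \<alpha>) \<partial>M" and ?v = "\<integral>\<omega>. U t \<omega> powr (q / \<alpha>) \<partial>M"
      have "s t \<le> K * ?v" unfolding s_def S_def K_def using q by (intro max_proj_integrable(2)[OF e _ _ t iq[OF t]]) auto
      then have "s t / m t \<le> (K * ?v) / m t" using m0[OF elim] by (intro divide_right_mono) auto
      also have "\<dots> \<le> (K * ?v) / (c * ?u)"
      proof (rule divide_left_mono[OF c(2)[OF t]])
        have "0 \<le> ?v" by (intro integral_nonneg_AE) auto
        then show "0 \<le> K * ?v" by (simp add: K_def)
        show "0 < m t * (c * ?u)" using m0[OF elim] c(1) pos[OF elim] by simp
      qed
      finally show ?case by simp
    qed
  qed simp
  define A where "A a t = (\<integral>\<omega>. layer_volume \<Omega> (S t \<omega> / a) \<partial>M)" for a t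
  define b where "b \<epsilon> = (\<epsilon> / 2) * r0 / (real CARD('d))\<^sup>2" for \<epsilon>
  define B where "B \<epsilon> t = (\<integral>\<omega>. layer_volume \<Omega> ((S t \<omega>)\<^sup>2 / b \<epsilon>) \<partial>M)" for \<epsilon> t
  have Alim: "((\<lambda>t. A a t / m t) \<longlongrightarrow> P / a) (at_right 0)" if a: "0 < a" for a
  proof (rule tendstoI)
    fix k :: real assume k: "0 < k"
    \<comment> \<open>After division by a the linear error contributes exactly k / 2.\<close>
    define \<eta> where "\<eta> = k * a / 2"
    have \<eta>: "0 < \<eta>" using k a by (simp add: \<eta>_def)
    obtain L where L: "0 \<le> L" "\<And>r. 0 \<le> r \<Longrightarrow> \<bar>layer_volume \<Omega> r - P * r\<bar> \<le> \<eta> * r + L * r powr q"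
      using \<Omega>.layer_volume_bounds(1)[OF P q(1,3) \<eta>] by blast
    have "((\<lambda>t. L / a powr q * (s t / m t)) \<longlongrightarrow> L / a powr q * 0) (at_right 0)" by (intro tendsto_mult_left slim)
    then have "((\<lambda>t. L / a powr q * (s t / m t)) \<longlongrightarrow> 0) (at_right 0)" by (simp only: mult_zero_right)
    then have "\<forall>\<^sub>F t in at_right 0. L / a powr q * (s t / m t) < k / 2" using half_gt_zero[OF k] by (rule order_tendstoD)
    then show "\<forall>\<^sub>F t in at_right 0. dist (A a t / m t) (P / a) < k"
      using evp
    proof eventually_elim
      case (elim t)
      then have t: "0 \<le> t" by simp
      have mm: "(\<lambda>\<omega>. S t \<omega> / a) \<in> borel_measurable M" using mS[OF t] by simp
      have il: "integrable M (\<lambda>\<omega>. layer_volume \<Omega> (S t \<omega> / a))" by (rule \<Omega>.layer_volume_fubini(3)[OF prob_space_axioms mm])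
      have i2: "integrable M (\<lambda>\<omega>. P * (S t \<omega> / a))" using iS[OF t] by simp
      have i3: "integrable M (\<lambda>\<omega>. \<eta> * (S t \<omega> / a) + L / a powr q * S t \<omega> powr q)" using iS[OF t] iSq[OF t] by simp
      have "\<bar>A a t - P * m t / a\<bar> = \<bar>\<integral>\<omega>. layer_volume \<Omega> (S t \<omega> / a) - P * (S t \<omega> / a) \<partial>M\<bar>"
        using il i2 by (simp add: A_def mt)
      also have "\<dots> \<le> (\<integral>\<omega>. \<bar>layer_volume \<Omega> (S t \<omega> / a) - P * (S t \<omega> / a)\<bar> \<partial>M)" by (rule integral_abs_bound)
      also have "\<dots> \<le> (\<integral>\<omega>. \<eta> * (S t \<omega> / a) + L / a powr q * S t \<omega> powr q \<partial>M)"
      proof (rule integral_mono[OF _ i3])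
        show "integrable M (\<lambda>\<omega>. \<bar>layer_volume \<Omega> (S t \<omega> / a) - P * (S t \<omega> / a)\<bar>)" using il i2 by simp
        fix \<omega> show "\<bar>layer_volume \<Omega> (S t \<omega> / a) - P * (S t \<omega> / a)\<bar> \<le> \<eta> * (S t \<omega> / a) + L / a powr q * S t \<omega> powr q"
          using L(2)[of "S t \<omega> / a"] S0[of t \<omega>] a by (simp add: powr_divide)
      qed
      also have "\<dots> = \<eta> * (m t / a) + L / a powr q * s t" using iS[OF t] iSq[OF t] by (simp add: mt s_def)
      finally have le: "\<bar>A a t - P * m t / a\<bar> \<le> \<eta> * (m t / a) + L / a powr q * s t" .
      have mp: "0 < m t" by (rule m0[OF elim(2)])
      have "dist (A a t / m t) (P / a) = \<bar>A a t - P * m t / a\<bar> / m t"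
      proof -
        have "A a t / m t - P / a = (A a t - P * m t / a) / m t" using mp by (simp add: diff_divide_distrib)
        then show ?thesis using mp by (simp add: dist_real_def)
      qed
      also have "\<dots> \<le> (\<eta> * (m t / a) + L / a powr q * s t) / m t" using le mp by (intro divide_right_mono) auto
      also have "\<dots> = k / 2 + L / a powr q * (s t / m t)" using mp a by (simp add: add_divide_distrib \<eta>_def)
      finally show ?case using elim(1) by linarith
    qed
  qed
  have Blim: "((\<lambda>t. B \<epsilon> t / m t) \<longlongrightarrow> 0) (at_right 0)" if \<epsilon>: "0 < \<epsilon>" for \<epsilon>
  proof -
    have b0: "0 < b \<epsilon>" using \<epsilon> \<Omega>.r0 by (simp add: b_def)
    obtain L where L: "0 \<le> L" "\<And>r. 0 \<le> r \<Longrightarrow> layer_volume \<Omega> r \<le> L * r powr (q / 2)"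
      using \<Omega>.layer_volume_bounds(2)[OF P q(1,3)] by blast
    define L' where "L' = L / b \<epsilon> powr (q / 2)"
    show ?thesis
    proof (rule tendsto_sandwich[of "\<lambda>_. 0"])
      show "((\<lambda>t. L' * (s t / m t)) \<longlongrightarrow> 0) (at_right 0)" using tendsto_mult_left[OF slim, of L'] by simp
      show "\<forall>\<^sub>F t in at_right 0. 0 \<le> B \<epsilon> t / m t"
        using evp by eventually_elim (auto simp: B_def less_imp_le[OF m0] intro!: divide_nonneg_nonneg integral_nonneg_AE \<Omega>.layer_volume_nonneg)
      show "\<forall>\<^sub>F t in at_right 0. B \<epsilon> t / m t \<le> L' * (s t / m t)"
        using evp
      proof eventually_elim
        case (elim t)
        then have t: "0 \<le> t" by simp
        have mm: "(\<lambda>\<omega>. (S t \<omega>)\<^sup>2 / b \<epsilon>) \<in> borel_measurable M" using mS[OF t] by simp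
        have "B \<epsilon> t \<le> (\<integral>\<omega>. L' * S t \<omega> powr q \<partial>M)"
          unfolding B_def
        proof (rule integral_mono)
          show "integrable M (\<lambda>\<omega>. layer_volume \<Omega> ((S t \<omega>)\<^sup>2 / b \<epsilon>))" by (rule \<Omega>.layer_volume_fubini(3)[OF prob_space_axioms mm])
          show "integrable M (\<lambda>\<omega>. L' * S t \<omega> powr q)" using iSq[OF t] by simp
          fix \<omega>
          show "layer_volume \<Omega> ((S t \<omega>)\<^sup>2 / b \<epsilon>) \<le> L' * S t \<omega> powr q"
            using L(2)[of "(S t \<omega>)\<^sup>2 / b \<epsilon>"] b0 S0[of t \<omega>] by (simp add: powr_divide square_powr_half L'_def)
        qed
        also have "\<dots> = L' * s t" by (simp add: s_def)
        finally have "B \<epsilon> t / m t \<le> (L' * s t) / m t" using m0[OF elim] by (intro divide_right_mono) auto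
        then show ?case by simp
      qed
    qed simp
  qed
  show ?thesis
  proof (rule tendsto_by_squeezing[where A = A and B = B and D = "2 * real CARD('d)"])
    fix \<epsilon> t :: real assume \<epsilon>: "0 < \<epsilon>" "\<epsilon> < 1 / 2" and t: "0 < t"
    note hb = heat_loss_bounds[OF subordinated_stable_axioms \<Omega>.two_ball_domain_axioms ne less_imp_le[OF t] e \<epsilon>]
    show "measure lebesgue \<Omega> - spectral_heat_content M (time_change Y U) \<Omega> t \<le> A (1 - \<epsilon>) t + 2 * real CARD('d) * B \<epsilon> t"
      using hb(1) by (simp only: A_def B_def b_def S_def)
    show "A (1 + \<epsilon>) t - 2 * real CARD('d) * B \<epsilon> t \<le> measure lebesgue \<Omega> - spectral_heat_content M (time_change Y U) \<Omega> t"
      using hb(2) by (simp only: A_def B_def b_def S_def)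
  qed (use m0 P(1) Alim Blim in auto)
qed

text \<open>The line is split at \<eta>: below it \<open>x powr (q - 1)\<close> is controlled, above
  it \<open>x powr (q - p)\<close>.\<close>

lemma powr_interpolation:
  fixes x :: real
  assumes "0 \<le> x" "0 < \<eta>" "1 < q" "q \<le> p"
  shows "x powr q \<le> \<eta> powr (q - 1) * x + \<eta> powr (q - p) * x powr p"
proof (cases "x = 0")
  case True then show ?thesis by simp
next
  case False
  then have x: "0 < x" using assms by simp
  show ?thesis
  proof (cases "x \<le> \<eta>")
    case True
    have "x powr q = x powr (q - 1) * x" using x by (simp add: powr_diff)
    also have "\<dots> \<le> \<eta> powr (q - 1) * x" using True assms by (intro mult_right_mono powr_mono2) auto
    finally show ?thesis by (simp add: add_increasing2)
  next
    case False
    have "x powr q = x powr (q - p) * x powr p" using x by (simp add: powr_diff)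
    also have "\<dots> \<le> \<eta> powr (q - p) * x powr p" using False assms by (intro mult_right_mono powr_mono2') auto
    finally show ?thesis using assms by (simp add: add_increasing)
  qed
qed

text \<open>The moment bounds for the maximum require an exponent below \<alpha>, which p need not
  be. In the interpolated bound the first term contributes an arbitrarily small constant to the
  ratio, and with \<eta> fixed the second vanishes by hypothesis.\<close>

lemma moment_ratio_smaller_exponent:
  fixes U :: "real \<Rightarrow> 'w \<Rightarrow> real"
  assumes M: "prob_space M" and \<alpha>: "0 < \<alpha>" and q: "1 < q" "q \<le> p"
    and mU: "\<And>t. 0 \<le> t \<Longrightarrow> U t \<in> borel_measurable M" 
    and ip: "\<And>t. 0 \<le> t \<Longrightarrow> integrable M (\<lambda>\<omega>. U t \<omega> powr (p / \<alpha>))"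
    and pos: "\<And>t. 0 < t \<Longrightarrow> 0 < (\<integral>\<omega>. U t \<omega> powr (1 / \<alpha>) \<partial>M)"
    and lim: "((\<lambda>t. (\<integral>\<omega>. U t \<omega> powr (p / \<alpha>) \<partial>M) / (\<integral>\<omega>. U t \<omega> powr (1 / \<alpha>) \<partial>M)) \<longlongrightarrow> 0) (at_right 0)"
  shows "\<And>t. 0 \<le> t \<Longrightarrow> integrable M (\<lambda>\<omega>. U t \<omega> powr (1 / \<alpha>))"
    and "\<And>t. 0 \<le> t \<Longrightarrow> integrable M (\<lambda>\<omega>. U t \<omega> powr (q / \<alpha>))"
    and "((\<lambda>t. (\<integral>\<omega>. U t \<omega> powr (q / \<alpha>) \<partial>M) / (\<integral>\<omega>. U t \<omega> powr (1 / \<alpha>) \<partial>M)) \<longlongrightarrow> 0) (at_right 0)"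
proof -
  interpret prob_space M by fact
  have pw: "u powr (r / \<alpha>) = (u powr (1 / \<alpha>)) powr r" for u r :: real by (simp add: powr_powr)
  show i1: "integrable M (\<lambda>\<omega>. U t \<omega> powr (1 / \<alpha>))" if t: "0 \<le> t" for t
  proof (rule Bochner_Integration.integrable_bound)
    show "integrable M (\<lambda>\<omega>. 1 + U t \<omega> powr (p / \<alpha>))" using ip[OF t] by simp
    show "AE \<omega> in M. norm (U t \<omega> powr (1 / \<alpha>)) \<le> norm (1 + U t \<omega> powr (p / \<alpha>))"
    proof (rule AE_I2)
      fix \<omega>
      define x where "x = U t \<omega> powr (1 / \<alpha>)"
      have "x \<le> 1 + x powr p"
      proof (cases "x \<le> 1")
        case False
        then have "x powr 1 \<le> x powr p" using q by (intro powr_mono) auto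
        then show ?thesis using False by simp
      qed (simp add: add_increasing2)
      then show "norm (U t \<omega> powr (1 / \<alpha>)) \<le> norm (1 + U t \<omega> powr (p / \<alpha>))" unfolding pw[of _ p] x_def[symmetric] by (simp add: x_def)
    qed
    show "(\<lambda>\<omega>. U t \<omega> powr (1 / \<alpha>)) \<in> borel_measurable M" using mU[OF t] by measurable
  qed
  have interp: "U t \<omega> powr (q / \<alpha>) \<le> \<eta> powr (q - 1) * U t \<omega> powr (1 / \<alpha>) + \<eta> powr (q - p) * U t \<omega> powr (p / \<alpha>)"
    if "0 < \<eta>" for \<eta> t \<omega>
    unfolding pw[of _ q] pw[of _ p] using that q by (intro powr_interpolation) auto
  show iq: "integrable M (\<lambda>\<omega>. U t \<omega> powr (q / \<alpha>))" if t: "0 \<le> t" for t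
  proof (rule Bochner_Integration.integrable_bound)
    show "integrable M (\<lambda>\<omega>. U t \<omega> powr (1 / \<alpha>) + U t \<omega> powr (p / \<alpha>))" using ip[OF t] i1[OF t] by simp
    show "AE \<omega> in M. norm (U t \<omega> powr (q / \<alpha>)) \<le> norm (U t \<omega> powr (1 / \<alpha>) + U t \<omega> powr (p / \<alpha>))"
      using interp[of 1 t] by (intro AE_I2) (simp add: add_nonneg_nonneg)
    show "(\<lambda>\<omega>. U t \<omega> powr (q / \<alpha>)) \<in> borel_measurable M" using mU[OF t] by measurable
  qed
  show "((\<lambda>t. (\<integral>\<omega>. U t \<omega> powr (q / \<alpha>) \<partial>M) / (\<integral>\<omega>. U t \<omega> powr (1 / \<alpha>) \<partial>M)) \<longlongrightarrow> 0) (at_right 0)"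
  proof (rule tendstoI)
    fix k :: real assume k: "0 < k"
    \<comment> \<open>Solves \<open>\<eta> powr (q - 1) = k / 2\<close>.\<close>
    define \<eta> where "\<eta> = (k / 2) powr (1 / (q - 1))"
    have \<eta>: "0 < \<eta>" "\<eta> powr (q - 1) = k / 2" using k q by (auto simp: \<eta>_def powr_powr)
    define R where "R t = (\<integral>\<omega>. U t \<omega> powr (p / \<alpha>) \<partial>M) / (\<integral>\<omega>. U t \<omega> powr (1 / \<alpha>) \<partial>M)" for t
    have "((\<lambda>t. \<eta> powr (q - p) * R t) \<longlongrightarrow> 0) (at_right 0)"
      using tendsto_mult_left[OF lim, of "\<eta> powr (q - p)"] unfolding R_def by (simp only: mult_zero_right)
    then have "\<forall>\<^sub>F t in at_right 0. \<eta> powr (q - p) * R t < k / 2" using half_gt_zero[OF k] by (rule order_tendstoD)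
    moreover have "\<forall>\<^sub>F t in at_right 0. (0::real) < t" by (simp add: eventually_at_filter)
    ultimately show "\<forall>\<^sub>F t in at_right 0. dist ((\<integral>\<omega>. U t \<omega> powr (q / \<alpha>) \<partial>M) / (\<integral>\<omega>. U t \<omega> powr (1 / \<alpha>) \<partial>M)) 0 < k"
    proof eventually_elim
      case (elim t)
      then have t: "0 \<le> t" by simp
      let ?u = "\<integral>\<omega>. U t \<omega> powr (1 / \<alpha>) \<partial>M" and ?v = "\<integral>\<omega>. U t \<omega> powr (p / \<alpha>) \<partial>M"
      have u: "0 < ?u" by (rule pos[OF elim(2)])
      have "(\<integral>\<omega>. U t \<omega> powr (q / \<alpha>) \<partial>M) \<le> (\<integral>\<omega>. \<eta> powr (q - 1) * U t \<omega> powr (1 / \<alpha>) + \<eta> powr (q - p) * U t \<omega> powr (p / \<alpha>) \<partial>M)"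
        using iq[OF t] i1[OF t] ip[OF t] interp[OF \<eta>(1)] by (intro integral_mono) auto
      also have "\<dots> = k / 2 * ?u + \<eta> powr (q - p) * ?v" using i1[OF t] ip[OF t] by (simp add: \<eta>(2))
      finally have "(\<integral>\<omega>. U t \<omega> powr (q / \<alpha>) \<partial>M) / ?u \<le> (k / 2 * ?u + \<eta> powr (q - p) * ?v) / ?u"
        using u by (intro divide_right_mono) auto
      also have "\<dots> = k / 2 + \<eta> powr (q - p) * R t" using u by (simp add: add_divide_distrib R_def)
      also have "\<dots> < k" using elim(1) by linarith
      finally have "(\<integral>\<omega>. U t \<omega> powr (q / \<alpha>) \<partial>M) / ?u < k" .
      moreover have "0 \<le> (\<integral>\<omega>. U t \<omega> powr (q / \<alpha>) \<partial>M) / ?u" using u by (intro divide_nonneg_nonneg integral_nonneg_AE) auto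
      ultimately show ?case by (simp add: dist_real_def)
    qed
  qed
qed

text \<open>The events of a deterministic process are trivial. Applied to the clock
  \<open>t\<close>, this makes \<open>Y\<close> itself a subordinated process, so that its supremum
  is covered by the results for \<open>X\<close>.\<close>

lemma indep_processes_deterministic:
  fixes Y :: "real \<Rightarrow> 'w \<Rightarrow> 'b::topological_space" and f :: "real \<Rightarrow> 'c::topological_space"
  assumes M: "prob_space M" and mY: "\<And>t. 0 \<le> t \<Longrightarrow> Y t \<in> borel_measurable M"
  shows "indep_processes M Y (\<lambda>t \<omega>. f t)"
proof -
  interpret prob_space M by fact
  let ?P = "\<lambda>T. Pi\<^sub>M {0::real..} (\<lambda>_. T)"
  have sub: "process_events M Z \<subseteq> events" if mZ: "\<And>t. 0 \<le> t \<Longrightarrow> Z t \<in> borel_measurable M" for Z :: "real \<Rightarrow> 'w \<Rightarrow> 'z::topological_space"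
  proof -
    have "(\<lambda>\<omega>. \<lambda>t\<in>{0..}. Z t \<omega>) \<in> measurable M (?P borel)" using mZ by (intro measurable_restrict) auto
    then show ?thesis unfolding process_events_def sets_vimage_algebra
      by (intro sets.sigma_sets_subset) (auto dest: measurable_sets)
  qed
  have triv: "process_events M (\<lambda>t \<omega>. f t) \<subseteq> {{}, space M}"
  proof
    fix B assume "B \<in> process_events M (\<lambda>t \<omega>. f t)"
    then have "B \<in> sigma_sets (space M) {(\<lambda>\<omega>. \<lambda>t\<in>{0..}. f t) -` A \<inter> space M |A. A \<in> sets (?P borel)}"
      unfolding process_events_def sets_vimage_algebra .
    then show "B \<in> {{}, space M}"
    proof induction
      case (Basic a)
      then obtain A where "a = (\<lambda>\<omega>. \<lambda>t\<in>{0..}. f t) -` A \<inter> space M" by blast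
      then show ?case by (cases "(\<lambda>t\<in>{0..}. f t) \<in> A") auto
    next
      case (Compl a) then show ?case by auto
    next
      case (Union a) then show ?case by blast
    qed simp
  qed
  have "prob (a \<inter> b) = prob a * prob b" if "a \<in> process_events M Y" "b \<in> process_events M (\<lambda>t \<omega>. f t)" for a b
  proof -
    have a: "a \<in> events" by (rule subsetD[OF sub[OF mY] that(1)])
    have "b \<in> {{}, space M}" by (rule subsetD[OF triv that(2)])
    then consider "b = {}" | "b = space M" by blast
    then show ?thesis using sets.sets_into_space[OF a] by cases (auto simp: prob_space Int_absorb2)
  qed
  then show ?thesis unfolding indep_processes_def indep_sets2_eq using sub[OF mY] sub[of "\<lambda>t \<omega>. f t"] by simp
qed

lemma (in subordinated_stable) mean_sup_eq:
  assumes t: "0 \<le> t" and e: "\<And>y. e \<bullet> y = h y"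
  shows "(\<integral>\<omega>. (SUP s\<in>{0..t}. h (X s \<omega>)) \<partial>completion M) = (\<integral>\<omega>. max_proj e t \<omega> \<partial>M)"
proof (rule integral_completion_AE[OF measurable_max_proj[OF t]])
  show "AE \<omega> in M. max_proj e t \<omega> = (SUP s\<in>{0..t}. h (X s \<omega>))"
    using G(2) by eventually_elim (simp add: max_proj_good(1)[OF _ t] e)
qed

lemma (in subordinated_stable) mean_max_proj_continuous:
  assumes e: "norm e = 1" and t: "0 \<le> t" and cont: "AE \<omega> in M. continuous_on {0..} (\<lambda>t. U t \<omega>)"
    and i: "integrable M (\<lambda>\<omega>. U t \<omega> powr (1 / \<alpha>))"
  shows "(\<integral>\<omega>. max_proj e t \<omega> \<partial>M) = enn2real (sup_moment e 1) * (\<integral>\<omega>. U t \<omega> powr (1 / \<alpha>) \<partial>M)"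
proof -
  have u: "(\<integral>\<^sup>+\<omega>. ennreal (U t \<omega> powr (1 / \<alpha>)) \<partial>M) = ennreal (\<integral>\<omega>. U t \<omega> powr (1 / \<alpha>) \<partial>M)"
    using i by (intro nn_integral_eq_integral) auto
  have u0: "0 \<le> (\<integral>\<omega>. U t \<omega> powr (1 / \<alpha>) \<partial>M)" by (intro integral_nonneg_AE) auto
  have "(\<integral>\<^sup>+\<omega>. ennreal (max_proj e t \<omega>) \<partial>M) = sup_moment e 1 * ennreal (\<integral>\<omega>. U t \<omega> powr (1 / \<alpha>) \<partial>M)"
    using max_proj_mean_continuous[OF e t cont] by (simp add: u)
  then have "enn2real (\<integral>\<^sup>+\<omega>. ennreal (max_proj e t \<omega>) \<partial>M) = enn2real (sup_moment e 1) * (\<integral>\<omega>. U t \<omega> powr (1 / \<alpha>) \<partial>M)"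
    using u0 by (simp add: enn2real_mult)
  then show ?thesis
    using measurable_max_proj[OF t] max_proj_nonneg by (subst integral_eq_nn_integral) auto
qed

theorem proposition2p3:
  fixes M :: "'w measure"
    and Y :: "real \<Rightarrow> 'w \<Rightarrow> real^'d"
    and U :: "real \<Rightarrow> 'w \<Rightarrow> real"
    and X :: "real \<Rightarrow> 'w \<Rightarrow> real^'d"
    and \<alpha> p :: real
    and k :: "'d::finite"  \<comment> \<open>the index of the first coordinate\<close>
  assumes "1 < \<alpha>" "\<alpha> \<le> 2"
    and "isotropic_stable_process M \<alpha> Y"
    and "\<And>t. 0 \<le> t \<Longrightarrow> U t \<in> borel_measurable M"
    and "AE \<omega> in M. U 0 \<omega> = 0 \<and> (\<forall>t\<ge>0. 0 \<le> U t \<omega>) \<and>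
           mono_on {0..} (\<lambda>t. U t \<omega>) \<and> cadlag (\<lambda>t. U t \<omega>)"
    and "indep_processes M Y U"
    and "X = time_change Y U"
    and "1 < p"
    and "\<And>t. 0 \<le> t \<Longrightarrow> integrable M (\<lambda>\<omega>. U t \<omega> powr (p / \<alpha>))"
    and "\<And>t. 0 < t \<Longrightarrow> 0 < (\<integral>\<omega>. U t \<omega> powr (1 / \<alpha>) \<partial>M)"
    and "((\<lambda>t. (\<integral>\<omega>. U t \<omega> powr (p / \<alpha>) \<partial>M) / (\<integral>\<omega>. U t \<omega> powr (1 / \<alpha>) \<partial>M))
           \<longlongrightarrow> 0) (at_right 0)"
  shows "(\<forall>\<Omega> :: (real^'d) set.
            open \<Omega> \<longrightarrow> bounded \<Omega> \<longrightarrow> C1_holder_boundary 1 \<Omega> \<longrightarrow>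
            ((\<lambda>t. ereal ((measure lebesgue \<Omega> - spectral_heat_content M X \<Omega> t) / mean_sup M k X t))
               \<longlongrightarrow> perimeter \<Omega>) (at_right 0)) \<and>
         ((AE \<omega> in M. continuous_on {0..} (\<lambda>t. U t \<omega>)) \<longrightarrow>
            (\<forall>t\<ge>0. mean_sup M k X t
                     = mean_sup M k Y 1 * (\<integral>\<omega>. U t \<omega> powr (1 / \<alpha>) \<partial>M)))"
proof -
  note Y = assms(3)
  interpret prob_space M by (rule isotropic_stable_processD(1)[OF Y])
  have "AE \<omega> in M. good_paths (\<lambda>t. Y t \<omega>) (\<lambda>t. U t \<omega>) \<and> good_paths (\<lambda>t. Y t \<omega>) (\<lambda>t. t)"
    using assms(5) isotropic_stable_processD(3,4)[OF Y]
  proof eventually_elim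
    case (elim \<omega>)
    have "cadlag (\<lambda>t::real. t)" by (auto simp: cadlag_def)
    then show ?case using elim by (auto simp: good_paths_def mono_on_def)
  qed
  \<comment> \<open>The set of good sample points need not be measurable, so \<open>G\<close> is the
    complement of a measurable null set.\<close>
  then obtain N where N': "{\<omega> \<in> space M. \<not> (good_paths (\<lambda>t. Y t \<omega>) (\<lambda>t. U t \<omega>) \<and> good_paths (\<lambda>t. Y t \<omega>) (\<lambda>t. t))} \<subseteq> N"
    and N0: "N \<in> null_sets M" unfolding eventually_ae_filter by blast
  have N: "good_paths (\<lambda>t. Y t \<omega>) (\<lambda>t. U t \<omega>) \<and> good_paths (\<lambda>t. Y t \<omega>) (\<lambda>t. t)" if "\<omega> \<in> space M - N" for \<omega>
    using N' that by blast
  define G where "G = space M - N"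
  have G: "G \<in> sets M" "AE \<omega> in M. \<omega> \<in> G"
    using N0 AE_not_in[OF N0] AE_space[of M] by (auto simp: G_def elim: eventually_elim2)
  interpret S: subordinated_stable M \<alpha> Y U G
    using assms(1) Y assms(4,6) G N by unfold_locales (auto simp: G_def)
  interpret S1: subordinated_stable M \<alpha> Y "\<lambda>t \<omega>. t" G
    using assms(1) Y indep_processes_deterministic[OF prob_space_axioms isotropic_stable_processD(2)[OF Y], of "\<lambda>t. t"] G N
    by unfold_locales (auto simp: G_def)
  let ?e = "axis k 1 :: real^'d"
  have e: "norm ?e = 1" by (simp add: norm_axis_1)
  have inner: "?e \<bullet> y = y $ k" for y :: "real^'d" by (simp add: inner_axis')
  \<comment> \<open>The midpoint of 1 and \<alpha> lies strictly between them, and \<alpha> at most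
    2 gives q at most 2.\<close>
  define q where "q = min p ((1 + \<alpha>) / 2)"
  have q: "1 < q" "q < \<alpha>" "q \<le> 2" "q \<le> p" using assms(1,2,8) by (auto simp: q_def min_def)
  have \<alpha>0: "0 < \<alpha>" using assms(1) by simp
  note mr0 = moment_ratio_smaller_exponent[where U = U and p = p and q = q, OF prob_space_axioms \<alpha>0 q(1,4)]
  have mr1: "integrable M (\<lambda>\<omega>. U t \<omega> powr (1 / \<alpha>))" "integrable M (\<lambda>\<omega>. U t \<omega> powr (q / \<alpha>))" if "0 \<le> t" for t
    by (rule mr0(1); (fact assms | fact that)) (rule mr0(2); (fact assms | fact that))
  have mr2: "((\<lambda>t. (\<integral>\<omega>. U t \<omega> powr (q / \<alpha>) \<partial>M) / (\<integral>\<omega>. U t \<omega> powr (1 / \<alpha>) \<partial>M)) \<longlongrightarrow> 0) (at_right 0)"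
    by (rule mr0(3); fact assms)
  have m: "mean_sup M k X t = (\<integral>\<omega>. S.max_proj ?e t \<omega> \<partial>M)" if "0 \<le> t" for t
    using S.mean_sup_eq[OF that inner] by (simp add: mean_sup_def assms(7) time_change_def)
  have m1: "mean_sup M k Y 1 = (\<integral>\<omega>. S1.max_proj ?e 1 \<omega> \<partial>M)"
    using S1.mean_sup_eq[OF zero_le_one inner] by (simp add: mean_sup_def)
  show ?thesis
  proof (intro conjI allI impI)
    fix \<Omega> :: "(real^'d) set"
    assume \<Omega>: "open \<Omega>" "bounded \<Omega>" "C1_holder_boundary 1 \<Omega>"
    obtain r where r: "0 < r" "two_sided_ball r \<Omega>" "negligible (frontier \<Omega>)"
      using C1_holder_boundary_two_sided_ball[OF \<Omega>] .
    interpret D: two_ball_domain \<Omega> r using \<Omega> r by unfold_locales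
    obtain P where P: "0 \<le> P" "perimeter \<Omega> = ereal P" "((\<lambda>r. layer_volume \<Omega> r / r) \<longlongrightarrow> P) (at_right 0)"
      using layer_volume_tendsto_perimeter[OF D.two_ball_domain_axioms] .
    show "((\<lambda>t. ereal ((measure lebesgue \<Omega> - spectral_heat_content M X \<Omega> t) / mean_sup M k X t)) \<longlongrightarrow> perimeter \<Omega>) (at_right 0)"
    \<comment> \<open>The empty set has an empty frontier, which the analysis of exits excludes;
      here both sides are 0.\<close>
    proof (cases "\<Omega> = {}")
      case True
      have "layer_volume \<Omega> r = 0" for r using D.layer_volume_le[of r] D.layer_volume_nonneg[of r] True by simp
      then have "((\<lambda>r. 0) \<longlongrightarrow> P) (at_right (0::real))" using P(3) by simp
      then have "P = 0" using tendsto_const_iff[of "at_right (0::real)" "0::real" P] by simp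
      then show ?thesis using True P(2) by (simp add: spectral_heat_content_def set_lebesgue_integral_def)
    next
      case False
      have "\<Omega> \<noteq> UNIV" using \<Omega>(2) not_bounded_UNIV by metis
      then have ne: "frontier \<Omega> \<noteq> {}" using False by (simp add: frontier_eq_empty)
      have "((\<lambda>t. (measure lebesgue \<Omega> - spectral_heat_content M (time_change Y U) \<Omega> t) / (\<integral>\<omega>. S.max_proj ?e t \<omega> \<partial>M)) \<longlongrightarrow> P) (at_right 0)"
        by (rule heat_loss_asymptotics[OF S.subordinated_stable_axioms D.two_ball_domain_axioms ne e q(1,2,3) mr1 assms(10) mr2 P(1,3)])
      then have "((\<lambda>t. (measure lebesgue \<Omega> - spectral_heat_content M X \<Omega> t) / mean_sup M k X t) \<longlongrightarrow> P) (at_right 0)"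
      proof (rule Lim_transform_eventually)
        have "\<forall>\<^sub>F t in at_right 0. (0::real) < t" by (simp add: eventually_at_filter)
        then show "\<forall>\<^sub>F t in at_right 0. (measure lebesgue \<Omega> - spectral_heat_content M (time_change Y U) \<Omega> t) / (\<integral>\<omega>. S.max_proj ?e t \<omega> \<partial>M) =
            (measure lebesgue \<Omega> - spectral_heat_content M X \<Omega> t) / mean_sup M k X t"
          by eventually_elim (simp add: m less_imp_le flip: assms(7))
      qed
      then show ?thesis unfolding P(2) by (rule tendsto_ereal)
    qed
  next
    fix t :: real assume cont: "AE \<omega> in M. continuous_on {0..} (\<lambda>t. U t \<omega>)" and t: "0 \<le> t"
    have "mean_sup M k X t = enn2real (S.sup_moment ?e 1) * (\<integral>\<omega>. U t \<omega> powr (1 / \<alpha>) \<partial>M)"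
      unfolding m[OF t] by (rule S.mean_max_proj_continuous[OF e t cont mr1(1)[OF t]])
    \<comment> \<open>The identity clock has the value 1 at time 1, so the same formula holds with
      moment factor 1.\<close>
    moreover have "mean_sup M k Y 1 = enn2real (S.sup_moment ?e 1)"
      unfolding m1 using S1.mean_max_proj_continuous[OF e zero_le_one] by (simp add: prob_space continuous_on_id)
    ultimately show "mean_sup M k X t = mean_sup M k Y 1 * (\<integral>\<omega>. U t \<omega> powr (1 / \<alpha>) \<partial>M)" by simp
  qed
qed

end
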